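(* Let $G=(V,E)$ be a finite graph with a Schrödinger operator $\mathcal H$, and let $G_\Gamma$ be a connected normal cover of $G$ with deck group $\Gamma$. Then for every $\theta\in\mathbb R$, $$\mu_{G^{\mathrm{ab}}}(\{\theta\})\le\mu_{G_\Gamma}(\{\theta\}).$$
   Context: Graphs are multigraphs: parallel edges and loops are allowed. $\vec E(G)$ is the set of edges with both orientations (a loop also has two distinct orientations); $\bar e$ is the reverse of $e$, and $o(e),t(e)$ are its origin and terminus. A Schrödinger operator on a finite graph $G=(V,E)$ is $\mathcal H=\sum_{e\in\vec E}w_eA_e+\mathcal V$ on $\ell^2(V)$, where $A_e$ is the matrix with $1$ in entry $(o(e),t(e))$ and $0$ elsewhere (so a loop contributes twice to its diagonal entry), $w_{\bar e}=\overline{w_e}\neq0$, and $\mathcal V=\mathrm{diag}(\mathcal V_v)_{v\in V}$ is real. A covering $\pi:\tilde G\to G$ is normal with deck group $\Gamma$ if its group $\Gamma$ of deck transformations acts transitively on each fibre. (Since $G_\Gamma$ is connected, so is $G$.) $\mathcal H$ lifts to $\tilde G$ by $(\mathcal H_{\tilde G}f)(x)=\sum_{\tilde e\in\vec E(\tilde G):\,o(\tilde e)=x}w_{\pi(\tilde e)}f(t(\tilde e))+\mathcal V_{\pi(x)}f(x)$ on $\ell^2(V(\tilde G))$. The spectral measure of a normal cover is $\mu_{\tilde G}(B)=\frac1{|V|}\sum_{v\in V}\langle \mathbf 1_B(\mathcal H_{\tilde G})\delta_{\tilde v},\delta_{\tilde v}\rangle$ for Borel $B\subseteq\mathbb R$,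 where $\tilde v$ is any chosen lift of $v$. The maximal abelian cover $G^{\mathrm{ab}}$ of a connected graph $G$ is the connected normal cover with fundamental group $[\pi_1(G),\pi_1(G)]$, with deck group $H_1(G;\mathbb Z)$. No relation between $G_\Gamma$ and $G^{\mathrm{ab}}$ is assumed beyond both being covers of $G$. *)

theory Defs
  imports
    "HOL-Analysis.Analysis"
    "HOL-Algebra.Generated_Groups"
    "Graph_Theory.Bidirected_Digraph"
    "Graph_Theory.Digraph_Component"
    "Graph_Theory.Arc_Walk"
begin

text \<open>
  A multigraph is a \<^locale>\<open>bidirected_digraph\<close>: the arcs are the oriented edges, \<^term>\<open>tail G e\<close> is the
  origin and \<^term>\<open>head G e\<close> the terminus of \<^term>\<open>e\<close>, and \<^term>\<open>arev\<close> is the orientation reversal. Since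
  \<^term>\<open>arev\<close> has no fixed point among the arcs, a loop consists of two distinct arcs.
\<close>

subsection \<open>Coverings\<close>

definition graph_covering ::
  "('v, 'e) pre_digraph \<Rightarrow> ('e \<Rightarrow> 'e) \<Rightarrow> ('x, 'f) pre_digraph \<Rightarrow> ('f \<Rightarrow> 'f) \<Rightarrow> ('x \<Rightarrow> 'v) \<Rightarrow> ('f \<Rightarrow> 'e) \<Rightarrow> bool"
  where
  "graph_covering G arev H hrev p q \<longleftrightarrow>
     bidirected_digraph G arev \<and> bidirected_digraph H hrev \<and>
     p ` verts H = verts G \<and>
     (\<forall>e\<in>arcs H. q e \<in> arcs G \<and> tail G (q e) = p (tail H e) \<and> head G (q e) = p (head H e) \<and>
        q (hrev e) = arev (q e)) \<and>
     (\<forall>x\<in>verts H. bij_betw q (out_arcs H x) (out_arcs G (p x)))"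

definition deck_transformations ::
  "('x, 'f) pre_digraph \<Rightarrow> ('f \<Rightarrow> 'f) \<Rightarrow> ('x \<Rightarrow> 'v) \<Rightarrow> ('f \<Rightarrow> 'e) \<Rightarrow> (('x \<Rightarrow> 'x) \<times> ('f \<Rightarrow> 'f)) set"
  where
  "deck_transformations H hrev p q =
     {(\<phi>, \<psi>). bij_betw \<phi> (verts H) (verts H) \<and> bij_betw \<psi> (arcs H) (arcs H) \<and>
        (\<forall>e\<in>arcs H. tail H (\<psi> e) = \<phi> (tail H e) \<and> head H (\<psi> e) = \<phi> (head H e) \<and>
           \<psi> (hrev e) = hrev (\<psi> e)) \<and>
        (\<forall>x\<in>verts H. p (\<phi> x) = p x) \<and> (\<forall>e\<in>arcs H. q (\<psi> e) = q e)}"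

definition connected_normal_cover ::
  "('v, 'e) pre_digraph \<Rightarrow> ('e \<Rightarrow> 'e) \<Rightarrow> ('x, 'f) pre_digraph \<Rightarrow> ('f \<Rightarrow> 'f) \<Rightarrow> ('x \<Rightarrow> 'v) \<Rightarrow> ('f \<Rightarrow> 'e) \<Rightarrow> bool"
  where
  "connected_normal_cover G arev H hrev p q \<longleftrightarrow>
     graph_covering G arev H hrev p q \<and> Digraph_Component.connected H \<and>
     (\<forall>x\<in>verts H. \<forall>y\<in>verts H. p x = p y \<longrightarrow> (\<exists>(\<phi>, \<psi>)\<in>deck_transformations H hrev p q. \<phi> x = y))"

subsection \<open>Fundamental group and maximal abelian cover\<close>

text \<open>Homotopy of closed walks at \<^term>\<open>x\<close> is generated by the insertion of backtracks.\<close>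

definition loop_homotopic ::
  "('v, 'e) pre_digraph \<Rightarrow> ('e \<Rightarrow> 'e) \<Rightarrow> 'v \<Rightarrow> 'e list \<Rightarrow> 'e list \<Rightarrow> bool" where
  "loop_homotopic G arev x =
     equivclp (\<lambda>c d. pre_digraph.awalk G x c x \<and> pre_digraph.awalk G x d x \<and>
       (\<exists>us vs e. e \<in> arcs G \<and> c = us @ vs \<and> d = us @ [e, arev e] @ vs))"

definition loop_class ::
  "('v, 'e) pre_digraph \<Rightarrow> ('e \<Rightarrow> 'e) \<Rightarrow> 'v \<Rightarrow> 'e list \<Rightarrow> 'e list set" where
  "loop_class G arev x c = {d. loop_homotopic G arev x c d}"

definition fundamental_group ::
  "('v, 'e) pre_digraph \<Rightarrow> ('e \<Rightarrow> 'e) \<Rightarrow> 'v \<Rightarrow> 'e list set monoid" where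
  "fundamental_group G arev x =
     \<lparr>carrier = {loop_class G arev x c | c. pre_digraph.awalk G x c x},
      mult = (\<lambda>C D. \<Union>c\<in>C. \<Union>d\<in>D. loop_class G arev x (c @ d)),
      one = loop_class G arev x []\<rparr>"

definition induced_map ::
  "('v, 'e) pre_digraph \<Rightarrow> ('e \<Rightarrow> 'e) \<Rightarrow> ('x \<Rightarrow> 'v) \<Rightarrow> ('f \<Rightarrow> 'e) \<Rightarrow> 'x \<Rightarrow> 'f list set \<Rightarrow> 'e list set" where
  "induced_map G arev p q x C = (\<Union>c\<in>C. loop_class G arev (p x) (map q c))"

definition maximal_abelian_cover ::
  "('v, 'e) pre_digraph \<Rightarrow> ('e \<Rightarrow> 'e) \<Rightarrow> ('x, 'f) pre_digraph \<Rightarrow> ('f \<Rightarrow> 'f) \<Rightarrow> ('x \<Rightarrow> 'v) \<Rightarrow> ('f \<Rightarrow> 'e) \<Rightarrow> bool"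
  where
  "maximal_abelian_cover G arev H hrev p q \<longleftrightarrow>
     connected_normal_cover G arev H hrev p q \<and>
     (\<forall>x\<in>verts H.
        induced_map G arev p q x ` carrier (fundamental_group H hrev x) =
        derived (fundamental_group G arev (p x)) (carrier (fundamental_group G arev (p x))))"

subsection \<open>Spectral projections on square-summable functions\<close>

definition ell2 :: "'x set \<Rightarrow> ('x \<Rightarrow> complex) set" where
  "ell2 X = {f. (\<forall>x. x \<notin> X \<longrightarrow> f x = 0) \<and> (\<lambda>x. (cmod (f x))\<^sup>2) summable_on X}"

definition ell2_inner :: "'x set \<Rightarrow> ('x \<Rightarrow> complex) \<Rightarrow> ('x \<Rightarrow> complex) \<Rightarrow> complex" where
  "ell2_inner X f g = (\<Sum>\<^sub>\<infinity>x\<in>X. f x * cnj (g x))"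

definition delta :: "'x \<Rightarrow> 'x \<Rightarrow> complex" where
  "delta x = (\<lambda>y. if y = x then 1 else 0)"

definition orthogonal_projection :: "'x set \<Rightarrow> (('x \<Rightarrow> complex) \<Rightarrow> ('x \<Rightarrow> complex)) \<Rightarrow> bool" where
  "orthogonal_projection X P \<longleftrightarrow>
     (\<forall>f\<in>ell2 X. P f \<in> ell2 X \<and> P (P f) = P f) \<and>
     (\<forall>f\<in>ell2 X. \<forall>g\<in>ell2 X. \<forall>a b. P (\<lambda>x. a * f x + b * g x) = (\<lambda>x. a * P f x + b * P g x)) \<and>
     (\<forall>f\<in>ell2 X. \<forall>g\<in>ell2 X. ell2_inner X (P f) g = ell2_inner X f (P g))"

definition projection_valued_measure ::
  "'x set \<Rightarrow> (real set \<Rightarrow> ('x \<Rightarrow> complex) \<Rightarrow> ('x \<Rightarrow> complex)) \<Rightarrow> bool" where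
  "projection_valued_measure X E \<longleftrightarrow>
     (\<forall>B\<in>sets borel. orthogonal_projection X (E B)) \<and>
     (\<forall>f\<in>ell2 X. E UNIV f = f) \<and>
     (\<forall>A\<in>sets borel. \<forall>B\<in>sets borel. \<forall>f\<in>ell2 X. E (A \<inter> B) f = E A (E B f)) \<and>
     (\<forall>A :: nat \<Rightarrow> real set. range A \<subseteq> sets borel \<longrightarrow> disjoint_family A \<longrightarrow>
        (\<forall>f\<in>ell2 X. \<forall>g\<in>ell2 X.
           (\<lambda>n. ell2_inner X (E (A n) f) g) sums ell2_inner X (E (\<Union>n. A n) f) g))"

text \<open>\<open>E\<close> has bounded support and the operator \<open>T\<close> is \<open>\<integral> t dE(t)\<close>, as quadratic forms.\<close>

definition spectral_resolution ::
  "'x set \<Rightarrow> (('x \<Rightarrow> complex) \<Rightarrow> ('x \<Rightarrow> complex)) \<Rightarrow> (real set \<Rightarrow> ('x \<Rightarrow> complex) \<Rightarrow> ('x \<Rightarrow> complex)) \<Rightarrow> bool"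
  where
  "spectral_resolution X T E \<longleftrightarrow>
     projection_valued_measure X E \<and>
     (\<exists>a. \<forall>f\<in>ell2 X. E {-a<..<a} f = f) \<and>
     (\<forall>f\<in>ell2 X. ell2_inner X (T f) f =
        complex_of_real
          (\<integral>t. t \<partial>(measure_of UNIV (sets borel) (\<lambda>B. ennreal (Re (ell2_inner X (E B f) f))))))"

text \<open>
  \<open>spectral_projection X T B\<close> is \<open>1\<^sub>B(T)\<close>. For a bounded self-adjoint operator \<open>T\<close> on \<^term>\<open>ell2 X\<close> the spectral
  theorem says that a resolution exists and that its values on Borel sets and \<^term>\<open>ell2 X\<close> are unique.
\<close>

definition spectral_projection ::
  "'x set \<Rightarrow> (('x \<Rightarrow> complex) \<Rightarrow> ('x \<Rightarrow> complex)) \<Rightarrow> real set \<Rightarrow> ('x \<Rightarrow> complex) \<Rightarrow> ('x \<Rightarrow> complex)"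
  where
  "spectral_projection X T = (SOME E. spectral_resolution X T E)"

subsection \<open>Schroedinger operators\<close>

definition schrodinger_operator ::
  "('v, 'e) pre_digraph \<Rightarrow> ('e \<Rightarrow> complex) \<Rightarrow> ('v \<Rightarrow> real) \<Rightarrow> ('v \<Rightarrow> complex) \<Rightarrow> ('v \<Rightarrow> complex)" where
  "schrodinger_operator G w V f =
     (\<lambda>x. if x \<in> verts G
          then (\<Sum>e\<in>out_arcs G x. w e * f (head G e)) + complex_of_real (V x) * f x else 0)"

definition schrodinger_weights :: "('v, 'e) pre_digraph \<Rightarrow> ('e \<Rightarrow> 'e) \<Rightarrow> ('e \<Rightarrow> complex) \<Rightarrow> bool" where
  "schrodinger_weights G arev w \<longleftrightarrow> (\<forall>e\<in>arcs G. w (arev e) = cnj (w e) \<and> w e \<noteq> 0)"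

definition lifted_operator ::
  "('x, 'f) pre_digraph \<Rightarrow> ('x \<Rightarrow> 'v) \<Rightarrow> ('f \<Rightarrow> 'e) \<Rightarrow> ('e \<Rightarrow> complex) \<Rightarrow> ('v \<Rightarrow> real) \<Rightarrow>
     ('x \<Rightarrow> complex) \<Rightarrow> ('x \<Rightarrow> complex)" where
  "lifted_operator H p q w V = schrodinger_operator H (w \<circ> q) (V \<circ> p)"

definition vertex_lift ::
  "('v, 'e) pre_digraph \<Rightarrow> ('x, 'f) pre_digraph \<Rightarrow> ('x \<Rightarrow> 'v) \<Rightarrow> ('v \<Rightarrow> 'x) \<Rightarrow> bool" where
  "vertex_lift G H p s \<longleftrightarrow> (\<forall>v\<in>verts G. s v \<in> verts H \<and> p (s v) = v)"

text \<open>The parameter \<open>s\<close> is the choice of one lift for every vertex of \<open>G\<close>.\<close>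

definition cover_spectral_measure ::
  "('v, 'e) pre_digraph \<Rightarrow> ('e \<Rightarrow> complex) \<Rightarrow> ('v \<Rightarrow> real) \<Rightarrow>
     ('x, 'f) pre_digraph \<Rightarrow> ('x \<Rightarrow> 'v) \<Rightarrow> ('f \<Rightarrow> 'e) \<Rightarrow> ('v \<Rightarrow> 'x) \<Rightarrow> real set \<Rightarrow> real" where
  "cover_spectral_measure G w V H p q s B =
     (\<Sum>v\<in>verts G. Re (ell2_inner (verts H)
        (spectral_projection (verts H) (lifted_operator H p q w V) B (delta (s v))) (delta (s v))))
     / real (card (verts G))"

end

theory Submission
  imports
    Defs
    "HOL-Complex_Analysis.Conformal_Mappings"
    "HOL-Probability.Infinite_Product_Measure"
    "Jordan_Normal_Form.Determinant"
begin

text \<open>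
  Both point masses are normalized traces of the projection onto the kernel of the lifted operator with potential
  \<open>V - \<theta>\<close>. More generally, for a set \<open>S\<close> of vertices of the finite graph let \<open>N\<^sub>S\<close> be the projection onto the
  kernel of the operator compressed to the fibres over \<open>S\<close>. On the graph itself multiply the weight of each
  arc \<open>e\<close> by the phase \<open>cis (x e - x (arev e))\<close>; outside a null set of \<open>x\<close> the nullity of the compression to \<open>S\<close>
  is a constant, the generic nullity \<open>\<tau> S\<close>.

  For the maximal abelian cover the trace is the generic nullity of the whole graph, by Fourier analysis. A vertex of
  this cover is determined by its projection and by its height, the net number of passages of a walk from the base
  point through each edge, since a closed walk lifts to a closed one iff all these numbers vanish. Averaging the
  moments of the twisted operators over the phases therefore yields the moments of the lifted operator \<open>A\<close>, and
  \<open>(1 - A\<^sup>2/c\<^sup>2)\<^sup>m\<close> converges to the projection onto the kernel.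

  For an arbitrary normal cover \<open>\<tau> S \<le> tr N\<^sub>S\<close> holds by induction on \<open>S\<close>. Deleting a vertex changes both sides by
  at most one, and the induction step is immediate unless \<open>S\<close> is connected and every vertex of \<open>S\<close> is in the
  support of some generic kernel vector. In that critical case the generic kernel is a line, and comparing its
  vectors for phases that differ on one edge forces \<open>S\<close> to be a tree. The phases can then be gauged away, and a tree
  lifts to every cover together with its kernel vector, so that the trace is at least one.
\<close>

no_notation scalar_prod (infix "\<bullet>" 70)

subsection \<open>Self-adjoint operators on a real Hilbert space\<close>

text \<open>Nothing relates the two covers: the deck group need not be abelian and neither cover
  need lie above the other. So they are compared through a number that belongs to the finite graph
  alone. The obstacle is that kernels on a cover are infinite-dimensional; dimension is replaced by
  the trace over one lift of each vertex. The deletion argument asks of it little more than that an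
  operator and its adjoint have equal rank (\<open>rank_identity\<close>), which follows from traces
  of powers and tr AB = tr BA, without polar decomposition. \<open>spectral_projection\<close> is
  chosen by \<open>SOME\<close>. Hence a resolution has to be constructed, and every resolution has
  to be shown to give the eigenprojection at a point. The construction uses the real part of the
  inner product; complex linearity is recovered from commutation with the imaginary unit. The tree
  property comes from the ratios \<open>cur\<close> of a critical kernel vector: a change of phase
  on an edge conjugates its ratio, and three phases together make it real. An edge crossed only once
  by a closed walk could then be used to rotate a real product off the real line.\<close>

definition selfadj :: "('a::real_inner \<Rightarrow> 'a) \<Rightarrow> bool" where
  "selfadj T \<longleftrightarrow> bounded_linear T \<and> (\<forall>x y. T x \<bullet> y = x \<bullet> T y)"

definition is_proj :: "('a::real_inner \<Rightarrow> 'a) \<Rightarrow> bool" where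
  "is_proj P \<longleftrightarrow> selfadj P \<and> (\<forall>x. P (P x) = P x)"

definition commutes :: "('a \<Rightarrow> 'a) \<Rightarrow> ('a \<Rightarrow> 'a) \<Rightarrow> bool" where
  "commutes U T \<longleftrightarrow> (\<forall>x. U (T x) = T (U x))"

lemma selfadj_bounded_linear: "selfadj T \<Longrightarrow> bounded_linear T"
  by (simp add: selfadj_def)

lemma selfadj_inner: "selfadj T \<Longrightarrow> T x \<bullet> y = x \<bullet> T y"
  by (simp add: selfadj_def)

lemma selfadj_simps:
  assumes "selfadj T"
  shows "T (x + y) = T x + T y" "T (x - y) = T x - T y" "T (r *\<^sub>R x) = r *\<^sub>R T x" "T 0 = 0" "T (- x) = - T x"
proof -
  interpret bounded_linear T using assms by (rule selfadj_bounded_linear)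
  show "T (x + y) = T x + T y" "T (x - y) = T x - T y" "T (r *\<^sub>R x) = r *\<^sub>R T x" "T 0 = 0" "T (- x) = - T x"
    by (auto simp: add diff scaleR zero linear_neg linear_axioms)
qed

lemma selfadj_id: "selfadj (\<lambda>x. x)"
  by (simp add: selfadj_def bounded_linear_ident)

lemma selfadj_zero: "selfadj (\<lambda>x. 0)"
  by (simp add: selfadj_def bounded_linear_zero)

lemma selfadj_add: "selfadj S \<Longrightarrow> selfadj T \<Longrightarrow> selfadj (\<lambda>x. S x + T x)"
  by (auto simp: selfadj_def bounded_linear_add inner_add_left inner_add_right)

lemma selfadj_diff: "selfadj S \<Longrightarrow> selfadj T \<Longrightarrow> selfadj (\<lambda>x. S x - T x)"
  by (auto simp: selfadj_def bounded_linear_sub inner_diff_left inner_diff_right)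

lemma selfadj_scale: "selfadj S \<Longrightarrow> selfadj (\<lambda>x. r *\<^sub>R S x)"
  by (auto simp: selfadj_def intro: bounded_linear_compose[OF bounded_linear_scaleR_right])

lemma selfadj_compose:
  assumes "selfadj S" "selfadj T" "commutes S T"
  shows "selfadj (\<lambda>x. S (T x))"
  using assms by (auto simp: selfadj_def commutes_def intro: bounded_linear_compose)

lemma selfadj_sum:
  assumes "\<And>i. i \<in> I \<Longrightarrow> selfadj (S i)"
  shows "selfadj (\<lambda>x. \<Sum>i\<in>I. S i x)"
  using assms
  by (induction I rule: infinite_finite_induct) (auto simp: selfadj_zero selfadj_add)

text \<open>Polarization: comparing the forms at \<open>x + y\<close> makes \<open>S x - T x\<close>
  orthogonal to every \<open>y\<close>, in particular to itself.\<close>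

lemma selfadj_quadratic_eq:
  assumes "selfadj S" "selfadj T" "\<And>x. S x \<bullet> x = T x \<bullet> x"
  shows "S x = T x"
proof -
  have *: "(S x - T x) \<bullet> y = 0" for y
  proof -
    have "S (x + y) \<bullet> (x + y) = T (x + y) \<bullet> (x + y)" by (rule assms)
    then have "S x \<bullet> y + S y \<bullet> x = T x \<bullet> y + T y \<bullet> x"
      using assms(3)[of x] assms(3)[of y]
      by (simp add: selfadj_simps[OF assms(1)] selfadj_simps[OF assms(2)] inner_add_left inner_add_right)
    moreover have "S y \<bullet> x = S x \<bullet> y" "T y \<bullet> x = T x \<bullet> y"
      using selfadj_inner[OF assms(1)] selfadj_inner[OF assms(2)] by (metis inner_commute)+
    ultimately show ?thesis by (simp add: inner_diff_left)
  qed
  from *[of "S x - T x"] show ?thesis by simp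
qed

lemma is_proj_selfadj: "is_proj P \<Longrightarrow> selfadj P"
  by (simp add: is_proj_def)

lemma is_proj_idem: "is_proj P \<Longrightarrow> P (P x) = P x"
  by (simp add: is_proj_def)

lemma is_proj_inner: "is_proj P \<Longrightarrow> P x \<bullet> x = (norm (P x))\<^sup>2"
  by (metis is_proj_def power2_norm_eq_inner selfadj_inner)

lemma is_proj_norm_le:
  assumes "is_proj P" shows "norm (P x) \<le> norm x"
proof -
  have "norm (P x) * norm (P x) \<le> norm (P x) * norm x"
    using is_proj_inner[OF assms, of x] norm_cauchy_schwarz[of "P x" x] by (simp add: power2_eq_square)
  then show ?thesis
    by (cases "norm (P x) = 0") (auto simp: mult_le_cancel_left)
qed

lemma is_proj_complement: "is_proj P \<Longrightarrow> is_proj (\<lambda>x. x - P x)"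
  by (auto simp: is_proj_def selfadj_id selfadj_diff selfadj_simps)

lemma is_proj_pythagoras:
  assumes "is_proj P" shows "(norm x)\<^sup>2 = (norm (P x))\<^sup>2 + (norm (x - P x))\<^sup>2"
  using is_proj_inner[OF assms, of x] is_proj_inner[OF is_proj_complement[OF assms], of x]
  by (simp add: inner_diff_left power2_norm_eq_inner)

lemma is_proj_norm_eqD:
  assumes "is_proj P" "(norm (P x))\<^sup>2 = (norm x)\<^sup>2"
  shows "P x = x"
  using is_proj_pythagoras[OF assms(1), of x] assms(2) by simp

text \<open>Each projection absorbs the other on the left, and passing to adjoints moves the
  absorption to the right. Projections that arise as different limits are identified by
  this.\<close>

lemma is_proj_unique:
  assumes "is_proj P" "is_proj Q" "\<And>x. P x = x \<longleftrightarrow> Q x = x"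
  shows "P x = Q x"
proof -
  have 1: "Q (P x) = P x" for x using assms(3)[of "P x"] is_proj_idem[OF assms(1)] by simp
  have 2: "P (Q x) = Q x" for x using assms(3)[of "Q x"] is_proj_idem[OF assms(2)] by simp
  note s = is_proj_selfadj[OF assms(1)] is_proj_selfadj[OF assms(2)]
  have "(P x - Q x) \<bullet> y = 0" for y
  proof -
    have "P x \<bullet> y = Q (P x) \<bullet> y" by (simp add: 1)
    also have "\<dots> = x \<bullet> P (Q y)" using selfadj_inner[OF s(1)] selfadj_inner[OF s(2)] by simp
    also have "\<dots> = Q x \<bullet> y" using selfadj_inner[OF s(2)] by (simp add: 2)
    finally show ?thesis by (simp add: inner_diff_left)
  qed
  from this[of "P x - Q x"] show ?thesis by simp
qed

lemma is_proj_le_quadratic: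
  assumes "is_proj P" "is_proj Q" "\<And>x. P x = x \<Longrightarrow> Q x = x"
  shows "P x \<bullet> x \<le> Q x \<bullet> x"
proof -
  have 1: "Q (P x) = P x" for x using assms(3)[of "P x"] is_proj_idem[OF assms(1)] by simp
  have "P (Q x) = P x"
  proof -
    have "(P (Q x) - P x) \<bullet> y = 0" for y
    proof -
      have "P (Q x) \<bullet> y = x \<bullet> Q (P y)"
        using selfadj_inner[OF is_proj_selfadj[OF assms(1)]] selfadj_inner[OF is_proj_selfadj[OF assms(2)]] by simp
      also have "\<dots> = P x \<bullet> y" using selfadj_inner[OF is_proj_selfadj[OF assms(1)]] by (simp add: 1)
      finally show ?thesis by (simp add: inner_diff_left)
    qed
    from this[of "P (Q x) - P x"] show ?thesis by simp
  qed
  then have "norm (P x) \<le> norm (Q x)" using is_proj_norm_le[OF assms(1), of "Q x"] by simp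
  then show ?thesis by (simp add: is_proj_inner assms)
qed

text \<open>A minimum argument: \<open>y\<close> minimizes the nonnegative form, and if
  \<open>B y\<close> were nonzero, a small step from \<open>y\<close> against \<open>B y\<close>
  would make the form negative.\<close>

lemma positive_form_zero:
  assumes "selfadj B" "\<And>x. 0 \<le> B x \<bullet> x" "B y \<bullet> y = 0"
  shows "B y = 0"
proof (rule ccontr)
  assume "B y \<noteq> 0"
  define a where "a = (norm (B y))\<^sup>2"
  define b where "b = B (B y) \<bullet> B y"
  have "a > 0" using \<open>B y \<noteq> 0\<close> by (simp add: a_def)
  have "b \<ge> 0" using assms(2) by (simp add: b_def)
  \<comment> \<open>At distance \<open>t\<close> the form is \<open>t^2 * b - 2 * t * a\<close>,
    which is negative as long as \<open>t * b < 2 * a\<close>. The \<open>+ 1\<close> covers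
    \<open>b = 0\<close>.\<close>
  define t where "t = a / (b + 1)"
  have "t > 0" using \<open>a > 0\<close> \<open>b \<ge> 0\<close> by (simp add: t_def)
  have "0 \<le> B (y - t *\<^sub>R B y) \<bullet> (y - t *\<^sub>R B y)" by (rule assms)
  also have "\<dots> = - 2 * t * a + t\<^sup>2 * b"
  proof -
    have "B (B y) \<bullet> y = a" "B y \<bullet> B y = a"
      using selfadj_inner[OF assms(1), of "B y" y] by (simp_all add: a_def power2_norm_eq_inner)
    then show ?thesis using assms(3)
      by (simp add: selfadj_simps[OF assms(1)] inner_diff_left inner_diff_right b_def power2_eq_square algebra_simps)
  qed
  finally have "(2 * a) * t \<le> (t * b) * t" by (simp add: power2_eq_square algebra_simps)
  then have "2 * a \<le> t * b" using \<open>t > 0\<close> by (rule mult_right_le_imp_le)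
  also have "\<dots> \<le> a" using \<open>a > 0\<close> \<open>b \<ge> 0\<close> by (simp add: t_def field_simps)
  finally show False using \<open>a > 0\<close> by simp
qed

lemma strong_limit_selfadj:
  assumes "\<And>n. selfadj (X n)" "\<And>x. (\<lambda>n. X n x) \<longlonglongrightarrow> S x" "\<And>n x. norm (X n x) \<le> norm x"
  shows "selfadj S" "norm (S x) \<le> norm x"
proof -
  have nb: "norm (S x) \<le> norm x" for x
    by (rule LIMSEQ_le_const2[OF tendsto_norm[OF assms(2)]]) (use assms(3) in auto)
  then show "norm (S x) \<le> norm x" .
  have "bounded_linear S"
  proof (rule bounded_linear_intro[where K = 1])
    show "S (x + y) = S x + S y" for x y
      by (rule LIMSEQ_unique[OF assms(2)])
        (simp add: selfadj_simps[OF assms(1)] tendsto_add[OF assms(2) assms(2)])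
    show "S (r *\<^sub>R x) = r *\<^sub>R S x" for r x
      by (rule LIMSEQ_unique[OF assms(2)])
        (simp add: selfadj_simps[OF assms(1)] tendsto_scaleR[OF tendsto_const assms(2)])
    show "norm (S x) \<le> norm x * 1" for x using nb by simp
  qed
  moreover have "S x \<bullet> y = x \<bullet> S y" for x y
    using LIMSEQ_unique[OF tendsto_inner[OF assms(2)[of x] tendsto_const[of y]]]
      tendsto_inner[OF tendsto_const[of x] assms(2)[of y]] selfadj_inner[OF assms(1)] by simp
  ultimately show "selfadj S" by (simp add: selfadj_def)
qed

lemma strong_limit_compose:
  assumes "\<And>n. selfadj (X n)" "\<And>x. (\<lambda>n. X n x) \<longlonglongrightarrow> S x" "\<And>n x. norm (X n x) \<le> norm x" "y \<longlonglongrightarrow> z"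
  shows "(\<lambda>n. X n (y n)) \<longlonglongrightarrow> S z"
proof -
  have "(\<lambda>n. norm (X n (y n - z))) \<longlonglongrightarrow> 0"
    by (rule tendsto_sandwich[of "\<lambda>_. 0" _ _ "\<lambda>n. norm (y n - z)"])
      (use assms(3,4) in \<open>auto simp: tendsto_norm_zero_iff LIM_zero\<close>)
  then have "(\<lambda>n. X n (y n - z) + X n z) \<longlonglongrightarrow> 0 + S z"
    by (intro tendsto_add assms(2)) (simp add: tendsto_norm_zero_iff)
  then show ?thesis by (simp add: selfadj_simps[OF assms(1)])
qed

lemma strong_limit_commutes:
  assumes "\<And>x. (\<lambda>n. X n x) \<longlonglongrightarrow> S x" "bounded_linear U" "\<And>n. commutes U (X n)"
  shows "commutes U S"
  unfolding commutes_def
proof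
  fix x
  have "(\<lambda>n. U (X n x)) \<longlonglongrightarrow> U (S x)"
    using assms by (intro bounded_linear.tendsto[OF assms(2)])
  moreover have "(\<lambda>n. X n (U x)) \<longlonglongrightarrow> S (U x)" by (rule assms)
  ultimately show "U (S x) = S (U x)"
    using assms(3) by (simp add: commutes_def LIMSEQ_unique)
qed

lemma strong_limit_is_proj:
  assumes "\<And>n. is_proj (X n)" "\<And>x. (\<lambda>n. X n x) \<longlonglongrightarrow> S x"
  shows "is_proj S"
proof -
  have nb: "norm (X n x) \<le> norm x" for n x using is_proj_norm_le[OF assms(1)] .
  note sa = is_proj_selfadj[OF assms(1)]
  have "S (S x) = S x" for x
    using LIMSEQ_unique[OF strong_limit_compose[OF sa assms(2) nb assms(2)[of x]]] assms(2)[of x]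
    by (simp add: is_proj_idem[OF assms(1)])
  then show ?thesis
    using strong_limit_selfadj[OF sa assms(2) nb] by (simp add: is_proj_def)
qed

text \<open>The strong limits of operators below are obtained from this: the squared distance of two
  members of the sequence at a vector is dominated by the change of a numerical sequence, which in
  most cases is monotone and bounded.\<close>

lemma bounded_mono_square_Cauchy:
  fixes X :: "nat \<Rightarrow> 'a::real_normed_vector"
  assumes "\<And>m n. n \<le> m \<Longrightarrow> (norm (X m - X n))\<^sup>2 \<le> \<bar>s m - s n\<bar>" "convergent s"
  shows "Cauchy X"
proof (rule CauchyI)
  fix e :: real assume "e > 0"
  have "Cauchy s" using assms(2) by (simp add: convergent_Cauchy)
  then obtain N where N: "\<And>m n. N \<le> m \<Longrightarrow> N \<le> n \<Longrightarrow> norm (s m - s n) < e\<^sup>2"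
    using CauchyD[of s "e\<^sup>2"] \<open>e > 0\<close> by auto
  have "norm (X m - X n) < e" if "N \<le> m" "N \<le> n" for m n
  proof -
    have "(norm (X m - X n))\<^sup>2 \<le> \<bar>s m - s n\<bar>"
    proof (cases "n \<le> m")
      case True then show ?thesis by (rule assms)
    next
      case False then show ?thesis using assms(1)[of m n] by (simp add: norm_minus_commute abs_minus_commute)
    qed
    also have "\<dots> < e\<^sup>2" using N[OF that] by simp
    finally show ?thesis using \<open>e > 0\<close> by (simp add: power_less_imp_less_base)
  qed
  then show "\<exists>M. \<forall>m\<ge>M. \<forall>n\<ge>M. norm (X m - X n) < e" by auto
qed

section \<open>Powers of a positive contraction and the projection onto its fixed vectors\<close>

locale positive_contraction =
  fixes D :: "'a::{real_inner,complete_space} \<Rightarrow> 'a"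
  assumes sa: "selfadj D" and nonneg: "\<And>x. 0 \<le> D x \<bullet> x" and le1: "\<And>x. D x \<bullet> x \<le> x \<bullet> x"
begin

lemma square_le: "D x \<bullet> D x \<le> D x \<bullet> x"
proof -
  have "D x \<bullet> x - D x \<bullet> D x = (D x \<bullet> D x - D (D x) \<bullet> D x) + D (x - D x) \<bullet> (x - D x)"
    using selfadj_inner[OF sa, of "D x" x]
    by (simp add: selfadj_simps[OF sa] inner_diff_left inner_diff_right inner_commute)
  then show ?thesis using le1[of "D x"] nonneg[of "x - D x"] by linarith
qed

lemma norm_le: "norm (D x) \<le> norm x"
  by (rule power2_le_imp_le) (use square_le[of x] le1[of x] in \<open>auto simp: power2_norm_eq_inner\<close>)

lemma selfadj_funpow: "selfadj (D ^^ n)"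
proof (induction n)
  case 0 show ?case by (simp add: selfadj_id id_def)
next
  case (Suc n)
  have "selfadj (\<lambda>x. D ((D ^^ n) x))"
    by (rule selfadj_compose[OF sa Suc]) (simp add: commutes_def funpow_swap1)
  then show ?case by (simp add: o_def)
qed

lemma norm_funpow_le: "norm ((D ^^ n) x) \<le> norm x"
  by (induction n) (auto intro: order_trans[OF norm_le])

text \<open>Without square roots the parities have to be separated: an even power gives a squared
  norm, an odd one the form of \<open>D\<close> itself at \<open>(D ^^ j) x\<close>.\<close>

lemma funpow_quadratic:
  "(D ^^ (2 * j)) x \<bullet> x = (norm ((D ^^ j) x))\<^sup>2"
  "(D ^^ Suc (2 * j)) x \<bullet> x = D ((D ^^ j) x) \<bullet> (D ^^ j) x"
proof -
  show "(D ^^ (2 * j)) x \<bullet> x = (norm ((D ^^ j) x))\<^sup>2"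
    using selfadj_inner[OF selfadj_funpow, of j "(D ^^ j) x" x]
    by (simp add: mult_2 funpow_add power2_norm_eq_inner)
  have "(D ^^ Suc (2 * j)) x = (D ^^ j) (D ((D ^^ j) x))"
    by (simp add: mult_2 funpow_add funpow_swap1)
  then show "(D ^^ Suc (2 * j)) x \<bullet> x = D ((D ^^ j) x) \<bullet> (D ^^ j) x"
    using selfadj_inner[OF selfadj_funpow, of j "D ((D ^^ j) x)" x] by simp
qed

lemma funpow_nonneg: "0 \<le> (D ^^ n) x \<bullet> x"
proof (cases "even n")
  case True
  then obtain j where "n = 2 * j" by (auto elim: evenE)
  then show ?thesis using funpow_quadratic(1)[of j x] by simp
next
  case False
  then obtain j where "n = Suc (2 * j)" by (auto elim: oddE)
  then show ?thesis using funpow_quadratic(2)[of j x] nonneg by simp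
qed

lemma funpow_decreasing: "(D ^^ Suc n) x \<bullet> x \<le> (D ^^ n) x \<bullet> x"
proof (cases "even n")
  case True
  then obtain j where "n = 2 * j" by (auto elim: evenE)
  then show ?thesis using funpow_quadratic[of j x] le1[of "(D ^^ j) x"] by (simp add: power2_norm_eq_inner)
next
  case False
  then obtain j where j: "n = Suc (2 * j)" by (auto elim: oddE)
  have "(D ^^ Suc n) x \<bullet> x = (norm (D ((D ^^ j) x)))\<^sup>2"
    using funpow_quadratic(1)[of "Suc j" x] by (simp add: j)
  then show ?thesis
    using funpow_quadratic(2)[of j x] square_le[of "(D ^^ j) x"] by (simp add: power2_norm_eq_inner j)
qed

lemma funpow_antimono: "m \<le> n \<Longrightarrow> (D ^^ n) x \<bullet> x \<le> (D ^^ m) x \<bullet> x"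
  by (induction rule: dec_induct) (use funpow_decreasing order_trans in blast)+

text \<open>Expanding the square leaves \<open>s m + s n\<close> minus twice the form of the power
  \<open>m + n\<close>. Since \<open>m + n \<le> 2 * m\<close> and the forms decrease with the
  exponent, this is at most \<open>s n - s m\<close>.\<close>

lemma funpow_Cauchy: "Cauchy (\<lambda>n. (D ^^ n) x)"
proof (rule bounded_mono_square_Cauchy)
  define s where "s = (\<lambda>n. (D ^^ (2 * n)) x \<bullet> x)"
  show "convergent s"
    unfolding convergent_def
  proof (rule decseq_convergent)
    show "decseq s" unfolding decseq_def s_def by (simp add: funpow_antimono)
    show "\<forall>i. 0 \<le> s i" unfolding s_def by (simp add: funpow_nonneg)
  qed auto
  fix m n :: nat assume "n \<le> m"
  have e: "(D ^^ i) x \<bullet> (D ^^ j) x = (D ^^ (i + j)) x \<bullet> x" for i j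
    using selfadj_inner[OF selfadj_funpow, of i x "(D ^^ j) x"] by (simp add: funpow_add inner_commute)
  have "(norm ((D ^^ m) x - (D ^^ n) x))\<^sup>2 = s m + s n - 2 * ((D ^^ (m + n)) x \<bullet> x)"
    unfolding power2_norm_eq_inner inner_diff_left inner_diff_right e s_def
    by (simp only: mult_2 add.commute[of n m])
  also have "\<dots> \<le> s n - s m"
    using funpow_antimono[of "m + n" "2 * m" x] \<open>n \<le> m\<close> by (simp add: s_def)
  finally show "(norm ((D ^^ m) x - (D ^^ n) x))\<^sup>2 \<le> \<bar>s m - s n\<bar>" by linarith
qed

text \<open>This limit yields kernel projections without any spectral theory: for \<open>D\<close> =
  1 - A^2/c^2 the fixed vectors are the kernel of A. As a limit of powers it inherits commutation
  relations, and its trace is accessible through the traces of the powers.\<close>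

definition proj1 :: "'a \<Rightarrow> 'a" where "proj1 x = lim (\<lambda>n. (D ^^ n) x)"

lemma funpow_tendsto: "(\<lambda>n. (D ^^ n) x) \<longlonglongrightarrow> proj1 x"
  unfolding proj1_def using funpow_Cauchy by (simp add: Cauchy_convergent_iff convergent_LIMSEQ_iff)

lemma D_proj1: "D (proj1 x) = proj1 x"
proof -
  have "(\<lambda>n. (D ^^ Suc n) x) \<longlonglongrightarrow> D (proj1 x)"
    using bounded_linear.tendsto[OF selfadj_bounded_linear[OF sa] funpow_tendsto] by simp
  moreover have "(\<lambda>n. (D ^^ Suc n) x) \<longlonglongrightarrow> proj1 x"
    by (rule LIMSEQ_Suc[OF funpow_tendsto])
  ultimately show ?thesis by (rule LIMSEQ_unique)
qed

lemma proj1_fixed: "D x = x \<Longrightarrow> proj1 x = x"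
proof -
  assume "D x = x"
  then have "(D ^^ n) x = x" for n by (induction n) auto
  then show ?thesis using LIMSEQ_unique[OF funpow_tendsto[of x]] by simp
qed

lemma proj1_iff: "proj1 x = x \<longleftrightarrow> D x = x"
  using D_proj1[of x] proj1_fixed by auto

lemma is_proj_proj1: "is_proj proj1"
  using strong_limit_selfadj(1)[of "\<lambda>n. D ^^ n" proj1, OF selfadj_funpow funpow_tendsto norm_funpow_le]
    proj1_fixed[OF D_proj1] by (simp add: is_proj_def)

lemma commutes_proj1:
  assumes "bounded_linear U" "commutes U D" shows "commutes U proj1"
proof (rule strong_limit_commutes[OF funpow_tendsto assms(1)])
  show "commutes U (D ^^ n)" for n
    using assms(2) by (induction n) (auto simp: commutes_def)
qed

end

subsection \<open>The sign of a self-adjoint operator\<close>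

text \<open>Polynomials in \<open>c\<close> with nonnegative coefficients. They commute, and they
  are nonnegative operators if \<open>c\<close> is a nonnegative self-adjoint one; this takes the
  place of a functional calculus.\<close>

inductive_set cone :: "('a::real_inner \<Rightarrow> 'a) \<Rightarrow> ('a \<Rightarrow> 'a) set" for c where
  cone_id: "(\<lambda>x. x) \<in> cone c"
| cone_step: "T \<in> cone c \<Longrightarrow> (\<lambda>x. c (T x)) \<in> cone c"
| cone_add: "S \<in> cone c \<Longrightarrow> T \<in> cone c \<Longrightarrow> (\<lambda>x. S x + T x) \<in> cone c"
| cone_scale: "T \<in> cone c \<Longrightarrow> 0 \<le> r \<Longrightarrow> (\<lambda>x. r *\<^sub>R T x) \<in> cone c"

lemma cone_commutes:
  assumes "T \<in> cone c" "linear U" "commutes U c"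
  shows "U (T x) = T (U x)"
  using assms(1)
  by (induction arbitrary: x) (use assms(2,3) in \<open>auto simp: commutes_def linear_add linear_scale\<close>)

lemma cone_selfadj:
  assumes "T \<in> cone c" "selfadj c"
  shows "selfadj T"
  using assms(1)
proof induction
  case (cone_step T)
  show ?case
    by (rule selfadj_compose[OF assms(2) cone_step.IH])
      (use cone_commutes[OF cone_step.hyps, of c] assms(2) in
        \<open>auto simp: commutes_def bounded_linear.linear selfadj_bounded_linear\<close>)
qed (auto intro: selfadj_id selfadj_add selfadj_scale)

lemma cone_compose:
  assumes "S \<in> cone c" "T \<in> cone c"
  shows "(\<lambda>x. S (T x)) \<in> cone c"
  using assms(1)
proof induction
  case (cone_step S)
  then show ?case using cone.cone_step[OF cone_step.IH] by simp
qed (use assms(2) in \<open>auto intro: cone.intros\<close>)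

lemma cone_nonneg:
  assumes "T \<in> cone c" "selfadj c" "\<And>x. 0 \<le> c x \<bullet> x"
  shows "0 \<le> T x \<bullet> x"
proof -
  \<comment> \<open>Both conjuncts go through the induction together, because positivity moves on by
    two factors \<open>c\<close> at a time: the form of \<open>c (c (T x))\<close> at
    \<open>x\<close> is the form of \<open>T\<close> at \<open>c x\<close>.\<close>
  have "\<forall>x. 0 \<le> T x \<bullet> x \<and> 0 \<le> c (T x) \<bullet> x"
    using assms(1)
  proof induction
    case (cone_step T)
    have "c (c (T x)) \<bullet> x = T (c x) \<bullet> c x" for x
      using cone_commutes[OF cone_step.hyps, of c] assms(2) selfadj_inner[OF assms(2), of "c (T x)" x]
      by (auto simp: commutes_def bounded_linear.linear selfadj_bounded_linear)
    then show ?case using cone_step.IH by auto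
  qed (use assms(2,3) in \<open>auto simp: selfadj_simps inner_add_left\<close>)
  then show ?thesis by blast
qed

text \<open>With X = A g this is the Newton-Schulz iteration X + X(1 - X^2)/2 for the sign of
  \<open>A\<close>, and \<open>sgn_c\<close> is the defect 1 - X^2. In terms of the defect a step
  reads 3/4 c^2 + 1/4 c^3. All coefficients are nonnegative, so the defect and the factor
  \<open>sgn_g\<close> stay in the cone of 1 - A^2, and \<open>sgn_g\<close> grows; that is why
  these two are iterated and not X.\<close>

fun sgn_c :: "('a::real_inner \<Rightarrow> 'a) \<Rightarrow> nat \<Rightarrow> 'a \<Rightarrow> 'a" where
  "sgn_c A 0 = (\<lambda>x. x - A (A x))"
| "sgn_c A (Suc n) = (\<lambda>x. (3/4) *\<^sub>R sgn_c A n (sgn_c A n x) + (1/4) *\<^sub>R sgn_c A n (sgn_c A n (sgn_c A n x)))"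

fun sgn_g :: "('a::real_inner \<Rightarrow> 'a) \<Rightarrow> nat \<Rightarrow> 'a \<Rightarrow> 'a" where
  "sgn_g A 0 = (\<lambda>x. x)"
| "sgn_g A (Suc n) = (\<lambda>x. sgn_g A n x + (1/2) *\<^sub>R sgn_g A n (sgn_c A n x))"

locale selfadj_contraction =
  fixes A :: "'a::{real_inner,complete_space} \<Rightarrow> 'a"
  assumes sa: "selfadj A" and contr: "\<And>x. norm (A x) \<le> norm x"
begin

abbreviation "c \<equiv> sgn_c A"
abbreviation "g \<equiv> sgn_g A"
abbreviation "X \<equiv> (\<lambda>n x. A (g n x))"

lemma c0_selfadj: "selfadj (c 0)"
proof -
  have "selfadj (\<lambda>x. A (A x))"
    by (rule selfadj_compose[OF sa sa]) (simp add: commutes_def)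
  then show ?thesis by (simp add: selfadj_diff selfadj_id)
qed

lemma c0_nonneg: "0 \<le> c 0 x \<bullet> x"
proof -
  have "c 0 x \<bullet> x = (norm x)\<^sup>2 - (norm (A x))\<^sup>2"
    by (simp add: inner_diff_left selfadj_inner[OF sa] power2_norm_eq_inner)
  then show ?thesis using contr[of x] by (simp add: power_mono)
qed

lemma c_cone: "c n \<in> cone (c 0)"
proof (induction n)
  case 0
  show ?case using cone_step[OF cone_id, of "c 0"] by simp
next
  case (Suc n)
  have 2: "(\<lambda>x. c n (c n x)) \<in> cone (c 0)" by (rule cone_compose[OF Suc Suc])
  have 3: "(\<lambda>x. c n (c n (c n x))) \<in> cone (c 0)" by (rule cone_compose[OF Suc 2])
  show ?case unfolding sgn_c.simps(2)
    by (rule cone_add[OF cone_scale[OF 2] cone_scale[OF 3]]) auto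
qed

lemma gc_cone: "(\<lambda>x. (1/2) *\<^sub>R g n (c n x)) \<in> cone (c 0)" if "g n \<in> cone (c 0)" for n
  by (rule cone_scale[OF cone_compose[OF that c_cone]]) simp

lemma g_cone: "g n \<in> cone (c 0)"
proof (induction n)
  case 0
  show ?case using cone_id by (simp add: id_def)
next
  case (Suc n)
  show ?case unfolding sgn_g.simps(2) by (rule cone_add[OF Suc gc_cone[OF Suc]])
qed

lemma g_diff_cone:
  assumes "n \<le> m"
  shows "\<exists>d\<in>cone (c 0). \<forall>x. g m x = g n x + d x"
  using assms
proof (induction rule: dec_induct)
  case base
  have "(\<lambda>x. 0 *\<^sub>R x) \<in> cone (c 0)" by (intro cone_scale cone_id) auto
  then show ?case by (intro bexI[of _ "\<lambda>x. 0 *\<^sub>R x"]) auto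
next
  case (step m)
  then obtain d where d: "d \<in> cone (c 0)" "\<And>x. g m x = g n x + d x" by auto
  show ?case
  proof (intro bexI allI)
    show "(\<lambda>x. d x + (1/2) *\<^sub>R g m (c m x)) \<in> cone (c 0)" by (rule cone_add[OF d(1) gc_cone[OF g_cone]])
    show "g (Suc m) x = g n x + (d x + (1/2) *\<^sub>R g m (c m x))" for x by (simp add: d(2) add.assoc)
  qed
qed

lemma commutes_c0:
  assumes "linear U" "commutes U A" shows "commutes U (c 0)"
  using assms by (auto simp: commutes_def linear_diff)

lemma A_c0: "commutes A (c 0)"
  by (rule commutes_c0) (use sa in \<open>auto simp: selfadj_bounded_linear bounded_linear.linear commutes_def\<close>)

lemma A_cone: "T \<in> cone (c 0) \<Longrightarrow> A (T x) = T (A x)"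
  by (rule cone_commutes[OF _ _ A_c0]) (use sa in \<open>auto simp: selfadj_bounded_linear bounded_linear.linear\<close>)

lemma cone_cone:
  assumes "S \<in> cone (c 0)" "T \<in> cone (c 0)" shows "S (T x) = T (S x)"
proof -
  have lin: "linear T" "linear (c 0)"
    using cone_selfadj[OF assms(2) c0_selfadj] c0_selfadj by (auto simp: selfadj_bounded_linear bounded_linear.linear)
  have "commutes T (c 0)"
    using cone_commutes[OF assms(2) lin(2)] by (simp add: commutes_def)
  then show ?thesis using cone_commutes[OF assms(1) lin(1)] by simp
qed

lemmas cone_sa = cone_selfadj[OF _ c0_selfadj]
lemmas cone_pos = cone_nonneg[OF _ c0_selfadj c0_nonneg]

lemma X_selfadj: "selfadj (X n)"
  by (rule selfadj_compose[OF sa cone_sa[OF g_cone]]) (simp add: commutes_def A_cone[OF g_cone])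

lemma XX: "X n (X n x) = x - c n x"
proof (induction n arbitrary: x)
  case 0 then show ?case by simp
next
  case (Suc n)
  note s = selfadj_simps[OF sa] selfadj_simps[OF cone_sa[OF c_cone]] selfadj_simps[OF cone_sa[OF g_cone]]
  have com: "X n (c n x) = c n (X n x)" for x
    using A_cone[OF c_cone] cone_cone[OF g_cone c_cone] by simp
  have step: "X (Suc n) x = X n x + (1/2) *\<^sub>R X n (c n x)" for x
    by (simp add: s)
  note sX = selfadj_simps[OF X_selfadj, of n]
  have h: "X n (c n x) = c n (X n x)" for x using com by simp
  have h1: "c n (X n (X n x)) = c n x - c n (c n x)" for x
    using Suc.IH by (simp add: s)
  have "X (Suc n) (X (Suc n) x) =
      X n (X n x) + (1/2) *\<^sub>R X n (X n (c n x)) + (1/2) *\<^sub>R (X n (c n (X n x)) + (1/2) *\<^sub>R X n (c n (X n (c n x))))"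
    unfolding step by (simp only: sX s)
  also have "\<dots> = x - c n x + (1/2) *\<^sub>R (c n x - c n (c n x)) +
     (1/2) *\<^sub>R (c n x - c n (c n x) + (1/2) *\<^sub>R (c n (c n x) - c n (c n (c n x))))"
  proof -
    have "X n (c n (X n y)) = c n y - c n (c n y)" for y
      using h[of "X n y"] h1[of y] by simp
    then show ?thesis by (simp only: Suc.IH)
  qed
  also have "\<dots> = x - ((3/4) *\<^sub>R c n (c n x) + (1/4) *\<^sub>R c n (c n (c n x)))"
    by (simp add: algebra_simps) (simp flip: scaleR_add_left)
  finally show ?case by simp
qed

lemma X_norm2: "(norm (X n x))\<^sup>2 = (norm x)\<^sup>2 - c n x \<bullet> x"
proof -
  have "(norm (X n x))\<^sup>2 = X n (X n x) \<bullet> x"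
    using selfadj_inner[OF X_selfadj, of n "X n x" x] by (simp add: power2_norm_eq_inner)
  also have "\<dots> = (norm x)\<^sup>2 - c n x \<bullet> x"
    by (simp add: XX inner_diff_left power2_norm_eq_inner)
  finally show ?thesis .
qed

lemma X_norm_le: "norm (X n x) \<le> norm x"
  by (rule power2_le_imp_le) (use X_norm2[of n x] cone_pos[OF c_cone, of n x] in auto)

text \<open>The factor \<open>g m\<close> exceeds \<open>g n\<close> by an element \<open>d\<close>
  of the cone. The cross term is therefore the form of the product of \<open>d\<close> and
  \<open>g n\<close> at \<open>A x\<close>, which is nonnegative.\<close>

lemma X_diff:
  assumes "n \<le> m" shows "(norm (X n x))\<^sup>2 \<le> X m x \<bullet> X n x"
proof -
  obtain d where d: "d \<in> cone (c 0)" "\<And>x. g m x = g n x + d x" using g_diff_cone[OF assms] by auto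
  have "X m x \<bullet> X n x = (norm (X n x))\<^sup>2 + A (d x) \<bullet> A (g n x)"
    by (simp add: d(2) selfadj_simps[OF sa] inner_add_left power2_norm_eq_inner)
  moreover have "A (d x) \<bullet> A (g n x) = d (g n (A x)) \<bullet> A x"
    using selfadj_inner[OF cone_sa[OF g_cone], of n "d (A x)" "A x"]
    by (simp add: A_cone[OF d(1)] A_cone[OF g_cone] cone_cone[OF d(1) g_cone])
  ultimately show ?thesis using cone_pos[OF cone_compose[OF d(1) g_cone], of n "A x"] by simp
qed

lemma X_Cauchy: "Cauchy (\<lambda>n. X n x)"
proof (rule bounded_mono_square_Cauchy)
  define s where "s = (\<lambda>n. (norm (X n x))\<^sup>2)"
  have *: "(norm (X m x - X n x))\<^sup>2 \<le> s m - s n" if "n \<le> m" for m n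
  proof -
    have "(norm (X m x - X n x))\<^sup>2 = s m + s n - 2 * (X m x \<bullet> X n x)"
      unfolding power2_norm_eq_inner inner_diff_left inner_diff_right s_def
      by (simp add: inner_commute[of "X n x" "X m x"])
    then show ?thesis using X_diff[OF that, of x] by (simp add: s_def)
  qed
  then show "(norm (X m x - X n x))\<^sup>2 \<le> \<bar>s m - s n\<bar>" if "n \<le> m" for m n
    using that by fastforce
  show "convergent s" unfolding convergent_def
  proof (rule incseq_convergent)
    show "incseq s" unfolding incseq_def
    proof (intro allI impI)
      fix n m :: nat assume "n \<le> m"
      then have "0 \<le> s m - s n" using * zero_le_power2 order_trans by blast
      then show "s n \<le> s m" by simp
    qed
    show "\<forall>i. s i \<le> (norm x)\<^sup>2" unfolding s_def using X_norm_le by (simp add: power_mono)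
  qed auto
qed

definition sg :: "'a \<Rightarrow> 'a" where "sg x = lim (\<lambda>n. X n x)"

lemma X_tendsto: "(\<lambda>n. X n x) \<longlonglongrightarrow> sg x"
  unfolding sg_def using X_Cauchy by (simp add: Cauchy_convergent_iff convergent_LIMSEQ_iff)

lemmas sg_selfadj = strong_limit_selfadj(1)[of X, OF X_selfadj X_tendsto X_norm_le]

lemma sg_commutes:
  assumes "bounded_linear U" "commutes U A" shows "commutes U sg"
proof (rule strong_limit_commutes[OF X_tendsto assms(1)])
  fix n
  have l: "linear U" using assms(1) by (rule bounded_linear.linear)
  show "commutes U (X n)"
    using cone_commutes[OF g_cone l commutes_c0[OF l assms(2)]] assms(2) by (simp add: commutes_def)
qed

lemma sg_A: "sg (A x) = A (sg x)"
  using sg_commutes[OF selfadj_bounded_linear[OF sa]] by (simp add: commutes_def)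

lemma sg_A_nonneg: "0 \<le> sg (A x) \<bullet> x"
proof (rule LIMSEQ_le_const[OF tendsto_inner[OF X_tendsto tendsto_const]])
  have "0 \<le> X n (A x) \<bullet> x" for n
    using cone_pos[OF g_cone, of n "A x"] selfadj_inner[OF sa, of "g n (A x)" x] by simp
  then show "\<exists>N. \<forall>n\<ge>N. 0 \<le> X n (A x) \<bullet> x" by blast
qed

text \<open>Written with X alone, the iteration step is 3/2 X - 1/2 X^3; in the strong limit this
  gives X = X^3, so that \<open>sg\<close> acts with the values -1, 0 and 1.\<close>

lemma sg_cube: "sg (sg (sg x)) = sg x"
proof -
  have th: "(3/2) *\<^sub>R y = y + (1/2) *\<^sub>R y" for y :: 'a
    using scaleR_add_left[of 1 "1/2" y] by simp
  have XX': "(\<lambda>n. X n (X n y)) \<longlonglongrightarrow> sg (sg y)" for y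
    by (rule strong_limit_compose[of X, OF X_selfadj X_tendsto X_norm_le X_tendsto])
  have "(\<lambda>n. X n (X n (X n x))) \<longlonglongrightarrow> sg (sg (sg x))"
    by (rule strong_limit_compose[of X, OF X_selfadj X_tendsto X_norm_le XX'])
  then have "(\<lambda>n. (3/2) *\<^sub>R X n x - (1/2) *\<^sub>R X n (X n (X n x))) \<longlonglongrightarrow> (3/2) *\<^sub>R sg x - (1/2) *\<^sub>R sg (sg (sg x))"
    by (intro tendsto_intros X_tendsto)
  moreover have "(3/2) *\<^sub>R X n x - (1/2) *\<^sub>R X n (X n (X n x)) = X (Suc n) x" for n
  proof -
    have "X (Suc n) x = X n x + (1/2) *\<^sub>R X n (c n x)"
      by (simp add: selfadj_simps[OF sa])
    also have "c n x = x - X n (X n x)" using XX[of n x] by simp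
    finally have "X (Suc n) x = X n x + ((1/2) *\<^sub>R X n x - (1/2) *\<^sub>R X n (X n (X n x)))"
      by (simp only: selfadj_simps[OF X_selfadj] scaleR_diff_right)
    then show ?thesis by (simp only: add_diff_eq th)
  qed
  ultimately have "(\<lambda>n. X (Suc n) x) \<longlonglongrightarrow> (3/2) *\<^sub>R sg x - (1/2) *\<^sub>R sg (sg (sg x))" by simp
  then have "(3/2) *\<^sub>R sg x - (1/2) *\<^sub>R sg (sg (sg x)) = sg x"
    using LIMSEQ_unique LIMSEQ_Suc[OF X_tendsto[of x]] by blast
  moreover have "(1/2) *\<^sub>R sg (sg (sg x)) = (1/2) *\<^sub>R sg x - ((3/2) *\<^sub>R sg x - (1/2) *\<^sub>R sg (sg (sg x)) - sg x)"
    by (simp add: algebra_simps th)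
  ultimately have "(1/2) *\<^sub>R sg (sg (sg x)) = (1/2) *\<^sub>R sg x" by simp
  then show ?thesis by simp
qed

text \<open>The sign vanishes at most where \<open>A\<close> does; together with
  \<open>sg_kernel\<close> the two kernels agree. The proof is \<open>X_diff\<close> with the start
  \<open>X 0 = A\<close> of the iteration.\<close>

lemma A_norm_le_sg: "norm (A x) \<le> norm (sg x)"
proof (rule LIMSEQ_le_const[OF tendsto_norm[OF X_tendsto]])
  have "norm (A x) \<le> norm (X n x)" for n
  proof -
    have "(norm (A x))\<^sup>2 \<le> X n x \<bullet> A x" using X_diff[of 0 n x] by simp
    also have "\<dots> \<le> norm (X n x) * norm (A x)" by (rule norm_cauchy_schwarz)
    finally show ?thesis
      by (cases "norm (A x) = 0") (auto simp: power2_eq_square mult_le_cancel_right)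
  qed
  then show "\<exists>N. \<forall>n\<ge>N. norm (A x) \<le> norm (X n x)" by blast
qed

lemma sg_kernel: "A x = 0 \<Longrightarrow> sg x = 0"
proof -
  assume "A x = 0"
  then have "X n x = 0" for n
    using A_cone[OF g_cone] selfadj_simps(4)[OF cone_sa[OF g_cone]] by simp
  then show ?thesis using LIMSEQ_unique[OF X_tendsto[of x]] by simp
qed

lemma A_sg_sg: "A (sg (sg x)) = A x"
proof -
  have "sg (x - sg (sg x)) = 0" by (simp add: selfadj_simps[OF sg_selfadj] sg_cube)
  then have "A (x - sg (sg x)) = 0" using A_norm_le_sg[of "x - sg (sg x)"] by simp
  then show ?thesis by (simp add: selfadj_simps[OF sa])
qed

end

text \<open>E is the spectral projection for the half-line up to and including \<open>l\<close>. The
  last clause puts the eigenspace at \<open>l\<close> into E; continuity from the right of the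
  spectral family rests on it.\<close>

lemma spectral_split:
  fixes T :: "'a::{real_inner,complete_space} \<Rightarrow> 'a"
  assumes "selfadj T"
  shows "\<exists>E. is_proj E \<and> (\<forall>U. bounded_linear U \<longrightarrow> commutes U T \<longrightarrow> commutes U E) \<and>
    (\<forall>x. E x = x \<longrightarrow> T x \<bullet> x \<le> l * (x \<bullet> x)) \<and> (\<forall>x. E x = 0 \<longrightarrow> l * (x \<bullet> x) \<le> T x \<bullet> x) \<and>
    (\<forall>x. T x = l *\<^sub>R x \<longrightarrow> E x = x)"
proof -
  have saTl: "selfadj (\<lambda>x. T x - l *\<^sub>R x)"
    by (rule selfadj_diff[OF assms selfadj_scale[OF selfadj_id]])
  from bounded_linear.pos_bounded[OF selfadj_bounded_linear[OF saTl]]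
  obtain K where K: "K > 0" "\<And>x. norm (T x - l *\<^sub>R x) \<le> norm x * K" by auto
  define A where "A = (\<lambda>x. (1/K) *\<^sub>R (T x - l *\<^sub>R x))"
  have TA: "T x = l *\<^sub>R x + K *\<^sub>R A x" for x using K(1) by (simp add: A_def)
  interpret selfadj_contraction A
  proof
    show "selfadj A" unfolding A_def by (rule selfadj_scale[OF saTl])
    show "norm (A x) \<le> norm x" for x
      using K(2)[of x] K(1) by (simp add: A_def pos_divide_le_eq del: scaleR_diff_right)
  qed
  \<comment> \<open>The part where \<open>T\<close> is strictly above \<open>l\<close>: the
    polynomial (s^2 + s)/2 sends the values 1, 0, -1 of the sign to 1, 0, 0.\<close>
  define F where "F = (\<lambda>x. (1/2) *\<^sub>R (sg (sg x) + sg x))"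
  note ss = selfadj_simps[OF sg_selfadj]
  have F: "is_proj F" unfolding is_proj_def
  proof (intro conjI allI)
    have "selfadj (\<lambda>x. sg (sg x))"
      by (rule selfadj_compose[OF sg_selfadj sg_selfadj]) (simp add: commutes_def)
    then show "selfadj F" unfolding F_def
      by (intro selfadj_scale selfadj_add sg_selfadj)
    show "F (F x) = F x" for x
      by (simp add: F_def ss sg_cube algebra_simps) (simp flip: scaleR_add_left)
  qed
  show ?thesis
  proof (intro exI[of _ "\<lambda>x. x - F x"] conjI allI impI)
    show "is_proj (\<lambda>x. x - F x)" by (rule is_proj_complement[OF F])
    show "commutes U (\<lambda>x. x - F x)" if U: "bounded_linear U" "commutes U T" for U
    proof -
      interpret U: bounded_linear U by fact
      have "commutes U A" using U(2) by (simp add: commutes_def A_def U.scaleR U.diff)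
      then have "commutes U sg" by (rule sg_commutes[OF U(1)])
      then show ?thesis by (simp add: commutes_def F_def U.diff U.scaleR U.add)
    qed
    show "T x \<bullet> x \<le> l * (x \<bullet> x)" if "x - F x = x" for x
    proof -
      have "sg (sg x) = - sg x" using that by (simp add: F_def add_eq_0_iff2)
      then have "A x = - sg (A x)" using A_sg_sg[of x] by (simp add: selfadj_simps[OF sa] sg_A)
      then have "A x \<bullet> x = - (sg (A x) \<bullet> x)" by (metis inner_minus_left)
      then have "A x \<bullet> x \<le> 0" using sg_A_nonneg[of x] by simp
      then show ?thesis using K(1) by (simp add: TA inner_add_left mult_nonneg_nonpos)
    qed
    show "l * (x \<bullet> x) \<le> T x \<bullet> x" if "x - F x = 0" for x
    proof -
      have Fx: "F x = x" using that by simp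
      have "sg (F x) = F x" by (simp add: F_def ss sg_cube add.commute)
      then have "sg x = x" by (simp add: Fx)
      then have "0 \<le> A x \<bullet> x" using sg_A_nonneg[of x] by (simp add: sg_A)
      then show ?thesis using K(1) by (simp add: TA inner_add_left)
    qed
    show "x - F x = x" if "T x = l *\<^sub>R x" for x
    proof -
      have "A x = 0" using that by (simp add: A_def)
      then show ?thesis using sg_kernel[of x] by (simp add: F_def ss)
    qed
  qed
qed

subsection \<open>The spectral theorem for bounded self-adjoint operators\<close>

text \<open>Over \<open>n\<close> equal pieces the increments of \<open>\<Phi>\<close> add up to at
  most (b - a)(F b - F a)/n. With it an operator form is identified with a spectral integral,
  without Riemann-Stieltjes sums.\<close>

lemma subdivision_constant:
  fixes \<Phi> F :: "real \<Rightarrow> real"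
  assumes bd: "\<And>s t. a \<le> s \<Longrightarrow> s \<le> t \<Longrightarrow> t \<le> b \<Longrightarrow> \<bar>\<Phi> t - \<Phi> s\<bar> \<le> (t - s) * (F t - F s)"
    and "a \<le> b"
  shows "\<Phi> b = \<Phi> a"
proof -
  have main: "\<bar>\<Phi> b - \<Phi> a\<bar> \<le> (b - a) * (F b - F a) / real (Suc m)" for m
  proof -
    define n where "n = Suc m"
    have "n > 0" by (simp add: n_def)
    define d where "d = (b - a) / n"
    define t where "t = (\<lambda>k. a + real k * d)"
    have t0: "t 0 = a" by (simp add: t_def)
    have tn: "t n = b" using \<open>n > 0\<close> by (simp add: t_def d_def)
    have step: "t (Suc k) - t k = (b - a) / n" for k
      by (simp add: t_def distrib_right flip: d_def)
    have ge: "a \<le> t k" for k using \<open>a \<le> b\<close> by (simp add: t_def d_def)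
    have mono: "t k \<le> t (Suc k)" for k
    proof -
      have "(b - a) / n \<ge> 0" using \<open>a \<le> b\<close> by simp
      then show ?thesis using step[of k] by linarith
    qed
    have le: "t k \<le> b" if "k \<le> n" for k
    proof -
      have "incseq t" using mono by (simp add: incseq_SucI)
      then show ?thesis using that tn by (metis incseqD)
    qed
    have "\<Phi> b - \<Phi> a = (\<Sum>k<n. \<Phi> (t (Suc k)) - \<Phi> (t k))"
      using sum_lessThan_telescope[of "\<lambda>k. \<Phi> (t k)" n] by (simp add: t0 tn)
    then have "\<bar>\<Phi> b - \<Phi> a\<bar> \<le> (\<Sum>k<n. \<bar>\<Phi> (t (Suc k)) - \<Phi> (t k)\<bar>)" by simp
    also have "\<dots> \<le> (\<Sum>k<n. (b - a) / n * (F (t (Suc k)) - F (t k)))"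
    proof (rule sum_mono)
      fix k assume "k \<in> {..<n}"
      then show "\<bar>\<Phi> (t (Suc k)) - \<Phi> (t k)\<bar> \<le> (b - a) / n * (F (t (Suc k)) - F (t k))"
        using bd[OF ge[of k] mono[of k] le[of "Suc k"]] by (simp add: step)
    qed
    also have "\<dots> = (b - a) / n * (F b - F a)"
      by (simp only: sum_distrib_left[symmetric] sum_lessThan_telescope[of "\<lambda>k. F (t k)"] t0 tn)
    finally show ?thesis by (simp add: n_def)
  qed
  have "(\<lambda>m. (b - a) * (F b - F a) / real (Suc m)) \<longlonglongrightarrow> 0"
    by (rule LIMSEQ_Suc[OF lim_const_over_n])
  then have "\<bar>\<Phi> b - \<Phi> a\<bar> \<le> 0"
    by (rule LIMSEQ_le_const) (use main in blast)
  then show ?thesis by simp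
qed

lemma mono_right_continuous:
  fixes F :: "real \<Rightarrow> real"
  assumes mono: "\<And>x y. x \<le> y \<Longrightarrow> F x \<le> F y"
    and lim: "(\<lambda>n. F (a + 1 / real (Suc n))) \<longlonglongrightarrow> F a"
  shows "continuous (at_right a) F"
  unfolding continuous_within
proof (rule tendstoI)
  fix e :: real assume "e > 0"
  then have "eventually (\<lambda>n. dist (F (a + 1 / real (Suc n))) (F a) < e) sequentially"
    by (rule tendstoD[OF lim])
  then obtain n where n: "dist (F (a + 1 / real (Suc n))) (F a) < e"
    by (auto simp: eventually_sequentially)
  have "eventually (\<lambda>x. x \<in> {a<..<a + 1 / real (Suc n)}) (at_right a)"
    by (rule eventually_at_right_real) simp
  then show "eventually (\<lambda>x. dist (F x) (F a) < e) (at_right a)"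
  proof eventually_elim
    case (elim x)
    then have "F a \<le> F x" "F x \<le> F (a + 1 / real (Suc n))" by (auto intro: mono)
    then show ?case using n by (simp add: dist_real_def)
  qed
qed

lemma inner_le_zeroD: "x \<bullet> x \<le> 0 \<Longrightarrow> x = 0" for x :: "'a::real_inner"
  using inner_ge_zero[of x] inner_eq_zero_iff[of x] by linarith

text \<open>\<open>P\<close> projects onto the closed subspace on which the resolution lives. It is
  the identity for the constructed resolution, and the restriction to a vertex set for a given
  resolution on that set, extended to the whole type.\<close>

definition real_resolution ::
  "('a::real_inner \<Rightarrow> 'a) \<Rightarrow> ('a \<Rightarrow> 'a) \<Rightarrow> (real set \<Rightarrow> 'a \<Rightarrow> 'a) \<Rightarrow> bool" where
  "real_resolution T P E \<longleftrightarrow>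
     (\<forall>B\<in>sets borel. is_proj (E B)) \<and> (\<forall>x. E UNIV x = P x) \<and>
     (\<forall>A\<in>sets borel. \<forall>B\<in>sets borel. \<forall>x. E (A \<inter> B) x = E A (E B x)) \<and>
     (\<forall>A :: nat \<Rightarrow> real set. range A \<subseteq> sets borel \<longrightarrow> disjoint_family A \<longrightarrow>
        (\<forall>x y. (\<lambda>n. E (A n) x \<bullet> y) sums (E (\<Union>n. A n) x \<bullet> y))) \<and>
     (\<exists>a. \<forall>x. E {-a<..<a} x = P x) \<and>
     (\<forall>x. P x = x \<longrightarrow>
        T x \<bullet> x = (\<integral>t. t \<partial>(measure_of UNIV (sets borel) (\<lambda>B. ennreal (E B x \<bullet> x)))))"

locale sa_operator =
  fixes T :: "'a::{real_inner,complete_space} \<Rightarrow> 'a"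
  assumes sa: "selfadj T"
begin

definition Ef :: "real \<Rightarrow> 'a \<Rightarrow> 'a" where
  "Ef l = (SOME E. is_proj E \<and> (\<forall>U. bounded_linear U \<longrightarrow> commutes U T \<longrightarrow> commutes U E) \<and>
    (\<forall>x. E x = x \<longrightarrow> T x \<bullet> x \<le> l * (x \<bullet> x)) \<and> (\<forall>x. E x = 0 \<longrightarrow> l * (x \<bullet> x) \<le> T x \<bullet> x) \<and>
    (\<forall>x. T x = l *\<^sub>R x \<longrightarrow> E x = x))"

lemma Ef_props:
  "is_proj (Ef l) \<and> (\<forall>U. bounded_linear U \<longrightarrow> commutes U T \<longrightarrow> commutes U (Ef l)) \<and>
    (\<forall>x. Ef l x = x \<longrightarrow> T x \<bullet> x \<le> l * (x \<bullet> x)) \<and> (\<forall>x. Ef l x = 0 \<longrightarrow> l * (x \<bullet> x) \<le> T x \<bullet> x) \<and>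
    (\<forall>x. T x = l *\<^sub>R x \<longrightarrow> Ef l x = x)"
  unfolding Ef_def by (rule someI_ex[OF spectral_split[OF sa]])

lemma Ef_proj: "is_proj (Ef l)" using Ef_props by blast
lemma Ef_commutes: "bounded_linear U \<Longrightarrow> commutes U T \<Longrightarrow> commutes U (Ef l)" using Ef_props by blast
lemma Ef_le: "Ef l x = x \<Longrightarrow> T x \<bullet> x \<le> l * (x \<bullet> x)" using Ef_props by blast
lemma Ef_ge: "Ef l x = 0 \<Longrightarrow> l * (x \<bullet> x) \<le> T x \<bullet> x" using Ef_props by blast
lemma Ef_eigen: "T x = l *\<^sub>R x \<Longrightarrow> Ef l x = x" using Ef_props by blast

lemmas Ef_sa = is_proj_selfadj[OF Ef_proj]
lemmas Ef_bl = selfadj_bounded_linear[OF Ef_sa]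
lemmas Ef_s = selfadj_simps[OF Ef_sa]
lemmas T_s = selfadj_simps[OF sa]

lemma T_Ef: "T (Ef l x) = Ef l (T x)"
  using Ef_commutes[OF selfadj_bounded_linear[OF sa]] by (simp add: commutes_def)

lemma Ef_Ef: "Ef l (Ef m x) = Ef m (Ef l x)"
  using Ef_commutes[OF Ef_bl, of l m] T_Ef by (simp add: commutes_def)

lemma Ef_mono:
  assumes "l \<le> m" shows "Ef l (Ef m x) = Ef l x" "Ef m (Ef l x) = Ef l x"
proof -
  have "Ef l (Ef m x) = Ef l x"
  proof (cases "l = m")
    case True then show ?thesis by (simp add: is_proj_idem[OF Ef_proj])
  next
    case False
    \<comment> \<open>This vector lies in the range of \<open>Ef l\<close> and in the kernel of
      \<open>Ef m\<close>, so its form is at most \<open>l\<close> and at least \<open>m\<close>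
      times its squared norm.\<close>
    define y where "y = Ef l (x - Ef m x)"
    have "Ef l y = y" by (simp add: y_def is_proj_idem[OF Ef_proj])
    moreover have "Ef m y = 0"
      unfolding y_def by (subst Ef_Ef) (simp add: Ef_s is_proj_idem[OF Ef_proj])
    ultimately have "m * (y \<bullet> y) \<le> l * (y \<bullet> y)" using Ef_le[of l y] Ef_ge[of m y] by simp
    then have "(m - l) * (y \<bullet> y) \<le> 0" by (simp add: algebra_simps)
    then have "y \<bullet> y \<le> 0" using False assms by (simp add: mult_le_0_iff)
    then have "y = 0" by (rule inner_le_zeroD)
    then show ?thesis by (simp add: y_def Ef_s)
  qed
  then show "Ef l (Ef m x) = Ef l x" "Ef m (Ef l x) = Ef l x" by (simp_all add: Ef_Ef[of m l])
qed

lemma diff_proj: "l \<le> m \<Longrightarrow> is_proj (\<lambda>x. Ef m x - Ef l x)"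
  unfolding is_proj_def
  by (auto simp: selfadj_diff Ef_sa Ef_s Ef_mono is_proj_idem[OF Ef_proj])

lemma Ef_norm_mono: "l \<le> m \<Longrightarrow> Ef l x \<bullet> x \<le> Ef m x \<bullet> x"
  using is_proj_inner[OF diff_proj, of l m x] by (simp add: inner_diff_left)
    (smt (verit) zero_le_power2)

definition K :: real where "K = (SOME K. K > 0 \<and> (\<forall>x. norm (T x) \<le> norm x * K))"

lemma K: "K > 0" "norm (T x) \<le> norm x * K"
proof -
  have "\<exists>K>0. \<forall>x. norm (T x) \<le> norm x * K"
    using bounded_linear.pos_bounded[OF selfadj_bounded_linear[OF sa]] .
  then have "K > 0 \<and> (\<forall>x. norm (T x) \<le> norm x * K)" unfolding K_def by (rule someI_ex)
  then show "K > 0" "norm (T x) \<le> norm x * K" by auto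
qed

lemma T_bound: "\<bar>T x \<bullet> x\<bar> \<le> K * (x \<bullet> x)"
proof -
  have "\<bar>T x \<bullet> x\<bar> \<le> norm (T x) * norm x" by (rule Cauchy_Schwarz_ineq2)
  also have "\<dots> \<le> (norm x * K) * norm x" by (intro mult_right_mono K) auto
  finally show ?thesis
    by (metis dot_square_norm mult.commute mult.left_commute power2_eq_square)
qed

lemma Ef_low: "l < - K \<Longrightarrow> Ef l x = 0"
proof -
  assume l: "l < - K"
  define y where "y = Ef l x"
  have "T y \<bullet> y \<le> l * (y \<bullet> y)" by (rule Ef_le) (simp add: y_def is_proj_idem[OF Ef_proj])
  then have "0 \<le> (l + K) * (y \<bullet> y)" using T_bound[of y] by (simp add: algebra_simps)
  then have "y \<bullet> y \<le> 0" using l by (simp add: zero_le_mult_iff)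
  then have "y = 0" by (rule inner_le_zeroD)
  then show "Ef l x = 0" by (simp add: y_def)
qed

lemma Ef_high: "K < l \<Longrightarrow> Ef l x = x"
proof -
  assume l: "K < l"
  define y where "y = x - Ef l x"
  have "l * (y \<bullet> y) \<le> T y \<bullet> y" by (rule Ef_ge) (simp add: y_def Ef_s is_proj_idem[OF Ef_proj])
  then have "(l - K) * (y \<bullet> y) \<le> 0" using T_bound[of y] by (simp add: algebra_simps)
  then have "y \<bullet> y \<le> 0" using l by (simp add: mult_le_0_iff)
  then have "y = 0" by (rule inner_le_zeroD)
  then show "Ef l x = x" by (simp add: y_def)
qed

text \<open>The jump \<open>y\<close> at \<open>l\<close> lies in the range of
  \<open>Ef (m n)\<close> for all \<open>n\<close>, so the form of \<open>T\<close> at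
  \<open>y\<close> is at most \<open>l\<close> times the squared norm. On the complement of
  \<open>Ef l\<close> it is at least that. Equality in a positive form forces an eigenvector at
  \<open>l\<close>, but these belong to \<open>Ef l\<close>; so the jump is zero.\<close>

lemma Ef_right_cont: "(\<lambda>n. Ef (l + 1 / real (Suc n)) x) \<longlonglongrightarrow> Ef l x"
proof -
  define m where "m = (\<lambda>n. l + 1 / real (Suc n))"
  have mle: "m j \<le> m i" if "i \<le> j" for i j
    using that by (simp add: m_def frac_le)
  have lm: "l \<le> m n" for n by (simp add: m_def)
  have Cauchy: "Cauchy (\<lambda>n. Ef (m n) x)"
  proof (rule bounded_mono_square_Cauchy)
    show "(norm (Ef (m i) x - Ef (m j) x))\<^sup>2 \<le> \<bar>Ef (m i) x \<bullet> x - Ef (m j) x \<bullet> x\<bar>" if "j \<le> i" for i j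
      using is_proj_inner[OF diff_proj[OF mle[OF that]], of x] by (simp add: inner_diff_left norm_minus_commute)
    show "convergent (\<lambda>n. Ef (m n) x \<bullet> x)" unfolding convergent_def
    proof (rule decseq_convergent)
      show "decseq (\<lambda>n. Ef (m n) x \<bullet> x)" unfolding decseq_def using Ef_norm_mono mle by blast
      show "\<forall>i. 0 \<le> Ef (m i) x \<bullet> x" by (simp add: is_proj_inner[OF Ef_proj])
    qed auto
  qed
  then obtain z where z: "(\<lambda>n. Ef (m n) x) \<longlonglongrightarrow> z" by (auto simp: Cauchy_convergent_iff convergent_def)
  define y where "y = z - Ef l x"
  have Efz: "Ef (m n) z = z" for n
  proof (rule LIMSEQ_unique[OF bounded_linear.tendsto[OF Ef_bl z] LIMSEQ_offset[OF _, of _ n]])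
    have "Ef (m n) (Ef (m (k + n)) x) = Ef (m (k + n)) x" for k using Ef_mono(2)[OF mle[of n "k + n"]] by simp
    then show "(\<lambda>k. Ef (m n) (Ef (m (k + n)) x)) \<longlonglongrightarrow> z" using LIMSEQ_ignore_initial_segment[OF z] by simp
  qed
  have y1: "Ef (m n) y = y" for n by (simp add: y_def Ef_s Efz Ef_mono(2)[OF lm])
  have "Ef l z = Ef l x"
    using LIMSEQ_unique[OF bounded_linear.tendsto[OF Ef_bl[of l] z]] by (simp add: Ef_mono(1)[OF lm])
  then have y2: "Ef l y = 0" by (simp add: y_def Ef_s is_proj_idem[OF Ef_proj])
  have "T y \<bullet> y \<le> l * (y \<bullet> y)"
  proof (rule LIMSEQ_le_const)
    have "(\<lambda>n. m n * (y \<bullet> y)) \<longlonglongrightarrow> (l + 0) * (y \<bullet> y)"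
      unfolding m_def by (intro tendsto_intros LIMSEQ_Suc[OF lim_const_over_n])
    then show "(\<lambda>n. m n * (y \<bullet> y)) \<longlonglongrightarrow> l * (y \<bullet> y)" by simp
    show "\<exists>N. \<forall>n\<ge>N. T y \<bullet> y \<le> m n * (y \<bullet> y)" using Ef_le[OF y1] by blast
  qed
  define B where "B = (\<lambda>v. T (v - Ef l v) - l *\<^sub>R (v - Ef l v))"
  have "selfadj (\<lambda>v. T (v - Ef l v))"
    by (rule selfadj_compose[OF sa selfadj_diff[OF selfadj_id Ef_sa]]) (simp add: commutes_def T_s T_Ef)
  then have saB: "selfadj B" unfolding B_def
    by (intro selfadj_diff selfadj_scale selfadj_id Ef_sa)
  have Bnn: "0 \<le> B v \<bullet> v" for v
  proof -
    define u where "u = v - Ef l v"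
    have u: "Ef l u = 0" by (simp add: u_def Ef_s is_proj_idem[OF Ef_proj])
    have uE: "u \<bullet> Ef l v = 0" using selfadj_inner[OF Ef_sa, of l u v] u by simp
    have TuE: "T u \<bullet> Ef l v = 0" using selfadj_inner[OF Ef_sa, of l "T u" v] u by (simp add: T_s flip: T_Ef)
    have v: "v = u + Ef l v" by (simp add: u_def)
    have "B v \<bullet> v = (T u - l *\<^sub>R u) \<bullet> (u + Ef l v)" unfolding B_def u_def by simp
    also have "\<dots> = T u \<bullet> u - l * (u \<bullet> u)"
      by (simp add: inner_diff_left inner_add_right uE TuE)
    finally show ?thesis using Ef_ge[OF u] by simp
  qed
  have By: "B y = T y - l *\<^sub>R y" by (simp add: B_def y2)
  have "B y \<bullet> y = 0" using Bnn[of y] \<open>T y \<bullet> y \<le> l * (y \<bullet> y)\<close> by (simp add: By inner_diff_left)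
  then have "B y = 0" by (rule positive_form_zero[OF saB Bnn])
  then have "T y = l *\<^sub>R y" by (simp add: By)
  then have "Ef l y = y" by (rule Ef_eigen)
  then have "z = Ef l x" using y2 by (simp add: y_def)
  then show ?thesis using z by (simp add: m_def)
qed

abbreviation F :: "'a \<Rightarrow> real \<Rightarrow> real" where "F x l \<equiv> Ef l x \<bullet> x"

lemma F_mono: "l \<le> m \<Longrightarrow> F x l \<le> F x m" by (rule Ef_norm_mono)

lemma F_cont: "continuous (at_right a) (F x)"
  by (rule mono_right_continuous[OF F_mono tendsto_inner[OF Ef_right_cont tendsto_const]])

section \<open>Spectral measures of vectors\<close>

definition Mx :: "'a \<Rightarrow> real measure" where "Mx x = interval_measure (F x)"

lemma sets_Mx [simp, measurable_cong]: "sets (Mx x) = sets borel" by (simp add: Mx_def)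
lemma space_Mx [simp]: "space (Mx x) = UNIV" by (simp add: Mx_def)

lemma emeasure_Mx_Ioc: "a \<le> b \<Longrightarrow> emeasure (Mx x) {a<..b} = ennreal (F x b - F x a)"
  unfolding Mx_def by (rule emeasure_interval_measure_Ioc[OF _ F_mono F_cont])

lemma emeasure_Mx_UNIV: "emeasure (Mx x) UNIV = ennreal (x \<bullet> x)"
proof -
  have "(\<lambda>n. emeasure (Mx x) {- real n<..real n}) \<longlonglongrightarrow> emeasure (Mx x) (\<Union>n. {- real n<..real n})"
    by (rule Lim_emeasure_incseq) (auto simp: incseq_def)
  moreover have "(\<Union>n. {- real n<..real n}) = UNIV"
  proof (intro equalityI subsetI UNIV_I)
    fix t :: real
    obtain n where "\<bar>t\<bar> < real n" using reals_Archimedean2 by blast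
    then show "t \<in> (\<Union>n. {- real n<..real n})" by (intro UN_I[of n]) auto
  qed
  moreover have "(\<lambda>n. emeasure (Mx x) {- real n<..real n}) \<longlonglongrightarrow> ennreal (x \<bullet> x)"
  proof (rule tendsto_eventually)
    obtain N where N: "K < real N" using reals_Archimedean2 by blast
    show "\<forall>\<^sub>F n in sequentially. emeasure (Mx x) {- real n<..real n} = ennreal (x \<bullet> x)"
      unfolding eventually_sequentially
    proof (intro exI[of _ N] allI impI)
      fix n :: nat assume "N \<le> n"
      then have "K < real n" using N by simp
      then show "emeasure (Mx x) {- real n<..real n} = ennreal (x \<bullet> x)"
        by (simp add: emeasure_Mx_Ioc Ef_low Ef_high)
    qed
  qed
  ultimately show ?thesis using LIMSEQ_unique by metis
qed

sublocale fin: finite_measure "Mx x" for x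
  by (rule finite_measureI) (simp add: emeasure_Mx_UNIV)

lemma measure_Mx_UNIV: "measure (Mx x) UNIV = x \<bullet> x"
  by (simp add: measure_def emeasure_Mx_UNIV)

lemma measure_Mx_Ioc: "a \<le> b \<Longrightarrow> measure (Mx x) {a<..b} = F x b - F x a"
  by (simp add: measure_def emeasure_Mx_Ioc F_mono)

text \<open>Cut off both sides at a level. From level \<open>s\<close> to level \<open>t\<close>
  each of them changes by an amount between \<open>s\<close> and \<open>t\<close> times the mass of
  the interval, so their difference changes by at most \<open>t - s\<close> times this mass and is
  constant by \<open>subdivision_constant\<close>.\<close>

lemma Mx_integral: "T x \<bullet> x = (\<integral>t. t \<partial>Mx x)"
proof -
  \<comment> \<open>Strictly beyond the norm bound, so that \<open>Ef_low\<close> and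
    \<open>Ef_high\<close> apply at both ends.\<close>
  define L where "L = K + 1"
  have L: "K < L" "0 < L" using K(1) by (auto simp: L_def)
  have int: "integrable (Mx x) (\<lambda>t. indicator {a<..b} t * t)" for a b :: real
    by (rule fin.integrable_const_bound[of _ "max \<bar>a\<bar> \<bar>b\<bar>"]) (auto simp: indicator_def)
  have intc: "integrable (Mx x) (\<lambda>t. indicator {a<..b} t * c)" for a b c :: real
    by (rule fin.integrable_const_bound[of _ "\<bar>c\<bar>"]) (auto simp: indicator_def)
  define \<Phi> where "\<Phi> = (\<lambda>l. T (Ef l x) \<bullet> x - (\<integral>t. indicator {-L<..l} t * t \<partial>Mx x))"
  have "\<Phi> L = \<Phi> (-L)"
  proof (rule subdivision_constant[where \<Phi> = \<Phi> and a = "-L" and b = L and F = "F x"])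
    show "-L \<le> L" using L by simp
    fix s t assume st: "-L \<le> s" "s \<le> t" "t \<le> L"
    define p where "p = Ef t x - Ef s x"
    have p1: "Ef t p = p" "Ef s p = 0"
      by (simp_all add: p_def Ef_s Ef_mono[OF st(2)] is_proj_idem[OF Ef_proj])
    have pp: "p \<bullet> p = F x t - F x s"
      using is_proj_inner[OF diff_proj[OF st(2)], of x] by (simp add: p_def inner_diff_left power2_norm_eq_inner)
    have "T p \<bullet> x = T p \<bullet> p"
    proof -
      have "Ef t (T p) = T p" "Ef s (T p) = 0" using T_Ef[of t p] T_Ef[of s p] p1 by (simp_all add: T_s)
      then have "T p \<bullet> x = T p \<bullet> (Ef t x - Ef s x)"
        using selfadj_inner[OF Ef_sa, of t "T p" x] selfadj_inner[OF Ef_sa, of s "T p" x]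
        by (simp add: inner_diff_right)
      then show ?thesis by (simp add: p_def)
    qed
    then have b1: "s * (p \<bullet> p) \<le> T p \<bullet> x" "T p \<bullet> x \<le> t * (p \<bullet> p)"
      using Ef_le[OF p1(1)] Ef_ge[OF p1(2)] by auto
    have spl: "indicator {-L<..t} u * u = indicator {-L<..s} u * u + indicator {s<..t} u * (u::real)" for u
      using st by (auto simp: indicator_def)
    have "(\<integral>u. indicator {-L<..t} u * u \<partial>Mx x) = (\<integral>u. indicator {-L<..s} u * u \<partial>Mx x) + (\<integral>u. indicator {s<..t} u * u \<partial>Mx x)"
      unfolding spl by (rule Bochner_Integration.integral_add[OF int int])
    moreover have "measure (Mx x) {s<..t} = p \<bullet> p"
      by (simp add: pp measure_Mx_Ioc[OF st(2)])
    moreover have "(\<integral>u. indicator {s<..t} u * s \<partial>Mx x) \<le> (\<integral>u. indicator {s<..t} u * u \<partial>Mx x)"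
      by (rule integral_mono[OF intc int]) (auto simp: indicator_def)
    moreover have "(\<integral>u. indicator {s<..t} u * u \<partial>Mx x) \<le> (\<integral>u. indicator {s<..t} u * t \<partial>Mx x)"
      by (rule integral_mono[OF int intc]) (auto simp: indicator_def)
    ultimately have b2: "s * (p \<bullet> p) \<le> (\<integral>u. indicator {-L<..t} u * u \<partial>Mx x) - (\<integral>u. indicator {-L<..s} u * u \<partial>Mx x)"
      "(\<integral>u. indicator {-L<..t} u * u \<partial>Mx x) - (\<integral>u. indicator {-L<..s} u * u \<partial>Mx x) \<le> t * (p \<bullet> p)"
      by (auto simp: mult.commute)
    have "\<Phi> t - \<Phi> s = T p \<bullet> x - ((\<integral>u. indicator {-L<..t} u * u \<partial>Mx x) - (\<integral>u. indicator {-L<..s} u * u \<partial>Mx x))"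
      by (simp add: \<Phi>_def p_def T_s inner_diff_left)
    moreover have "(t - s) * (F x t - F x s) = t * (p \<bullet> p) - s * (p \<bullet> p)"
      unfolding pp by (rule left_diff_distrib)
    ultimately show "\<bar>\<Phi> t - \<Phi> s\<bar> \<le> (t - s) * (F x t - F x s)" using b1 b2 by linarith
  qed
  moreover have "\<Phi> (-L) = 0" using L by (simp add: \<Phi>_def Ef_low T_s)
  ultimately have "T x \<bullet> x = (\<integral>t. indicator {-L<..L} t * t \<partial>Mx x)"
    using L by (simp add: \<Phi>_def Ef_high)
  also have "\<dots> = (\<integral>t. t \<partial>Mx x)"
  proof (rule integral_cong_AE)
    have "measure (Mx x) (UNIV - {-L<..L}) = measure (Mx x) UNIV - measure (Mx x) {-L<..L}"
      by (rule fin.finite_measure_Diff) auto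
    also have "\<dots> = 0" using L by (simp add: measure_Mx_UNIV measure_Mx_Ioc Ef_low Ef_high)
    finally have "UNIV - {-L<..L} \<in> null_sets (Mx x)"
      by (intro null_setsI) (auto simp: fin.emeasure_eq_measure)
    then show "AE t in Mx x. indicator {-L<..L} t * t = t"
      by (rule AE_I') (auto simp: indicator_def)
  qed auto
  finally show ?thesis .
qed

text \<open>The spectral measures determine the projection through its quadratic form. Commutation
  with everything that commutes with \<open>T\<close> is carried along for two later instances:
  multiplication by the imaginary unit and restriction to a vertex set.\<close>

definition spec_proj :: "real set \<Rightarrow> ('a \<Rightarrow> 'a) \<Rightarrow> bool" where
  "spec_proj B P \<longleftrightarrow> is_proj P \<and> (\<forall>U. bounded_linear U \<longrightarrow> commutes U T \<longrightarrow> commutes U P) \<and>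
     (\<forall>x. P x \<bullet> x = measure (Mx x) B)"

text \<open>A vector in the range of \<open>Q\<close> has its whole spectral mass in
  \<open>B\<close>, and none is left for \<open>A\<close>.\<close>

lemma spec_proj_orthogonal:
  assumes "spec_proj A P" "spec_proj B Q" "A \<inter> B = {}" "A \<in> sets borel" "B \<in> sets borel"
  shows "P (Q x) = 0"
proof -
  define y where "y = Q x"
  have Q: "is_proj Q" "is_proj P" using assms by (auto simp: spec_proj_def)
  have "Q y = y" by (simp add: y_def is_proj_idem[OF Q(1)])
  then have "measure (Mx y) B = measure (Mx y) UNIV"
    using assms(2) by (metis measure_Mx_UNIV spec_proj_def)
  moreover have "measure (Mx y) A + measure (Mx y) B \<le> measure (Mx y) UNIV"
    using fin.finite_measure_Union[of A y B] fin.finite_measure_mono[of "A \<union> B" UNIV y] assms by simp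
  ultimately have "measure (Mx y) A = 0" using measure_nonneg[of "Mx y" A] by linarith
  then have "P y \<bullet> y = 0" using assms(1) by (simp add: spec_proj_def)
  then show ?thesis using is_proj_inner[OF Q(2), of y] by (simp add: y_def)
qed

text \<open>Half-open intervals are stable under intersection and generate the Borel sets, so
  complements and disjoint countable unions suffice. For a union, the partial sums of the mutually
  orthogonal projections form an increasing sequence of projections and converge strongly.\<close>

lemma spec_proj_exists:
  assumes "B \<in> sets borel" shows "\<exists>P. spec_proj B P"
proof -
  have B: "B \<in> sigma_sets UNIV (range (\<lambda>(a, b). {a<..b::real}))"
    using assms by (simp add: borel_sigma_sets_Ioc)
  have borel: "sigma_sets UNIV (range (\<lambda>(a, b). {a<..b::real})) = sets borel"
    by (simp add: borel_sigma_sets_Ioc)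
  have "Int_stable (range (\<lambda>(a, b). {a<..b::real}))"
  proof (rule Int_stableI)
    fix A B :: "real set"
    assume "A \<in> range (\<lambda>(a, b). {a<..b})" "B \<in> range (\<lambda>(a, b). {a<..b})"
    then obtain a b c d where "A = {a<..b}" "B = {c<..d}" by auto
    then have "A \<inter> B = (\<lambda>(a, b). {a<..b}) (max a c, min b d)" by auto
    then show "A \<inter> B \<in> range (\<lambda>(a, b). {a<..b})" by blast
  qed
  moreover have "range (\<lambda>(a, b). {a<..b::real}) \<subseteq> Pow UNIV" by simp
  ultimately show ?thesis
    using B
  proof (induction rule: sigma_sets_induct_disjoint)
    case (basic A)
    then obtain a b where A: "A = {a<..b}" by auto
    show ?case
    proof (cases "a \<le> b")
      case True
      have "spec_proj A (\<lambda>x. Ef b x - Ef a x)"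
        unfolding spec_proj_def
      proof (intro conjI allI impI)
        show "is_proj (\<lambda>x. Ef b x - Ef a x)" by (rule diff_proj[OF True])
        show "commutes U (\<lambda>x. Ef b x - Ef a x)" if "bounded_linear U" "commutes U T" for U
          using Ef_commutes[OF that] linear_diff[OF bounded_linear.linear[OF that(1)]] by (simp add: commutes_def)
        show "(Ef b x - Ef a x) \<bullet> x = measure (Mx x) A" for x
          by (simp add: A measure_Mx_Ioc[OF True] inner_diff_left)
      qed
      then show ?thesis by blast
    next
      case False
      then have "spec_proj A (\<lambda>x. 0)"
        by (auto simp: spec_proj_def is_proj_def selfadj_zero commutes_def A bounded_linear.linear linear_0)
      then show ?thesis by blast
    qed
  next
    case empty
    have "spec_proj {} (\<lambda>x. 0)"
      by (auto simp: spec_proj_def is_proj_def selfadj_zero commutes_def bounded_linear.linear linear_0)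
    then show ?case by blast
  next
    case (compl A)
    then obtain P where P: "spec_proj A P" by blast
    have Ab: "A \<in> sets borel" using compl(1) borel by simp
    have "spec_proj (UNIV - A) (\<lambda>x. x - P x)" unfolding spec_proj_def
    proof (intro conjI allI impI)
      show "is_proj (\<lambda>x. x - P x)" using P is_proj_complement[of P] by (simp add: spec_proj_def)
      show "commutes U (\<lambda>x. x - P x)" if "bounded_linear U" "commutes U T" for U
        using P that linear_diff[OF bounded_linear.linear[OF that(1)]] by (simp add: spec_proj_def commutes_def)
      show "(x - P x) \<bullet> x = measure (Mx x) (UNIV - A)" for x
        using P fin.finite_measure_Diff[of UNIV x A] Ab by (simp add: inner_diff_left spec_proj_def measure_Mx_UNIV)
    qed
    then show ?case by blast
  next
    case (union A)
    have Ab: "A i \<in> sets borel" for i using union(2) borel by blast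
    obtain P where P: "\<And>i. spec_proj (A i) (P i)" using union(3) by metis
    have Pp: "is_proj (P i)" for i using P by (simp add: spec_proj_def)
    have orth: "P i (P j x) = 0" if "i \<noteq> j" for i j x
      using spec_proj_orthogonal[OF P P _ Ab Ab, of i j] union(1) that by (simp add: disjoint_family_on_def)
    define S where "S = (\<lambda>n x. \<Sum>i<n. P i x)"
    have S_sa: "selfadj (S n)" for n unfolding S_def by (intro selfadj_sum is_proj_selfadj Pp)
    have PS: "P i (S n x) = (if i < n then P i x else 0)" for i n x
    proof -
      have "P i (S n x) = (\<Sum>j<n. P i (P j x))"
        unfolding S_def using linear_sum[OF bounded_linear.linear[OF selfadj_bounded_linear[OF is_proj_selfadj[OF Pp]]]] by blast
      also have "\<dots> = (\<Sum>j<n. if j = i then P i x else 0)"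
        by (rule sum.cong) (auto simp: orth is_proj_idem[OF Pp])
      finally show ?thesis by simp
    qed
    have SS: "S m (S n x) = S n x" if "n \<le> m" for m n x
    proof -
      have "S m (S n x) = (\<Sum>i<m. if i < n then P i x else 0)" by (subst S_def) (simp add: PS)
      also have "\<dots> = (\<Sum>i\<in>{..<n}. P i x)" using that by (intro sum.mono_neutral_cong_right) auto
      finally show ?thesis by (simp add: S_def)
    qed
    have S_proj: "is_proj (S n)" for n by (simp add: is_proj_def S_sa SS)
    have S_meas: "S n x \<bullet> x = measure (Mx x) (\<Union>i<n. A i)" for n x
    proof -
      have "S n x \<bullet> x = (\<Sum>i<n. measure (Mx x) (A i))"
        using P by (simp add: S_def inner_sum_left spec_proj_def)
      also have "\<dots> = measure (Mx x) (\<Union>i<n. A i)"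
        by (rule fin.finite_measure_finite_Union[symmetric])
          (use Ab union(1) in \<open>auto simp: disjoint_family_on_def\<close>)
      finally show ?thesis .
    qed
    have lim_meas: "(\<lambda>n. S n x \<bullet> x) \<longlonglongrightarrow> measure (Mx x) (\<Union>i. A i)" for x
    proof -
      have "(\<lambda>n. measure (Mx x) (\<Union>i<n. A i)) \<longlonglongrightarrow> measure (Mx x) (\<Union>n. \<Union>i<n. A i)"
        by (rule fin.finite_Lim_measure_incseq) (use Ab in \<open>auto simp: incseq_def\<close>, force)
      moreover have "(\<Union>n. \<Union>i<n. A i) = (\<Union>i. A i)" by auto
      ultimately show ?thesis by (simp add: S_meas)
    qed
    have "Cauchy (\<lambda>n. S n x)" for x
    proof (rule bounded_mono_square_Cauchy)
      show "convergent (\<lambda>n. S n x \<bullet> x)" using lim_meas by (auto simp: convergent_def)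
      fix m n :: nat assume "n \<le> m"
      have "S m x \<bullet> S n x = S n x \<bullet> S n x"
        using selfadj_inner[OF S_sa, of m x "S n x"] selfadj_inner[OF S_sa, of n x "S n x"]
        by (simp add: SS[OF \<open>n \<le> m\<close>] SS)
      then have "(norm (S m x - S n x))\<^sup>2 = S m x \<bullet> S m x - S n x \<bullet> S n x"
        unfolding power2_norm_eq_inner inner_diff_left inner_diff_right by (simp add: inner_commute[of "S n x" "S m x"])
      also have "\<dots> = S m x \<bullet> x - S n x \<bullet> x"
        using is_proj_inner[OF S_proj] by (simp add: power2_norm_eq_inner)
      finally show "(norm (S m x - S n x))\<^sup>2 \<le> \<bar>S m x \<bullet> x - S n x \<bullet> x\<bar>" by simp
    qed
    then have "\<forall>x. \<exists>z. (\<lambda>n. S n x) \<longlonglongrightarrow> z" by (simp add: Cauchy_convergent_iff convergent_def)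
    then obtain Q where Q: "\<And>x. (\<lambda>n. S n x) \<longlonglongrightarrow> Q x" by metis
    have "spec_proj (\<Union>i. A i) Q" unfolding spec_proj_def
    proof (intro conjI allI impI)
      show "is_proj Q" by (rule strong_limit_is_proj[OF S_proj Q])
      show "commutes U Q" if U: "bounded_linear U" "commutes U T" for U
      proof (rule strong_limit_commutes[OF Q U(1)])
        show "commutes U (S n)" for n
          using P U by (auto simp: commutes_def S_def linear_sum[OF bounded_linear.linear[OF U(1)]] spec_proj_def)
      qed
      show "Q x \<bullet> x = measure (Mx x) (\<Union>i. A i)" for x
        by (rule LIMSEQ_unique[OF tendsto_inner[OF Q tendsto_const] lim_meas])
    qed
    then show ?case by blast
  qed
qed

definition EB :: "real set \<Rightarrow> 'a \<Rightarrow> 'a" where "EB B = (SOME P. spec_proj B P)"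

lemma EB: "B \<in> sets borel \<Longrightarrow> spec_proj B (EB B)"
  unfolding EB_def by (rule someI_ex[OF spec_proj_exists])

lemma EB_proj: "B \<in> sets borel \<Longrightarrow> is_proj (EB B)" using EB by (simp add: spec_proj_def)
lemma EB_measure: "B \<in> sets borel \<Longrightarrow> EB B x \<bullet> x = measure (Mx x) B" using EB by (simp add: spec_proj_def)

lemma EB_commutes: "B \<in> sets borel \<Longrightarrow> bounded_linear U \<Longrightarrow> commutes U T \<Longrightarrow> commutes U (EB B)"
  using EB by (simp add: spec_proj_def)

lemma EB_Un:
  assumes "A \<in> sets borel" "B \<in> sets borel" "A \<inter> B = {}"
  shows "EB (A \<union> B) x = EB A x + EB B x"
  by (rule selfadj_quadratic_eq)
    (use assms fin.finite_measure_Union[of A _ B] in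
      \<open>auto simp: EB_proj is_proj_selfadj selfadj_add EB_measure inner_add_left\<close>)

lemma EB_Int:
  assumes "A \<in> sets borel" "B \<in> sets borel"
  shows "EB (A \<inter> B) x = EB A (EB B x)"
proof -
  have AB: "A \<inter> B \<in> sets borel" "A - B \<in> sets borel" "B - A \<in> sets borel" using assms by auto
  have "EB A (EB B x) = EB (A \<inter> B) (EB B x) + EB (A - B) (EB B x)"
    using EB_Un[OF AB(1,2), of "EB B x"] by (simp add: Int_Diff_Un Int_Diff_disjoint)
  moreover have "EB (A - B) (EB B x) = 0"
    by (rule spec_proj_orthogonal[OF EB EB]) (use assms AB in auto)
  moreover have "EB B x = EB (A \<inter> B) x + EB (B - A) x"
    using EB_Un[OF AB(1,3), of x] by (simp add: Int_Diff_Un Int_Diff_disjoint Int_commute[of A])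
  moreover have "EB (A \<inter> B) (EB (A \<inter> B) x + EB (B - A) x) = EB (A \<inter> B) x + EB (A \<inter> B) (EB (B - A) x)"
    by (simp add: selfadj_simps[OF is_proj_selfadj[OF EB_proj[OF AB(1)]]] is_proj_idem[OF EB_proj[OF AB(1)]])
  moreover have "EB (A \<inter> B) (EB (B - A) x) = 0"
    by (rule spec_proj_orthogonal[OF EB EB]) (use assms AB in auto)
  ultimately show ?thesis by simp
qed

lemma EB_UNIV: "EB UNIV x = x"
  by (rule selfadj_quadratic_eq[OF _ selfadj_id])
    (auto simp: EB_proj is_proj_selfadj EB_measure measure_Mx_UNIV)

lemma EB_sums:
  fixes A :: "nat \<Rightarrow> real set"
  assumes "range A \<subseteq> sets borel" "disjoint_family A"
  shows "(\<lambda>n. EB (A n) x \<bullet> y) sums (EB (\<Union>n. A n) x \<bullet> y)"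
proof -
  have Ab: "A n \<in> sets borel" for n using assms by auto
  then have Ub: "(\<Union>n. A n) \<in> sets borel" by auto
  have q: "(\<lambda>n. EB (A n) z \<bullet> z) sums (EB (\<Union>n. A n) z \<bullet> z)" for z
    using fin.finite_measure_UNION[of A z] assms by (simp add: EB_measure Ab Ub)
  \<comment> \<open>Countable additivity is first known for the quadratic forms only; polarization
    carries it over to the bilinear ones.\<close>
  have pol: "EB B x \<bullet> y = (1/4) * (EB B (x + y) \<bullet> (x + y) - EB B (x - y) \<bullet> (x - y))" if "B \<in> sets borel" for B
  proof -
    note sB = is_proj_selfadj[OF EB_proj[OF that]]
    have "EB B y \<bullet> x = EB B x \<bullet> y" using selfadj_inner[OF sB, of y x] by (simp add: inner_commute)
    then show ?thesis
      by (simp add: selfadj_simps[OF sB] inner_add_left inner_add_right inner_diff_left inner_diff_right)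
  qed
  show ?thesis unfolding pol[OF Ab] pol[OF Ub]
    by (intro sums_mult sums_diff q)
qed

lemma EB_measure_of: "measure_of UNIV (sets borel) (\<lambda>B. ennreal (EB B x \<bullet> x)) = Mx x"
proof -
  have "measure_of UNIV (sets borel) (\<lambda>B. ennreal (EB B x \<bullet> x)) = measure_of UNIV (sets borel) (emeasure (Mx x))"
    by (rule measure_of_eq)
      (auto simp: EB_measure fin.emeasure_eq_measure sets.sigma_sets_eq[of borel, simplified])
  also have "\<dots> = Mx x" using measure_of_of_measure[of "Mx x"] by simp
  finally show ?thesis .
qed

lemma EB_resolution: "real_resolution T (\<lambda>x. x) EB"
  unfolding real_resolution_def
proof (intro conjI ballI allI impI)
  \<comment> \<open>The open interval has to contain the half-open interval from -(K+1) to K+1,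
    which already carries the full mass; hence \<open>K + 2\<close>.\<close>
  show "\<exists>a. \<forall>x. EB {- a<..<a} x = x"
  proof (intro exI[of _ "K + 2"] allI)
    fix x
    have "measure (Mx x) {- (K+1)<..K+1} \<le> measure (Mx x) {- (K+2)<..<K+2}"
      by (rule fin.finite_measure_mono) auto
    moreover have "measure (Mx x) {- (K+1)<..K+1} = x \<bullet> x"
      using K(1) by (simp add: measure_Mx_Ioc Ef_low Ef_high)
    moreover have "measure (Mx x) {- (K+2)<..<K+2} \<le> measure (Mx x) UNIV" by (rule fin.finite_measure_mono) auto
    ultimately have "EB {- (K+2)<..<K+2} x \<bullet> x = x \<bullet> x" by (simp add: EB_measure measure_Mx_UNIV)
    then show "EB {- (K+2)<..<K+2} x = x"
      using is_proj_inner[OF EB_proj, of "{- (K+2)<..<K+2}" x]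
      by (intro is_proj_norm_eqD[OF EB_proj]) (auto simp: power2_norm_eq_inner)
  qed
qed (auto simp: EB_proj EB_UNIV EB_Int EB_sums EB_measure_of Mx_integral)

end

subsection \<open>Eigenspaces and spectral projections\<close>

text \<open>An arbitrary resolution, as \<open>SOME\<close> might deliver it. It relates
  \<open>T\<close> to the projections only through the integral of the quadratic form; that
  \<open>T\<close> commutes with them has to be derived (\<open>T_E\<close>) before eigenvectors can
  be localized.\<close>

locale resolution =
  fixes T P :: "'a::real_inner \<Rightarrow> 'a" and E
  assumes R: "real_resolution T P E" and saT: "selfadj T"
    and PT: "\<And>x. P (T x) = T x"
begin

lemma E_proj: "B \<in> sets borel \<Longrightarrow> is_proj (E B)"
  and E_UNIV: "E UNIV x = P x"
  and E_Int: "A \<in> sets borel \<Longrightarrow> B \<in> sets borel \<Longrightarrow> E (A \<inter> B) x = E A (E B x)"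
  and E_sums: "range F \<subseteq> sets borel \<Longrightarrow> disjoint_family F \<Longrightarrow>
      (\<lambda>n. E (F n) x \<bullet> y) sums (E (\<Union>n::nat. F n) x \<bullet> y)"
  and E_supp: "\<exists>a. \<forall>x. E {-a<..<a} x = P x"
  and E_quad: "P x = x \<Longrightarrow>
      T x \<bullet> x = (\<integral>t. t \<partial>(measure_of UNIV (sets borel) (\<lambda>B. ennreal (E B x \<bullet> x))))"
  using R unfolding real_resolution_def by blast+

lemmas E_s = selfadj_simps[OF is_proj_selfadj[OF E_proj]]
lemmas E_idem = is_proj_idem[OF E_proj]
lemmas E_inner = selfadj_inner[OF is_proj_selfadj[OF E_proj]]
lemmas T_s = selfadj_simps[OF saT]

lemma P_proj: "is_proj P"
proof -
  have "E UNIV = P" by (rule ext) (rule E_UNIV)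
  then show ?thesis using E_proj[of UNIV] by simp
qed

lemmas P_s = selfadj_simps[OF is_proj_selfadj[OF P_proj]]

lemma P_E: "B \<in> sets borel \<Longrightarrow> P (E B x) = E B x" "B \<in> sets borel \<Longrightarrow> E B (P x) = E B x"
  using E_Int[of UNIV B x] E_Int[of B UNIV x] by (simp_all add: E_UNIV)

lemma E_empty: "E {} x = 0"
proof -
  have "(\<lambda>n::nat. E {} x \<bullet> E {} x) sums (E (\<Union>n::nat. {}) x \<bullet> E {} x)"
    by (rule E_sums) (auto simp: disjoint_family_on_def)
  then have "summable (\<lambda>n::nat. E {} x \<bullet> E {} x)" by (rule sums_summable)
  then show ?thesis by (simp add: summable_const_iff)
qed

lemma E_Un:
  assumes "A \<in> sets borel" "B \<in> sets borel" "A \<inter> B = {}"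
  shows "E (A \<union> B) x = E A x + E B x"
proof -
  have "(E (A \<union> B) x - (E A x + E B x)) \<bullet> y = 0" for y
  proof -
    have "(\<lambda>n. E (binaryset A B n) x \<bullet> y) sums (E (\<Union>n. binaryset A B n) x \<bullet> y)"
      by (rule E_sums) (use assms in \<open>auto simp: range_binaryset_eq disjoint_family_on_def binaryset_def\<close>)
    moreover have "(\<lambda>n. E (binaryset A B n) x \<bullet> y) sums (E A x \<bullet> y + E B x \<bullet> y)"
      by (rule binaryset_sums) (simp add: E_empty)
    ultimately show ?thesis
      by (simp add: UN_binaryset_eq inner_diff_left inner_add_left sums_unique2)
  qed
  from this[of "E (A \<union> B) x - (E A x + E B x)"] show ?thesis by simp
qed

lemma E_compl: "B \<in> sets borel \<Longrightarrow> E (- B) x = P x - E B x"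
  using E_Un[of B "- B" x] by (simp add: E_UNIV Compl_partition)

definition N :: "'a \<Rightarrow> real measure" where
  "N x = measure_of UNIV (sets borel) (\<lambda>B. ennreal (E B x \<bullet> x))"

lemma sets_N [simp, measurable_cong]: "sets (N x) = sets borel"
  unfolding N_def by (simp add: sets.sigma_sets_eq[of borel, simplified])

lemma space_N [simp]: "space (N x) = UNIV"
  unfolding N_def by (simp add: space_measure_of_conv)

lemma E_nonneg: "B \<in> sets borel \<Longrightarrow> 0 \<le> E B x \<bullet> x"
  by (simp add: is_proj_inner[OF E_proj])

lemma emeasure_N:
  assumes "B \<in> sets borel" shows "emeasure (N x) B = ennreal (E B x \<bullet> x)"
proof (rule emeasure_measure_of[OF N_def])
  show "positive (sets (N x)) (\<lambda>B. ennreal (E B x \<bullet> x))" by (simp add: positive_def E_empty)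
  show "countably_additive (sets (N x)) (\<lambda>B. ennreal (E B x \<bullet> x))"
  proof (rule countably_additiveI)
    fix F :: "nat \<Rightarrow> real set" assume F: "range F \<subseteq> sets (N x)" "disjoint_family F"
    then have s: "(\<lambda>n. E (F n) x \<bullet> x) sums (E (\<Union>n. F n) x \<bullet> x)" by (intro E_sums) auto
    have "(\<Sum>i. ennreal (E (F i) x \<bullet> x)) = ennreal (\<Sum>i. E (F i) x \<bullet> x)"
      by (rule suminf_ennreal2) (use F s in \<open>auto intro: E_nonneg sums_summable\<close>)
    then show "(\<Sum>i. ennreal (E (F i) x \<bullet> x)) = ennreal (E (\<Union> (range F)) x \<bullet> x)"
      using s by (simp add: sums_iff)
  qed
qed (use assms in auto)

lemma finite_N: "finite_measure (N x)"
  by (rule finite_measureI) (simp add: emeasure_N)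

lemma measure_N: "B \<in> sets borel \<Longrightarrow> measure (N x) B = E B x \<bullet> x"
  by (simp add: measure_def emeasure_N E_nonneg)

lemma AE_N:
  assumes "B \<in> sets borel" "E B x = P x" shows "AE t in N x. t \<in> B"
proof (rule AE_I')
  have "E (- B) x = 0" using E_compl[OF assms(1)] assms(2) by simp
  then show "- B \<in> null_sets (N x)" using assms(1) by (intro null_setsI) (auto simp: emeasure_N)
qed auto

lemma integrable_N: "integrable (N x) (\<lambda>t. t)"
proof -
  obtain a where a: "\<And>x. E {-a<..<a} x = P x" using E_supp by blast
  interpret finite_measure "N x" by (rule finite_N)
  show ?thesis
  proof (rule integrable_const_bound[of _ a])
    show "AE t in N x. norm t \<le> a"
      by (rule eventually_mono[OF AE_N[OF _ a[of x]]]) auto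
  qed auto
qed

lemma quad: "P x = x \<Longrightarrow> T x \<bullet> x = (\<integral>t. t \<partial>N x)"
  unfolding N_def by (rule E_quad)

lemma quad_const: "integral\<^sup>L (N x) (\<lambda>t. c) = c * (P x \<bullet> x)"
  by (simp add: measure_N E_UNIV)

text \<open>The measure of \<open>x\<close> is that of \<open>x + y\<close> cut down to
  \<open>B\<close>: inside \<open>B\<close> the vector \<open>y\<close> is invisible, and the mixed
  terms vanish.\<close>

lemma N_density:
  assumes B: "B \<in> sets borel" and x: "E B x = x" and y: "E B y = 0" "P y = y"
  shows "N x = density (N (x + y)) (\<lambda>t. ennreal (indicator B t))"
proof (rule measure_eqI)
  fix C assume "C \<in> sets (N x)"
  then have C: "C \<in> sets borel" by simp
  have CB: "C \<inter> B \<in> sets borel" using B C by auto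
  have 1: "E (C \<inter> B) x = E C x" "E (C \<inter> B) y = 0"
    using E_Int[OF C B] x y by (simp_all add: E_s(4)[OF C])
  have 2: "E C x \<bullet> y = 0"
    using E_Int[OF B C, of x] E_Int[OF C B, of x] E_inner[OF B, of "E C x" y] x y by (simp add: Int_commute)
  have "emeasure (density (N (x + y)) (\<lambda>t. ennreal (indicator B t))) C
      = (\<integral>\<^sup>+ t. indicator (C \<inter> B) t \<partial>N (x + y))"
  proof -
    have "ennreal (indicator B t) * indicator C t = indicator (C \<inter> B) t" for t :: real
      by (auto simp: indicator_def)
    then show ?thesis using B C by (subst emeasure_density) auto
  qed
  also have "\<dots> = ennreal (E (C \<inter> B) (x + y) \<bullet> (x + y))" using CB by (simp add: emeasure_N)
  also have "E (C \<inter> B) (x + y) \<bullet> (x + y) = E C x \<bullet> x"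
    by (simp add: E_s[OF CB] 1 2 inner_add_right)
  finally show "emeasure (N x) C = emeasure (density (N (x + y)) (\<lambda>t. ennreal (indicator B t))) C"
    using C by (simp add: emeasure_N)
qed simp

text \<open>The integral for \<open>x + y\<close> splits into its parts over \<open>B\<close> and
  over the complement, which are the integrals for \<open>x\<close> and for \<open>y\<close>. So the
  form of \<open>T\<close> at \<open>x + y\<close> has no mixed term.\<close>

lemma T_orthogonal:
  assumes B: "B \<in> sets borel" and x: "E B x = x" and y: "E B y = 0" "P y = y"
  shows "T x \<bullet> y = 0"
proof -
  have Px: "P x = x" using P_E(1)[OF B, of x] x by simp
  have cB: "- B \<in> sets borel" using B by auto
  have y': "E (- B) y = y" "E (- B) x = 0" using E_compl[OF B] x y Px by auto
  have meas: "(\<lambda>t::real. t) \<in> borel_measurable (N z)" for z by simp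
  have "(\<integral>t. t \<partial>N x) = (\<integral>t. indicator B t *\<^sub>R t \<partial>N (x + y))"
    unfolding N_density[OF B x y] by (rule integral_density) (use B in auto)
  moreover have "(\<integral>t. t \<partial>N y) = (\<integral>t. indicator (- B) t *\<^sub>R t \<partial>N (y + x))"
    unfolding N_density[OF cB y' Px] by (rule integral_density) (use cB in auto)
  moreover have "(\<integral>t. t \<partial>N (x + y)) = (\<integral>t. indicator B t *\<^sub>R t + indicator (- B) t *\<^sub>R t \<partial>N (x + y))"
    by (rule Bochner_Integration.integral_cong) (auto simp: indicator_def)
  moreover have "\<dots> = (\<integral>t. indicator B t *\<^sub>R t \<partial>N (x + y)) + (\<integral>t. indicator (- B) t *\<^sub>R t \<partial>N (x + y))"
    by (rule Bochner_Integration.integral_add; rule integrable_mult_indicator) (use B cB integrable_N in auto)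
  ultimately have "T (x + y) \<bullet> (x + y) = T x \<bullet> x + T y \<bullet> y"
    using quad[of "x + y"] quad[OF Px] quad[OF y(2)] by (simp add: P_s Px y add.commute)
  moreover have "T y \<bullet> x = T x \<bullet> y" using selfadj_inner[OF saT, of y x] by (simp add: inner_commute)
  ultimately show ?thesis by (simp add: T_s inner_add_left inner_add_right)
qed

lemma T_E: assumes B: "B \<in> sets borel" shows "T (E B x) = E B (T x)"
proof -
  have inv: "E B (T (E B x)) = T (E B x)" for x
  proof -
    define u where "u = T (E B x)"
    define r where "r = u - E B u"
    have Br: "E B r = 0" by (simp add: r_def E_s[OF B] E_idem[OF B])
    have "P r = r" by (simp add: r_def u_def P_s PT P_E[OF B])
    then have "u \<bullet> r = 0" unfolding u_def by (intro T_orthogonal[OF B E_idem[OF B] Br])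
    moreover have "E B u \<bullet> r = 0" using E_inner[OF B, of u r] Br by simp
    ultimately have "r \<bullet> r = 0" by (simp add: r_def inner_diff_left inner_diff_right)
    then show ?thesis by (simp add: r_def u_def)
  qed
  have "(E B (T x) - E B (T (E B x))) \<bullet> y = 0" for y
  proof -
    have "E B (T x) \<bullet> y = x \<bullet> T (E B y)" by (simp add: E_inner[OF B] selfadj_inner[OF saT])
    also have "\<dots> = x \<bullet> E B (T (E B y))" by (simp add: inv)
    also have "\<dots> = E B (T (E B x)) \<bullet> y" by (simp add: E_inner[OF B] selfadj_inner[OF saT])
    finally show ?thesis by (simp add: inner_diff_left)
  qed
  from this[of "E B (T x) - E B (T (E B x))"] show ?thesis by (simp add: inv)
qed

text \<open>The component \<open>E B x\<close> is again an eigenvector for \<theta>, but its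
  spectral measure lives on \<open>B\<close>, where the mean is at least \<open>c > \<theta>\<close>
  times the total mass.\<close>

lemma E_above:
  assumes B: "B \<in> sets borel" and "\<And>t. t \<in> B \<Longrightarrow> c \<le> t" "\<theta> < c" "T x = \<theta> *\<^sub>R x"
  shows "E B x = 0"
proof -
  define u where "u = E B x"
  interpret finite_measure "N u" by (rule finite_N)
  have u: "T u = \<theta> *\<^sub>R u" "P u = u" "E B u = u"
    by (simp_all add: u_def T_E[OF B] assms(4) E_s[OF B] P_E[OF B] E_idem[OF B])
  have "c * (u \<bullet> u) = integral\<^sup>L (N u) (\<lambda>t. c)" by (simp only: quad_const u)
  also have "\<dots> \<le> (\<integral>t. t \<partial>N u)"
    by (rule integral_mono_AE) (use AE_N[OF B, of u] u assms(2) integrable_N in \<open>auto elim: eventually_mono\<close>)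
  also have "\<dots> = \<theta> * (u \<bullet> u)" using quad[OF u(2)] u(1) by simp
  finally have "(c - \<theta>) * (u \<bullet> u) \<le> 0" by (simp add: algebra_simps)
  then show ?thesis using assms(3) inner_le_zeroD[of u] by (simp add: mult_le_0_iff u_def)
qed

lemma E_below:
  assumes B: "B \<in> sets borel" and "\<And>t. t \<in> B \<Longrightarrow> t \<le> c" "c < \<theta>" "T x = \<theta> *\<^sub>R x"
  shows "E B x = 0"
proof -
  define u where "u = E B x"
  interpret finite_measure "N u" by (rule finite_N)
  have u: "T u = \<theta> *\<^sub>R u" "P u = u" "E B u = u"
    by (simp_all add: u_def T_E[OF B] assms(4) E_s[OF B] P_E[OF B] E_idem[OF B])
  have "\<theta> * (u \<bullet> u) = (\<integral>t. t \<partial>N u)" using quad[OF u(2)] u(1) by simp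
  also have "\<dots> \<le> integral\<^sup>L (N u) (\<lambda>t. c)"
    by (rule integral_mono_AE) (use AE_N[OF B, of u] u assms(2) integrable_N in \<open>auto elim: eventually_mono\<close>)
  also have "\<dots> = c * (u \<bullet> u)" by (simp only: quad_const u)
  finally have "(\<theta> - c) * (u \<bullet> u) \<le> 0" by (simp add: algebra_simps)
  then show ?thesis using assms(3) inner_le_zeroD[of u] by (simp add: mult_le_0_iff u_def)
qed

lemma E_Union_zero:
  fixes B :: "nat \<Rightarrow> real set"
  assumes "\<And>n. B n \<in> sets borel" "\<And>n. E (B n) x = 0"
  shows "E (\<Union>n. B n) x = 0"
proof -
  have "(\<Union>n. B n) \<in> null_sets (N x)"
    by (rule null_sets_UN) (use assms in \<open>auto intro!: null_setsI simp: emeasure_N\<close>)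
  then have "ennreal (E (\<Union>n. B n) x \<bullet> x) = 0" using assms(1) by (auto simp: null_sets_def emeasure_N)
  then have "E (\<Union>n. B n) x \<bullet> x \<le> 0" by (simp add: ennreal_eq_0_iff)
  then show ?thesis using is_proj_inner[OF E_proj, of "\<Union>n. B n" x] assms(1) by auto
qed

text \<open>All resolutions of \<open>T\<close> thus agree at singletons. An eigenvector is killed
  by the projections of closed half-lines at distance 1/(n+1) from \<theta>, hence by those of both
  open half-lines. Conversely, the form of \<open>T\<close> on the range of
  \<open>E {\<theta>}\<close> is \<theta> times the squared norm, and polarization makes this an
  operator equation.\<close>

theorem E_eigenspace: "E {\<theta>} x = x \<longleftrightarrow> P x = x \<and> T x = \<theta> *\<^sub>R x"
proof
  assume x: "E {\<theta>} x = x"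
  have b: "{\<theta>} \<in> sets borel" by simp
  have q: "T u \<bullet> u = \<theta> * (u \<bullet> u)" if u: "E {\<theta>} u = u" for u
  proof -
    have Pu: "P u = u" using P_E(1)[OF b, of u] u by simp
    have "T u \<bullet> u = (\<integral>t. t \<partial>N u)" by (rule quad[OF Pu])
    also have "\<dots> = integral\<^sup>L (N u) (\<lambda>t. \<theta>)"
      by (rule integral_cong_AE) (use AE_N[OF b, of u] u Pu in auto)
    finally show ?thesis by (simp only: quad_const Pu)
  qed
  have com: "commutes T (E {\<theta>})" by (simp add: commutes_def T_E)
  have "T (E {\<theta>} x) = \<theta> *\<^sub>R E {\<theta>} x"
  proof (rule selfadj_quadratic_eq[where S = "\<lambda>x. T (E {\<theta>} x)" and T = "\<lambda>x. \<theta> *\<^sub>R E {\<theta>} x"])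
    show "selfadj (\<lambda>x. T (E {\<theta>} x))" by (rule selfadj_compose[OF saT is_proj_selfadj[OF E_proj[OF b]] com])
    show "selfadj (\<lambda>x. \<theta> *\<^sub>R E {\<theta>} x)" by (rule selfadj_scale[OF is_proj_selfadj[OF E_proj[OF b]]])
    show "T (E {\<theta>} y) \<bullet> y = \<theta> *\<^sub>R E {\<theta>} y \<bullet> y" for y
    proof -
      have "T (E {\<theta>} y) \<bullet> y = E {\<theta>} (T (E {\<theta>} y)) \<bullet> y" by (simp flip: T_E add: E_idem)
      then have "T (E {\<theta>} y) \<bullet> y = T (E {\<theta>} y) \<bullet> E {\<theta>} y" by (simp add: E_inner)
      then show ?thesis using q[OF E_idem[OF b], of y] E_inner[OF b, of "E {\<theta>} y" y] by (simp add: E_idem)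
    qed
  qed
  then show "P x = x \<and> T x = \<theta> *\<^sub>R x" using x P_E(1)[OF b, of x] by simp
next
  assume x: "P x = x \<and> T x = \<theta> *\<^sub>R x"
  have above: "E {\<theta><..} x = 0"
  proof -
    have "E (\<Union>n. {\<theta> + 1 / real (Suc n)..}) x = 0"
      by (rule E_Union_zero, simp, rule E_above[where c = "\<theta> + 1 / real (Suc _)" and \<theta> = \<theta>]) (use x in auto)
    moreover have "(\<Union>n. {\<theta> + 1 / real (Suc n)..}) = {\<theta><..}"
    proof (intro equalityI subsetI)
      fix t assume "t \<in> {\<theta><..}"
      then obtain n where "1 / real (Suc n) < t - \<theta>" using nat_approx_posE[of "t - \<theta>"] by auto
      then show "t \<in> (\<Union>n. {\<theta> + 1 / real (Suc n)..})" by (intro UN_I[of n]) auto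
    qed (auto intro: less_le_trans[rotated])
    ultimately show ?thesis by simp
  qed
  have below: "E {..<\<theta>} x = 0"
  proof -
    have "E (\<Union>n. {..\<theta> - 1 / real (Suc n)}) x = 0"
      by (rule E_Union_zero, simp, rule E_below[where c = "\<theta> - 1 / real (Suc _)" and \<theta> = \<theta>]) (use x in auto)
    moreover have "(\<Union>n. {..\<theta> - 1 / real (Suc n)}) = {..<\<theta>}"
    proof (intro equalityI subsetI)
      fix t assume "t \<in> {..<\<theta>}"
      then obtain n where "1 / real (Suc n) < \<theta> - t" using nat_approx_posE[of "\<theta> - t"] by auto
      then show "t \<in> (\<Union>n. {..\<theta> - 1 / real (Suc n)})" by (intro UN_I[of n]) auto
    qed (auto intro: le_less_trans)
    ultimately show ?thesis by simp
  qed
  have "{\<theta>} \<union> {\<theta><..} \<union> {..<\<theta>} = UNIV" by auto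
  then have "P x = E ({\<theta>} \<union> {\<theta><..} \<union> {..<\<theta>}) x" by (simp add: E_UNIV)
  also have "\<dots> = E {\<theta>} x + E {\<theta><..} x + E {..<\<theta>} x"
  proof -
    have "({\<theta>} \<union> {\<theta><..}) \<inter> {..<\<theta>} = {}" "{\<theta>} \<inter> {\<theta><..} = {}" by auto
    then show ?thesis using E_Un[of "{\<theta>} \<union> {\<theta><..}" "{..<\<theta>}" x] E_Un[of "{\<theta>}" "{\<theta><..}" x] by simp
  qed
  finally show "E {\<theta>} x = x" using above below x by simp
qed

end

subsection \<open>The Hilbert space of square-summable functions\<close>

lemma ell2_norm_product_summable:
  assumes "(\<lambda>x. (cmod (f x))\<^sup>2) summable_on A" "(\<lambda>x. (cmod (g x))\<^sup>2) summable_on A"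
  shows "(\<lambda>x. norm (f x * cnj (g x))) summable_on A"
proof (rule summable_on_comparison_test)
  show "(\<lambda>x. (cmod (f x))\<^sup>2 + (cmod (g x))\<^sup>2) summable_on A" by (rule summable_on_add[OF assms])
  show "norm (f x * cnj (g x)) \<le> (cmod (f x))\<^sup>2 + (cmod (g x))\<^sup>2" for x
  proof -
    have "2 * (cmod (f x) * cmod (g x)) \<le> (cmod (f x))\<^sup>2 + (cmod (g x))\<^sup>2"
      using sum_squares_bound[of "cmod (f x)" "cmod (g x)"] by (simp add: mult.assoc)
    moreover have "0 \<le> cmod (f x) * cmod (g x)" by simp
    moreover have "norm (f x * cnj (g x)) = cmod (f x) * cmod (g x)" by (simp add: norm_mult)
    ultimately show ?thesis by linarith
  qed
qed simp

lemma ell2_product_summable: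
  assumes "(\<lambda>x. (cmod (f x))\<^sup>2) summable_on A" "(\<lambda>x. (cmod (g x))\<^sup>2) summable_on A"
  shows "(\<lambda>x. f x * cnj (g x)) summable_on A"
  using ell2_norm_product_summable[OF assms] by (rule abs_summable_summable)

lemma ell2_add:
  assumes "f \<in> ell2 X" "g \<in> ell2 X" shows "(\<lambda>x. f x + g x) \<in> ell2 X"
proof -
  have "(\<lambda>x. (cmod (f x + g x))\<^sup>2) summable_on X"
  proof (rule summable_on_comparison_test)
    show "(\<lambda>x. 2 * (cmod (f x))\<^sup>2 + 2 * (cmod (g x))\<^sup>2) summable_on X"
      using assms by (intro summable_on_add summable_on_cmult_right) (auto simp: ell2_def)
    show "(cmod (f x + g x))\<^sup>2 \<le> 2 * (cmod (f x))\<^sup>2 + 2 * (cmod (g x))\<^sup>2" for x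
    proof -
      have "(cmod (f x + g x))\<^sup>2 \<le> (cmod (f x) + cmod (g x))\<^sup>2"
        by (intro power_mono norm_triangle_ineq) auto
      also have "\<dots> \<le> 2 * (cmod (f x))\<^sup>2 + 2 * (cmod (g x))\<^sup>2"
        using sum_squares_bound[of "cmod (f x)" "cmod (g x)"] by (simp add: power2_sum)
      finally show ?thesis .
    qed
  qed simp
  then show ?thesis using assms by (auto simp: ell2_def)
qed

lemma ell2_scale:
  assumes "f \<in> ell2 X" shows "(\<lambda>x. c * f x) \<in> ell2 X"
  using assms summable_on_cmult_right[of "\<lambda>x. (cmod (f x))\<^sup>2" X "(cmod c)\<^sup>2"]
  by (auto simp: ell2_def norm_mult power_mult_distrib)

lemma ell2_zero: "(\<lambda>x. 0) \<in> ell2 X" by (simp add: ell2_def)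

text \<open>Functions on the whole type are taken, so that operators for all vertex sets act on one
  Hilbert space; the functions on a subset are the range of the projection
  \<open>restr\<close>.\<close>

typedef 'a l2 = "ell2 (UNIV :: 'a set)" morphisms rep_l2 Abs_l2
  using ell2_zero by blast

lemma rep_l2_add_mem: "(\<lambda>x. rep_l2 f x + rep_l2 g x) \<in> ell2 UNIV"
  by (intro ell2_add rep_l2)

lemma rep_l2_scale_mem: "(\<lambda>x. c * rep_l2 f x) \<in> ell2 UNIV"
  by (intro ell2_scale rep_l2)

definition scaleC :: "complex \<Rightarrow> 'a l2 \<Rightarrow> 'a l2" where
  "scaleC c f = Abs_l2 (\<lambda>x. c * rep_l2 f x)"

lemma rep_scaleC [simp]: "rep_l2 (scaleC c f) x = c * rep_l2 f x"
  by (simp add: scaleC_def Abs_l2_inverse rep_l2_scale_mem)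

lemma l2_eqI: "(\<And>x. rep_l2 f x = rep_l2 g x) \<Longrightarrow> f = g"
  by (metis ext rep_l2_inject)

instantiation l2 :: (type) real_vector
begin
definition "zero_l2 = Abs_l2 (\<lambda>x. 0)"
definition "plus_l2 f g = Abs_l2 (\<lambda>x. rep_l2 f x + rep_l2 g x)"
definition "uminus_l2 f = scaleC (-1) f" for f :: "'a l2"
definition "minus_l2 f g = f + scaleC (-1) g" for f :: "'a l2"
definition "scaleR_l2 r f = scaleC (complex_of_real r) f" for f :: "'a l2"

lemma rep_l2_simps [simp]:
  "rep_l2 0 x = 0" "rep_l2 (f + g) x = rep_l2 f x + rep_l2 g x"
  "rep_l2 (- f) x = - rep_l2 f x" "rep_l2 (f - g) x = rep_l2 f x - rep_l2 g x"
  "rep_l2 (r *\<^sub>R f) x = complex_of_real r * rep_l2 f x"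
proof -
  show p: "rep_l2 (f + g) x = rep_l2 f x + rep_l2 g x" for f g :: "'a l2"
    by (simp add: plus_l2_def Abs_l2_inverse rep_l2_add_mem)
  show "rep_l2 0 x = 0" "rep_l2 (- f) x = - rep_l2 f x" "rep_l2 (f - g) x = rep_l2 f x - rep_l2 g x"
    "rep_l2 (r *\<^sub>R f) x = complex_of_real r * rep_l2 f x"
    by (simp_all add: zero_l2_def Abs_l2_inverse ell2_zero uminus_l2_def minus_l2_def scaleR_l2_def p)
qed

instance
  by standard (auto intro!: l2_eqI simp: algebra_simps)
end

definition cin :: "'a l2 \<Rightarrow> 'a l2 \<Rightarrow> complex" where
  "cin f g = (\<Sum>\<^sub>\<infinity>x. rep_l2 f x * cnj (rep_l2 g x))"

lemma rep_l2_sq_summable: "(\<lambda>x. (cmod (rep_l2 f x))\<^sup>2) summable_on UNIV"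
  using rep_l2[of f] by (simp add: ell2_def)

lemma cin_summable: "(\<lambda>x. rep_l2 f x * cnj (rep_l2 g x)) summable_on UNIV"
  by (intro ell2_product_summable rep_l2_sq_summable)

lemma cin_add_left: "cin (f + g) h = cin f h + cin g h"
  unfolding cin_def by (simp add: distrib_right infsum_add cin_summable)

lemma cin_scaleC_left: "cin (scaleC c f) h = c * cin f h"
  unfolding cin_def by (simp add: mult.assoc infsum_cmult_right cin_summable)

lemma cin_commute: "cin f g = cnj (cin g f)"
  unfolding cin_def by (subst infsum_cnj[symmetric]) (simp add: mult.commute)

lemma cin_add_right: "cin h (f + g) = cin h f + cin h g"
  by (subst (1 2 3) cin_commute) (simp add: cin_add_left)

lemma cin_scaleC_right: "cin h (scaleC c f) = cnj c * cin h f"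
  by (subst (1 2) cin_commute) (simp add: cin_scaleC_left)

lemma cin_self: "cin f f = complex_of_real (\<Sum>\<^sub>\<infinity>x. (cmod (rep_l2 f x))\<^sup>2)"
  unfolding cin_def complex_norm_square[symmetric]
  by (rule infsumI[OF has_sum_of_real[OF has_sum_infsum[OF rep_l2_sq_summable]]])

lemma cin_self_nonneg: "0 \<le> Re (cin f f)"
  by (simp add: cin_self infsum_nonneg)

lemma cin_self_zero:
  assumes "Re (cin f f) = 0" shows "f = 0"
proof (rule l2_eqI)
  fix x
  have "(cmod (rep_l2 f x))\<^sup>2 = 0"
    using nonneg_infsum_le_0D[of "\<lambda>x. (cmod (rep_l2 f x))\<^sup>2" UNIV x] assms rep_l2_sq_summable[of f]
    by (simp add: cin_self)
  then show "rep_l2 f x = rep_l2 0 x" by simp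
qed

instantiation l2 :: (type) real_inner
begin
definition "inner_l2 f g = Re (cin f g)"
definition "norm_l2 f = sqrt (Re (cin f f))" for f :: "'a l2"
definition "dist_l2 f g = norm (f - g)" for f :: "'a l2"
definition "sgn_l2 f = f /\<^sub>R norm f" for f :: "'a l2"
definition [code del]: "(uniformity :: ('a l2 \<times> 'a l2) filter) = (INF e\<in>{0<..}. principal {(x, y). dist x y < e})"
definition [code del]: "open (U :: 'a l2 set) \<longleftrightarrow> (\<forall>x\<in>U. eventually (\<lambda>(x', y). x' = x \<longrightarrow> y \<in> U) uniformity)"
instance
proof
  fix f g h :: "'a l2" and r :: real
  show "dist f g = norm (f - g)" by (simp add: dist_l2_def)
  show "sgn f = f /\<^sub>R norm f" by (simp add: sgn_l2_def)
  show "(uniformity :: ('a l2 \<times> 'a l2) filter) = (INF e\<in>{0<..}. principal {(x, y). dist x y < e})"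
    by (rule uniformity_l2_def)
  show "open U \<longleftrightarrow> (\<forall>x\<in>U. eventually (\<lambda>(x', y). x' = x \<longrightarrow> y \<in> U) uniformity)" for U :: "'a l2 set"
    by (rule open_l2_def)
  show "inner f g = inner g f" unfolding inner_l2_def by (subst cin_commute) simp
  show "inner (f + g) h = inner f h + inner g h" by (simp add: inner_l2_def cin_add_left)
  show "inner (r *\<^sub>R f) g = r * inner f g" by (simp add: inner_l2_def scaleR_l2_def cin_scaleC_left)
  show "0 \<le> inner f f" by (simp add: inner_l2_def cin_self_nonneg)
  show "inner f f = 0 \<longleftrightarrow> f = 0"
    using cin_self_zero[of f] by (auto simp: inner_l2_def cin_def)
  show "norm f = sqrt (inner f f)" by (simp add: norm_l2_def inner_l2_def)
qed
end

lemma l2_norm_sq: "(norm f)\<^sup>2 = (\<Sum>\<^sub>\<infinity>x. (cmod (rep_l2 f x))\<^sup>2)"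
  by (simp add: power2_norm_eq_inner inner_l2_def cin_self)

lemma l2_sum_le_norm:
  assumes "finite F" shows "(\<Sum>x\<in>F. (cmod (rep_l2 f x))\<^sup>2) \<le> (norm f)\<^sup>2"
  unfolding l2_norm_sq by (rule finite_sum_le_infsum[OF rep_l2_sq_summable assms]) auto

lemma l2_coord_le_norm: "cmod (rep_l2 f x) \<le> norm f"
  by (rule power2_le_imp_le) (use l2_sum_le_norm[of "{x}" f] in auto)

instance l2 :: (type) complete_space
proof
  fix X :: "nat \<Rightarrow> 'a l2" assume C: "Cauchy X"
  have "Cauchy (\<lambda>n. rep_l2 (X n) x)" for x
  proof (rule CauchyI)
    fix e :: real assume "e > 0"
    then obtain M where M: "\<And>m n. M \<le> m \<Longrightarrow> M \<le> n \<Longrightarrow> norm (X m - X n) < e" using CauchyD[OF C] by blast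
    have "norm (rep_l2 (X m) x - rep_l2 (X n) x) < e" if "M \<le> m" "M \<le> n" for m n
      using l2_coord_le_norm[of "X m - X n" x] M[OF that] by simp
    then show "\<exists>M. \<forall>m\<ge>M. \<forall>n\<ge>M. norm (rep_l2 (X m) x - rep_l2 (X n) x) < e" by blast
  qed
  then have "\<forall>x. \<exists>l. (\<lambda>n. rep_l2 (X n) x) \<longlonglongrightarrow> l" by (simp add: Cauchy_convergent_iff convergent_def)
  then obtain f where f: "\<And>x. (\<lambda>n. rep_l2 (X n) x) \<longlonglongrightarrow> f x" by metis
  \<comment> \<open>Estimates on finite sums survive the passage to the pointwise limit; they then
    yield both the summability of the limit and the distance to it.\<close>
  have bound: "(\<Sum>x\<in>F. (cmod (rep_l2 (X n) x - f x))\<^sup>2) \<le> e\<^sup>2"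
    if "finite F" "M \<le> n" "\<And>m n. M \<le> m \<Longrightarrow> M \<le> n \<Longrightarrow> norm (X m - X n) < e" for F n M e
  proof (rule LIMSEQ_le_const2)
    show "(\<lambda>m. \<Sum>x\<in>F. (cmod (rep_l2 (X n) x - rep_l2 (X m) x))\<^sup>2) \<longlonglongrightarrow> (\<Sum>x\<in>F. (cmod (rep_l2 (X n) x - f x))\<^sup>2)"
      by (intro tendsto_intros f)
    have "(\<Sum>x\<in>F. (cmod (rep_l2 (X n) x - rep_l2 (X m) x))\<^sup>2) \<le> e\<^sup>2" if "M \<le> m" for m
    proof -
      have "(\<Sum>x\<in>F. (cmod (rep_l2 (X n) x - rep_l2 (X m) x))\<^sup>2) \<le> (norm (X n - X m))\<^sup>2"
        using l2_sum_le_norm[OF \<open>finite F\<close>, of "X n - X m"] by simp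
      also have "\<dots> \<le> e\<^sup>2"
        by (intro power_mono) (use \<open>\<And>m n. M \<le> m \<Longrightarrow> M \<le> n \<Longrightarrow> norm (X m - X n) < e\<close>[of n m] \<open>M \<le> n\<close> that in auto)
      finally show ?thesis .
    qed
    then show "\<exists>N. \<forall>m\<ge>N. (\<Sum>x\<in>F. (cmod (rep_l2 (X n) x - rep_l2 (X m) x))\<^sup>2) \<le> e\<^sup>2" by blast
  qed
  have mem: "(\<lambda>x. rep_l2 (X n) x - f x) \<in> ell2 UNIV \<and> (\<Sum>\<^sub>\<infinity>x. (cmod (rep_l2 (X n) x - f x))\<^sup>2) \<le> e\<^sup>2"
    if "M \<le> n" "\<And>m n. M \<le> m \<Longrightarrow> M \<le> n \<Longrightarrow> norm (X m - X n) < e" for n M e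
  proof -
    have s: "(\<lambda>x. (cmod (rep_l2 (X n) x - f x))\<^sup>2) summable_on UNIV"
      by (rule nonneg_bdd_above_summable_on) (use bound[OF _ that] in \<open>auto intro!: bdd_aboveI2[where M = "e\<^sup>2"]\<close>)
    then show ?thesis using bound[OF _ that] by (auto simp: ell2_def intro!: infsum_le_finite_sums)
  qed
  obtain M1 where M1: "\<And>m n. M1 \<le> m \<Longrightarrow> M1 \<le> n \<Longrightarrow> norm (X m - X n) < 1" using CauchyD[OF C, of 1] by auto
  have "(\<lambda>x. rep_l2 (X M1) x - f x) \<in> ell2 UNIV" using mem[of M1 M1 1] M1 by simp
  then have "(\<lambda>x. rep_l2 (X M1) x + (-1) * (rep_l2 (X M1) x - f x)) \<in> ell2 UNIV"
    by (intro ell2_add ell2_scale rep_l2)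
  then have fm: "f \<in> ell2 UNIV" by simp
  define g where "g = Abs_l2 f"
  have rg: "rep_l2 g x = f x" for x by (simp add: g_def Abs_l2_inverse fm)
  have "X \<longlonglongrightarrow> g"
  proof (rule metric_LIMSEQ_I)
    fix e :: real assume "e > 0"
    then obtain M where M: "\<And>m n. M \<le> m \<Longrightarrow> M \<le> n \<Longrightarrow> norm (X m - X n) < e / 2" using CauchyD[OF C, of "e / 2"] by auto
    have "dist (X n) g < e" if "M \<le> n" for n
    proof -
      have "(norm (X n - g))\<^sup>2 \<le> (e / 2)\<^sup>2" using mem[OF that M] by (simp add: l2_norm_sq rg)
      then have "norm (X n - g) \<le> e / 2" by (rule power2_le_imp_le) (use \<open>e > 0\<close> in simp)
      then show ?thesis using \<open>e > 0\<close> by (simp add: dist_norm)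
    qed
    then show "\<exists>N. \<forall>n\<ge>N. dist (X n) g < e" by blast
  qed
  then show "convergent X" by (auto simp: convergent_def)
qed

subsection \<open>Complex-linear operators\<close>

lemma inner_cin: "f \<bullet> g = Re (cin f g)"
  by (rule inner_l2_def)

lemma cin_zero [simp]: "cin 0 g = 0" "cin g 0 = 0"
  by (simp_all add: cin_def)

lemma scaleC_add: "scaleC c (f + g) = scaleC c f + scaleC c g"
  by (rule l2_eqI) (simp add: algebra_simps)

lemma scaleC_scaleC [simp]: "scaleC c (scaleC d f) = scaleC (c * d) f"
  by (rule l2_eqI) (simp add: algebra_simps)

lemma scaleC_one [simp]: "scaleC 1 f = f"
  by (rule l2_eqI) simp

lemma scaleC_zero [simp]: "scaleC c 0 = 0" "scaleC 0 f = 0"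
  by (rule l2_eqI, simp)+

lemma scaleR_scaleC: "r *\<^sub>R f = scaleC (complex_of_real r) f" for f :: "'a l2"
  by (rule scaleR_l2_def)

lemma uminus_scaleC: "- f = scaleC (-1) f" for f :: "'a l2"
  by (rule uminus_l2_def)

lemma cin_minus_left: "cin (- f) g = - cin f g"
  by (simp add: uminus_scaleC cin_scaleC_left)

lemma cin_minus_right: "cin f (- g) = - cin f g"
  by (simp add: uminus_scaleC cin_scaleC_right)

lemma cin_diff_left: "cin (f - g) h = cin f h - cin g h"
  using cin_add_left[of f "- g" h] by (simp add: cin_minus_left)

lemma cin_diff_right: "cin h (f - g) = cin h f - cin h g"
  using cin_add_right[of h f "- g"] by (simp add: cin_minus_right)

lemma cin_scaleR_left: "cin (r *\<^sub>R f) g = r * cin f g"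
  by (simp add: scaleR_scaleC cin_scaleC_left)

lemma cin_scaleR_right: "cin f (r *\<^sub>R g) = r * cin f g"
  by (simp add: scaleR_scaleC cin_scaleC_right)

lemma cin_sum_left: "cin (\<Sum>i\<in>I. f i) g = (\<Sum>i\<in>I. cin (f i) g)"
  by (induction I rule: infinite_finite_induct) (auto simp: cin_add_left)

lemma cin_sum_right: "cin g (\<Sum>i\<in>I. f i) = (\<Sum>i\<in>I. cin g (f i))"
  by (induction I rule: infinite_finite_induct) (auto simp: cin_add_right)

lemma rep_l2_sum: "rep_l2 (\<Sum>i\<in>I. f i) x = (\<Sum>i\<in>I. rep_l2 (f i) x)"
  by (induction I rule: infinite_finite_induct) auto

lemma Im_cin: "Im (cin f g) = f \<bullet> scaleC \<i> g"
  by (simp add: inner_cin cin_scaleC_right)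

lemma cin_eq_Complex: "cin f g = Complex (f \<bullet> g) (f \<bullet> scaleC \<i> g)"
  by (simp add: complex_eq_iff inner_cin cin_scaleC_right)

lemma cin_self_norm: "cin f f = complex_of_real ((norm f)\<^sup>2)"
  by (simp add: cin_self l2_norm_sq)

lemma cin_eqI: "(\<And>h. cin f h = cin g h) \<Longrightarrow> f = g"
proof -
  assume "\<And>h. cin f h = cin g h"
  then have "cin (f - g) (f - g) = 0" by (simp add: cin_diff_left)
  then show ?thesis by (simp add: cin_self_norm)
qed

lemma norm_scaleC: "norm (scaleC c f) = cmod c * norm f"
proof -
  have "(norm (scaleC c f))\<^sup>2 = Re ((c * cnj c) * cin f f)"
    unfolding power2_norm_eq_inner inner_cin
    by (simp only: cin_scaleC_left cin_scaleC_right mult.assoc mult.left_commute[of c])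
  also have "\<dots> = (cmod c * norm f)\<^sup>2"
    by (simp only: complex_norm_square[symmetric] cin_self_norm) (simp add: power_mult_distrib flip: of_real_power)
  finally show ?thesis by (simp add: power2_eq_iff_nonneg)
qed

lemma bounded_linear_scaleC: "bounded_linear (scaleC c)"
proof (rule bounded_linear_intro[where K = "cmod c"])
  show "scaleC c (r *\<^sub>R x) = r *\<^sub>R scaleC c x" for r and x :: "'a l2"
    by (rule l2_eqI) simp
qed (auto simp: scaleC_add norm_scaleC mult.commute)

lemma norm_cin_le: "cmod (cin f g) \<le> norm f * norm g"
proof -
  define c where "c = cnj (sgn (cin f g))"
  have "cmod (cin f g) = Re (c * cin f g)"
  proof (cases "cin f g = 0")
    case False
    have "c * cin f g = cin f g * cnj (cin f g) / cmod (cin f g)"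
      by (simp add: c_def sgn_eq)
    also have "\<dots> = complex_of_real (cmod (cin f g))"
      using False by (simp add: complex_norm_square[symmetric] power2_eq_square)
    finally show ?thesis by simp
  qed simp
  also have "\<dots> = scaleC c f \<bullet> g" by (simp add: inner_cin cin_scaleC_left)
  also have "\<dots> \<le> norm (scaleC c f) * norm g" by (rule norm_cauchy_schwarz)
  also have "\<dots> \<le> norm f * norm g"
    by (intro mult_right_mono) (auto simp: norm_scaleC c_def norm_sgn mult_le_cancel_right1)
  finally show ?thesis .
qed

definition clin :: "('a l2 \<Rightarrow> 'b l2) \<Rightarrow> bool" where
  "clin T \<longleftrightarrow> bounded_linear T \<and> (\<forall>c f. T (scaleC c f) = scaleC c (T f))"

definition adjoint :: "('a l2 \<Rightarrow> 'b l2) \<Rightarrow> ('b l2 \<Rightarrow> 'a l2) \<Rightarrow> bool" where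
  "adjoint S T \<longleftrightarrow> (\<forall>f g. cin (S f) g = cin f (T g))"

lemma adjoint_sym: "adjoint S T \<Longrightarrow> adjoint T S"
  unfolding adjoint_def by (metis cin_commute)

text \<open>Symmetry is demanded for the complex inner product; complex linearity follows from it
  (\<open>csa_scaleC\<close>).\<close>

definition csa :: "('a l2 \<Rightarrow> 'a l2) \<Rightarrow> bool" where
  "csa T \<longleftrightarrow> bounded_linear T \<and> (\<forall>f g. cin (T f) g = cin f (T g))"

lemma csa_cin: "csa T \<Longrightarrow> cin (T f) g = cin f (T g)" by (simp add: csa_def)

lemma csa_scaleC: "csa T \<Longrightarrow> T (scaleC c f) = scaleC c (T f)"
  by (rule cin_eqI) (simp add: csa_def cin_scaleC_left)

lemma csa_selfadj: "csa T \<Longrightarrow> selfadj T"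
  by (simp add: csa_def selfadj_def inner_cin)

lemma csa_clin: "csa T \<Longrightarrow> clin T"
  using csa_scaleC by (auto simp: clin_def csa_def)

text \<open>The imaginary part of the complex inner product is the real one with a factor
  \<open>\<i>\<close> inserted, so an operator that commutes with \<open>\<i>\<close> is symmetric
  for both parts.\<close>

lemma csaI:
  assumes "selfadj T" "\<And>f. T (scaleC \<i> f) = scaleC \<i> (T f)"
  shows "csa T"
proof -
  have "cin (T f) g = cin f (T g)" for f g
    using selfadj_inner[OF assms(1), of f g] selfadj_inner[OF assms(1), of f "scaleC \<i> g"] assms(2)
    by (simp add: cin_eq_Complex)
  then show ?thesis using assms(1) by (simp add: csa_def selfadj_bounded_linear)
qed

lemma csa_cin_real: "csa T \<Longrightarrow> cin (T f) f = complex_of_real (T f \<bullet> f)"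
proof -
  assume "csa T"
  then have "cin (T f) f = cnj (cin (T f) f)" by (metis cin_commute csa_def)
  then have "Im (cin (T f) f) = 0" by (metis cnj.simps(2) equal_neg_zero)
  then show ?thesis by (simp add: complex_eq_iff inner_cin)
qed

lemma clin_simps:
  assumes "clin T"
  shows "T (f + g) = T f + T g" "T (f - g) = T f - T g" "T (r *\<^sub>R f) = r *\<^sub>R T f" "T 0 = 0"
    "T (scaleC c f) = scaleC c (T f)"
proof -
  interpret bounded_linear T using assms by (simp add: clin_def)
  show "T (f + g) = T f + T g" "T (f - g) = T f - T g" "T (r *\<^sub>R f) = r *\<^sub>R T f" "T 0 = 0"
    by (auto simp: add diff scaleR zero)
  show "T (scaleC c f) = scaleC c (T f)" using assms by (simp add: clin_def)
qed

lemma clin_sum: "clin T \<Longrightarrow> T (\<Sum>i\<in>I. f i) = (\<Sum>i\<in>I. T (f i))"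
  by (intro linear_sum bounded_linear.linear) (simp add: clin_def)

lemma clin_compose: "clin S \<Longrightarrow> clin T \<Longrightarrow> clin (\<lambda>f. S (T f))"
  by (auto simp: clin_def intro: bounded_linear_compose)

lemma clin_add: "clin S \<Longrightarrow> clin T \<Longrightarrow> clin (\<lambda>f. S f + T f)"
  by (auto simp: clin_def scaleC_add intro: bounded_linear_add)

lemma clin_scaleC: "clin S \<Longrightarrow> clin (\<lambda>f. scaleC c (S f))"
  by (auto simp: clin_def mult.commute intro: bounded_linear_compose[OF bounded_linear_scaleC])

lemma clin_scaleR: "clin S \<Longrightarrow> clin (\<lambda>f. r *\<^sub>R S f)"
  unfolding scaleR_scaleC by (rule clin_scaleC)

lemma clin_diff: "clin S \<Longrightarrow> clin T \<Longrightarrow> clin (\<lambda>f. S f - T f)"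
  using clin_add[of S "\<lambda>f. scaleC (-1) (T f)"] clin_scaleC[of T "-1"] by (simp flip: uminus_scaleC)

lemma clin_zero: "clin (\<lambda>f. 0)"
  by (simp add: clin_def bounded_linear_zero)

lemma clin_sumI: "(\<And>i. i \<in> I \<Longrightarrow> clin (S i)) \<Longrightarrow> clin (\<lambda>f. \<Sum>i\<in>I. S i f)"
  by (induction I rule: infinite_finite_induct) (auto intro: clin_zero clin_add)

definition del :: "'a \<Rightarrow> 'a l2" where "del x = Abs_l2 (delta x)"

lemma delta_ell2: "x \<in> X \<Longrightarrow> delta x \<in> ell2 X"
proof -
  assume x: "x \<in> X"
  have "(\<lambda>y. (cmod (delta x y))\<^sup>2) summable_on X \<longleftrightarrow> (\<lambda>y. (cmod (delta x y))\<^sup>2) summable_on {x}"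
    by (rule summable_on_cong_neutral) (use x in \<open>auto simp: delta_def\<close>)
  then show ?thesis using x by (auto simp: ell2_def delta_def)
qed

lemma rep_del: "rep_l2 (del x) = delta x"
  by (simp add: del_def Abs_l2_inverse delta_ell2)

lemma cin_del_right: "cin f (del x) = rep_l2 f x"
proof -
  have "(\<Sum>\<^sub>\<infinity>y. rep_l2 f y * cnj (rep_l2 (del x) y)) = (\<Sum>\<^sub>\<infinity>y\<in>{x}. rep_l2 f y * cnj (rep_l2 (del x) y))"
    by (rule infsum_cong_neutral) (auto simp: rep_del delta_def)
  then show ?thesis by (simp add: cin_def rep_del delta_def)
qed

lemma cin_del_left: "cin (del x) f = cnj (rep_l2 f x)"
  by (subst cin_commute) (simp add: cin_del_right)

lemma restr_ell2:
  assumes "f \<in> ell2 UNIV" shows "(\<lambda>x. if x \<in> A then f x else 0) \<in> ell2 UNIV"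
proof -
  have "(\<lambda>x. (cmod (if x \<in> A then f x else 0))\<^sup>2) summable_on UNIV"
    by (rule summable_on_comparison_test[of "\<lambda>x. (cmod (f x))\<^sup>2"]) (use assms in \<open>auto simp: ell2_def\<close>)
  then show ?thesis by (simp add: ell2_def)
qed

definition restr :: "'a set \<Rightarrow> 'a l2 \<Rightarrow> 'a l2" where
  "restr A f = Abs_l2 (\<lambda>x. if x \<in> A then rep_l2 f x else 0)"

lemma rep_restr: "rep_l2 (restr A f) x = (if x \<in> A then rep_l2 f x else 0)"
  by (simp add: restr_def Abs_l2_inverse restr_ell2 rep_l2)

lemma restr_restr: "restr A (restr B f) = restr (A \<inter> B) f"
  by (rule l2_eqI) (auto simp: rep_restr)

lemma restr_cin: "cin (restr A f) g = cin f (restr A g)"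
  unfolding cin_def by (rule infsum_cong) (simp add: rep_restr)

lemma restr_bounded_linear: "bounded_linear (restr A)"
proof (rule bounded_linear_intro[where K = 1])
  show "restr A (x + y) = restr A x + restr A y" for x y :: "'a l2" by (rule l2_eqI) (auto simp: rep_restr)
  show "restr A (r *\<^sub>R x) = r *\<^sub>R restr A x" for r and x :: "'a l2" by (rule l2_eqI) (auto simp: rep_restr)
  show "norm (restr A x) \<le> norm x * 1" for x :: "'a l2"
  proof -
    have "(norm (restr A x))\<^sup>2 \<le> (norm x)\<^sup>2"
      unfolding l2_norm_sq by (rule infsum_mono[OF rep_l2_sq_summable rep_l2_sq_summable]) (auto simp: rep_restr)
    then show ?thesis by (simp add: power2_le_iff_abs_le)
  qed
qed

lemma restr_csa: "csa (restr A)"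
  by (simp add: csa_def restr_bounded_linear restr_cin)

lemma restr_proj: "is_proj (restr A)"
  by (simp add: is_proj_def csa_selfadj[OF restr_csa] restr_restr)

lemma restr_fixed_iff: "restr A f = f \<longleftrightarrow> (\<forall>x. x \<notin> A \<longrightarrow> rep_l2 f x = 0)"
proof
  assume e: "restr A f = f"
  have "rep_l2 (restr A f) x = 0" if "x \<notin> A" for x using that by (simp add: rep_restr)
  then show "\<forall>x. x \<notin> A \<longrightarrow> rep_l2 f x = 0" by (simp add: e)
next
  assume "\<forall>x. x \<notin> A \<longrightarrow> rep_l2 f x = 0"
  then show "restr A f = f" by (intro l2_eqI) (simp add: rep_restr)
qed

lemma restr_del: "restr A (del x) = (if x \<in> A then del x else 0)"
  by (rule l2_eqI) (auto simp: rep_restr rep_del delta_def)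

subsection \<open>Spectral projections of operators on a subset\<close>

lemma ell2_UNIV: "f \<in> ell2 X \<Longrightarrow> f \<in> ell2 UNIV"
proof -
  assume f: "f \<in> ell2 X"
  have "(\<lambda>x. (cmod (f x))\<^sup>2) summable_on X \<longleftrightarrow> (\<lambda>x. (cmod (f x))\<^sup>2) summable_on UNIV"
    by (rule summable_on_cong_neutral) (use f in \<open>auto simp: ell2_def\<close>)
  then show ?thesis using f by (simp add: ell2_def)
qed

lemma rep_Abs_ell2: "f \<in> ell2 X \<Longrightarrow> rep_l2 (Abs_l2 f) = f"
  by (simp add: Abs_l2_inverse ell2_UNIV)

lemma restr_Abs_ell2: "f \<in> ell2 X \<Longrightarrow> restr X (Abs_l2 f) = Abs_l2 f"
  by (simp add: restr_fixed_iff rep_Abs_ell2) (simp add: ell2_def)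

lemma rep_l2_mem_ell2: "restr X f = f \<Longrightarrow> rep_l2 f \<in> ell2 X"
  using rep_l2_sq_summable[of f] by (auto simp: restr_fixed_iff ell2_def intro: summable_on_subset)

lemma ell2_inner_cin: "f \<in> ell2 X \<Longrightarrow> g \<in> ell2 X \<Longrightarrow> ell2_inner X f g = cin (Abs_l2 f) (Abs_l2 g)"
  unfolding ell2_inner_def cin_def
  by (rule infsum_cong_neutral) (auto simp: rep_Abs_ell2 ell2_def)

lemma spectral_resolutionD:
  assumes "spectral_resolution X T E"
  shows "B \<in> sets borel \<Longrightarrow> f \<in> ell2 X \<Longrightarrow> E B f \<in> ell2 X"
    "B \<in> sets borel \<Longrightarrow> f \<in> ell2 X \<Longrightarrow> E B (E B f) = E B f"
    "B \<in> sets borel \<Longrightarrow> f \<in> ell2 X \<Longrightarrow> g \<in> ell2 X \<Longrightarrow>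
      E B (\<lambda>x. a * f x + b * g x) = (\<lambda>x. a * E B f x + b * E B g x)"
    "B \<in> sets borel \<Longrightarrow> f \<in> ell2 X \<Longrightarrow> g \<in> ell2 X \<Longrightarrow> ell2_inner X (E B f) g = ell2_inner X f (E B g)"
    "f \<in> ell2 X \<Longrightarrow> E UNIV f = f"
    "A \<in> sets borel \<Longrightarrow> B \<in> sets borel \<Longrightarrow> f \<in> ell2 X \<Longrightarrow> E (A \<inter> B) f = E A (E B f)"
    "range F \<subseteq> sets borel \<Longrightarrow> disjoint_family F \<Longrightarrow> f \<in> ell2 X \<Longrightarrow> g \<in> ell2 X \<Longrightarrow>
      (\<lambda>n. ell2_inner X (E (F n) f) g) sums ell2_inner X (E (\<Union>n::nat. F n) f) g"
    "\<exists>a. \<forall>f\<in>ell2 X. E {-a<..<a} f = f"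
    "f \<in> ell2 X \<Longrightarrow> ell2_inner X (T f) f = complex_of_real
        (\<integral>t. t \<partial>(measure_of UNIV (sets borel) (\<lambda>B. ennreal (Re (ell2_inner X (E B f) f)))))"
proof -
  note D = assms[unfolded spectral_resolution_def projection_valued_measure_def orthogonal_projection_def]
  note pvm = D[THEN conjunct1] and rest = D[THEN conjunct2]
  note proj = pvm[THEN conjunct1, THEN bspec]
  show "B \<in> sets borel \<Longrightarrow> f \<in> ell2 X \<Longrightarrow> E B f \<in> ell2 X" using proj[of B] by simp
  show "B \<in> sets borel \<Longrightarrow> f \<in> ell2 X \<Longrightarrow> E B (E B f) = E B f" using proj[of B] by simp
  show "B \<in> sets borel \<Longrightarrow> f \<in> ell2 X \<Longrightarrow> g \<in> ell2 X \<Longrightarrow>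
      E B (\<lambda>x. a * f x + b * g x) = (\<lambda>x. a * E B f x + b * E B g x)"
    using proj[of B] by simp
  show "B \<in> sets borel \<Longrightarrow> f \<in> ell2 X \<Longrightarrow> g \<in> ell2 X \<Longrightarrow> ell2_inner X (E B f) g = ell2_inner X f (E B g)"
    using proj[of B] by simp
  show "f \<in> ell2 X \<Longrightarrow> E UNIV f = f" using pvm[THEN conjunct2, THEN conjunct1] by simp
  show "A \<in> sets borel \<Longrightarrow> B \<in> sets borel \<Longrightarrow> f \<in> ell2 X \<Longrightarrow> E (A \<inter> B) f = E A (E B f)"
    using pvm[THEN conjunct2, THEN conjunct2, THEN conjunct1] by simp
  show "range F \<subseteq> sets borel \<Longrightarrow> disjoint_family F \<Longrightarrow> f \<in> ell2 X \<Longrightarrow> g \<in> ell2 X \<Longrightarrow>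
      (\<lambda>n. ell2_inner X (E (F n) f) g) sums ell2_inner X (E (\<Union>n::nat. F n) f) g"
    using pvm[THEN conjunct2, THEN conjunct2, THEN conjunct2] by simp
  show "\<exists>a. \<forall>f\<in>ell2 X. E {-a<..<a} f = f" by (rule rest[THEN conjunct1])
  show "f \<in> ell2 X \<Longrightarrow> ell2_inner X (T f) f = complex_of_real
        (\<integral>t. t \<partial>(measure_of UNIV (sets borel) (\<lambda>B. ennreal (Re (ell2_inner X (E B f) f)))))"
    by (rule rest[THEN conjunct2, THEN bspec])
qed

text \<open>The bridge between raw functions on \<open>X\<close>, on which spectral projections are
  defined, and the Hilbert space type: \<open>T'\<close> represents \<open>T\<close> and lives on
  the range of \<open>restr X\<close>.\<close>

locale ell2_operator =
  fixes X :: "'a set" and T :: "('a \<Rightarrow> complex) \<Rightarrow> ('a \<Rightarrow> complex)" and T' :: "'a l2 \<Rightarrow> 'a l2"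
  assumes csa: "csa T'" and rep_T: "rep_l2 (T' f) = T (rep_l2 f)"
    and RT: "restr X (T' f) = T' f" and TR: "T' (restr X f) = T' f"
begin

lemma T_Abs: "f \<in> ell2 X \<Longrightarrow> T f \<in> ell2 X" "f \<in> ell2 X \<Longrightarrow> Abs_l2 (T f) = T' (Abs_l2 f)"
proof -
  assume f: "f \<in> ell2 X"
  have e: "rep_l2 (T' (Abs_l2 f)) = T f" using rep_T[of "Abs_l2 f"] rep_Abs_ell2[OF f] by simp
  show "T f \<in> ell2 X" using rep_l2_mem_ell2[OF RT, of "Abs_l2 f"] e by simp
  show "Abs_l2 (T f) = T' (Abs_l2 f)" by (simp add: e[symmetric] rep_l2_inverse)
qed

lemma resolution_exists: "\<exists>E. spectral_resolution X T E"
proof -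
  interpret sa_operator T' by standard (rule csa_selfadj[OF csa])
  note R = EB_resolution[unfolded real_resolution_def]
  define E where "E = (\<lambda>B f. rep_l2 (EB B (Abs_l2 f)))"
  have csaE: "csa (EB B)" if "B \<in> sets borel" for B
  proof (rule csaI[OF is_proj_selfadj[OF EB_proj[OF that]]])
    have "commutes (scaleC \<i>) (EB B)"
      by (rule EB_commutes[OF that bounded_linear_scaleC]) (simp add: commutes_def csa_scaleC[OF csa])
    then show "EB B (scaleC \<i> f) = scaleC \<i> (EB B f)" for f by (simp add: commutes_def)
  qed
  have RE: "restr X (EB B f) = EB B f" if "B \<in> sets borel" "restr X f = f" for B f
  proof -
    have "commutes (restr X) (EB B)"
      by (rule EB_commutes[OF that(1) restr_bounded_linear]) (simp add: commutes_def RT TR)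
    then show ?thesis using that(2) by (simp add: commutes_def)
  qed
  have Emem: "E B f \<in> ell2 X" if "B \<in> sets borel" "f \<in> ell2 X" for B f
    unfolding E_def by (rule rep_l2_mem_ell2[OF RE[OF that(1) restr_Abs_ell2[OF that(2)]]])
  have AbsE: "Abs_l2 (E B f) = EB B (Abs_l2 f)" for B f by (simp add: E_def rep_l2_inverse)
  have Ein: "ell2_inner X (E B f) g = cin (EB B (Abs_l2 f)) (Abs_l2 g)"
    if "B \<in> sets borel" "f \<in> ell2 X" "g \<in> ell2 X" for B f g
    using ell2_inner_cin[OF Emem[OF that(1,2)] that(3)] by (simp add: AbsE)
  have "spectral_resolution X T E"
    unfolding spectral_resolution_def projection_valued_measure_def orthogonal_projection_def
  proof (intro conjI ballI allI impI)
    fix B f assume B: "B \<in> sets (borel :: real measure)" and f: "f \<in> ell2 X"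
    show "E B f \<in> ell2 X" by (rule Emem[OF B f])
    show "E B (E B f) = E B f" using is_proj_idem[OF EB_proj[OF B]] by (simp add: E_def rep_l2_inverse)
    fix g assume g: "g \<in> ell2 X"
    show "E B (\<lambda>x. a * f x + b * g x) = (\<lambda>x. a * E B f x + b * E B g x)" for a b
    proof -
      have "Abs_l2 (\<lambda>x. a * f x + b * g x) = scaleC a (Abs_l2 f) + scaleC b (Abs_l2 g)"
        by (rule l2_eqI)
          (simp add: rep_Abs_ell2[OF f] rep_Abs_ell2[OF g] rep_Abs_ell2[OF ell2_add[OF ell2_scale[OF f] ell2_scale[OF g]]])
      then show ?thesis by (simp add: E_def clin_simps[OF csa_clin[OF csaE[OF B]]] fun_eq_iff)
    qed
    show "ell2_inner X (E B f) g = ell2_inner X f (E B g)"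
      using ell2_inner_cin[OF f Emem[OF B g]] by (simp add: Ein[OF B f g] AbsE csa_cin[OF csaE[OF B]])
  next
    fix f assume f: "f \<in> ell2 X"
    show "E UNIV f = f" by (simp add: E_def EB_UNIV rep_Abs_ell2[OF f])
  next
    fix A B f assume "A \<in> sets (borel :: real measure)" "B \<in> sets (borel :: real measure)" and f: "f \<in> ell2 X"
    then show "E (A \<inter> B) f = E A (E B f)" by (simp add: E_def EB_Int rep_l2_inverse)
  next
    fix A :: "nat \<Rightarrow> real set" and f g
    assume A: "range A \<subseteq> sets borel" "disjoint_family A" and f: "f \<in> ell2 X" and g: "g \<in> ell2 X"
    have Ab: "A n \<in> sets borel" for n using A by auto
    then have Ub: "(\<Union>n. A n) \<in> sets borel" by auto
    show "(\<lambda>n. ell2_inner X (E (A n) f) g) sums ell2_inner X (E (\<Union>n. A n) f) g"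
      unfolding Ein[OF Ab f g] Ein[OF Ub f g] sums_complex_iff Im_cin
      using EB_sums[OF A] by (simp flip: inner_cin)
  next
    obtain a where a: "\<And>x. EB {-a<..<a} x = x" using R by blast
    show "\<exists>a. \<forall>f\<in>ell2 X. E {- a<..<a} f = f"
      by (intro exI[of _ a]) (simp add: E_def a rep_Abs_ell2)
  next
    fix f assume f: "f \<in> ell2 X"
    have "ell2_inner X (T f) f = cin (T' (Abs_l2 f)) (Abs_l2 f)"
      using ell2_inner_cin[OF T_Abs(1)[OF f] f] by (simp add: T_Abs(2)[OF f])
    also have "\<dots> = complex_of_real (T' (Abs_l2 f) \<bullet> Abs_l2 f)" by (rule csa_cin_real[OF csa])
    also have "T' (Abs_l2 f) \<bullet> Abs_l2 f =
        (\<integral>t. t \<partial>(measure_of UNIV (sets borel) (\<lambda>B. ennreal (EB B (Abs_l2 f) \<bullet> Abs_l2 f))))"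
      using R by blast
    also have "measure_of UNIV (sets borel) (\<lambda>B. ennreal (EB B (Abs_l2 f) \<bullet> Abs_l2 f)) =
        measure_of UNIV (sets borel) (\<lambda>B. ennreal (Re (ell2_inner X (E B f) f)))"
      by (rule measure_of_eq)
        (auto simp: sets.sigma_sets_eq[of borel, simplified] Ein f inner_cin)
    finally show "ell2_inner X (T f) f = complex_of_real
        (\<integral>t. t \<partial>(measure_of UNIV (sets borel) (\<lambda>B. ennreal (Re (ell2_inner X (E B f) f)))))" .
  qed
  then show ?thesis by (rule exI[of "spectral_resolution X T"])
qed

lemma resolution_real:
  assumes "spectral_resolution X T E"
  shows "real_resolution T' (restr X) (\<lambda>B f. Abs_l2 (E B (rep_l2 (restr X f))))"
proof -
  note E = spectral_resolutionD[OF assms]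
  define r where "r = (\<lambda>f. rep_l2 (restr X f))"
  have rm: "r f \<in> ell2 X" for f unfolding r_def by (rule rep_l2_mem_ell2) (simp add: restr_restr)
  have Ar: "Abs_l2 (r f) = restr X f" for f by (simp add: r_def rep_l2_inverse)
  have Em: "E B (r f) \<in> ell2 X" if "B \<in> sets borel" for B f by (rule E(1)[OF that rm])
  define F where "F = (\<lambda>B f. Abs_l2 (E B (r f)))"
  have rF: "r (F B f) = E B (r f)" if "B \<in> sets borel" for B f
    using restr_Abs_ell2[OF Em[OF that, of f]] rep_Abs_ell2[OF Em[OF that]] by (simp add: r_def F_def)
  have RF: "restr X (F B f) = F B f" if "B \<in> sets borel" for B f
    unfolding F_def by (rule restr_Abs_ell2[OF Em[OF that]])
  have Fin: "cin (F B f) g = ell2_inner X (E B (r f)) (r g)" if "B \<in> sets borel" for B f g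
  proof -
    have "cin (F B f) g = cin (restr X (F B f)) g" by (simp add: RF[OF that])
    also have "\<dots> = cin (Abs_l2 (E B (r f))) (Abs_l2 (r g))" by (simp add: restr_cin Ar F_def)
    also have "\<dots> = ell2_inner X (E B (r f)) (r g)" by (rule ell2_inner_cin[OF Em[OF that] rm, symmetric])
    finally show ?thesis .
  qed
  have Fsym: "cin (F B f) g = cin f (F B g)" if B: "B \<in> sets borel" for B f g
  proof -
    have "cin (F B f) g = ell2_inner X (r f) (E B (r g))" using E(4)[OF B rm rm] Fin[OF B, of f g] by simp
    also have "\<dots> = cin (restr X f) (F B g)" using ell2_inner_cin[OF rm[of f] Em[OF B, of g]] by (simp add: Ar F_def)
    also have "\<dots> = cin f (F B g)" by (simp add: restr_cin RF[OF B])
    finally show ?thesis .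
  qed
  have Fl: "F B (scaleC a f + scaleC b g) = scaleC a (F B f) + scaleC b (F B g)" if B: "B \<in> sets borel" for B a b f g
  proof (rule l2_eqI)
    fix x
    have e: "r (scaleC a f + scaleC b g) = (\<lambda>x. a * r f x + b * r g x)"
      by (auto simp: r_def rep_restr fun_eq_iff)
    have "E B (r (scaleC a f + scaleC b g)) = (\<lambda>x. a * E B (r f) x + b * E B (r g) x)"
      unfolding e by (rule E(3)[OF B rm rm])
    moreover have "rep_l2 (F B h) = E B (r h)" for h unfolding F_def by (rule rep_Abs_ell2[OF Em[OF B]])
    ultimately show "rep_l2 (F B (scaleC a f + scaleC b g)) x = rep_l2 (scaleC a (F B f) + scaleC b (F B g)) x"
      by simp
  qed
  have Fidem: "F B (F B f) = F B f" if B: "B \<in> sets borel" for B f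
  proof -
    have "E B (E B (r f)) = E B (r f)" by (rule E(2)[OF B rm])
    then have "E B (r (F B f)) = E B (r f)" by (simp add: rF[OF B])
    then show ?thesis by (simp add: F_def)
  qed
  have Fproj: "is_proj (F B)" if B: "B \<in> sets borel" for B
  proof -
    have "bounded_linear (F B)"
    proof (rule bounded_linear_intro[where K = 1])
      show "F B (f + g) = F B f + F B g" for f g using Fl[OF B, of 1 f 1 g] by simp
      show "F B (c *\<^sub>R f) = c *\<^sub>R F B f" for c f using Fl[OF B, of "complex_of_real c" f 0 0] by (simp add: scaleR_scaleC)
      show "norm (F B f) \<le> norm f * 1" for f
      proof -
        have "(norm (F B f))\<^sup>2 = F B f \<bullet> f"
          using Fsym[OF B, of "F B f" f] by (simp add: power2_norm_eq_inner inner_cin Fidem[OF B])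
        also have "\<dots> \<le> norm (F B f) * norm f" by (rule norm_cauchy_schwarz)
        finally show ?thesis by (cases "F B f = 0") (auto simp: power2_eq_square mult_le_cancel_left)
      qed
    qed
    then show ?thesis using Fsym[OF B] Fidem[OF B] by (simp add: is_proj_def selfadj_def inner_cin)
  qed
  have "real_resolution T' (restr X) F"
    unfolding real_resolution_def
  proof (intro conjI ballI allI impI)
    show "is_proj (F B)" if "B \<in> sets borel" for B by (rule Fproj[OF that])
    show "F UNIV f = restr X f" for f
    proof -
      have "E UNIV (r f) = r f" by (rule E(5)[OF rm])
      then show ?thesis by (simp add: F_def Ar)
    qed
    show "F (A \<inter> B) f = F A (F B f)" if "A \<in> sets borel" "B \<in> sets borel" for A B f
    proof -
      have "E (A \<inter> B) (r f) = E A (E B (r f))" by (rule E(6)[OF that rm])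
      then have "E (A \<inter> B) (r f) = E A (r (F B f))" by (simp add: rF[OF that(2)])
      then show ?thesis by (simp add: F_def)
    qed
    show "(\<lambda>n. F (A n) f \<bullet> g) sums (F (\<Union>n. A n) f \<bullet> g)"
      if A: "range A \<subseteq> sets borel" "disjoint_family A" for A :: "nat \<Rightarrow> real set" and f g
    proof -
      have Ab: "A n \<in> sets borel" for n using A by auto
      then have Ub: "(\<Union>n. A n) \<in> sets borel" by auto
      have "(\<lambda>n. ell2_inner X (E (A n) (r f)) (r g)) sums ell2_inner X (E (\<Union>n. A n) (r f)) (r g)"
        by (rule E(7)[OF A rm rm])
      then show ?thesis by (simp add: sums_complex_iff inner_cin Fin[OF Ab] Fin[OF Ub])
    qed
    obtain a where "\<forall>f\<in>ell2 X. E {-a<..<a} f = f" using E(8) by blast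
    then have "F {-a<..<a} f = restr X f" for f using rm by (simp add: F_def Ar)
    then show "\<exists>a. \<forall>f. F {-a<..<a} f = restr X f" by blast
    fix f assume f: "restr X f = f"
    have rf: "r f = rep_l2 f" by (simp add: r_def f)
    have "ell2_inner X (T (r f)) (r f) = complex_of_real
        (\<integral>t. t \<partial>(measure_of UNIV (sets borel) (\<lambda>B. ennreal (Re (ell2_inner X (E B (r f)) (r f))))))"
      by (rule E(9)[OF rm])
    moreover have "ell2_inner X (T (r f)) (r f) = complex_of_real (T' f \<bullet> f)"
      using ell2_inner_cin[OF T_Abs(1)[OF rm] rm, of f f] csa_cin_real[OF csa, of f] T_Abs(2)[OF rm, of f]
      by (simp add: Ar f)
    ultimately have "T' f \<bullet> f = (\<integral>t. t \<partial>(measure_of UNIV (sets borel) (\<lambda>B. ennreal (Re (ell2_inner X (E B (r f)) (r f))))))"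
      by (simp only: of_real_eq_iff)
    also have "measure_of UNIV (sets borel) (\<lambda>B. ennreal (Re (ell2_inner X (E B (r f)) (r f))))
       = measure_of UNIV (sets borel) (\<lambda>B. ennreal (F B f \<bullet> f))"
      by (rule measure_of_eq)
        (auto simp: sets.sigma_sets_eq[of borel, simplified] Fin inner_cin)
    finally show "T' f \<bullet> f = (\<integral>t. t \<partial>(measure_of UNIV (sets borel) (\<lambda>B. ennreal (F B f \<bullet> f))))" .
  qed
  then show ?thesis by (simp add: F_def r_def)
qed

text \<open>The choice made by \<open>SOME\<close> is harmless at a singleton: whichever resolution
  is picked, \<open>E_eigenspace\<close> fixes the range of its projection there, and the range
  fixes the projection.\<close>

theorem spectral_projection_eigenspace:
  assumes Q: "is_proj Q" "\<And>f. Q f = f \<longleftrightarrow> restr X f = f \<and> T' f = \<theta> *\<^sub>R f"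
    and f: "restr X f = f"
  shows "spectral_projection X T {\<theta>} (rep_l2 f) = rep_l2 (Q f)"
proof -
  define E where "E = spectral_projection X T"
  have E: "spectral_resolution X T E"
    unfolding E_def spectral_projection_def by (rule someI_ex[OF resolution_exists])
  interpret resolution T' "restr X" "\<lambda>B f. Abs_l2 (E B (rep_l2 (restr X f)))"
    by standard (auto simp: resolution_real[OF E] csa_selfadj[OF csa] TR RT)
  have "Abs_l2 (E {\<theta>} (rep_l2 (restr X f))) = Q f"
    by (rule is_proj_unique[OF E_proj Q(1)]) (auto simp: E_eigenspace Q(2))
  moreover have "E {\<theta>} (rep_l2 f) \<in> ell2 X"
    by (rule spectral_resolutionD(1)[OF E _ rep_l2_mem_ell2[OF f]]) simp
  then have "rep_l2 (Abs_l2 (E {\<theta>} (rep_l2 f))) = E {\<theta>} (rep_l2 f)" by (rule rep_Abs_ell2)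
  ultimately show ?thesis by (simp add: f flip: E_def)
qed

end

subsection \<open>Pullback operators\<close>

definition pull :: "'a set \<Rightarrow> ('a \<Rightarrow> 'b) \<Rightarrow> 'b l2 \<Rightarrow> 'a l2" where
  "pull A h f = Abs_l2 (\<lambda>x. if x \<in> A then rep_l2 f (h x) else 0)"

lemma pull_summable:
  assumes "inj_on h A"
  shows "(\<lambda>x. (cmod (rep_l2 f (h x)))\<^sup>2) summable_on A"
proof -
  have "(\<lambda>y. (cmod (rep_l2 f y))\<^sup>2) summable_on h ` A"
    by (rule summable_on_subset_banach[OF rep_l2_sq_summable]) simp
  then show ?thesis by (simp add: summable_on_reindex[OF assms] o_def)
qed

lemma rep_pull:
  assumes "inj_on h A"
  shows "rep_l2 (pull A h f) x = (if x \<in> A then rep_l2 f (h x) else 0)"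
proof -
  have "(\<lambda>x. if x \<in> A then rep_l2 f (h x) else 0) \<in> ell2 A"
    using pull_summable[OF assms, of f] by (auto simp: ell2_def cong: summable_on_cong)
  then show ?thesis unfolding pull_def by (simp add: rep_Abs_ell2)
qed

lemma norm_pull_le:
  assumes "inj_on h A" shows "norm (pull A h f) \<le> norm f"
proof -
  have "(norm (pull A h f))\<^sup>2 = (\<Sum>\<^sub>\<infinity>x\<in>A. (cmod (rep_l2 f (h x)))\<^sup>2)"
    unfolding l2_norm_sq by (rule infsum_cong_neutral) (auto simp: rep_pull[OF assms])
  also have "\<dots> = (\<Sum>\<^sub>\<infinity>y\<in>h ` A. (cmod (rep_l2 f y))\<^sup>2)"
    using infsum_reindex[OF assms, of "\<lambda>y. (cmod (rep_l2 f y))\<^sup>2"] by (simp add: o_def)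
  also have "\<dots> \<le> (norm f)\<^sup>2"
    unfolding l2_norm_sq
    by (rule infsum_mono_neutral[OF summable_on_subset_banach[OF rep_l2_sq_summable] rep_l2_sq_summable]) auto
  finally show ?thesis by (simp add: power2_le_iff_abs_le)
qed

lemma clin_pull:
  assumes "inj_on h A" shows "clin (pull A h)"
  unfolding clin_def
proof (intro conjI allI)
  show sc: "pull A h (scaleC c f) = scaleC c (pull A h f)" for c f
    by (rule l2_eqI) (simp add: rep_pull[OF assms])
  show "bounded_linear (pull A h)"
  proof (rule bounded_linear_intro[where K = 1])
    show "pull A h (f + g) = pull A h f + pull A h g" for f g
      by (rule l2_eqI) (simp add: rep_pull[OF assms])
    show "pull A h (r *\<^sub>R f) = r *\<^sub>R pull A h f" for r f by (simp add: scaleR_scaleC sc)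
    show "norm (pull A h f) \<le> norm f * 1" for f using norm_pull_le[OF assms] by simp
  qed
qed

lemma adjoint_pull:
  assumes h: "bij_betw h A B" and k: "\<And>x. x \<in> A \<Longrightarrow> k (h x) = x"
  shows "adjoint (pull A h) (pull B k)"
  unfolding adjoint_def
proof (intro allI)
  fix f g
  have ih: "inj_on h A" using h by (rule bij_betw_imp_inj_on)
  have ik: "inj_on k B" using h k by (auto simp: bij_betw_def intro!: inj_onI)
  have "cin (pull A h f) g = (\<Sum>\<^sub>\<infinity>x\<in>A. rep_l2 f (h x) * cnj (rep_l2 g (k (h x))))"
    unfolding cin_def by (rule infsum_cong_neutral) (auto simp: rep_pull[OF ih] k)
  also have "\<dots> = (\<Sum>\<^sub>\<infinity>y\<in>B. rep_l2 f y * cnj (rep_l2 g (k y)))"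
    by (rule infsum_reindex_bij_betw[OF h])
  also have "\<dots> = cin f (pull B k g)"
    unfolding cin_def by (rule infsum_cong_neutral) (auto simp: rep_pull[OF ik])
  finally show "cin (pull A h f) g = cin f (pull B k g)" .
qed

subsection \<open>Operators on a cover\<close>

text \<open>A cover reduced to what its operators see: the vertices \<open>X\<close>, the projection
  \<open>p\<close>, and the endpoint \<open>L x e\<close> of the lift of \<open>e\<close> that
  starts at \<open>x\<close>. In this form the graph itself is a cover as well, and a walk is lifted
  by folding \<open>L\<close>.\<close>

locale lift_sys = fin_digraph G + bidirected_digraph G arev
  for G :: "('v, 'e) pre_digraph" and arev +
  fixes X :: "'x set" and p :: "'x \<Rightarrow> 'v" and L :: "'x \<Rightarrow> 'e \<Rightarrow> 'x"
  assumes p_in: "x \<in> X \<Longrightarrow> p x \<in> verts G"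
    and L_in: "x \<in> X \<Longrightarrow> e \<in> arcs G \<Longrightarrow> p x = tail G e \<Longrightarrow> L x e \<in> X"
    and p_L: "x \<in> X \<Longrightarrow> e \<in> arcs G \<Longrightarrow> p x = tail G e \<Longrightarrow> p (L x e) = head G e"
    and L_L: "x \<in> X \<Longrightarrow> e \<in> arcs G \<Longrightarrow> p x = tail G e \<Longrightarrow> L (L x e) (arev e) = x"
begin

definition fib :: "'v set \<Rightarrow> 'x set" where "fib S = {x \<in> X. p x \<in> S}"

definition Aop :: "'e \<Rightarrow> 'x l2 \<Rightarrow> 'x l2" where
  "Aop e = pull (fib {tail G e}) (\<lambda>x. L x e)"

lemma bij_L:
  assumes "e \<in> arcs G"
  shows "bij_betw (\<lambda>x. L x e) (fib {tail G e}) (fib {tail G (arev e)})"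
  by (rule bij_betwI[where g = "\<lambda>x. L x (arev e)"])
    (use assms L_L[of _ "arev e"] in \<open>auto simp: fib_def L_in p_L L_L\<close>)

lemma inj_L: "e \<in> arcs G \<Longrightarrow> inj_on (\<lambda>x. L x e) (fib {tail G e})"
  using bij_L bij_betw_imp_inj_on by blast

lemma rep_Aop: "e \<in> arcs G \<Longrightarrow> rep_l2 (Aop e f) x = (if x \<in> X \<and> p x = tail G e then rep_l2 f (L x e) else 0)"
  unfolding Aop_def by (subst rep_pull[OF inj_L]) (auto simp: fib_def)

lemma clin_Aop: "e \<in> arcs G \<Longrightarrow> clin (Aop e)"
  unfolding Aop_def by (rule clin_pull[OF inj_L])

lemma norm_Aop: "e \<in> arcs G \<Longrightarrow> norm (Aop e f) \<le> norm f"
  unfolding Aop_def by (rule norm_pull_le[OF inj_L])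

lemma adjoint_Aop: "e \<in> arcs G \<Longrightarrow> adjoint (Aop e) (Aop (arev e))"
  unfolding Aop_def by (rule adjoint_pull[OF bij_L]) (auto simp: fib_def L_L)

definition arcs_in :: "'v set \<Rightarrow> 'e set" where
  "arcs_in S = {e \<in> arcs G. tail G e \<in> S \<and> head G e \<in> S}"

definition Mop :: "('e \<Rightarrow> complex) \<Rightarrow> ('v \<Rightarrow> real) \<Rightarrow> 'v set \<Rightarrow> 'x l2 \<Rightarrow> 'x l2" where
  "Mop w V S f = (\<Sum>e\<in>arcs_in S. scaleC (w e) (Aop e f)) +
     (\<Sum>v\<in>S. scaleC (complex_of_real (V v)) (restr (fib {v}) f))"

lemma rep_Mop:
  assumes "finite S"
  shows "rep_l2 (Mop w V S f) x = (if x \<in> X \<and> p x \<in> S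
    then (\<Sum>e\<in>{e \<in> out_arcs G (p x). head G e \<in> S}. w e * rep_l2 f (L x e)) + V (p x) * rep_l2 f x else 0)"
proof -
  have "(\<Sum>e\<in>arcs_in S. w e * rep_l2 (Aop e f) x) =
      (if x \<in> X \<and> p x \<in> S then (\<Sum>e\<in>{e \<in> out_arcs G (p x). head G e \<in> S}. w e * rep_l2 f (L x e)) else 0)"
  proof (cases "x \<in> X \<and> p x \<in> S")
    case True
    have "(\<Sum>e\<in>arcs_in S. w e * rep_l2 (Aop e f) x) =
        (\<Sum>e\<in>{e \<in> out_arcs G (p x). head G e \<in> S}. w e * rep_l2 (Aop e f) x)"
      by (rule sum.mono_neutral_right) (use True in \<open>auto simp: arcs_in_def rep_Aop\<close>)
    also have "\<dots> = (\<Sum>e\<in>{e \<in> out_arcs G (p x). head G e \<in> S}. w e * rep_l2 f (L x e))"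
      by (rule sum.cong) (use True in \<open>auto simp: rep_Aop\<close>)
    finally show ?thesis using True by simp
  next
    case False
    then show ?thesis by (auto simp: arcs_in_def rep_Aop intro!: sum.neutral)
  qed
  moreover have "(\<Sum>v\<in>S. V v * rep_l2 (restr (fib {v}) f) x) = (if x \<in> X \<and> p x \<in> S then V (p x) * rep_l2 f x else 0)"
  proof -
    have "(\<Sum>v\<in>S. V v * rep_l2 (restr (fib {v}) f) x) = (\<Sum>v\<in>S. if v = p x then (if x \<in> X then V v * rep_l2 f x else 0) else 0)"
      by (rule sum.cong) (auto simp: rep_restr fib_def)
    then show ?thesis using assms by (simp add: sum.delta)
  qed
  ultimately show ?thesis by (simp add: Mop_def rep_l2_sum)
qed

lemma clin_restr: "clin (restr A)"
  by (rule csa_clin[OF restr_csa])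

lemma clin_Mop: "clin (Mop w V S)"
  unfolding Mop_def
  by (intro clin_add clin_sumI clin_scaleC clin_restr clin_Aop) (auto simp: arcs_in_def)

lemma csa_Mop:
  assumes "\<And>e. e \<in> arcs G \<Longrightarrow> w (arev e) = cnj (w e)"
  shows "csa (Mop w V S)"
  unfolding csa_def
proof (intro conjI allI)
  show "bounded_linear (Mop w V S)" using clin_Mop by (simp add: clin_def)
  fix f g
  have "(\<Sum>e\<in>arcs_in S. w e * cin (Aop e f) g) = (\<Sum>e\<in>arcs_in S. w e * cin f (Aop (arev e) g))"
    by (rule sum.cong) (use adjoint_Aop in \<open>auto simp: arcs_in_def adjoint_def\<close>)
  also have "\<dots> = (\<Sum>e\<in>arcs_in S. w (arev e) * cin f (Aop e g))"
    by (rule sum.reindex_bij_witness[of _ arev arev]) (auto simp: arcs_in_def)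
  also have "\<dots> = (\<Sum>e\<in>arcs_in S. cnj (w e) * cin f (Aop e g))"
    by (rule sum.cong) (auto simp: arcs_in_def assms)
  finally show "cin (Mop w V S f) g = cin f (Mop w V S g)"
    by (simp add: Mop_def cin_add_left cin_add_right cin_sum_left cin_sum_right cin_scaleC_left cin_scaleC_right restr_cin)
qed

text \<open>A bound for the norms of all compressions at once, with 1 added to make it positive. It
  depends on the weights only through their moduli and is therefore the same for all phases.\<close>

definition Kc :: "('e \<Rightarrow> complex) \<Rightarrow> ('v \<Rightarrow> real) \<Rightarrow> real" where
  "Kc w V = (\<Sum>e\<in>arcs G. cmod (w e)) + (\<Sum>v\<in>verts G. \<bar>V v\<bar>) + 1"

lemma Kc_pos: "Kc w V > 0"
  unfolding Kc_def by (intro add_nonneg_pos add_nonneg_nonneg sum_nonneg) auto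

lemma norm_restr_le: "norm (restr A f) \<le> norm f"
  by (rule is_proj_norm_le[OF restr_proj])

lemma norm_Mop:
  assumes "S \<subseteq> verts G" shows "norm (Mop w V S f) \<le> Kc w V * norm f"
proof -
  have fS: "finite S" using assms finite_verts by (rule finite_subset)
  have "norm (\<Sum>e\<in>arcs_in S. scaleC (w e) (Aop e f)) \<le> (\<Sum>e\<in>arcs_in S. cmod (w e) * norm f)"
    by (rule sum_norm_le) (auto simp: norm_scaleC arcs_in_def norm_Aop intro!: mult_left_mono)
  also have "\<dots> \<le> (\<Sum>e\<in>arcs G. cmod (w e) * norm f)"
    by (rule sum_mono2) (auto simp: arcs_in_def)
  finally have 1: "norm (\<Sum>e\<in>arcs_in S. scaleC (w e) (Aop e f)) \<le> (\<Sum>e\<in>arcs G. cmod (w e)) * norm f"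
    by (simp add: sum_distrib_right)
  have "norm (\<Sum>v\<in>S. scaleC (complex_of_real (V v)) (restr (fib {v}) f)) \<le> (\<Sum>v\<in>S. \<bar>V v\<bar> * norm f)"
    by (rule sum_norm_le) (auto simp: norm_scaleC norm_restr_le intro!: mult_left_mono)
  also have "\<dots> \<le> (\<Sum>v\<in>verts G. \<bar>V v\<bar> * norm f)"
    by (rule sum_mono2) (use assms in auto)
  finally have 2: "norm (\<Sum>v\<in>S. scaleC (complex_of_real (V v)) (restr (fib {v}) f)) \<le> (\<Sum>v\<in>verts G. \<bar>V v\<bar>) * norm f"
    by (simp add: sum_distrib_right)
  have "norm (Mop w V S f) \<le> (\<Sum>e\<in>arcs G. cmod (w e)) * norm f + (\<Sum>v\<in>verts G. \<bar>V v\<bar>) * norm f"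
    unfolding Mop_def using norm_triangle_ineq 1 2 by (meson add_mono order_trans)
  also have "\<dots> \<le> Kc w V * norm f"
    by (simp add: Kc_def distrib_right)
  finally show ?thesis .
qed

lemma restr_Mop: "finite S \<Longrightarrow> restr (fib S) (Mop w V S f) = Mop w V S f"
  by (rule l2_eqI) (auto simp: rep_restr rep_Mop fib_def)

lemma Mop_restr: "finite S \<Longrightarrow> Mop w V S (restr (fib S) f) = Mop w V S f"
  by (rule l2_eqI) (auto simp: rep_restr rep_Mop fib_def L_in p_L intro!: sum.cong)

text \<open>The constant makes this a positive contraction, and its fixed vectors are the kernel
  vectors supported over \<open>S\<close>; starting from \<open>restr (fib S)\<close> and not from
  the identity excludes everything outside these fibres.\<close>

definition Dop :: "('e \<Rightarrow> complex) \<Rightarrow> ('v \<Rightarrow> real) \<Rightarrow> 'v set \<Rightarrow> 'x l2 \<Rightarrow> 'x l2" where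
  "Dop w V S f = restr (fib S) f - (1 / (Kc w V)\<^sup>2) *\<^sub>R Mop w V S (Mop w V S f)"

definition kerproj :: "('e \<Rightarrow> complex) \<Rightarrow> ('v \<Rightarrow> real) \<Rightarrow> 'v set \<Rightarrow> 'x l2 \<Rightarrow> 'x l2" where
  "kerproj w V S f = lim (\<lambda>n. (Dop w V S ^^ n) f)"

end

locale lift_weights = lift_sys G arev X p L
  for G :: "('v, 'e) pre_digraph" and arev and X :: "'x set" and p L +
  fixes w :: "'e \<Rightarrow> complex" and V :: "'v \<Rightarrow> real" and S :: "'v set"
  assumes wt: "\<And>e. e \<in> arcs G \<Longrightarrow> w (arev e) = cnj (w e)" and S: "S \<subseteq> verts G"
begin

lemma finS: "finite S" using S finite_verts by (rule finite_subset)

lemma csaM: "csa (Mop w V S)" by (rule csa_Mop) (rule wt)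

lemma csaD: "csa (Dop w V S)"
proof -
  have D: "Dop w V S = (\<lambda>f. restr (fib S) f - (1 / (Kc w V)\<^sup>2) *\<^sub>R Mop w V S (Mop w V S f))"
    by (rule ext) (simp add: Dop_def)
  have "clin (Dop w V S)"
    unfolding D by (intro clin_diff clin_scaleR clin_restr clin_compose[OF clin_Mop clin_Mop])
  then show ?thesis
    by (simp add: csa_def clin_def Dop_def cin_diff_left cin_diff_right cin_scaleR_left cin_scaleR_right
        csa_cin[OF csaM] restr_cin)
qed

lemma Dop_quadratic: "Dop w V S f \<bullet> f = (norm (restr (fib S) f))\<^sup>2 - (norm (Mop w V S f) / Kc w V)\<^sup>2"
proof -
  have "restr (fib S) f \<bullet> f = (norm (restr (fib S) f))\<^sup>2" by (rule is_proj_inner[OF restr_proj])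
  moreover have "Mop w V S (Mop w V S f) \<bullet> f = (norm (Mop w V S f))\<^sup>2"
    using selfadj_inner[OF csa_selfadj[OF csaM], of "Mop w V S f" f] by (simp add: power2_norm_eq_inner)
  ultimately show ?thesis by (simp add: Dop_def inner_diff_left power_divide)
qed

lemma norm_Mop_div: "norm (Mop w V S f) / Kc w V \<le> norm (restr (fib S) f)"
  using norm_Mop[OF S, of w V "restr (fib S) f"] Kc_pos[of w V] by (simp add: Mop_restr[OF finS] divide_le_eq mult.commute)

sublocale pc: positive_contraction "Dop w V S"
proof
  show "selfadj (Dop w V S)" by (rule csa_selfadj[OF csaD])
  fix f
  have "(norm (Mop w V S f) / Kc w V)\<^sup>2 \<le> (norm (restr (fib S) f))\<^sup>2"
    by (rule power_mono[OF norm_Mop_div]) (use Kc_pos[of w V] in auto)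
  then show "0 \<le> Dop w V S f \<bullet> f" by (simp add: Dop_quadratic)
  have "(norm (restr (fib S) f))\<^sup>2 \<le> (norm f)\<^sup>2" by (rule power_mono[OF norm_restr_le]) auto
  then show "Dop w V S f \<bullet> f \<le> f \<bullet> f"
    using zero_le_power2[of "norm (Mop w V S f) / Kc w V"] unfolding Dop_quadratic power2_norm_eq_inner[of f] by linarith
qed

lemma kerproj_proj1: "kerproj w V S = pc.proj1"
  by (rule ext) (simp add: kerproj_def pc.proj1_def)

lemma kerproj_tendsto: "(\<lambda>n. (Dop w V S ^^ n) f) \<longlonglongrightarrow> kerproj w V S f"
  unfolding kerproj_proj1 by (rule pc.funpow_tendsto)

lemma is_proj_kerproj: "is_proj (kerproj w V S)"
  unfolding kerproj_proj1 by (rule pc.is_proj_proj1)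

lemma kerproj_iff: "kerproj w V S f = f \<longleftrightarrow> restr (fib S) f = f \<and> Mop w V S f = 0"
proof -
  have "Dop w V S f = f \<longleftrightarrow> restr (fib S) f = f \<and> Mop w V S f = 0"
  proof
    assume D: "Dop w V S f = f"
    then have "(norm f)\<^sup>2 = (norm (restr (fib S) f))\<^sup>2 - (norm (Mop w V S f) / Kc w V)\<^sup>2"
      using Dop_quadratic[of f] by (simp add: power2_norm_eq_inner)
    moreover have "(norm (restr (fib S) f))\<^sup>2 \<le> (norm f)\<^sup>2" by (rule power_mono[OF norm_restr_le]) auto
    ultimately have "(norm (restr (fib S) f))\<^sup>2 = (norm f)\<^sup>2" "(norm (Mop w V S f) / Kc w V)\<^sup>2 = 0"
      using zero_le_power2[of "norm (Mop w V S f) / Kc w V"] by linarith+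
    then show "restr (fib S) f = f \<and> Mop w V S f = 0"
      using is_proj_norm_eqD[OF restr_proj] Kc_pos[of w V] by auto
  next
    assume "restr (fib S) f = f \<and> Mop w V S f = 0"
    then show "Dop w V S f = f" by (simp add: Dop_def clin_simps[OF clin_Mop])
  qed
  then show ?thesis by (simp add: kerproj_proj1 pc.proj1_iff)
qed

lemma kerproj_commutes:
  assumes "bounded_linear U" "\<And>f. U (Mop w V S f) = Mop w V S (U f)" "\<And>f. U (restr (fib S) f) = restr (fib S) (U f)"
  shows "U (kerproj w V S f) = kerproj w V S (U f)"
proof -
  interpret U: bounded_linear U by fact
  have "commutes U (Dop w V S)"
    by (simp add: commutes_def Dop_def U.diff U.scaleR assms(2,3))
  then show ?thesis using pc.commutes_proj1[OF assms(1)] by (simp add: kerproj_proj1 commutes_def)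
qed

lemma csa_kerproj: "csa (kerproj w V S)"
proof (rule csaI[OF is_proj_selfadj[OF is_proj_kerproj]])
  show "kerproj w V S (scaleC \<i> f) = scaleC \<i> (kerproj w V S f)" for f
    by (rule kerproj_commutes[symmetric, OF bounded_linear_scaleC])
      (simp_all add: clin_simps[OF clin_Mop] clin_simps[OF clin_restr])
qed

lemma kerproj_kernel: "restr (fib S) (kerproj w V S f) = kerproj w V S f" "Mop w V S (kerproj w V S f) = 0"
  using kerproj_iff[of "kerproj w V S f"] is_proj_idem[OF is_proj_kerproj] by auto

lemma kerproj_restr: "kerproj w V S (restr (fib S) f) = kerproj w V S f"
proof -
  have "restr (fib S) (kerproj w V S f) = kerproj w V S (restr (fib S) f)"
    by (rule kerproj_commutes[OF restr_bounded_linear]) (simp_all add: restr_Mop[OF finS] Mop_restr[OF finS])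
  then show ?thesis by (simp add: kerproj_kernel)
qed

end

section \<open>Deck transformations, invariant operators and their trace\<close>

locale deck_sys = lift_sys G arev X p L
  for G :: "('v, 'e) pre_digraph" and arev and X :: "'x set" and p L +
  fixes \<Phi> :: "('x \<Rightarrow> 'x) set" and s :: "'v \<Rightarrow> 'x"
  assumes deck_bij: "\<phi> \<in> \<Phi> \<Longrightarrow> bij_betw \<phi> X X"
    and deck_p: "\<phi> \<in> \<Phi> \<Longrightarrow> x \<in> X \<Longrightarrow> p (\<phi> x) = p x"
    and deck_L: "\<phi> \<in> \<Phi> \<Longrightarrow> x \<in> X \<Longrightarrow> e \<in> arcs G \<Longrightarrow> p x = tail G e \<Longrightarrow> \<phi> (L x e) = L (\<phi> x) e"
    and deck_trans: "x \<in> X \<Longrightarrow> y \<in> X \<Longrightarrow> p x = p y \<Longrightarrow> \<exists>\<phi>\<in>\<Phi>. \<phi> x = y"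
    and deck_free: "\<phi> \<in> \<Phi> \<Longrightarrow> \<psi> \<in> \<Phi> \<Longrightarrow> x \<in> X \<Longrightarrow> \<phi> x = \<psi> x \<Longrightarrow> y \<in> X \<Longrightarrow> \<phi> y = \<psi> y"
    and s: "v \<in> verts G \<Longrightarrow> s v \<in> X" "v \<in> verts G \<Longrightarrow> p (s v) = v"
begin

definition eqv :: "('x l2 \<Rightarrow> 'x l2) \<Rightarrow> bool" where
  "eqv T \<longleftrightarrow> (\<forall>\<phi>\<in>\<Phi>. \<forall>f. T (pull X \<phi> f) = pull X \<phi> (T f))"

text \<open>For operators that commute with the deck maps this is the von Neumann trace, not
  normalized by the number of vertices. Its value on them does not depend on the lifts
  \<open>s\<close>, by \<open>eqv_diag\<close>.\<close>

definition tr :: "('x l2 \<Rightarrow> 'x l2) \<Rightarrow> real" where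
  "tr T = (\<Sum>v\<in>verts G. T (del (s v)) \<bullet> del (s v))"

lemma deck_inj: "\<phi> \<in> \<Phi> \<Longrightarrow> inj_on \<phi> X" using deck_bij bij_betw_imp_inj_on by blast

lemma deck_in: "\<phi> \<in> \<Phi> \<Longrightarrow> x \<in> X \<Longrightarrow> \<phi> x \<in> X" using deck_bij bij_betwE by blast

lemma rep_deck: "\<phi> \<in> \<Phi> \<Longrightarrow> rep_l2 (pull X \<phi> f) x = (if x \<in> X then rep_l2 f (\<phi> x) else 0)"
  by (rule rep_pull[OF deck_inj])

lemma eqv_compose: "eqv S \<Longrightarrow> eqv T \<Longrightarrow> eqv (\<lambda>f. S (T f))"
  by (simp add: eqv_def)

lemma eqv_funpow: "eqv T \<Longrightarrow> eqv (T ^^ n)"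
  by (induction n) (auto simp: eqv_def)

lemma eqv_add: "eqv S \<Longrightarrow> eqv T \<Longrightarrow> eqv (\<lambda>f. S f + T f)"
  by (simp add: eqv_def clin_simps[OF clin_pull[OF deck_inj]])

lemma eqv_diff: "eqv S \<Longrightarrow> eqv T \<Longrightarrow> eqv (\<lambda>f. S f - T f)"
  by (simp add: eqv_def clin_simps[OF clin_pull[OF deck_inj]])

lemma eqv_scaleC: "eqv S \<Longrightarrow> eqv (\<lambda>f. scaleC c (S f))"
  by (simp add: eqv_def clin_simps[OF clin_pull[OF deck_inj]])

lemma eqv_scaleR: "eqv S \<Longrightarrow> eqv (\<lambda>f. r *\<^sub>R S f)"
  by (simp add: eqv_def clin_simps[OF clin_pull[OF deck_inj]])

lemma eqv_sum: "(\<And>i. i \<in> I \<Longrightarrow> eqv (S i)) \<Longrightarrow> eqv (\<lambda>f. \<Sum>i\<in>I. S i f)"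
  by (simp add: eqv_def clin_sum[OF clin_pull[OF deck_inj]])

lemma eqv_restr_fib: "eqv (restr (fib S))"
  unfolding eqv_def by (intro ballI allI l2_eqI) (auto simp: rep_restr rep_deck fib_def deck_in deck_p)

lemma eqv_Aop: "e \<in> arcs G \<Longrightarrow> eqv (Aop e)"
  unfolding eqv_def by (intro ballI allI l2_eqI) (auto simp: rep_Aop rep_deck deck_in deck_p deck_L L_in)

lemma eqv_Mop: "eqv (Mop w V S)"
  unfolding Mop_def
  by (intro eqv_add eqv_sum eqv_scaleC eqv_restr_fib eqv_Aop) (auto simp: arcs_in_def)

lemma eqv_entry:
  assumes "eqv T" "\<phi> \<in> \<Phi>" "x \<in> X" "y \<in> X"
  shows "rep_l2 (T (del (\<phi> x))) (\<phi> y) = rep_l2 (T (del x)) y"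
proof -
  have "pull X \<phi> (del (\<phi> x)) = del x"
    by (rule l2_eqI) (use deck_inj[OF assms(2)] assms(3) in \<open>auto simp: rep_deck[OF assms(2)] rep_del delta_def inj_on_eq_iff\<close>)
  then have "rep_l2 (T (del x)) y = rep_l2 (pull X \<phi> (T (del (\<phi> x)))) y"
    using assms(1,2) unfolding eqv_def by metis
  also have "\<dots> = rep_l2 (T (del (\<phi> x))) (\<phi> y)" using assms(4) by (simp add: rep_deck[OF assms(2)])
  finally show ?thesis by simp
qed

lemma eqv_diag:
  assumes "eqv T" "x \<in> X" "y \<in> X" "p x = p y"
  shows "T (del x) \<bullet> del x = T (del y) \<bullet> del y"
proof -
  obtain \<phi> where "\<phi> \<in> \<Phi>" "\<phi> x = y" using deck_trans assms by blast
  then show ?thesis using eqv_entry[OF assms(1) _ assms(2,2), of \<phi>] by (simp add: inner_cin cin_del_right)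
qed

lemma infsum_fibres:
  assumes "(f :: 'x \<Rightarrow> complex) summable_on X"
  shows "infsum f X = (\<Sum>u\<in>verts G. infsum f (fib {u}))"
proof -
  have "infsum f (fib U) = (\<Sum>u\<in>U. infsum f (fib {u}))" if "finite U" for U
    using that
  proof (induction U rule: finite_induct)
    case empty then show ?case by (simp add: fib_def)
  next
    case (insert u U)
    have "fib (insert u U) = fib {u} \<union> fib U" by (auto simp: fib_def)
    moreover have "infsum f (fib {u} \<union> fib U) = infsum f (fib {u}) + infsum f (fib U)"
      by (rule infsum_Un_disjoint) (use insert assms in \<open>auto simp: fib_def intro: summable_on_subset_banach\<close>)
    ultimately show ?case using insert by simp
  qed
  moreover have "fib (verts G) = X" using p_in by (auto simp: fib_def)
  ultimately show ?thesis using finite_verts by metis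
qed

text \<open>Read \<open>K x y\<close> as mass sent from \<open>x\<close> to \<open>y\<close>: what
  the chosen lifts send equals what they receive. A deck map moves each pair of \<open>s v\<close>
  and a vertex over \<open>u\<close> to a pair of a vertex over \<open>v\<close> and
  \<open>s u\<close>, and \<open>K\<close> is invariant.\<close>

lemma mass_transport:
  fixes K :: "'x \<Rightarrow> 'x \<Rightarrow> complex"
  assumes inv: "\<And>\<phi> x y. \<phi> \<in> \<Phi> \<Longrightarrow> x \<in> X \<Longrightarrow> y \<in> X \<Longrightarrow> K (\<phi> x) (\<phi> y) = K x y"
    and sum1: "\<And>v. v \<in> verts G \<Longrightarrow> (\<lambda>y. K (s v) y) summable_on X"
    and sum2: "\<And>v. v \<in> verts G \<Longrightarrow> (\<lambda>y. K y (s v)) summable_on X"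
  shows "(\<Sum>v\<in>verts G. \<Sum>\<^sub>\<infinity>y\<in>X. K (s v) y) = (\<Sum>v\<in>verts G. \<Sum>\<^sub>\<infinity>y\<in>X. K y (s v))"
proof -
  have swap: "(\<Sum>\<^sub>\<infinity>y\<in>fib {u}. K (s v) y) = (\<Sum>\<^sub>\<infinity>x\<in>fib {v}. K x (s u))"
    if v: "v \<in> verts G" and u: "u \<in> verts G" for u v
  proof -
    have "\<forall>x\<in>fib {v}. \<exists>\<phi>\<in>\<Phi>. \<phi> x = s v" using deck_trans s[OF v] by (auto simp: fib_def)
    then obtain \<psi> where \<psi>: "\<And>x. x \<in> fib {v} \<Longrightarrow> \<psi> x \<in> \<Phi>" "\<And>x. x \<in> fib {v} \<Longrightarrow> \<psi> x x = s v" by metis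
    \<comment> \<open>\<open>\<psi> x\<close> carries \<open>x\<close> to \<open>s v\<close>. As
      \<open>x\<close> runs through the fibre over \<open>v\<close>, its value at \<open>s u\<close>
      runs once through the fibre over \<open>u\<close>, because deck maps that agree at one vertex
      agree everywhere.\<close>
    define h where "h = (\<lambda>x. \<psi> x (s u))"
    have bij: "bij_betw h (fib {v}) (fib {u})"
      unfolding bij_betw_def
    proof
      show "inj_on h (fib {v})"
      proof (rule inj_onI)
        fix x y assume x: "x \<in> fib {v}" and y: "y \<in> fib {v}" and e: "h x = h y"
        have "\<psi> x y = \<psi> y y"
          by (rule deck_free[OF \<psi>(1)[OF x] \<psi>(1)[OF y] s(1)[OF u]]) (use e y in \<open>auto simp: h_def fib_def\<close>)
        then have "\<psi> x y = \<psi> x x" using \<psi>(2) x y by simp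
        then show "x = y" using deck_inj[OF \<psi>(1)[OF x]] x y by (auto simp: inj_on_def fib_def)
      qed
      show "h ` fib {v} = fib {u}"
      proof (intro equalityI subsetI)
        fix y assume "y \<in> h ` fib {v}"
        then show "y \<in> fib {u}" using \<psi>(1) deck_in deck_p s[OF u] by (auto simp: h_def fib_def)
      next
        fix y assume y: "y \<in> fib {u}"
        then obtain \<phi> where \<phi>: "\<phi> \<in> \<Phi>" "\<phi> (s u) = y" using deck_trans s[OF u] by (auto simp: fib_def)
        have "s v \<in> \<phi> ` X" using deck_bij[OF \<phi>(1)] s[OF v] by (simp add: bij_betw_def)
        then obtain x where x: "x \<in> X" "\<phi> x = s v" by auto
        then have xf: "x \<in> fib {v}" using deck_p[OF \<phi>(1) x(1)] s[OF v] by (simp add: fib_def)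
        have "\<psi> x (s u) = \<phi> (s u)"
          by (rule deck_free[OF \<psi>(1)[OF xf] \<phi>(1) x(1)]) (use \<psi>(2)[OF xf] x s[OF u] in auto)
        then have "y = h x" by (simp add: h_def \<phi>)
        then show "y \<in> h ` fib {v}" using xf by blast
      qed
    qed
    have "(\<Sum>\<^sub>\<infinity>y\<in>fib {u}. K (s v) y) = (\<Sum>\<^sub>\<infinity>x\<in>fib {v}. K (s v) (h x))"
      by (rule infsum_reindex_bij_betw[OF bij, symmetric])
    also have "\<dots> = (\<Sum>\<^sub>\<infinity>x\<in>fib {v}. K x (s u))"
    proof (rule infsum_cong)
      fix x assume x: "x \<in> fib {v}"
      then have "K (\<psi> x x) (\<psi> x (s u)) = K x (s u)"
        using \<psi>(1)[OF x] s[OF u] by (intro inv) (auto simp: fib_def)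
      then show "K (s v) (h x) = K x (s u)" by (simp add: h_def \<psi>(2)[OF x])
    qed
    finally show ?thesis .
  qed
  have "(\<Sum>v\<in>verts G. \<Sum>\<^sub>\<infinity>y\<in>X. K (s v) y) = (\<Sum>v\<in>verts G. \<Sum>u\<in>verts G. \<Sum>\<^sub>\<infinity>y\<in>fib {u}. K (s v) y)"
    by (rule sum.cong) (simp_all add: infsum_fibres[OF sum1])
  also have "\<dots> = (\<Sum>v\<in>verts G. \<Sum>u\<in>verts G. \<Sum>\<^sub>\<infinity>x\<in>fib {v}. K x (s u))"
    by (intro sum.cong) (simp_all add: swap)
  also have "\<dots> = (\<Sum>u\<in>verts G. \<Sum>v\<in>verts G. \<Sum>\<^sub>\<infinity>x\<in>fib {v}. K x (s u))"
    by (rule sum.swap)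
  also have "\<dots> = (\<Sum>u\<in>verts G. \<Sum>\<^sub>\<infinity>y\<in>X. K y (s u))"
    by (rule sum.cong) (simp_all add: infsum_fibres[OF sum2])
  finally show ?thesis .
qed

text \<open>The matrix row of \<open>A\<close> at \<open>x\<close> is the conjugate of
  \<open>A' (del x)\<close> and hence square-summable; this is what the adjoint is for.\<close>

lemma diag_compose:
  assumes adj: "adjoint A A'" and supp: "\<And>f. restr X (B f) = B f"
  shows "(\<lambda>y. rep_l2 (B (del x)) y * rep_l2 (A (del y)) x) summable_on X"
    "cin (A (B (del x))) (del x) = (\<Sum>\<^sub>\<infinity>y\<in>X. rep_l2 (B (del x)) y * rep_l2 (A (del y)) x)"
proof -
  have e: "cnj (rep_l2 (A' (del x)) y) = rep_l2 (A (del y)) x" for y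
    using adj unfolding adjoint_def by (metis cin_del_left cin_del_right)
  have z: "rep_l2 (B f) y = 0" if "y \<notin> X" for f y using supp[of f] that by (simp add: restr_fixed_iff)
  have "(\<lambda>y. rep_l2 (B (del x)) y * rep_l2 (A (del y)) x) summable_on UNIV"
    using cin_summable[of "B (del x)" "A' (del x)"] by (simp add: e)
  then show "(\<lambda>y. rep_l2 (B (del x)) y * rep_l2 (A (del y)) x) summable_on X"
    by (rule summable_on_subset_banach) simp
  have "cin (A (B (del x))) (del x) = cin (B (del x)) (A' (del x))" using adj by (simp add: adjoint_def)
  also have "\<dots> = (\<Sum>\<^sub>\<infinity>y. rep_l2 (B (del x)) y * rep_l2 (A (del y)) x)" by (simp add: cin_def e)
  also have "\<dots> = (\<Sum>\<^sub>\<infinity>y\<in>X. rep_l2 (B (del x)) y * rep_l2 (A (del y)) x)"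
    by (rule infsum_cong_neutral) (auto simp: z)
  finally show "cin (A (B (del x))) (del x) = (\<Sum>\<^sub>\<infinity>y\<in>X. rep_l2 (B (del x)) y * rep_l2 (A (del y)) x)" .
qed

text \<open>The diagonal entries of the two products are sums of the same invariant kernel, over its
  second argument for one product and over its first for the other.\<close>

lemma trace_commute:
  assumes "eqv A" "eqv B" "adjoint A A'" "adjoint B B'"
    and supp: "\<And>f. restr X (A f) = A f" "\<And>f. restr X (B f) = B f"
  shows "tr (\<lambda>f. A (B f)) = tr (\<lambda>f. B (A f))"
proof -
  define K where "K = (\<lambda>x y. rep_l2 (B (del x)) y * rep_l2 (A (del y)) x)"
  have "(\<Sum>v\<in>verts G. \<Sum>\<^sub>\<infinity>y\<in>X. K (s v) y) = (\<Sum>v\<in>verts G. \<Sum>\<^sub>\<infinity>y\<in>X. K y (s v))"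
  proof (rule mass_transport)
    show "K (\<phi> x) (\<phi> y) = K x y" if "\<phi> \<in> \<Phi>" "x \<in> X" "y \<in> X" for \<phi> x y
      using eqv_entry[OF assms(1) that(1,3,2)] eqv_entry[OF assms(2) that] by (simp add: K_def)
    show "(\<lambda>y. K (s v) y) summable_on X" for v
      unfolding K_def by (rule diag_compose(1)[OF assms(3) supp(2)])
    show "(\<lambda>y. K y (s v)) summable_on X" for v
      using diag_compose(1)[where A = B and A' = B' and B = A and x = "s v", OF assms(4) supp(1)] by (simp add: K_def mult.commute)
  qed
  moreover have "cin (A (B (del x))) (del x) = (\<Sum>\<^sub>\<infinity>y\<in>X. K x y)" for x
    unfolding K_def by (rule diag_compose(2)[OF assms(3) supp(2)])
  moreover have "cin (B (A (del x))) (del x) = (\<Sum>\<^sub>\<infinity>y\<in>X. K y x)" for x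
    using diag_compose(2)[where A = B and A' = B' and B = A and x = x, OF assms(4) supp(1)] by (simp add: K_def mult.commute)
  ultimately have "(\<Sum>v\<in>verts G. cin (A (B (del (s v)))) (del (s v))) = (\<Sum>v\<in>verts G. cin (B (A (del (s v)))) (del (s v)))"
    by simp
  then have "Re (\<Sum>v\<in>verts G. cin (A (B (del (s v)))) (del (s v))) = Re (\<Sum>v\<in>verts G. cin (B (A (del (s v)))) (del (s v)))"
    by simp
  then show ?thesis by (simp add: tr_def inner_cin)
qed

lemma tr_diff: "tr (\<lambda>f. A f - B f) = tr A - tr B"
  by (simp add: tr_def inner_diff_left sum_subtractf)

lemma tr_add: "tr (\<lambda>f. A f + B f) = tr A + tr B"
  by (simp add: tr_def inner_add_left sum.distrib)

lemma tr_nonneg: "(\<And>f. 0 \<le> P f \<bullet> f) \<Longrightarrow> 0 \<le> tr P"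
  by (simp add: tr_def sum_nonneg)

lemma tr_proj_nonneg: "is_proj P \<Longrightarrow> 0 \<le> tr P"
  by (rule tr_nonneg) (simp add: is_proj_inner)

lemma tr_proj_mono:
  "is_proj P \<Longrightarrow> is_proj Q \<Longrightarrow> (\<And>f. P f = f \<Longrightarrow> Q f = f) \<Longrightarrow> tr P \<le> tr Q"
  unfolding tr_def by (intro sum_mono is_proj_le_quadratic) auto

lemma tr_restr_fib:
  assumes "S \<subseteq> verts G" shows "tr (restr (fib S)) = real (card S)"
proof -
  have "tr (restr (fib S)) = (\<Sum>v\<in>verts G. if v \<in> S then 1 else 0)"
    unfolding tr_def
  proof (rule sum.cong)
    fix v assume v: "v \<in> verts G"
    have "del (s v) \<bullet> del (s v) = 1" by (simp add: inner_cin cin_del_right rep_del delta_def)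
    then show "restr (fib S) (del (s v)) \<bullet> del (s v) = (if v \<in> S then 1 else 0)"
      using s[OF v] by (simp add: restr_del fib_def)
  qed simp
  also have "\<dots> = real (card S)"
    using assms finite_verts by (simp add: sum.If_cases Int_absorb1)
  finally show ?thesis .
qed

text \<open>Equality of the ranks of \<open>Y\<close> and of its adjoint \<open>Z\<close>, measured
  by traces: the kernel of \<open>Y\<close> in the range of \<open>Q\<close> and the kernel of
  \<open>Z\<close> in the range of \<open>R\<close> have the same codimension. The projections onto
  these kernels are the limits of the powers of Q - ZY and R - YZ. Since \<open>Y\<close>
  intertwines these two operators and the trace is cyclic, each further factor lowers both traces by
  the same amount.\<close>

lemma rank_identity:
  assumes Q: "is_proj Q" "csa Q" "eqv Q" and R: "is_proj R" "csa R" "eqv R"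
    and Y: "clin Y" "eqv Y" and Z: "clin Z" "eqv Z" and adj: "adjoint Y Z"
    and YQ: "\<And>f. Y (Q f) = Y f" and RY: "\<And>f. R (Y f) = Y f"
    and supp: "\<And>f. restr X (Q f) = Q f" "\<And>f. restr X (R f) = R f"
    and contr: "\<And>f. norm (Y f) \<le> norm f"
  shows "\<exists>P P'. is_proj P \<and> (\<forall>f. P f = f \<longleftrightarrow> Q f = f \<and> Y f = 0) \<and>
    is_proj P' \<and> (\<forall>f. P' f = f \<longleftrightarrow> R f = f \<and> Z f = 0) \<and> tr Q - tr P = tr R - tr P'"
proof -
  have adj': "adjoint Z Y" by (rule adjoint_sym[OF adj])
  have QZ: "Q (Z f) = Z f" for f
    by (rule cin_eqI) (metis YQ adj adjoint_sym adjoint_def csa_cin[OF Q(2)])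
  have ZR: "Z (R f) = Z f" for f
    by (rule cin_eqI) (metis RY adj adjoint_sym adjoint_def csa_cin[OF R(2)])
  have contr': "norm (Z f) \<le> norm f" for f
  proof -
    have "(norm (Z f))\<^sup>2 = f \<bullet> Y (Z f)" using adj' by (simp add: power2_norm_eq_inner inner_cin adjoint_def)
    also have "\<dots> \<le> norm f * norm (Y (Z f))" by (rule norm_cauchy_schwarz)
    also have "\<dots> \<le> norm f * norm (Z f)" by (intro mult_left_mono contr) auto
    finally show ?thesis by (cases "Z f = 0") (auto simp: power2_eq_square mult_le_cancel_right)
  qed
  have main: "positive_contraction (\<lambda>f. Q f - Z (Y f)) \<and> csa (\<lambda>f. Q f - Z (Y f)) \<and>
      (\<forall>f. Q f - Z (Y f) = f \<longleftrightarrow> Q f = f \<and> Y f = 0)"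
    if Q: "is_proj Q" "csa Q" and Y: "clin Y" and Z: "clin Z" and adj: "adjoint Y Z"
      and YQ: "\<And>f. Y (Q f) = Y f" and contr: "\<And>f. norm (Y f) \<le> norm f" for Q Y Z
  proof (intro conjI allI)
    have qd: "(Q f - Z (Y f)) \<bullet> f = (norm (Q f))\<^sup>2 - (norm (Y f))\<^sup>2" for f
    proof -
      have "Z (Y f) \<bullet> f = (norm (Y f))\<^sup>2"
        using adjoint_sym[OF adj] by (simp add: power2_norm_eq_inner inner_cin adjoint_def)
      then show ?thesis by (simp add: inner_diff_left is_proj_inner[OF Q(1)])
    qed
    have YQn: "norm (Y f) \<le> norm (Q f)" for f using contr[of "Q f"] by (simp add: YQ)
    show csa: "csa (\<lambda>f. Q f - Z (Y f))"
      using clin_diff[OF csa_clin[OF Q(2)] clin_compose[OF Z Y]] adj adjoint_sym[OF adj]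
      by (simp add: csa_def clin_def cin_diff_left cin_diff_right adjoint_def csa_cin[OF Q(2)])
    show "positive_contraction (\<lambda>f. Q f - Z (Y f))"
    proof
      show "selfadj (\<lambda>f. Q f - Z (Y f))" by (rule csa_selfadj[OF csa])
      fix f
      have "(norm (Y f))\<^sup>2 \<le> (norm (Q f))\<^sup>2" by (rule power_mono[OF YQn]) auto
      then show "0 \<le> (Q f - Z (Y f)) \<bullet> f" by (simp add: qd)
      have "(norm (Q f))\<^sup>2 \<le> (norm f)\<^sup>2" by (rule power_mono[OF is_proj_norm_le[OF Q(1)]]) auto
      then show "(Q f - Z (Y f)) \<bullet> f \<le> f \<bullet> f"
        using zero_le_power2[of "norm (Y f)"] unfolding qd power2_norm_eq_inner[of f] by linarith
    qed
    fix f
    show "Q f - Z (Y f) = f \<longleftrightarrow> Q f = f \<and> Y f = 0"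
    proof
      assume "Q f - Z (Y f) = f"
      then have "(norm f)\<^sup>2 = (norm (Q f))\<^sup>2 - (norm (Y f))\<^sup>2" using qd[of f] by (simp add: power2_norm_eq_inner)
      moreover have "(norm (Q f))\<^sup>2 \<le> (norm f)\<^sup>2" by (rule power_mono[OF is_proj_norm_le[OF Q(1)]]) auto
      ultimately have "(norm (Q f))\<^sup>2 = (norm f)\<^sup>2" "(norm (Y f))\<^sup>2 = 0"
        using zero_le_power2[of "norm (Y f)"] by linarith+
      then show "Q f = f \<and> Y f = 0" using is_proj_norm_eqD[OF Q(1)] by auto
    next
      assume "Q f = f \<and> Y f = 0" then show "Q f - Z (Y f) = f" by (simp add: clin_simps[OF Z])
    qed
  qed
  define D where "D = (\<lambda>f. Q f - Z (Y f))"
  define F where "F = (\<lambda>f. R f - Y (Z f))"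
  note D = main[OF Q(1,2) Y(1) Z(1) adj YQ contr, folded D_def]
  note F = main[OF R(1,2) Z(1) Y(1) adj' ZR contr', folded F_def]
  interpret D: positive_contraction D using D by blast
  interpret F: positive_contraction F using F by blast
  note Zs = clin_simps[OF Z(1)] and Ys = clin_simps[OF Y(1)] and Qs = clin_simps[OF csa_clin[OF Q(2)]]
    and Rs = clin_simps[OF csa_clin[OF R(2)]]
  have eqvF: "eqv F" unfolding F_def by (intro eqv_diff eqv_compose[OF Y(2) Z(2)] R(3))
  have FY: "(F ^^ m) (Y f) = Y ((D ^^ m) f)" for m f
  proof (induction m)
    case (Suc m)
    have "F (Y g) = Y (D g)" for g by (simp add: F_def D_def RY Ys YQ)
    then show ?case using Suc by simp
  qed simp
  have DZ: "(D ^^ m) (Z f) = Z ((F ^^ m) f)" for m f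
  proof (induction m)
    case (Suc m)
    have "D (Z g) = Z (F g)" for g by (simp add: F_def D_def QZ Zs ZR)
    then show ?case using Suc by simp
  qed simp
  have Dsuc: "(D ^^ Suc (Suc m)) f = (D ^^ Suc m) f - Z ((F ^^ Suc m) (Y f))" for m f
  proof -
    have "(D ^^ Suc (Suc m)) f = (D ^^ Suc m) (Q f - Z (Y f))"
      by (subst funpow_Suc_right) (simp add: D_def del: funpow.simps)
    also have "\<dots> = (D ^^ Suc m) (Q f) - (D ^^ Suc m) (Z (Y f))"
      by (rule selfadj_simps(2)[OF D.selfadj_funpow])
    also have "(D ^^ Suc m) (Q f) = (D ^^ Suc m) f"
      by (subst (1 2) funpow_Suc_right) (simp add: D_def is_proj_idem[OF Q(1)] YQ)
    finally show ?thesis by (simp only: DZ)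
  qed
  have Fsuc: "(F ^^ Suc (Suc m)) f = (F ^^ Suc m) f - (F ^^ Suc m) (Y (Z f))" for m f
  proof -
    have "(F ^^ Suc (Suc m)) f = (F ^^ Suc m) (R f - Y (Z f))"
      by (subst funpow_Suc_right) (simp add: F_def del: funpow.simps)
    also have "\<dots> = (F ^^ Suc m) (R f) - (F ^^ Suc m) (Y (Z f))"
      by (rule selfadj_simps(2)[OF F.selfadj_funpow])
    also have "(F ^^ Suc m) (R f) = (F ^^ Suc m) f"
      by (subst (1 2) funpow_Suc_right) (simp add: F_def is_proj_idem[OF R(1)] ZR)
    finally show ?thesis .
  qed
  have suppZ: "restr X (Z f) = Z f" for f using supp(1)[of "Z f"] unfolding QZ .
  have suppY: "restr X (Y f) = Y f" for f using supp(2)[of "Y f"] unfolding RY .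
  have trc: "tr (\<lambda>f. Z ((F ^^ m) (Y f))) = tr (\<lambda>f. (F ^^ m) (Y (Z f)))" for m
  proof -
    have e: "eqv (\<lambda>f. (F ^^ m) (Y f))" by (rule eqv_compose[OF eqv_funpow[OF eqvF] Y(2)])
    have "cin ((F ^^ m) f) g = cin f ((F ^^ m) g)" for f g
    proof (induction m arbitrary: f g)
      case (Suc m)
      have "cin ((F ^^ Suc m) f) g = cin f ((F ^^ m) (F g))"
        using csa_cin[of F "(F ^^ m) f" g] F Suc.IH[of f "F g"] by simp
      then show ?case by (simp add: funpow_swap1)
    qed simp
    then have a: "adjoint (\<lambda>f. (F ^^ m) (Y f)) (\<lambda>f. Z ((F ^^ m) f))"
      using adj by (simp add: adjoint_def)
    have s: "restr X ((F ^^ m) (Y f)) = (F ^^ m) (Y f)" for f unfolding FY by (rule suppY)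
    show ?thesis
      by (rule trace_commute[where A = Z and B = "\<lambda>f. (F ^^ m) (Y f)" and A' = Y and B' = "\<lambda>f. Z ((F ^^ m) f)"])
        (fact Z e adj' a suppZ s)+
  qed
  \<comment> \<open>The exponents start at 1, because the zeroth powers are the identity of the
    whole space and not \<open>Q\<close> and \<open>R\<close>.\<close>
  have const: "tr (D ^^ Suc m) - tr (F ^^ Suc m) = tr Q - tr R" for m
  proof (induction m)
    case 0
    have "tr D = tr Q - tr (\<lambda>f. Z (Y f))" "tr F = tr R - tr (\<lambda>f. Y (Z f))"
      unfolding D_def F_def by (rule tr_diff)+
    then show ?case using trc[of 0] by simp
  next
    case (Suc m)
    have "tr (D ^^ Suc (Suc m)) = tr (D ^^ Suc m) - tr (\<lambda>f. Z ((F ^^ Suc m) (Y f)))"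
      using tr_diff[of "D ^^ Suc m" "\<lambda>f. Z ((F ^^ Suc m) (Y f))"] by (simp only: Dsuc[symmetric] tr_def)
    moreover have "tr (F ^^ Suc (Suc m)) = tr (F ^^ Suc m) - tr (\<lambda>f. (F ^^ Suc m) (Y (Z f)))"
      using tr_diff[of "F ^^ Suc m" "\<lambda>f. (F ^^ Suc m) (Y (Z f))"] by (simp only: Fsuc[symmetric] tr_def)
    ultimately show ?case using trc[of "Suc m"] Suc by linarith
  qed
  have "(\<lambda>m. tr (D ^^ Suc m) - tr (F ^^ Suc m)) \<longlonglongrightarrow> tr D.proj1 - tr F.proj1"
    unfolding tr_def by (intro tendsto_intros LIMSEQ_Suc[OF D.funpow_tendsto] LIMSEQ_Suc[OF F.funpow_tendsto])
  then have "tr D.proj1 - tr F.proj1 = tr Q - tr R"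
    unfolding const using LIMSEQ_unique tendsto_const by blast
  then have "tr Q - tr D.proj1 = tr R - tr F.proj1" by simp
  moreover have "D f = f \<longleftrightarrow> Q f = f \<and> Y f = 0" "F f = f \<longleftrightarrow> R f = f \<and> Z f = 0" for f
    using D F by (auto simp: D_def F_def)
  ultimately show ?thesis
    by (intro exI[of _ D.proj1] exI[of _ F.proj1] conjI allI D.is_proj_proj1 F.is_proj_proj1)
      (simp_all add: D.proj1_iff F.proj1_iff)
qed

end

subsection \<open>Interlacing of kernels under vertex deletion\<close>

locale deck_weights = deck_sys G arev X p L \<Phi> s
  for G :: "('v, 'e) pre_digraph" and arev and X :: "'x set" and p L \<Phi> s +
  fixes w :: "'e \<Rightarrow> complex" and V :: "'v \<Rightarrow> real"
  assumes weights: "\<And>e. e \<in> arcs G \<Longrightarrow> w (arev e) = cnj (w e)"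
begin

abbreviation "M \<equiv> Mop w V"
abbreviation "N \<equiv> kerproj w V"

lemma lw: "S \<subseteq> verts G \<Longrightarrow> lift_weights G arev X p L w S"
  by unfold_locales (auto simp: weights)

lemmas N_proj = lift_weights.is_proj_kerproj[OF lw, where V = V]
lemmas N_csa = lift_weights.csa_kerproj[OF lw, where V = V]
lemmas N_iff = lift_weights.kerproj_iff[OF lw, where V = V]
lemmas N_kernel = lift_weights.kerproj_kernel[OF lw, where V = V]
lemmas N_restr = lift_weights.kerproj_restr[OF lw, where V = V]
lemmas N_tendsto = lift_weights.kerproj_tendsto[OF lw, where V = V]
lemmas N_commutes = lift_weights.kerproj_commutes[OF lw, where V = V]

lemma fin_sub: "S \<subseteq> verts G \<Longrightarrow> finite S"
  using finite_verts by (rule finite_subset[rotated])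

lemma M_csa: "csa (M S)" by (rule csa_Mop) (rule weights)

lemma eqv_N: "S \<subseteq> verts G \<Longrightarrow> eqv (N S)"
  unfolding eqv_def
proof (intro ballI allI)
  fix \<phi> f assume S: "S \<subseteq> verts G" and \<phi>: "\<phi> \<in> \<Phi>"
  have "pull X \<phi> (N S f) = N S (pull X \<phi> f)"
  proof (rule N_commutes[OF S])
    show "bounded_linear (pull X \<phi>)" using clin_pull[OF deck_inj[OF \<phi>]] by (simp add: clin_def)
    show "pull X \<phi> (M S f) = M S (pull X \<phi> f)" for f using eqv_Mop[of w V S] \<phi> by (simp add: eqv_def)
    show "pull X \<phi> (restr (fib S) f) = restr (fib S) (pull X \<phi> f)" for f
      using eqv_restr_fib[of S] \<phi> by (simp add: eqv_def)
  qed
  then show "N S (pull X \<phi> f) = pull X \<phi> (N S f)" by simp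
qed

lemma restr_X_fib: "restr (fib S) f = f \<Longrightarrow> restr X f = f"
  by (auto simp: restr_fixed_iff fib_def)

lemma N_supp: "S \<subseteq> verts G \<Longrightarrow> restr X (N S f) = N S f"
  by (rule restr_X_fib[OF N_kernel(1)])

lemma N_clin: "S \<subseteq> verts G \<Longrightarrow> clin (N S)"
  by (rule csa_clin[OF N_csa])

lemma M_sub:
  assumes S: "S \<subseteq> verts G" and T: "T \<subseteq> S" and f: "restr (fib T) f = f"
  shows "restr (fib T) (M S f) = M T f"
proof (rule l2_eqI)
  fix x
  have fS: "finite S" "finite T" using fin_sub[OF S] T by (auto intro: finite_subset)
  have z: "rep_l2 f y = 0" if "y \<notin> fib T" for y using f that by (simp add: restr_fixed_iff)
  show "rep_l2 (restr (fib T) (M S f)) x = rep_l2 (M T f) x"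
  proof (cases "x \<in> fib T")
    case False then show ?thesis using fS by (auto simp: rep_restr rep_Mop fib_def)
  next
    case True
    then have x: "x \<in> X" "p x \<in> T" "p x \<in> S" using T by (auto simp: fib_def)
    have "(\<Sum>e\<in>{e \<in> out_arcs G (p x). head G e \<in> S}. w e * rep_l2 f (L x e)) =
        (\<Sum>e\<in>{e \<in> out_arcs G (p x). head G e \<in> T}. w e * rep_l2 f (L x e))"
    proof (rule sum.mono_neutral_right)
      show "\<forall>e\<in>{e \<in> out_arcs G (p x). head G e \<in> S} - {e \<in> out_arcs G (p x). head G e \<in> T}. w e * rep_l2 f (L x e) = 0"
        using x(1) by (auto intro!: z simp: fib_def p_L)
    qed (use T in auto)
    then show ?thesis using True x fS by (simp add: rep_restr rep_Mop)
  qed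
qed

text \<open>Two descriptions of the kernel vectors for \<open>S\<close> that vanish over
  \<open>v\<close>: such a vector is the extension by zero of a kernel vector for
  \<open>S - {v}\<close> on which the rows over \<open>v\<close> vanish too.\<close>

lemma kernel_insert:
  assumes S: "S \<subseteq> verts G" and v: "v \<in> S"
  shows "N (S - {v}) f = f \<and> restr (fib {v}) (M S f) = 0 \<longleftrightarrow> N S f = f \<and> restr (fib {v}) f = 0"
proof -
  have S': "S - {v} \<subseteq> verts G" using S by auto
  have split: "restr (fib S) g = restr (fib (S - {v})) g + restr (fib {v}) g" for g
    by (rule l2_eqI) (use v in \<open>auto simp: rep_restr fib_def\<close>)
  show ?thesis
  proof
    assume h: "N (S - {v}) f = f \<and> restr (fib {v}) (M S f) = 0"
    then have f: "restr (fib (S - {v})) f = f" "M (S - {v}) f = 0" using N_iff[OF S'] by auto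
    have v0: "restr (fib {v}) f = 0"
      by (subst f(1)[symmetric], subst restr_restr, rule l2_eqI) (auto simp: rep_restr fib_def)
    have "M S f = restr (fib S) (M S f)" by (simp add: restr_Mop[OF fin_sub[OF S]])
    also have "\<dots> = 0" using h M_sub[OF S _ f(1)] by (simp add: split f(2))
    finally show "N S f = f \<and> restr (fib {v}) f = 0"
      using v0 N_iff[OF S, of f] split[of f] f(1) by simp
  next
    assume h: "N S f = f \<and> restr (fib {v}) f = 0"
    then have f: "restr (fib S) f = f" "M S f = 0" using N_iff[OF S] by auto
    have f': "restr (fib (S - {v})) f = f" using split[of f] h f by simp
    have "M (S - {v}) f = 0" using M_sub[OF S _ f'] f(2) by (simp add: clin_simps[OF clin_restr])
    then show "N (S - {v}) f = f \<and> restr (fib {v}) (M S f) = 0"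
      using N_iff[OF S', of f] f' f(2) by (simp add: clin_simps[OF clin_restr])
  qed
qed

text \<open>The kernels for \<open>S - {v}\<close> and \<open>S\<close> are compared through their
  common part \<open>P\<close>. It is cut out of the first by the rows over \<open>v\<close> and out
  of the second by the values over \<open>v\<close>. Both are maps into the fibre over
  \<open>v\<close>, which has trace 1, so \<open>rank_identity\<close> expresses both codimensions
  through the cokernels \<open>P1\<close> and \<open>P2\<close>.\<close>

lemma cut:
  assumes S: "S \<subseteq> verts G" and v: "v \<in> S"
  obtains P P1 P2 where "is_proj P" "\<And>f. P f = f \<longleftrightarrow> N S f = f \<and> restr (fib {v}) f = 0"
    "is_proj P1" "\<And>f. P1 f = f \<longleftrightarrow> restr (fib {v}) f = f \<and> N (S - {v}) (M S f) = 0"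
    "is_proj P2" "\<And>f. P2 f = f \<longleftrightarrow> restr (fib {v}) f = f \<and> N S f = 0"
    "tr (N (S - {v})) = tr P + 1 - tr P1" "tr (N S) = tr P + 1 - tr P2"
proof -
  define R where "R = restr (fib {v})"
  define S' where "S' = S - {v}"
  have S': "S' \<subseteq> verts G" using S by (auto simp: S'_def)
  \<comment> \<open>This factor turns the rows over \<open>v\<close> into a contraction, as
    \<open>rank_identity\<close> demands.\<close>
  define k where "k = 1 / Kc w V"
  have k: "k > 0" using Kc_pos[of w V] by (simp add: k_def)
  have R: "is_proj R" "csa R" "eqv R" by (auto simp: R_def restr_proj restr_csa eqv_restr_fib)
  have Rsupp: "restr X (R f) = R f" for f unfolding R_def by (rule restr_X_fib[of "{v}"]) (simp add: restr_restr)
  have Rc: "clin R" by (rule csa_clin[OF R(2)])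
  note Mc = clin_Mop[of w V S] and Nc = N_clin[OF S] and N'c = N_clin[OF S']
  have trR: "tr R = 1" using tr_restr_fib[of "{v}"] S v by (auto simp: R_def)
  define Y1 where "Y1 = (\<lambda>f. k *\<^sub>R R (M S (N S' f)))"
  define Z1 where "Z1 = (\<lambda>f. k *\<^sub>R N S' (M S (R f)))"
  have "\<exists>P P'. is_proj P \<and> (\<forall>f. P f = f \<longleftrightarrow> N S' f = f \<and> Y1 f = 0) \<and>
    is_proj P' \<and> (\<forall>f. P' f = f \<longleftrightarrow> R f = f \<and> Z1 f = 0) \<and> tr (N S') - tr P = tr R - tr P'"
  proof (rule rank_identity)
    show "is_proj (N S')" "csa (N S')" "eqv (N S')" using N_proj N_csa eqv_N S' by auto
    show "is_proj R" "csa R" "eqv R" by (fact R)+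
    show "clin Y1" unfolding Y1_def by (rule clin_scaleR[OF clin_compose[OF Rc clin_compose[OF Mc N'c]]])
    show "clin Z1" unfolding Z1_def by (rule clin_scaleR[OF clin_compose[OF N'c clin_compose[OF Mc Rc]]])
    show "eqv Y1" unfolding Y1_def by (rule eqv_scaleR[OF eqv_compose[OF R(3) eqv_compose[OF eqv_Mop eqv_N[OF S']]]])
    show "eqv Z1" unfolding Z1_def by (rule eqv_scaleR[OF eqv_compose[OF eqv_N[OF S'] eqv_compose[OF eqv_Mop R(3)]]])
    show "adjoint Y1 Z1"
      by (simp add: adjoint_def Y1_def Z1_def cin_scaleR_left cin_scaleR_right csa_cin[OF R(2)] csa_cin[OF M_csa] csa_cin[OF N_csa[OF S']])
    show "Y1 (N S' f) = Y1 f" for f by (simp add: Y1_def is_proj_idem[OF N_proj[OF S']])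
    show "R (Y1 f) = Y1 f" for f by (simp add: Y1_def is_proj_idem[OF R(1)] clin_simps[OF Rc])
    show "restr X (N S' f) = N S' f" for f by (rule N_supp[OF S'])
    show "restr X (R f) = R f" for f by (rule Rsupp)
    show "norm (Y1 f) \<le> norm f" for f
    proof -
      have "norm (R (M S (N S' f))) \<le> norm (M S (N S' f))" by (rule is_proj_norm_le[OF R(1)])
      also have "\<dots> \<le> Kc w V * norm (N S' f)" by (rule norm_Mop[OF S])
      also have "\<dots> \<le> Kc w V * norm f"
        using Kc_pos[of w V] by (intro mult_left_mono is_proj_norm_le[OF N_proj[OF S']]) auto
      finally show ?thesis using Kc_pos[of w V] by (simp add: Y1_def k_def divide_le_eq mult.commute)
    qed
  qed
  then obtain P P1 where 1: "is_proj P" "\<And>f. P f = f \<longleftrightarrow> N S' f = f \<and> Y1 f = 0"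
    "is_proj P1" "\<And>f. P1 f = f \<longleftrightarrow> R f = f \<and> Z1 f = 0" "tr (N S') - tr P = 1 - tr P1"
    by (auto simp: trR)
  define Y2 where "Y2 = (\<lambda>f. R (N S f))"
  define Z2 where "Z2 = (\<lambda>f. N S (R f))"
  have "\<exists>P P'. is_proj P \<and> (\<forall>f. P f = f \<longleftrightarrow> N S f = f \<and> Y2 f = 0) \<and>
    is_proj P' \<and> (\<forall>f. P' f = f \<longleftrightarrow> R f = f \<and> Z2 f = 0) \<and> tr (N S) - tr P = tr R - tr P'"
  proof (rule rank_identity)
    show "is_proj (N S)" "csa (N S)" "eqv (N S)" using N_proj N_csa eqv_N S by auto
    show "is_proj R" "csa R" "eqv R" by (fact R)+
    show "clin Y2" unfolding Y2_def by (rule clin_compose[OF Rc Nc])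
    show "clin Z2" unfolding Z2_def by (rule clin_compose[OF Nc Rc])
    show "eqv Y2" unfolding Y2_def by (rule eqv_compose[OF R(3) eqv_N[OF S]])
    show "eqv Z2" unfolding Z2_def by (rule eqv_compose[OF eqv_N[OF S] R(3)])
    show "adjoint Y2 Z2" by (simp add: adjoint_def Y2_def Z2_def csa_cin[OF R(2)] csa_cin[OF N_csa[OF S]])
    show "Y2 (N S f) = Y2 f" for f by (simp add: Y2_def is_proj_idem[OF N_proj[OF S]])
    show "R (Y2 f) = Y2 f" for f by (simp add: Y2_def is_proj_idem[OF R(1)])
    show "restr X (N S f) = N S f" for f by (rule N_supp[OF S])
    show "restr X (R f) = R f" for f by (rule Rsupp)
    show "norm (Y2 f) \<le> norm f" for f
      unfolding Y2_def using is_proj_norm_le[OF R(1)] is_proj_norm_le[OF N_proj[OF S]] order_trans by blast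
  qed
  then obtain P' P2 where 2: "is_proj P'" "\<And>f. P' f = f \<longleftrightarrow> N S f = f \<and> Y2 f = 0"
    "is_proj P2" "\<And>f. P2 f = f \<longleftrightarrow> R f = f \<and> Z2 f = 0" "tr (N S) - tr P' = 1 - tr P2"
    by (auto simp: trR)
  have Pf: "P f = f \<longleftrightarrow> N S f = f \<and> restr (fib {v}) f = 0" for f
  proof -
    have "P f = f \<longleftrightarrow> N S' f = f \<and> R (M S f) = 0" unfolding 1(2) using k by (auto simp: Y1_def)
    then show ?thesis using kernel_insert[OF S v, of f] by (simp add: R_def S'_def)
  qed
  have "P = P'"
    by (rule ext, rule is_proj_unique[OF 1(1) 2(1)]) (auto simp: Pf 2(2) Y2_def R_def)
  moreover have "P1 f = f \<longleftrightarrow> restr (fib {v}) f = f \<and> N (S - {v}) (M S f) = 0" for f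
    unfolding 1(4) using k by (auto simp: Z1_def R_def S'_def)
  moreover have "P2 f = f \<longleftrightarrow> restr (fib {v}) f = f \<and> N S f = 0" for f
    unfolding 2(4) by (auto simp: Z2_def R_def)
  ultimately show ?thesis
    using that[of P P1 P2] 1 2 Pf by (simp add: S'_def)
qed

text \<open>The common part \<open>P\<close> lies below both kernels, and its codimension in each of
  them is at most the trace 1 of a single fibre.\<close>

lemma interlace:
  assumes "S \<subseteq> verts G" "v \<in> S" shows "tr (N (S - {v})) \<le> tr (N S) + 1" "tr (N S) \<le> tr (N (S - {v})) + 1"
proof -
  have S': "S - {v} \<subseteq> verts G" using assms by auto
  obtain P P1 P2 where c: "is_proj P" "\<And>f. P f = f \<longleftrightarrow> N S f = f \<and> restr (fib {v}) f = 0"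
    "is_proj P1" "is_proj P2" "tr (N (S - {v})) = tr P + 1 - tr P1" "tr (N S) = tr P + 1 - tr P2"
    using cut[OF assms] by metis
  have "tr P \<le> tr (N S)" by (rule tr_proj_mono[OF c(1) N_proj[OF assms(1)]]) (simp add: c(2))
  moreover have "tr P \<le> tr (N (S - {v}))"
  proof (rule tr_proj_mono[OF c(1) N_proj[OF S']])
    fix f assume "P f = f"
    then show "N (S - {v}) f = f" using kernel_insert[OF assms, of f] c(2)[of f] by blast
  qed
  ultimately show "tr (N (S - {v})) \<le> tr (N S) + 1" "tr (N S) \<le> tr (N (S - {v})) + 1"
    using c tr_proj_nonneg[OF c(3)] tr_proj_nonneg[OF c(4)] by linarith+
qed

lemma N_nonneg: "S \<subseteq> verts G \<Longrightarrow> 0 \<le> tr (N S)"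
  by (rule tr_proj_nonneg[OF N_proj])

lemma tr_N_disjoint:
  assumes S: "A \<union> B \<subseteq> verts G" and AB: "A \<inter> B = {}"
    and sep: "\<And>e. e \<in> arcs G \<Longrightarrow> \<not> (tail G e \<in> A \<and> head G e \<in> B)"
  shows "tr (N (A \<union> B)) = tr (N A) + tr (N B)"
proof -
  have A: "A \<subseteq> verts G" and B: "B \<subseteq> verts G" using S by auto
  have sep': "\<not> (tail G e \<in> B \<and> head G e \<in> A)" if "e \<in> arcs G" for e
    using sep[of "arev e"] that by auto
  note fS = fin_sub[OF S] fin_sub[OF A] fin_sub[OF B]
  have Mdec: "M (A \<union> B) f = M A f + M B f" for f
  proof (rule l2_eqI)
    fix x
    have "{e \<in> out_arcs G (p x). head G e \<in> A \<union> B} = {e \<in> out_arcs G (p x). head G e \<in> A}" if "p x \<in> A"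
      using that sep by auto
    moreover have "{e \<in> out_arcs G (p x). head G e \<in> A \<union> B} = {e \<in> out_arcs G (p x). head G e \<in> B}" if "p x \<in> B"
      using that sep' by auto
    ultimately show "rep_l2 (M (A \<union> B) f) x = rep_l2 (M A f + M B f) x"
      using AB fS(2,3) rep_Mop[OF fS(1)]
      by (cases "p x \<in> A"; cases "p x \<in> B") (auto simp: rep_Mop)
  qed
  have split: "restr (fib (A \<union> B)) f = restr (fib A) f + restr (fib B) f" for f
    by (rule l2_eqI) (use AB in \<open>auto simp: rep_restr fib_def\<close>)
  have disj: "restr (fib A) (restr (fib B) f) = 0" "restr (fib B) (restr (fib A) f) = 0" for f
    by (rule l2_eqI, use AB in \<open>auto simp: rep_restr fib_def\<close>)+
  have NAB: "N A (N B f) = 0" for f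
    using N_restr[OF A, of "N B f"] disj(1)[of "N B f"] N_kernel(1)[OF B, of f] by (simp add: clin_simps[OF N_clin[OF A]])
  have NBA: "N B (N A f) = 0" for f
    using N_restr[OF B, of "N A f"] disj(2)[of "N A f"] N_kernel(1)[OF A, of f] by (simp add: clin_simps[OF N_clin[OF B]])
  define Q where "Q = (\<lambda>f. N A f + N B f)"
  have Q: "is_proj Q"
    unfolding is_proj_def Q_def
    by (auto simp: selfadj_add is_proj_selfadj N_proj A B clin_simps[OF N_clin[OF A]] clin_simps[OF N_clin[OF B]]
        NAB NBA is_proj_idem[OF N_proj[OF A]] is_proj_idem[OF N_proj[OF B]])
  have "N (A \<union> B) f = Q f" for f
  proof (rule is_proj_unique[OF N_proj[OF S] Q])
    fix f
    show "N (A \<union> B) f = f \<longleftrightarrow> Q f = f"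
    proof
      assume "N (A \<union> B) f = f"
      then have f: "restr (fib (A \<union> B)) f = f" "M A f + M B f = 0" using N_iff[OF S] Mdec by auto
      have MA: "M A f = 0"
      proof -
        have "M A f = restr (fib A) (M A f + M B f)"
          using restr_Mop[OF fS(2), of w V f] disj(1)[of "M B f"] restr_Mop[OF fS(3), of w V f] by (simp add: clin_simps[OF clin_restr])
        then show ?thesis using f(2) by (simp add: clin_simps[OF clin_restr])
      qed
      then have MB: "M B f = 0" using f(2) by simp
      have "N A (restr (fib A) f) = restr (fib A) f"
        using N_iff[OF A] MA by (simp add: restr_restr Mop_restr[OF fS(2)])
      moreover have "N B (restr (fib B) f) = restr (fib B) f"
        using N_iff[OF B] MB by (simp add: restr_restr Mop_restr[OF fS(3)])
      ultimately show "Q f = f" using f(1) split[of f] by (simp add: Q_def N_restr[OF A] N_restr[OF B])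
    next
      assume "Q f = f"
      then have f: "f = N A f + N B f" by (simp add: Q_def)
      have Af: "restr (fib A) f = N A f"
        using N_kernel(1)[OF A, of f] disj(1)[of "N B f"] N_kernel(1)[OF B, of f]
        by (subst f) (simp add: clin_simps[OF clin_restr])
      have Bf: "restr (fib B) f = N B f"
        using N_kernel(1)[OF B, of f] disj(2)[of "N A f"] N_kernel(1)[OF A, of f]
        by (subst f) (simp add: clin_simps[OF clin_restr])
      have "M A f = M A (restr (fib A) f)" "M B f = M B (restr (fib B) f)" using Mop_restr fS by auto
      then have "M A f = 0" "M B f = 0" by (simp_all add: Af Bf N_kernel[OF A] N_kernel[OF B])
      then show "N (A \<union> B) f = f" using f Af Bf by (simp add: N_iff[OF S] Mdec split)
    qed
  qed
  then have "N (A \<union> B) = Q" by (rule ext)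
  then show ?thesis unfolding Q_def by (simp only: tr_add)
qed

end

subsection \<open>Kernels on the finite graph\<close>

locale herm = fin_digraph G + bidirected_digraph G arev
  for G :: "('v, 'e) pre_digraph" and arev +
  fixes w :: "'e \<Rightarrow> complex" and V :: "'v \<Rightarrow> real"
  assumes herm_weights: "\<And>e. e \<in> arcs G \<Longrightarrow> w (arev e) = cnj (w e)"
begin

text \<open>The graph is its own cover with trivial deck group, and the trace becomes the ordinary
  one. All results on covers then hold for the finite matrices.\<close>

sublocale triv: deck_weights G arev "verts G" "\<lambda>x. x" "\<lambda>x e. head G e" "{\<lambda>x. x}" "\<lambda>x. x" w V
  by unfold_locales (auto simp: herm_weights bij_betw_def)

definition \<tau> :: "'v set \<Rightarrow> real" where "\<tau> S = triv.tr (triv.N S)"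

definition ker :: "'v set \<Rightarrow> 'v l2 set" where "ker S = {f. triv.N S f = f}"

lemma triv_fib: "S \<subseteq> verts G \<Longrightarrow> triv.fib S = S"
  by (auto simp: triv.fib_def)

lemma ker_iff: "S \<subseteq> verts G \<Longrightarrow> f \<in> ker S \<longleftrightarrow>
    (\<forall>x. x \<notin> S \<longrightarrow> rep_l2 f x = 0) \<and>
    (\<forall>x\<in>S. (\<Sum>e\<in>{e \<in> out_arcs G x. head G e \<in> S}. w e * rep_l2 f (head G e)) + V x * rep_l2 f x = 0)"
proof -
  assume S: "S \<subseteq> verts G"
  have "triv.M S f = 0 \<longleftrightarrow> (\<forall>x. rep_l2 (triv.M S f) x = 0)"
    by (metis l2_eqI rep_l2_simps(1))
  then show ?thesis
    using S triv.fin_sub[OF S] by (auto simp: ker_def triv.N_iff triv_fib restr_fixed_iff triv.rep_Mop)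
qed

lemma N_in_ker: "S \<subseteq> verts G \<Longrightarrow> triv.N S f \<in> ker S"
  by (simp add: ker_def is_proj_idem[OF triv.N_proj])

lemma N_del_zero_iff: "S \<subseteq> verts G \<Longrightarrow> triv.N S (del v) = 0 \<longleftrightarrow> (\<forall>f\<in>ker S. rep_l2 f v = 0)"
proof
  assume S: "S \<subseteq> verts G" and z: "triv.N S (del v) = 0"
  show "\<forall>f\<in>ker S. rep_l2 f v = 0"
  proof
    fix f assume "f \<in> ker S"
    then have "rep_l2 f v = cin (triv.N S f) (del v)" by (simp add: ker_def cin_del_right)
    also have "\<dots> = 0" by (simp add: csa_cin[OF triv.N_csa[OF S]] z)
    finally show "rep_l2 f v = 0" .
  qed
next
  assume S: "S \<subseteq> verts G" and z: "\<forall>f\<in>ker S. rep_l2 f v = 0"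
  show "triv.N S (del v) = 0"
  proof (rule cin_eqI)
    fix h
    have "cin (triv.N S (del v)) h = cnj (rep_l2 (triv.N S h) v)"
      by (simp add: csa_cin[OF triv.N_csa[OF S]] cin_del_left)
    then show "cin (triv.N S (del v)) h = cin 0 h" using z N_in_ker[OF S] by simp
  qed
qed

lemma restr_single: "v \<in> verts G \<Longrightarrow> restr (triv.fib {v}) f = scaleC (rep_l2 f v) (del v)"
  by (rule l2_eqI) (auto simp: triv_fib rep_restr rep_del delta_def)

lemma tr_line_full:
  assumes "v \<in> verts G" "is_proj P" "\<And>f. P f = f \<longleftrightarrow> restr (triv.fib {v}) f = f"
  shows "triv.tr P = 1"
proof -
  have "P = restr (triv.fib {v})"
    by (rule ext, rule is_proj_unique[OF assms(2) restr_proj]) (rule assms(3))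
  then show ?thesis using triv.tr_restr_fib[of "{v}"] assms(1) by simp
qed

lemma tr_zero:
  assumes "is_proj P" "\<And>f. P f = f \<Longrightarrow> f = 0"
  shows "triv.tr P = 0"
proof -
  have "P f = 0" for f using assms(2)[of "P f"] is_proj_idem[OF assms(1)] by simp
  then show ?thesis by (simp add: triv.tr_def)
qed

lemma \<tau>_nonneg: "S \<subseteq> verts G \<Longrightarrow> 0 \<le> \<tau> S"
  unfolding \<tau>_def by (rule triv.N_nonneg)

lemma \<tau>_zero_iff: "S \<subseteq> verts G \<Longrightarrow> \<tau> S = 0 \<longleftrightarrow> ker S = {0}"
proof
  assume S: "S \<subseteq> verts G"
  assume "\<tau> S = 0"
  then have "(\<Sum>v\<in>verts G. (norm (triv.N S (del v)))\<^sup>2) = 0"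
    by (simp add: \<tau>_def triv.tr_def is_proj_inner[OF triv.N_proj[OF S]])
  then have z: "triv.N S (del v) = 0" if "v \<in> verts G" for v
    using that by (simp add: sum_nonneg_eq_0_iff)
  have "f = 0" if f: "f \<in> ker S" for f
  proof (rule l2_eqI)
    fix x show "rep_l2 f x = rep_l2 0 x"
      using N_del_zero_iff[OF S, of x] z f ker_iff[OF S, of f] S by (cases "x \<in> S") auto
  qed
  then show "ker S = {0}" by (auto simp: ker_def clin_simps[OF triv.N_clin[OF S]])
next
  assume S: "S \<subseteq> verts G" and "ker S = {0}"
  then show "\<tau> S = 0" unfolding \<tau>_def by (intro tr_zero triv.N_proj) (auto simp: ker_def)
qed

text \<open>No nonzero multiple of \<open>del v\<close> is orthogonal to \<open>f\<close>, so
  \<open>P2\<close> is zero. A kernel vector for \<open>S - {v}\<close> is mapped by the operator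
  for \<open>S\<close> to a multiple of \<open>del v\<close>; being orthogonal to the kernel vector
  \<open>f\<close>, this multiple is zero. So the row of \<open>v\<close> imposes no condition and
  \<open>P1\<close> is the whole line.\<close>

lemma \<tau>_delete_essential:
  assumes S: "S \<subseteq> verts G" and v: "v \<in> S" and f: "f \<in> ker S" "rep_l2 f v \<noteq> 0"
  shows "\<tau> (S - {v}) = \<tau> S - 1"
proof -
  have vG: "v \<in> verts G" and S': "S - {v} \<subseteq> verts G" using S v by auto
  obtain P P1 P2 where c:
    "is_proj P1" "\<And>f. P1 f = f \<longleftrightarrow> restr (triv.fib {v}) f = f \<and> triv.N (S - {v}) (triv.M S f) = 0"
    "is_proj P2" "\<And>f. P2 f = f \<longleftrightarrow> restr (triv.fib {v}) f = f \<and> triv.N S f = 0"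
    "\<tau> (S - {v}) = triv.tr P + 1 - triv.tr P1" "\<tau> S = triv.tr P + 1 - triv.tr P2"
    using triv.cut[OF S v] unfolding \<tau>_def by metis
  have "triv.tr P2 = 0"
  proof (rule tr_zero[OF c(3)])
    fix g assume "P2 g = g"
    then have g: "restr (triv.fib {v}) g = g" "triv.N S g = 0" using c(4) by auto
    have g': "g = scaleC (rep_l2 g v) (del v)" using restr_single[OF vG, of g] g by simp
    have "cin f g = 0" using csa_cin[OF triv.N_csa[OF S], of f g] f g by (simp add: ker_def)
    then have "cnj (rep_l2 g v) * rep_l2 f v = 0"
      using g' by (metis cin_del_right cin_scaleC_right)
    then show "g = 0" using f(2) g' by simp
  qed
  moreover have "triv.tr P1 = 1"
  proof (rule tr_line_full[OF vG c(1)])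
    fix g
    have "triv.N (S - {v}) (triv.M S g) = 0" if g: "restr (triv.fib {v}) g = g"
    proof -
      have g': "g = scaleC (rep_l2 g v) (del v)" using restr_single[OF vG, of g] g by simp
      have "triv.N (S - {v}) (triv.M S (del v)) = 0"
      proof (rule cin_eqI)
        fix h
        define k where "k = triv.N (S - {v}) h"
        have k: "restr (triv.fib (S - {v})) k = k" "triv.M (S - {v}) k = 0"
          using triv.N_kernel[OF S'] by (auto simp: k_def)
        have supp: "rep_l2 (triv.M S k) x = 0" if "x \<noteq> v" for x
        proof -
          have "restr (triv.fib (S - {v})) (triv.M S k) = 0" using triv.M_sub[OF S _ k(1)] k(2) by auto
          then have "rep_l2 (restr (triv.fib (S - {v})) (triv.M S k)) x = 0" by simp
          then show ?thesis using that S triv.fin_sub[OF S]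
            by (auto simp: rep_restr triv_fib[OF S'] triv.rep_Mop split: if_splits)
        qed
        have e: "triv.M S k = scaleC (rep_l2 (triv.M S k) v) (del v)"
          by (rule l2_eqI) (auto simp: rep_del delta_def supp)
        have "cin (triv.M S k) f = 0"
          using f(1) triv.N_iff[OF S, of f] by (simp add: csa_cin[OF triv.M_csa] ker_def)
        then have "rep_l2 (triv.M S k) v * cnj (rep_l2 f v) = 0"
          using e by (metis cin_del_left cin_scaleC_left)
        then have "triv.M S k = 0" using f(2) e by simp
        then show "cin (triv.N (S - {v}) (triv.M S (del v))) h = cin 0 h"
          by (simp add: csa_cin[OF triv.N_csa[OF S']] csa_cin[OF triv.M_csa] flip: k_def)
      qed
      then show ?thesis
        by (subst g') (simp add: clin_simps[OF triv.clin_Mop] clin_simps[OF triv.N_clin[OF S']])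
    qed
    then show "P1 g = g \<longleftrightarrow> restr (triv.fib {v}) g = g" using c(2) by blast
  qed
  ultimately show ?thesis using c by simp
qed

text \<open>Now \<open>P2\<close> is the whole line. Whether \<open>P1\<close> is zero or the whole
  line depends on the row of \<open>v\<close>: if it is nonzero on the kernel for
  \<open>S - {v}\<close>, then it removes one dimension when \<open>v\<close> is added, and
  otherwise none.\<close>

lemma \<tau>_delete_inessential:
  assumes S: "S \<subseteq> verts G" and v: "v \<in> S" and z: "\<And>f. f \<in> ker S \<Longrightarrow> rep_l2 f v = 0"
  shows "(\<exists>k\<in>ker (S - {v}). rep_l2 (triv.M S k) v \<noteq> 0) \<Longrightarrow> \<tau> (S - {v}) = \<tau> S + 1"
    "\<not> (\<exists>k\<in>ker (S - {v}). rep_l2 (triv.M S k) v \<noteq> 0) \<Longrightarrow> \<tau> (S - {v}) = \<tau> S"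
proof -
  have vG: "v \<in> verts G" and S': "S - {v} \<subseteq> verts G" using S v by auto
  obtain P P1 P2 where c:
    "is_proj P1" "\<And>f. P1 f = f \<longleftrightarrow> restr (triv.fib {v}) f = f \<and> triv.N (S - {v}) (triv.M S f) = 0"
    "is_proj P2" "\<And>f. P2 f = f \<longleftrightarrow> restr (triv.fib {v}) f = f \<and> triv.N S f = 0"
    "\<tau> (S - {v}) = triv.tr P + 1 - triv.tr P1" "\<tau> S = triv.tr P + 1 - triv.tr P2"
    using triv.cut[OF S v] unfolding \<tau>_def by metis
  have "triv.tr P2 = 1"
  proof (rule tr_line_full[OF vG c(3)])
    have "triv.N S (del v) = 0" using N_del_zero_iff[OF S] z by blast
    then have "triv.N S (restr (triv.fib {v}) g) = 0" for g
      by (simp add: restr_single[OF vG] clin_simps[OF triv.N_clin[OF S]])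
    then show "P2 g = g \<longleftrightarrow> restr (triv.fib {v}) g = g" for g using c(4) by metis
  qed
  then have \<tau>S: "\<tau> S = triv.tr P" using c by simp
  have pair: "cin (triv.N (S - {v}) (triv.M S (del v))) h = cnj (rep_l2 (triv.M S (triv.N (S - {v}) h)) v)" for h
    by (simp add: csa_cin[OF triv.N_csa[OF S']] csa_cin[OF triv.M_csa] cin_del_left)
  show "\<tau> (S - {v}) = \<tau> S + 1" if ex: "\<exists>k\<in>ker (S - {v}). rep_l2 (triv.M S k) v \<noteq> 0"
  proof -
    obtain k where k: "k \<in> ker (S - {v})" "rep_l2 (triv.M S k) v \<noteq> 0" using ex by blast
    have nz: "triv.N (S - {v}) (triv.M S (del v)) \<noteq> 0" using pair[of k] k by (auto simp: ker_def)
    have "triv.tr P1 = 0"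
    proof (rule tr_zero[OF c(1)])
      fix g assume "P1 g = g"
      then have g: "restr (triv.fib {v}) g = g" "triv.N (S - {v}) (triv.M S g) = 0" using c(2) by auto
      have g': "g = scaleC (rep_l2 g v) (del v)" using restr_single[OF vG, of g] g by simp
      have "triv.N (S - {v}) (triv.M S g) = scaleC (rep_l2 g v) (triv.N (S - {v}) (triv.M S (del v)))"
        by (subst g') (simp add: clin_simps[OF triv.clin_Mop] clin_simps[OF triv.N_clin[OF S']])
      then have "scaleC (rep_l2 g v) (triv.N (S - {v}) (triv.M S (del v))) = 0" using g(2) by simp
      then have "rep_l2 g v = 0"
        using nz norm_scaleC[of "rep_l2 g v" "triv.N (S - {v}) (triv.M S (del v))"] by simp
      then show "g = 0" using g' by simp
    qed
    then show ?thesis using c \<tau>S by simp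
  qed
  show "\<tau> (S - {v}) = \<tau> S" if "\<not> (\<exists>k\<in>ker (S - {v}). rep_l2 (triv.M S k) v \<noteq> 0)"
  proof -
    have "triv.N (S - {v}) (triv.M S (del v)) = 0"
      by (rule cin_eqI) (use that N_in_ker[OF S'] in \<open>simp add: pair\<close>)
    then have "triv.N (S - {v}) (triv.M S (restr (triv.fib {v}) g)) = 0" for g
      by (simp add: restr_single[OF vG] clin_simps[OF triv.N_clin[OF S']] clin_simps[OF triv.clin_Mop])
    then have "triv.tr P1 = 1" by (intro tr_line_full[OF vG c(1)]) (metis c(2))
    then show ?thesis using c \<tau>S by simp
  qed
qed

lemma \<tau>_le_1:
  assumes S: "S \<subseteq> verts G" and v: "v \<in> S" and z: "\<And>f. f \<in> ker S \<Longrightarrow> rep_l2 f v = 0 \<Longrightarrow> f = 0"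
  shows "\<tau> S \<le> 1"
proof -
  have vG: "v \<in> verts G" using S v by auto
  obtain P P2 where c: "is_proj P" "\<And>f. P f = f \<longleftrightarrow> triv.N S f = f \<and> restr (triv.fib {v}) f = 0"
    "is_proj P2" "\<tau> S = triv.tr P + 1 - triv.tr P2"
    using triv.cut[OF S v] unfolding \<tau>_def by metis
  have "triv.tr P = 0"
  proof (rule tr_zero[OF c(1)])
    fix f assume "P f = f"
    then have f: "f \<in> ker S" "restr (triv.fib {v}) f = 0" using c(2) by (auto simp: ker_def)
    have "rep_l2 (restr (triv.fib {v}) f) v = 0" using f by simp
    then have "rep_l2 f v = 0" using vG by (simp add: rep_restr triv_fib)
    then show "f = 0" using z f by blast
  qed
  then show ?thesis using c triv.tr_proj_nonneg[OF c(3)] by simp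
qed

lemma \<tau>_delete_ge: "S \<subseteq> verts G \<Longrightarrow> v \<in> S \<Longrightarrow> \<tau> S \<le> \<tau> (S - {v}) + 1"
  unfolding \<tau>_def by (rule triv.interlace(2))

lemma \<tau>_le_card:
  assumes "finite R" "R \<subseteq> S" "S \<subseteq> verts G" "\<tau> (S - R) = 0"
  shows "\<tau> S \<le> card R"
  using assms
proof (induction R arbitrary: S rule: finite_induct)
  case (insert v R)
  have "\<tau> (S - {v}) \<le> card R"
    by (rule insert.IH) (use insert in \<open>auto simp: Diff_insert2[symmetric]\<close>)
  moreover have "\<tau> S \<le> \<tau> (S - {v}) + 1" by (rule \<tau>_delete_ge) (use insert in auto)
  ultimately show ?case using insert by simp
qed simp

text \<open>A Hermitian matrix has an invertible principal submatrix whose size is its rank: delete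
  vertices at which some kernel vector is nonzero, each of which lowers the nullity by exactly one.
  Nullities can thus be compared through principal determinants.\<close>

lemma \<tau>_principal:
  assumes "S \<subseteq> verts G"
  shows "\<exists>R\<subseteq>S. \<tau> S = card R \<and> \<tau> (S - R) = 0"
  using assms
proof (induction "card S" arbitrary: S rule: less_induct)
  case less
  note S = \<open>S \<subseteq> verts G\<close>
  show ?case
  proof (cases "\<tau> S = 0")
    case True then show ?thesis by (intro exI[of _ "{}"]) simp
  next
    case False
    then have "ker S \<noteq> {0}" using \<tau>_zero_iff[OF S] by simp
    moreover have "0 \<in> ker S" by (simp add: ker_def clin_simps[OF triv.N_clin[OF S]])
    ultimately obtain f where f: "f \<in> ker S" "f \<noteq> 0" by blast
    then obtain v where v: "rep_l2 f v \<noteq> 0" using l2_eqI[of f 0] by auto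
    then have vS: "v \<in> S" using f(1) ker_iff[OF S] by blast
    have e: "\<tau> (S - {v}) = \<tau> S - 1" by (rule \<tau>_delete_essential[OF S vS f(1) v])
    have "card (S - {v}) < card S" using vS triv.fin_sub[OF S] by (intro psubset_card_mono) auto
    then obtain R where R: "R \<subseteq> S - {v}" "\<tau> (S - {v}) = card R" "\<tau> (S - {v} - R) = 0"
      using less.hyps[of "S - {v}"] S by auto
    have "finite R" using R(1) triv.fin_sub[OF S] by (auto intro: finite_subset)
    then have "card (insert v R) = card R + 1" using R(1) by (subst card_insert_disjoint) auto
    moreover have "S - insert v R = S - {v} - R" by auto
    ultimately show ?thesis
      using R e vS by (intro exI[of _ "insert v R"]) auto
  qed
qed

lemma \<tau>_Un: "A \<union> B \<subseteq> verts G \<Longrightarrow> A \<inter> B = {} \<Longrightarrow> (\<And>e. e \<in> arcs G \<Longrightarrow> \<not> (tail G e \<in> A \<and> head G e \<in> B)) \<Longrightarrow>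
    \<tau> (A \<union> B) = \<tau> A + \<tau> B"
  unfolding \<tau>_def by (rule triv.tr_N_disjoint)

end

subsection \<open>Generic phases\<close>

definition unif :: "real measure" where "unif = uniform_measure lborel {0..2*pi}"

lemma prob_space_unif: "prob_space unif"
  unfolding unif_def by (rule prob_space_uniform_measure) auto

lemma sets_unif [simp, measurable_cong]: "sets unif = sets borel"
  by (simp add: unif_def)

lemma space_unif [simp]: "space unif = UNIV"
  by (simp add: unif_def)

lemma AE_unif_countable:
  assumes "countable A" shows "AE t in unif. t \<notin> A"
  unfolding unif_def
proof (rule AE_uniform_measureI)
  have "A \<in> null_sets lborel" using assms by (rule countable_imp_null_set_lborel)
  then have "AE t in lborel. t \<notin> A" by (rule AE_not_in)
  then show "AE t in lborel. t \<in> {0..2*pi} \<longrightarrow> t \<notin> A" by eventually_elim simp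
qed simp

interpretation PU: product_prob_space "\<lambda>_. unif" I for I :: "'i set"
proof -
  interpret prob_space unif by (rule prob_space_unif)
  show "product_prob_space (\<lambda>_. unif)" by unfold_locales
qed

text \<open>Fubini, one coordinate at a time, starting from a point \<open>x\<close> with
  \<open>D x \<noteq> 0\<close>. The values outside \<open>I\<close> are supplied by
  \<open>y\<close>; the induction first holds the coordinate \<open>i\<close> at its value in
  \<open>x\<close> and then lets it vary along slices, on which the zeros are countable and
  therefore null.\<close>

lemma AE_slices:
  fixes D :: "('i \<Rightarrow> real) \<Rightarrow> complex"
  assumes "finite I"
    and slice: "\<And>x i. i \<in> I \<Longrightarrow> D x \<noteq> 0 \<Longrightarrow> countable {t. D (x(i := t)) = 0}"
    and meas: "\<And>J y. J \<subseteq> I \<Longrightarrow> (\<lambda>z. D (\<lambda>i. if i \<in> J then z i else y i)) \<in> borel_measurable (Pi\<^sub>M J (\<lambda>_. unif))"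
    and "D x \<noteq> 0" "\<And>i. i \<notin> I \<Longrightarrow> x i = y i"
  shows "AE z in Pi\<^sub>M I (\<lambda>_. unif). D (\<lambda>i. if i \<in> I then z i else y i) \<noteq> 0"
  using assms
proof (induction I arbitrary: y rule: finite_induct)
  case empty
  then have "x = y" by auto
  then show ?case using empty by simp
next
  case (insert i I)
  define ov where "ov = (\<lambda>J z (y :: 'i \<Rightarrow> real) j. if j \<in> J then z j else y j)"
  have IH: "AE z in Pi\<^sub>M I (\<lambda>_. unif). D (ov I z (y(i := x i))) \<noteq> 0"
    unfolding ov_def
  proof (rule insert.IH)
    show "countable {t. D (x(j := t)) = 0}" if "j \<in> I" "D x \<noteq> 0" for x j
      by (rule insert.prems(1)) (use that in auto)
    show "(\<lambda>z. D (\<lambda>i. if i \<in> J then z i else y i)) \<in> borel_measurable (Pi\<^sub>M J (\<lambda>_. unif))" if "J \<subseteq> I" for J y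
      by (rule insert.prems(2)) (use that in auto)
  qed (use insert.prems in auto)
  have m: "(\<lambda>z. D (ov (insert i I) z y)) \<in> borel_measurable (Pi\<^sub>M (insert i I) (\<lambda>_. unif))"
    unfolding ov_def by (rule insert.prems) simp
  define B where "B = {z \<in> space (Pi\<^sub>M (insert i I) (\<lambda>_. unif)). \<not> D (ov (insert i I) z y) \<noteq> 0}"
  have mB: "B \<in> sets (Pi\<^sub>M (insert i I) (\<lambda>_. unif))"
    unfolding B_def using m by measurable
  have "(\<integral>\<^sup>+ z. indicator B z \<partial>Pi\<^sub>M (insert i I) (\<lambda>_. unif)) =
      (\<integral>\<^sup>+ z. (\<integral>\<^sup>+ t. indicator B (z(i := t)) \<partial>unif) \<partial>Pi\<^sub>M I (\<lambda>_. unif))"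
    by (rule PU.product_nn_integral_insert) (use insert mB in auto)
  also have "\<dots> = (\<integral>\<^sup>+ z. 0 \<partial>Pi\<^sub>M I (\<lambda>_. unif))"
  proof (rule nn_integral_cong_AE)
    show "AE z in Pi\<^sub>M I (\<lambda>_. unif). (\<integral>\<^sup>+ t. indicator B (z(i := t)) \<partial>unif) = 0"
      using IH
    proof eventually_elim
      fix z assume z: "D (ov I z (y(i := x i))) \<noteq> 0"
      have e: "ov (insert i I) (z(i := t)) y = (ov I z (y(i := x i)))(i := t)" for t
        using insert.hyps by (auto simp: ov_def fun_eq_iff)
      have "countable {t. D ((ov I z (y(i := x i)))(i := t)) = 0}"
        by (rule insert.prems(1)[OF _ z]) simp
      from AE_unif_countable[OF this]
      have "AE t in unif. indicator B (z(i := t)) = (0 :: ennreal)"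
        by eventually_elim (simp add: B_def e indicator_def)
      then have "(\<integral>\<^sup>+ t. indicator B (z(i := t)) \<partial>unif) = (\<integral>\<^sup>+ t. 0 \<partial>unif)"
        by (rule nn_integral_cong_AE)
      then show "(\<integral>\<^sup>+ t. indicator B (z(i := t)) \<partial>unif) = 0" by simp
    qed
  qed
  finally have "emeasure (Pi\<^sub>M (insert i I) (\<lambda>_. unif)) B = 0" using mB by simp
  then have "AE z in Pi\<^sub>M (insert i I) (\<lambda>_. unif). z \<notin> B"
    using mB by (intro AE_not_in) (simp add: null_sets_def)
  moreover have "AE z in Pi\<^sub>M (insert i I) (\<lambda>_. unif). z \<in> space (Pi\<^sub>M (insert i I) (\<lambda>_. unif))" by (rule AE_space)
  ultimately show ?case by eventually_elim (simp add: B_def ov_def)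
qed

section \<open>Twisted operators and their generic nullities\<close>

locale twist = fin_digraph G + bidirected_digraph G arev
  for G :: "('v, 'e) pre_digraph" and arev +
  fixes w :: "'e \<Rightarrow> complex" and V :: "'v \<Rightarrow> real"
  assumes w_arev: "\<And>e. e \<in> arcs G \<Longrightarrow> w (arev e) = cnj (w e)"
    and w_nz: "\<And>e. e \<in> arcs G \<Longrightarrow> w e \<noteq> 0"
begin

text \<open>Every arc has its own coordinate and only the difference over an edge enters. This keeps
  the twisted weights Hermitian without a choice of orientation.\<close>

definition wx :: "('e \<Rightarrow> real) \<Rightarrow> 'e \<Rightarrow> complex" where
  "wx x e = w e * cis (x e - x (arev e))"

lemma wx_arev: "e \<in> arcs G \<Longrightarrow> wx x (arev e) = cnj (wx x e)"
  by (simp add: wx_def w_arev cis_cnj)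

sublocale h: herm G arev "wx x" V for x
  by unfold_locales (rule wx_arev)

definition entry :: "('e \<Rightarrow> complex) \<Rightarrow> 'v \<Rightarrow> 'v \<Rightarrow> complex" where
  "entry u a b = (\<Sum>e\<in>{e \<in> arcs G. tail G e = a \<and> head G e = b}. u e) + (if a = b then complex_of_real (V a) else 0)"

definition Dmat :: "('e \<Rightarrow> complex) \<Rightarrow> 'v list \<Rightarrow> complex mat" where
  "Dmat u l = mat (length l) (length l) (\<lambda>(i, j). entry u (l ! i) (l ! j))"

lemma row_sum:
  fixes u :: "'e \<Rightarrow> complex" and f :: "'v \<Rightarrow> complex"
  assumes "finite S" "a \<in> S"
  shows "(\<Sum>e\<in>{e \<in> out_arcs G a. head G e \<in> S}. u e * f (head G e)) + V a * f a = (\<Sum>b\<in>S. entry u a b * f b)"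
proof -
  let ?E = "{e \<in> out_arcs G a. head G e \<in> S}"
  have "(\<Sum>e\<in>?E. u e * f (head G e)) = (\<Sum>b\<in>S. \<Sum>e\<in>{e \<in> ?E. head G e = b}. u e * f (head G e))"
    by (rule sum.group[symmetric]) (use assms in \<open>auto simp: out_arcs_def intro: finite_subset[OF _ finite_arcs]\<close>)
  also have "\<dots> = (\<Sum>b\<in>S. (\<Sum>e\<in>{e \<in> arcs G. tail G e = a \<and> head G e = b}. u e) * f b)"
  proof (rule sum.cong[OF refl])
    fix b assume "b \<in> S"
    then have "{e \<in> ?E. head G e = b} = {e \<in> arcs G. tail G e = a \<and> head G e = b}" by auto
    then show "(\<Sum>e\<in>{e \<in> ?E. head G e = b}. u e * f (head G e)) = (\<Sum>e\<in>{e \<in> arcs G. tail G e = a \<and> head G e = b}. u e) * f b"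
      by (simp add: sum_distrib_right)
  qed
  moreover have "V a * f a = (\<Sum>b\<in>S. (if a = b then complex_of_real (V a) else 0) * f b)"
  proof -
    have "(\<Sum>b\<in>S. (if a = b then complex_of_real (V a) else 0) * f b) = (\<Sum>b\<in>S. if a = b then V a * f b else 0)"
      by (rule sum.cong) auto
    then show ?thesis using assms by simp
  qed
  ultimately show ?thesis by (simp add: entry_def distrib_right sum.distrib)
qed

lemma ker_det:
  assumes l: "distinct l" "set l \<subseteq> verts G"
  shows "h.ker x (set l) = {0} \<longleftrightarrow> det (Dmat (wx x) l) \<noteq> 0"
proof -
  define n where "n = length l"
  define S where "S = set l"
  have S: "S \<subseteq> verts G" "finite S" using l by (auto simp: S_def)
  have A: "Dmat (wx x) l \<in> carrier_mat n n" by (simp add: Dmat_def n_def)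
  have bij: "bij_betw ((!) l) {..<n} S" unfolding n_def S_def using l(1) by (rule bij_betw_nth) auto
  have ker: "f \<in> h.ker x S \<longleftrightarrow> (\<forall>a. a \<notin> S \<longrightarrow> rep_l2 f a = 0) \<and>
      (\<forall>a\<in>S. (\<Sum>b\<in>S. entry (wx x) a b * rep_l2 f b) = 0)" for f
    using h.ker_iff[OF S(1), of f x] row_sum[OF S(2), of _ "wx x" "rep_l2 f"] by simp
  have zero: "0 \<in> h.ker x S" by (simp add: ker)
  have mv: "(Dmat (wx x) l *\<^sub>v v) $ i = (\<Sum>j<n. entry (wx x) (l ! i) (l ! j) * v $ j)"
    if "i < n" "v \<in> carrier_vec n" for i v
    using that by (simp add: Dmat_def n_def scalar_prod_def atLeast0LessThan carrier_vecD)
  show ?thesis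
  proof -
    have "det (Dmat (wx x) l) = 0 \<longleftrightarrow> (\<exists>f\<in>h.ker x S. f \<noteq> 0)"
    proof
      assume "det (Dmat (wx x) l) = 0"
      then obtain v where v: "v \<in> carrier_vec n" "v \<noteq> 0\<^sub>v n" "Dmat (wx x) l *\<^sub>v v = 0\<^sub>v n"
        using det_0_iff_vec_prod_zero[OF A] by auto
      define f where "f = (\<Sum>j<n. scaleC (v $ j) (del (l ! j)))"
      have fj: "rep_l2 f (l ! i) = v $ i" if "i < n" for i
      proof -
        have "rep_l2 f (l ! i) = (\<Sum>j<n. if j = i then v $ j else 0)"
          unfolding f_def rep_l2_sum
          by (rule sum.cong) (use that l(1) in \<open>auto simp: rep_del delta_def n_def nth_eq_iff_index_eq\<close>)
        then show ?thesis using that by simp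
      qed
      have f0: "rep_l2 f a = 0" if "a \<notin> S" for a
        unfolding f_def rep_l2_sum
      proof (intro sum.neutral ballI)
        fix j assume "j \<in> {..<n}"
        then have "l ! j \<in> S" by (simp add: S_def n_def)
        then have "a \<noteq> l ! j" using that by blast
        then show "rep_l2 (scaleC (v $ j) (del (l ! j))) a = 0" by (simp add: rep_del delta_def)
      qed
      have "(\<Sum>b\<in>S. entry (wx x) a b * rep_l2 f b) = 0" if "a \<in> S" for a
      proof -
        have "a \<in> set l" using that by (simp add: S_def)
        then obtain i where i: "i < n" "a = l ! i" unfolding n_def by (metis in_set_conv_nth)
        have "(\<Sum>b\<in>S. entry (wx x) a b * rep_l2 f b) = (\<Sum>j<n. entry (wx x) a (l ! j) * rep_l2 f (l ! j))"
          by (rule sum.reindex_bij_betw[OF bij, symmetric])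
        also have "\<dots> = (Dmat (wx x) l *\<^sub>v v) $ i" by (simp add: mv[OF i(1) v(1)] i(2) fj)
        also have "\<dots> = 0" using i(1) by (simp add: v(3))
        finally show ?thesis .
      qed
      then have "f \<in> h.ker x S" using f0 by (simp add: ker)
      moreover have "f \<noteq> 0"
      proof
        assume "f = 0"
        then have "v $ i = 0" if "i < n" for i using fj[OF that] by simp
        then have "v = 0\<^sub>v n" using v(1) by (intro eq_vecI) auto
        then show False using v(2) by simp
      qed
      ultimately show "\<exists>f\<in>h.ker x S. f \<noteq> 0" by blast
    next
      assume "\<exists>f\<in>h.ker x S. f \<noteq> 0"
      then obtain f where f: "f \<in> h.ker x S" "f \<noteq> 0" by blast
      define v where "v = vec n (\<lambda>i. rep_l2 f (l ! i))"
      have v: "v \<in> carrier_vec n" by (simp add: v_def)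
      have "v \<noteq> 0\<^sub>v n"
      proof
        assume "v = 0\<^sub>v n"
        then have "v $ i = 0" if "i < n" for i using that by simp
        then have "rep_l2 f a = 0" if "a \<in> S" for a
        proof -
          have "a \<in> set l" using that by (simp add: S_def)
          then obtain i where i: "i < n" "a = l ! i" unfolding n_def by (metis in_set_conv_nth)
          then show ?thesis using \<open>\<And>i. i < n \<Longrightarrow> v $ i = 0\<close>[OF i(1)] by (simp add: v_def)
        qed
        then have "rep_l2 f a = 0" for a using f(1) by (cases "a \<in> S") (auto simp: ker)
        then have "f = 0" by (intro l2_eqI) simp
        then show False using f(2) by simp
      qed
      moreover have "Dmat (wx x) l *\<^sub>v v = 0\<^sub>v n"
      proof (rule eq_vecI)
        fix i assume "i < dim_vec (0\<^sub>v n :: complex vec)"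
        then have i: "i < n" by simp
        have "(Dmat (wx x) l *\<^sub>v v) $ i = (\<Sum>j<n. entry (wx x) (l ! i) (l ! j) * rep_l2 f (l ! j))"
          by (simp add: mv[OF i v]) (simp add: v_def)
        also have "\<dots> = (\<Sum>b\<in>S. entry (wx x) (l ! i) b * rep_l2 f b)"
          by (rule sum.reindex_bij_betw[OF bij])
        also have "\<dots> = 0"
        proof -
          have "l ! i \<in> S" using i by (simp add: S_def n_def)
          then show ?thesis using f(1) unfolding ker by blast
        qed
        finally show "(Dmat (wx x) l *\<^sub>v v) $ i = 0\<^sub>v n $ i" using i by simp
      qed (use A in auto)
      ultimately show "det (Dmat (wx x) l) = 0"
        using det_0_iff_vec_prod_zero[OF A] v by blast
    qed
    then show ?thesis using zero unfolding S_def[symmetric] by auto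
  qed
qed

lemma det_Dmat: "det (Dmat u l) = (\<Sum>\<pi>\<in>{\<pi>. \<pi> permutes {0..<length l}}.
    signof \<pi> * (\<Prod>i = 0..<length l. entry u (l ! i) (l ! \<pi> i)))"
proof -
  have A: "Dmat u l \<in> carrier_mat (length l) (length l)" by (simp add: Dmat_def)
  show ?thesis
    unfolding det_def'[OF A]
  proof (rule sum.cong[OF refl])
    fix \<pi> assume "\<pi> \<in> {\<pi>. \<pi> permutes {0..<length l}}"
    then have "\<pi> i < length l" if "i < length l" for i
      using that permutes_in_image[of \<pi> "{0..<length l}" i] by simp
    then show "signof \<pi> * (\<Prod>i = 0..<length l. Dmat u l $$ (i, \<pi> i)) =
        signof \<pi> * (\<Prod>i = 0..<length l. entry u (l ! i) (l ! \<pi> i))"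
      by (intro arg_cong2[where f = "(*)"] refl prod.cong) (auto simp: Dmat_def)
  qed
qed

text \<open>Let the coordinate of \<open>e\<close> be complex; it occurs in the weights of
  \<open>e\<close> and of its reverse. The determinant becomes an entire function that is not
  identically zero, so its zeros are countable, and so are the real ones among them.\<close>

lemma det_slice:
  assumes "det (Dmat (wx x) l) \<noteq> 0"
  shows "countable {t. det (Dmat (wx (x(e := t))) l) = 0}"
proof -
  define u where "u = (\<lambda>c e'. w e' * exp (\<i> * ((if e' = e then c else complex_of_real (x e')) -
      (if arev e' = e then c else complex_of_real (x (arev e'))))))"
  define g where "g = (\<lambda>c. det (Dmat (u c) l))"
  have u: "u (complex_of_real t) = wx (x(e := t))" for t
    by (rule ext) (simp add: u_def wx_def cis_conv_exp)
  have hol: "(\<lambda>c. u c e') holomorphic_on UNIV" for e'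
    unfolding u_def by (cases "e' = e"; cases "arev e' = e") (auto intro!: holomorphic_intros)
  have "(\<lambda>c. entry (u c) a b) holomorphic_on UNIV" for a b
    unfolding entry_def by (cases "a = b") (auto intro!: holomorphic_intros hol)
  then have ghol: "g holomorphic_on UNIV"
    unfolding g_def det_Dmat by (intro holomorphic_intros)
  have gx: "g (complex_of_real (x e)) \<noteq> 0" using assms by (simp add: g_def u)
  have "countable {z. g z = 0}"
  proof (cases "g constant_on UNIV")
    case True
    then have "g z = g (complex_of_real (x e))" for z by (auto simp: constant_on_def)
    then have "{z. g z = 0} = {}" using gx by (metis (mono_tags, lifting) empty_Collect_eq)
    then show ?thesis by simp
  next
    case False
    have "countable {z \<in> UNIV. g z = 0}"
      by (rule holomorphic_countable_zeros[OF ghol _ _ _ False]) auto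
    then show ?thesis by simp
  qed
  then have "countable (complex_of_real ` {t. g (complex_of_real t) = 0})"
    by (rule countable_subset[rotated]) auto
  then have "countable {t. g (complex_of_real t) = 0}"
    by (rule countable_image_inj_on) (simp add: inj_on_def)
  then show ?thesis by (simp add: g_def u)
qed

lemma wx_cong: "(\<And>e. e \<in> arcs G \<Longrightarrow> x e = y e) \<Longrightarrow> e \<in> arcs G \<Longrightarrow> wx x e = wx y e"
  by (simp add: wx_def)

lemma entry_cong: "(\<And>e. e \<in> arcs G \<Longrightarrow> u e = u' e) \<Longrightarrow> entry u a b = entry u' a b"
  unfolding entry_def by (intro arg_cong2[where f = "(+)"] sum.cong) auto

lemma \<tau>_det: "distinct l \<Longrightarrow> set l \<subseteq> verts G \<Longrightarrow> h.\<tau> x (set l) = 0 \<longleftrightarrow> det (Dmat (wx x) l) \<noteq> 0"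
  by (simp add: h.\<tau>_zero_iff ker_det)

text \<open>Every principal compression that is invertible for some phases is invertible for these.
  Only finitely many determinants are involved, so almost all phases qualify, and by
  \<open>\<tau>_principal\<close> they minimize all nullities simultaneously.\<close>

definition gen :: "('e \<Rightarrow> real) set" where
  "gen = {x. \<forall>S\<subseteq>verts G. (\<exists>y. h.\<tau> y S = 0) \<longrightarrow> h.\<tau> x S = 0}"

lemma list_of: "S \<subseteq> verts G \<Longrightarrow> \<exists>l. distinct l \<and> set l = S"
  using finite_distinct_list finite_subset[OF _ finite_verts] by metis

lemma \<tau>_slice: "S \<subseteq> verts G \<Longrightarrow> h.\<tau> x S = 0 \<Longrightarrow> countable {t. h.\<tau> (x(e := t)) S \<noteq> 0}"
  using list_of[of S] \<tau>_det det_slice by fastforce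

lemma gen_slice: "x \<in> gen \<Longrightarrow> countable {t. x(e := t) \<notin> gen}"
proof -
  assume x: "x \<in> gen"
  have "{t. x(e := t) \<notin> gen} \<subseteq> (\<Union>S\<in>{S \<in> Pow (verts G). h.\<tau> x S = 0}. {t. h.\<tau> (x(e := t)) S \<noteq> 0})"
    using x by (auto simp: gen_def)
  moreover have "countable (\<Union>S\<in>{S \<in> Pow (verts G). h.\<tau> x S = 0}. {t. h.\<tau> (x(e := t)) S \<noteq> 0})"
    by (rule countable_UN) (auto intro: countable_finite \<tau>_slice)
  ultimately show ?thesis by (rule countable_subset)
qed

text \<open>The step is shorter than 1, so that even two such steps in a row stay below 2 and their
  factor \<open>cis\<close> is not real (\<open>cis_ne_1\<close>).\<close>

lemma gen_perturb:
  assumes "x \<in> gen" "finite T" shows "\<exists>t. x e < t \<and> t < x e + 1 \<and> t \<notin> T \<and> x(e := t) \<in> gen"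
proof -
  have "uncountable {x e<..<x e + 1}" by (simp add: uncountable_open_interval)
  moreover have "countable ({t. x(e := t) \<notin> gen} \<union> T)"
    using gen_slice[OF assms(1)] assms(2) by (simp add: countable_finite)
  ultimately have "uncountable ({x e<..<x e + 1} - ({t. x(e := t) \<notin> gen} \<union> T))"
    by (rule uncountable_minus_countable)
  then obtain t where "t \<in> {x e<..<x e + 1} - ({t. x(e := t) \<notin> gen} \<union> T)"
    by (metis all_not_in_conv countable_empty)
  then show ?thesis by auto
qed

lemma gen_AE: "AE x in Pi\<^sub>M (arcs G) (\<lambda>_. unif). x \<in> gen"
proof -
  have one: "AE x in Pi\<^sub>M (arcs G) (\<lambda>_. unif). h.\<tau> x S = 0" if S: "S \<subseteq> verts G" and ex: "\<exists>y. h.\<tau> y S = 0" for S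
  proof -
    obtain y where y: "h.\<tau> y S = 0" using ex by blast
    obtain l where l: "distinct l" "set l = S" using list_of[OF S] by blast
    define D where "D = (\<lambda>x. det (Dmat (wx x) l))"
    have Dy: "D y \<noteq> 0" using \<tau>_det[OF l(1)] l S y by (simp add: D_def)
    have "AE z in Pi\<^sub>M (arcs G) (\<lambda>_. unif). D (\<lambda>e. if e \<in> arcs G then z e else y e) \<noteq> 0"
    proof (rule AE_slices[where D = D and x = y])
      show "finite (arcs G)" by simp
      show "countable {t. D (x(e := t)) = 0}" if "D x \<noteq> 0" for x e
        using det_slice that by (simp add: D_def)
      fix J :: "'e set" and z0 :: "'e \<Rightarrow> real" assume J: "J \<subseteq> arcs G"
      have c: "(\<lambda>z. if e \<in> J then z e else z0 e) \<in> borel_measurable (Pi\<^sub>M J (\<lambda>_. unif))" for e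
      proof (cases "e \<in> J")
        case True
        then have "(\<lambda>z. z e) \<in> measurable (Pi\<^sub>M J (\<lambda>_. unif)) unif" by (rule measurable_component_singleton)
        then show ?thesis using True by (simp cong: measurable_cong_sets)
      qed simp
      have wm: "(\<lambda>z. wx (\<lambda>e. if e \<in> J then z e else z0 e) e) \<in> borel_measurable (Pi\<^sub>M J (\<lambda>_. unif))" for e
        unfolding wx_def cis_conv_exp by (intro borel_measurable_times borel_measurable_const
            measurable_compose[OF _ borel_measurable_continuous_onI[OF continuous_on_exp[OF continuous_on_id]]]
            measurable_compose[OF _ borel_measurable_of_real] borel_measurable_diff c)
      show "(\<lambda>z. D (\<lambda>e. if e \<in> J then z e else z0 e)) \<in> borel_measurable (Pi\<^sub>M J (\<lambda>_. unif))"
        unfolding D_def det_Dmat entry_def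
        by (intro borel_measurable_sum borel_measurable_times borel_measurable_const borel_measurable_prod
            borel_measurable_add wm)
    qed (use Dy in auto)
    moreover have "D (\<lambda>e. if e \<in> arcs G then z e else y e) = D z" for z
      unfolding D_def det_Dmat
      by (intro sum.cong refl arg_cong2[where f = "(*)"] prod.cong entry_cong wx_cong) auto
    ultimately have "AE z in Pi\<^sub>M (arcs G) (\<lambda>_. unif). D z \<noteq> 0" by simp
    then show ?thesis using \<tau>_det[OF l(1)] l S by (simp add: D_def)
  qed
  have "AE x in Pi\<^sub>M (arcs G) (\<lambda>_. unif). \<forall>S\<in>{S \<in> Pow (verts G). \<exists>y. h.\<tau> y S = 0}. h.\<tau> x S = 0"
    by (rule AE_finite_allI) (use one in auto)
  then show ?thesis by eventually_elim (auto simp: gen_def)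
qed

text \<open>For \<open>y\<close>, deleting as many vertices as the nullity gives an invertible
  compression. It remains invertible at the generic \<open>x\<close>, and restoring each vertex
  there adds at most one to the nullity.\<close>

lemma \<tau>_gen_le:
  assumes "x \<in> gen" "S \<subseteq> verts G" shows "h.\<tau> x S \<le> h.\<tau> y S"
proof -
  obtain R where R: "R \<subseteq> S" "h.\<tau> y S = card R" "h.\<tau> y (S - R) = 0" using h.\<tau>_principal[OF assms(2)] by blast
  have fR: "finite R" using R(1) assms(2) finite_verts by (meson finite_subset)
  have "S - R \<subseteq> verts G" using assms(2) by auto
  then have "h.\<tau> x (S - R) = 0" using assms(1) R(3) by (auto simp: gen_def)
  then show ?thesis using h.\<tau>_le_card[OF fR R(1) assms(2)] R(2) by metis
qed

lemma \<tau>_gen_eq: "x \<in> gen \<Longrightarrow> y \<in> gen \<Longrightarrow> S \<subseteq> verts G \<Longrightarrow> h.\<tau> x S = h.\<tau> y S"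
  by (intro antisym \<tau>_gen_le)

definition ess :: "('e \<Rightarrow> real) \<Rightarrow> 'v set \<Rightarrow> 'v set" where
  "ess x S = {v \<in> S. \<exists>f\<in>h.ker x S. rep_l2 f v \<noteq> 0}"

text \<open>Deleting an inessential vertex never lowers the nullity. Essential vertices can thus be
  read off from nullities, and the set of them is the same for all generic phases.\<close>

lemma ess_iff:
  assumes "S \<subseteq> verts G" "v \<in> S" shows "v \<in> ess x S \<longleftrightarrow> h.\<tau> x (S - {v}) = h.\<tau> x S - 1"
proof
  assume "v \<in> ess x S"
  then show "h.\<tau> x (S - {v}) = h.\<tau> x S - 1" using h.\<tau>_delete_essential[OF assms] by (auto simp: ess_def)
next
  assume e: "h.\<tau> x (S - {v}) = h.\<tau> x S - 1"
  show "v \<in> ess x S"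
  proof (rule ccontr)
    assume "v \<notin> ess x S"
    then have z: "\<And>f. f \<in> h.ker x S \<Longrightarrow> rep_l2 f v = 0" using assms(2) by (auto simp: ess_def)
    show False
      using h.\<tau>_delete_inessential[OF assms, where x = x] z e
      by (cases "\<exists>k\<in>h.ker x (S - {v}). rep_l2 (h.triv.M x S k) v \<noteq> 0") auto
  qed
qed

lemma ess_gen_eq: "x \<in> gen \<Longrightarrow> y \<in> gen \<Longrightarrow> S \<subseteq> verts G \<Longrightarrow> ess x S = ess y S"
proof -
  assume a: "x \<in> gen" "y \<in> gen" "S \<subseteq> verts G"
  have "v \<in> ess x S \<longleftrightarrow> v \<in> ess y S" if "v \<in> S" for v
  proof -
    have "S - {v} \<subseteq> verts G" using a by auto
    then show ?thesis using ess_iff[OF a(3) that] \<tau>_gen_eq[OF a] \<tau>_gen_eq[OF a(1,2), of "S - {v}"] by simp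
  qed
  then show ?thesis by (auto simp: ess_def)
qed

lemma cis_ne_1: "0 < d \<Longrightarrow> d < 2 \<Longrightarrow> cis d \<noteq> 1 \<and> Im (cis d) \<noteq> 0" for d :: real
proof -
  assume "0 < d" "d < 2"
  then have "0 < sin d" using pi_gt3 by (intro sin_gt_zero) auto
  then show ?thesis by (auto simp: complex_eq_iff)
qed

end

subsection \<open>Critical vertex sets\<close>

context pre_digraph begin

lemma cas_append: "cas u (c @ d) v \<longleftrightarrow> (\<exists>m. cas u c m \<and> cas m d v)"
  by (induction c arbitrary: u) auto

end

declare (in pre_digraph) cas_append_iff [simp del]

context bidirected_digraph begin

definition revw :: "'b list \<Rightarrow> 'b list" where "revw c = rev (map arev c)"

lemma revw_simps [simp]: "revw [] = []" "revw (e # c) = revw c @ [arev e]"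
  by (simp_all add: revw_def)

lemma set_revw: "set c \<subseteq> arcs G \<Longrightarrow> set (revw c) \<subseteq> arcs G"
  by (auto simp: revw_def)

lemma cas_revw: "set c \<subseteq> arcs G \<Longrightarrow> cas u c v \<Longrightarrow> cas v (revw c) u"
  by (induction c arbitrary: u) (auto simp: cas_append)

end

context twist begin

lemma wx_upd:
  assumes "e \<in> arcs G" "e' \<in> arcs G"
  shows "wx (x(e := t)) e' = (if e' = e then wx x e * cis (t - x e)
    else if e' = arev e then wx x e' * cnj (cis (t - x e)) else wx x e')"
proof -
  have ne: "arev e \<noteq> e" by (rule arev_neq[OF assms(1)])
  have "arev e' = e \<longleftrightarrow> e' = arev e" by (metis arev_arev)
  moreover have "cis (t - x (arev e)) = cis (x e - x (arev e)) * cis (t - x e)"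
    by (simp add: cis_mult)
  moreover have "cis (x (arev e) - t) = cis (x (arev e) - x e) * cnj (cis (t - x e))"
    by (simp add: cis_cnj[symmetric] cis_mult cis_cnj)
  ultimately show ?thesis using ne by (auto simp: wx_def mult.assoc)
qed

lemma wx_nz: "e \<in> arcs G \<Longrightarrow> wx x e \<noteq> 0"
  by (simp add: wx_def w_nz)

abbreviation inner_arcs :: "'v set \<Rightarrow> 'e set" where
  "inner_arcs S \<equiv> {e \<in> arcs G. tail G e \<in> S \<and> head G e \<in> S}"

lemma ker_delete:
  assumes S: "S \<subseteq> verts G" and f: "f \<in> h.ker x S" "rep_l2 f v = 0"
  shows "f \<in> h.ker x (S - {v})"
proof -
  have S': "S - {v} \<subseteq> verts G" using S by auto
  have "(\<Sum>e\<in>{e \<in> out_arcs G a. head G e \<in> S - {v}}. wx x e * rep_l2 f (head G e)) =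
      (\<Sum>e\<in>{e \<in> out_arcs G a. head G e \<in> S}. wx x e * rep_l2 f (head G e))" for a
    by (rule sum.mono_neutral_left) (use f(2) in \<open>auto simp: out_arcs_def intro: finite_subset[OF _ finite_arcs]\<close>)
  then show ?thesis using f by (auto simp: h.ker_iff[OF S'] h.ker_iff[OF S])
qed

lemma ker_agree:
  assumes S: "S \<subseteq> verts G" and "\<And>e. e \<in> inner_arcs S \<Longrightarrow> wx x e = wx y e"
  shows "h.ker x S = h.ker y S"
proof -
  have "(\<Sum>e\<in>{e \<in> out_arcs G a. head G e \<in> S}. wx x e * rep_l2 f (head G e)) =
      (\<Sum>e\<in>{e \<in> out_arcs G a. head G e \<in> S}. wx y e * rep_l2 f (head G e))" if "a \<in> S" for a f
    by (rule sum.cong) (use that assms(2) in auto)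
  then show ?thesis by (auto simp: h.ker_iff[OF S])
qed

text \<open>Otherwise the row of \<open>v\<close> annihilates all kernel vectors for
  \<open>S - {v}\<close>, in particular a vector \<open>f\<close> that is nonzero at the head of
  \<open>e\<close>. A new phase on \<open>e\<close> leaves the compression to \<open>S - {v}\<close>
  unchanged, so the new row of \<open>v\<close> annihilates \<open>f\<close> too. But on
  \<open>f\<close> the two rows differ only in the entry of \<open>e\<close>, where \<open>f\<close>
  does not vanish.\<close>

lemma delete_boundary:
  assumes x: "x \<in> gen" and S: "S \<subseteq> verts G" and v: "v \<in> S" "v \<notin> ess x S"
    and e: "e \<in> arcs G" "tail G e = v" "head G e \<in> ess x S"
  shows "h.\<tau> x (S - {v}) = h.\<tau> x S + 1"
proof (rule ccontr)
  assume ne: "h.\<tau> x (S - {v}) \<noteq> h.\<tau> x S + 1"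
  have S': "S - {v} \<subseteq> verts G" using S by auto
  have uv: "head G e \<noteq> v" using e(3) v(2) by auto
  have uS: "head G e \<in> S" using e(3) by (simp add: ess_def)
  obtain f where f: "f \<in> h.ker x S" "rep_l2 f (head G e) \<noteq> 0" using e(3) by (auto simp: ess_def)
  have fv: "rep_l2 f v = 0" using v f(1) by (auto simp: ess_def)
  have fS': "f \<in> h.ker x (S - {v})" by (rule ker_delete[OF S f(1) fv])
  have zx: "\<And>g. g \<in> h.ker x S \<Longrightarrow> rep_l2 g v = 0" using v by (auto simp: ess_def)
  have \<tau>x: "h.\<tau> x (S - {v}) = h.\<tau> x S"
    using h.\<tau>_delete_inessential[OF S v(1), where x = x] zx ne by blast
  have Mx: "rep_l2 (h.triv.M x S f) v = 0"
    using h.\<tau>_delete_inessential(1)[OF S v(1), where x = x] zx ne fS' by blast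
  obtain t where t: "x e < t" "t < x e + 1" "x(e := t) \<in> gen" using gen_perturb[OF x, of "{}" e] by auto
  define y where "y = x(e := t)"
  have y: "y \<in> gen" using t by (simp add: y_def)
  have wxy: "wx y e' = (if e' = e then wx x e * cis (t - x e) else if e' = arev e then wx x e' * cnj (cis (t - x e)) else wx x e')"
    if "e' \<in> arcs G" for e' unfolding y_def by (rule wx_upd[OF e(1) that])
  have zy: "\<And>g. g \<in> h.ker y S \<Longrightarrow> rep_l2 g v = 0"
    using v ess_gen_eq[OF x y S] by (auto simp: ess_def)
  have "h.ker x (S - {v}) = h.ker y (S - {v})"
    by (rule ker_agree[OF S']) (use e in \<open>auto simp: wxy\<close>)
  then have fy: "f \<in> h.ker y (S - {v})" using fS' by simp
  have "h.\<tau> y (S - {v}) \<noteq> h.\<tau> y S + 1"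
    using \<tau>_gen_eq[OF x y S] \<tau>_gen_eq[OF x y S'] ne by simp
  then have My: "rep_l2 (h.triv.M y S f) v = 0"
    using h.\<tau>_delete_inessential(1)[OF S v(1), where x = y] zy fy by blast
  have fS: "finite S" using S finite_verts by (rule finite_subset)
  have vG: "v \<in> verts G" using S v by auto
  define E where "E = {e' \<in> out_arcs G v. head G e' \<in> S}"
  have fE: "finite E" by (auto simp: E_def out_arcs_def intro: finite_subset[OF _ finite_arcs])
  have eE: "e \<in> E" using e uS by (auto simp: E_def)
  have "(\<Sum>e'\<in>E. (wx y e' - wx x e') * rep_l2 f (head G e')) = 0"
    using Mx My v(1) vG
    by (simp add: h.triv.rep_Mop[OF fS] E_def left_diff_distrib sum_subtractf fv)
  moreover have "(\<Sum>e'\<in>E. (wx y e' - wx x e') * rep_l2 f (head G e')) = (\<Sum>e'\<in>E. if e' = e then (wx y e - wx x e) * rep_l2 f (head G e) else 0)"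
  proof (rule sum.cong[OF refl])
    fix e' assume e': "e' \<in> E"
    then have "e' \<noteq> arev e" using e uv by (auto simp: E_def)
    then show "(wx y e' - wx x e') * rep_l2 f (head G e') = (if e' = e then (wx y e - wx x e) * rep_l2 f (head G e) else 0)"
      using e' wxy[of e'] by (auto simp: E_def)
  qed
  ultimately have "(wx y e - wx x e) * rep_l2 f (head G e) = 0" using fE eE by simp
  then have "wx x e * (cis (t - x e) - 1) = 0" using f(2) wxy[OF e(1)] by (simp add: algebra_simps)
  then show False using wx_nz[OF e(1)] cis_ne_1[of "t - x e"] t by auto
qed

lemma ker_pairing:
  fixes g :: "'v \<Rightarrow> complex"
  assumes S: "S \<subseteq> verts G" and f: "f \<in> h.ker x S"
  shows "(\<Sum>e\<in>inner_arcs S. wx x e * rep_l2 f (head G e) * g (tail G e)) + (\<Sum>a\<in>S. V a * rep_l2 f a * g a) = 0"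
proof -
  have fS: "finite S" using S finite_verts by (rule finite_subset)
  have "(\<Sum>e\<in>inner_arcs S. wx x e * rep_l2 f (head G e) * g (tail G e)) =
      (\<Sum>a\<in>S. \<Sum>e\<in>{e \<in> inner_arcs S. tail G e = a}. wx x e * rep_l2 f (head G e) * g (tail G e))"
    by (rule sum.group[symmetric]) (use fS in auto)
  also have "\<dots> = (\<Sum>a\<in>S. (\<Sum>e\<in>{e \<in> out_arcs G a. head G e \<in> S}. wx x e * rep_l2 f (head G e)) * g a)"
  proof (rule sum.cong[OF refl])
    fix a assume "a \<in> S"
    then have "{e \<in> inner_arcs S. tail G e = a} = {e \<in> out_arcs G a. head G e \<in> S}" by auto
    then show "(\<Sum>e\<in>{e \<in> inner_arcs S. tail G e = a}. wx x e * rep_l2 f (head G e) * g (tail G e)) =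
        (\<Sum>e\<in>{e \<in> out_arcs G a. head G e \<in> S}. wx x e * rep_l2 f (head G e)) * g a"
      by (simp add: sum_distrib_right)
  qed
  finally have "(\<Sum>e\<in>inner_arcs S. wx x e * rep_l2 f (head G e) * g (tail G e)) + (\<Sum>a\<in>S. V a * rep_l2 f a * g a) =
      (\<Sum>a\<in>S. ((\<Sum>e\<in>{e \<in> out_arcs G a. head G e \<in> S}. wx x e * rep_l2 f (head G e)) + V a * rep_l2 f a) * g a)"
    by (simp add: distrib_right sum.distrib)
  also have "\<dots> = 0" by (rule sum.neutral) (use f in \<open>auto simp: h.ker_iff[OF S]\<close>)
  finally show ?thesis .
qed

text \<open>Pair a kernel vector for the new phase with one for the old phase. The two operators
  differ only in \<open>e\<close> and its reverse, so all other terms cancel, and the two that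
  remain share the factor \<open>cis (t - x e) - 1\<close>.\<close>

lemma flip:
  assumes S: "S \<subseteq> verts G" and e: "e \<in> inner_arcs S"
    and \<psi>: "\<psi> \<in> h.ker x S" and \<eta>: "\<eta> \<in> h.ker (x(e := t)) S" and z: "cis (t - x e) \<noteq> 1"
  shows "wx (x(e := t)) e * rep_l2 \<eta> (head G e) * cnj (rep_l2 \<psi> (tail G e)) =
    cnj (wx x e) * rep_l2 \<eta> (tail G e) * cnj (rep_l2 \<psi> (head G e))"
proof -
  define y where "y = x(e := t)"
  define \<zeta> where "\<zeta> = cis (t - x e)"
  define a where "a = wx x e"
  have eG: "e \<in> arcs G" using e by auto
  have zz: "\<zeta> * cnj \<zeta> = 1" by (simp add: \<zeta>_def cis_cnj cis_mult)
  have wxy: "wx y e' = (if e' = e then wx x e * \<zeta> else if e' = arev e then wx x e' * cnj \<zeta> else wx x e')"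
    if "e' \<in> arcs G" for e' unfolding y_def \<zeta>_def by (rule wx_upd[OF eG that])
  have fin: "finite (inner_arcs S)" by simp
  define F where "F = (\<lambda>e'. rep_l2 \<eta> (head G e') * cnj (rep_l2 \<psi> (tail G e')))"
  have 1: "(\<Sum>e'\<in>inner_arcs S. wx y e' * F e') + (\<Sum>b\<in>S. V b * rep_l2 \<eta> b * cnj (rep_l2 \<psi> b)) = 0"
    using ker_pairing[OF S \<eta>, of "\<lambda>b. cnj (rep_l2 \<psi> b)"] by (simp add: F_def y_def mult.assoc)
  have "cnj ((\<Sum>e'\<in>inner_arcs S. wx x e' * rep_l2 \<psi> (head G e') * cnj (rep_l2 \<eta> (tail G e'))) + (\<Sum>b\<in>S. V b * rep_l2 \<psi> b * cnj (rep_l2 \<eta> b))) = 0"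
    using ker_pairing[OF S \<psi>, of "\<lambda>b. cnj (rep_l2 \<eta> b)"] by simp
  then have a1: "(\<Sum>e'\<in>inner_arcs S. cnj (wx x e') * cnj (rep_l2 \<psi> (head G e')) * rep_l2 \<eta> (tail G e')) + (\<Sum>b\<in>S. V b * rep_l2 \<eta> b * cnj (rep_l2 \<psi> b)) = 0"
    by (simp add: cnj_sum mult.commute mult.left_commute)
  have a2: "(\<Sum>e'\<in>inner_arcs S. cnj (wx x e') * cnj (rep_l2 \<psi> (head G e')) * rep_l2 \<eta> (tail G e')) = (\<Sum>e'\<in>inner_arcs S. wx x e' * F e')"
    by (rule sum.reindex_bij_witness[of _ arev arev]) (auto simp: wx_arev F_def)
  have 2: "(\<Sum>e'\<in>inner_arcs S. wx x e' * F e') + (\<Sum>b\<in>S. V b * rep_l2 \<eta> b * cnj (rep_l2 \<psi> b)) = 0"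
    using a1 unfolding a2 .
  have "(\<Sum>e'\<in>inner_arcs S. (wx y e' - wx x e') * F e') = 0"
  proof -
    have "(\<Sum>e'\<in>inner_arcs S. wx y e' * F e') = (\<Sum>e'\<in>inner_arcs S. wx x e' * F e')"
      by (rule add_right_imp_eq[OF trans[OF 1 2[symmetric]]])
    then show ?thesis by (simp add: left_diff_distrib sum_subtractf)
  qed
  moreover have "(\<Sum>e'\<in>inner_arcs S. (wx y e' - wx x e') * F e') = (\<Sum>e'\<in>{e, arev e}. (wx y e' - wx x e') * F e')"
    by (rule sum.mono_neutral_right[OF fin]) (use e in \<open>auto simp: wxy\<close>)
  moreover have "\<dots> = (wx y e - wx x e) * F e + (wx y (arev e) - wx x (arev e)) * F (arev e)"
    using arev_neq[OF eG] by (subst sum.insert) auto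
  ultimately have "(\<zeta> - 1) * (a * F e) + (cnj \<zeta> - 1) * (cnj a * F (arev e)) = 0"
    using arev_neq[OF eG] eG by (simp add: wxy wx_arev a_def algebra_simps)
  \<comment> \<open>Since \<zeta> is unimodular, multiplication by it turns
    \<open>cnj \<zeta> - 1\<close> into \<open>1 - \<zeta>\<close>, and the common factor
    appears.\<close>
  then have "\<zeta> * ((\<zeta> - 1) * (a * F e) + (cnj \<zeta> - 1) * (cnj a * F (arev e))) = 0" by simp
  moreover have "\<zeta> * ((\<zeta> - 1) * (a * F e) + (cnj \<zeta> - 1) * (cnj a * F (arev e))) =
      (\<zeta> - 1) * (\<zeta> * a * F e) + (\<zeta> * cnj \<zeta> - \<zeta>) * (cnj a * F (arev e))"
    by (simp add: algebra_simps)
  ultimately have "(\<zeta> - 1) * (\<zeta> * a * F e - cnj a * F (arev e)) = 0"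
    unfolding zz by (simp add: algebra_simps)
  then have "\<zeta> * a * F e = cnj a * F (arev e)" using z by (simp add: \<zeta>_def)
  then show ?thesis using eG wxy[OF eG] by (simp add: F_def a_def y_def mult.commute mult.left_commute mult.assoc)
qed

end

section \<open>Rigidity of kernel vectors on a critical set\<close>

locale critical = twist G arev w V
  for G :: "('v, 'e) pre_digraph" and arev w V +
  fixes x0 :: "'e \<Rightarrow> real" and S :: "'v set"
  assumes x0: "x0 \<in> gen" and S: "S \<subseteq> verts G" "S \<noteq> {}" and all_ess: "ess x0 S = S"
    and conn: "\<And>A. A \<subseteq> S \<Longrightarrow> A \<noteq> {} \<Longrightarrow> A \<noteq> S \<Longrightarrow> \<exists>e\<in>arcs G. tail G e \<in> A \<and> head G e \<in> S - A"
begin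

lemma gen_ess: "x \<in> gen \<Longrightarrow> v \<in> S \<Longrightarrow> \<exists>f\<in>h.ker x S. rep_l2 f v \<noteq> 0"
  using ess_gen_eq[OF x0 _ S(1)] all_ess by (auto simp: ess_def)

text \<open>A single kernel vector \<eta> for a neighbouring phase, nonzero at the tail of
  \<open>e\<close>, turns \<open>flip\<close> into one linear relation that all kernel vectors at
  \<open>x\<close> satisfy.\<close>

lemma ratio:
  assumes x: "x \<in> gen" and e: "e \<in> inner_arcs S"
  shows "\<exists>c. \<forall>\<psi>\<in>h.ker x S. rep_l2 \<psi> (head G e) = c * rep_l2 \<psi> (tail G e)"
proof -
  obtain t where t: "x e < t" "t < x e + 1" "x(e := t) \<in> gen" using gen_perturb[OF x, of "{}" e] by auto
  obtain \<eta> where \<eta>: "\<eta> \<in> h.ker (x(e := t)) S" "rep_l2 \<eta> (tail G e) \<noteq> 0" using gen_ess[OF t(3), of "tail G e"] e by auto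
  define d where "d = wx (x(e := t)) e * rep_l2 \<eta> (head G e) / (cnj (wx x e) * rep_l2 \<eta> (tail G e))"
  have nz: "cnj (wx x e) * rep_l2 \<eta> (tail G e) \<noteq> 0" using wx_nz[of e x] e \<eta>(2) by auto
  have "rep_l2 \<psi> (head G e) = cnj d * rep_l2 \<psi> (tail G e)" if \<psi>: "\<psi> \<in> h.ker x S" for \<psi>
  proof -
    have "cis (t - x e) \<noteq> 1" using cis_ne_1[of "t - x e"] t by auto
    from flip[OF S(1) e \<psi> \<eta>(1) this]
    have "cnj (rep_l2 \<psi> (head G e)) = d * cnj (rep_l2 \<psi> (tail G e))"
      using nz by (simp add: d_def field_simps)
    then show ?thesis by (metis complex_cnj_cnj complex_cnj_mult)
  qed
  then show ?thesis by blast
qed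

text \<open>By \<open>ratio\<close> a zero at the tail of an arc forces one at its head, so in the
  connected set \<open>S\<close> the zeros spread everywhere. The kernel is therefore a
  line.\<close>

lemma nowhere_zero:
  assumes x: "x \<in> gen" and \<psi>: "\<psi> \<in> h.ker x S" "\<psi> \<noteq> 0" and u: "u \<in> S"
  shows "rep_l2 \<psi> u \<noteq> 0"
proof
  assume "rep_l2 \<psi> u = 0"
  define A where "A = {a \<in> S. rep_l2 \<psi> a = 0}"
  have "u \<in> A" using u \<open>rep_l2 \<psi> u = 0\<close> by (simp add: A_def)
  have "A = S"
  proof (rule ccontr)
    assume "A \<noteq> S"
    then obtain e where e: "e \<in> arcs G" "tail G e \<in> A" "head G e \<in> S - A"
      using conn[of A] \<open>u \<in> A\<close> by (auto simp: A_def)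
    then obtain c where "rep_l2 \<psi> (head G e) = c * rep_l2 \<psi> (tail G e)"
      using ratio[OF x, of e] \<psi>(1) by (auto simp: A_def)
    then show False using e by (auto simp: A_def)
  qed
  then have "rep_l2 \<psi> a = 0" for a using \<psi>(1) h.ker_iff[OF S(1)] by (cases "a \<in> S") (auto simp: A_def)
  then have "\<psi> = 0" by (intro l2_eqI) simp
  then show False using \<psi>(2) by simp
qed

lemma \<tau>_critical: "h.\<tau> x0 S \<le> 1"
proof -
  obtain v where v: "v \<in> S" using S(2) by blast
  show ?thesis by (rule h.\<tau>_le_1[OF S(1) v]) (use nowhere_zero[OF x0] v in blast)
qed

definition psi :: "('e \<Rightarrow> real) \<Rightarrow> 'v \<Rightarrow> complex" where
  "psi x = rep_l2 (SOME f. f \<in> h.ker x S \<and> f \<noteq> 0)"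

lemma psi_ker: "x \<in> gen \<Longrightarrow> \<exists>f\<in>h.ker x S. f \<noteq> 0 \<and> psi x = rep_l2 f"
proof -
  assume x: "x \<in> gen"
  obtain v where v: "v \<in> S" using S(2) by blast
  have "\<exists>f. f \<in> h.ker x S \<and> f \<noteq> 0" using gen_ess[OF x v] by (metis rep_l2_simps(1))
  from someI_ex[OF this] show ?thesis by (auto simp: psi_def)
qed

lemma psi_nz: "x \<in> gen \<Longrightarrow> u \<in> S \<Longrightarrow> psi x u \<noteq> 0"
  using psi_ker nowhere_zero by metis

text \<open>The share of the arc in the kernel equation at its tail, relative to the value of the
  vector there; rescaling \<open>psi\<close> does not change it.\<close>

definition cur :: "('e \<Rightarrow> real) \<Rightarrow> 'e \<Rightarrow> complex" where
  "cur x e = wx x e * psi x (head G e) / psi x (tail G e)"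

lemma cur_flip:
  assumes "x \<in> gen" "x(e := t) \<in> gen" "e \<in> inner_arcs S" "cis (t - x e) \<noteq> 1"
  shows "cur (x(e := t)) e = cnj (cur x e)"
proof -
  obtain f g where f: "f \<in> h.ker x S" "psi x = rep_l2 f" and g: "g \<in> h.ker (x(e := t)) S" "psi (x(e := t)) = rep_l2 g"
    using psi_ker[OF assms(1)] psi_ker[OF assms(2)] by blast
  from flip[OF S(1) assms(3) f(1) g(1) assms(4)] show ?thesis
    using psi_nz[OF assms(1), of "tail G e"] psi_nz[OF assms(2), of "tail G e"] assms(3)
    by (simp add: cur_def f(2)[symmetric] g(2)[symmetric] field_simps)
qed

text \<open>Take three phases of \<open>e\<close>, with \<open>t\<close> and \<open>s\<close> new.
  Changing to \<open>t\<close> or to \<open>s\<close> conjugates the value, and changing from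
  \<open>t\<close> to \<open>s\<close> conjugates it once more. So the value at \<open>s\<close> is
  the original one as well as its conjugate.\<close>

lemma cur_real:
  assumes x: "x \<in> gen" and e: "e \<in> inner_arcs S" shows "cur x e \<in> \<real>"
proof -
  obtain t where t: "x e < t" "t < x e + 1" "x(e := t) \<in> gen" using gen_perturb[OF x, of "{}" e] by auto
  obtain s where s: "t < s" "s < t + 1" "x(e := s) \<in> gen" using gen_perturb[OF t(3), of "{}" e] by auto
  have 1: "cur (x(e := t)) e = cnj (cur x e)"
    by (rule cur_flip[OF x t(3) e]) (use cis_ne_1[of "t - x e"] t in auto)
  have 2: "cur (x(e := s)) e = cnj (cur x e)"
    by (rule cur_flip[OF x s(3) e]) (use cis_ne_1[of "s - x e"] t s in auto)
  have "cur ((x(e := t))(e := s)) e = cnj (cur (x(e := t)) e)"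
    by (rule cur_flip[OF t(3) _ e]) (use cis_ne_1[of "s - t"] s in auto)
  then have "cnj (cur x e) = cur x e" using 1 2 by simp
  then show ?thesis by (simp add: Reals_cnj_iff)
qed

section \<open>Closed walks in a critical set: the absence of cycles\<close>

lemma walk_product:
  assumes x: "x \<in> gen"
  shows "set c \<subseteq> inner_arcs S \<Longrightarrow> cas u c v \<Longrightarrow> u \<in> S \<Longrightarrow>
    prod_list (map (wx x) c) * psi x v = prod_list (map (cur x) c) * psi x u"
proof (induction c arbitrary: u)
  case (Cons e c)
  then have "prod_list (map (wx x) c) * psi x v = prod_list (map (cur x) c) * psi x (head G e)" by auto
  moreover have "wx x e * psi x (head G e) = cur x e * psi x u"
    using Cons.prems psi_nz[OF x, of u] by (auto simp: cur_def)
  ultimately show ?case by (simp add: mult.assoc mult.left_commute)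
qed simp

text \<open>Around a closed walk the values of \<open>psi\<close> cancel, and a product of real
  ratios remains.\<close>

lemma closed_walk_real:
  assumes x: "x \<in> gen" and c: "set c \<subseteq> inner_arcs S" "cas u c u" "u \<in> S"
  shows "prod_list (map (wx x) c) \<in> \<real>" "prod_list (map (wx x) c) \<noteq> 0"
proof -
  have "prod_list (map (wx x) c) = prod_list (map (cur x) c)"
    using walk_product[OF x c] psi_nz[OF x c(3)] by simp
  moreover have "prod_list (map (cur x) c) \<in> \<real>"
    using c(1) by (induction c) (auto intro!: Reals_mult cur_real[OF x])
  ultimately show "prod_list (map (wx x) c) \<in> \<real>" by simp
  show "prod_list (map (wx x) c) \<noteq> 0" using c(1) wx_nz by (auto simp: prod_list_zero_iff)
qed

text \<open>The product of the weights along the walk is real and nonzero for all generic phases,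
  but a new phase on \<open>e\<close> multiplies it by a nonreal number, since the edge is passed
  only once.\<close>

lemma no_single_crossing:
  assumes c: "set c \<subseteq> inner_arcs S" "cas u (e # c) u" "e \<in> inner_arcs S" "e \<notin> set c" "arev e \<notin> set c"
  shows False
proof -
  have eG: "e \<in> arcs G" and uS: "u \<in> S" using c by auto
  obtain t where t: "x0 e < t" "t < x0 e + 1" "x0(e := t) \<in> gen" using gen_perturb[OF x0, of "{}" e] by auto
  define y where "y = x0(e := t)"
  have "wx y e' = wx x0 e'" if "e' \<in> set c" for e'
    unfolding y_def using wx_upd[OF eG, of e'] that c by auto
  then have m: "map (wx y) c = map (wx x0) c" by simp
  have "wx y e = cis (t - x0 e) * wx x0 e" using wx_upd[OF eG eG, of x0 t] by (simp add: y_def)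
  then have p: "prod_list (map (wx y) (e # c)) = cis (t - x0 e) * prod_list (map (wx x0) (e # c))"
    by (simp only: list.map prod_list.Cons m mult.assoc)
  define P where "P = prod_list (map (wx x0) (e # c))"
  have "P \<in> \<real>" "P \<noteq> 0" "cis (t - x0 e) * P \<in> \<real>"
    using closed_walk_real[OF x0, of "e # c" u] closed_walk_real(1)[of y "e # c" u] c uS t(3) p
    by (auto simp: P_def y_def)
  then have "cis (t - x0 e) * P / P \<in> \<real>" by (intro Reals_divide)
  then have "cis (t - x0 e) \<in> \<real>" using \<open>P \<noteq> 0\<close> by simp
  then have "Im (cis (t - x0 e)) = 0" by (simp add: complex_is_Real_iff)
  then show False using cis_ne_1[of "t - x0 e"] t by auto
qed

text \<open>This is the tree property. If the edge of the first arc is passed again, it cuts off a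
  shorter closed walk or gives a backtrack at once; if not, it is crossed exactly once.\<close>

lemma backtrack_exists:
  assumes "set c \<subseteq> inner_arcs S" "cas u c u" "c \<noteq> []"
  shows "\<exists>us e vs. c = us @ [e, arev e] @ vs"
  using assms
proof (induction "length c" arbitrary: c u rule: less_induct)
  case less
  obtain e d where c: "c = e # d" using less.prems(3) by (cases c) auto
  have e: "e \<in> inner_arcs S" "tail G e = u" "cas (head G e) d u" using less.prems by (auto simp: c)
  consider "e \<in> set d" | "arev e \<in> set d" | "e \<notin> set d" "arev e \<notin> set d" by blast
  then show ?case
  proof cases
    case 1
    then obtain as bs where d: "d = as @ e # bs" by (meson split_list)
    then have "cas u (e # as) u" using e by (auto simp: cas_append)
    then have "\<exists>us f vs. e # as = us @ [f, arev f] @ vs"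
      using less.hyps[of "e # as" u] less.prems(1) by (auto simp: c d)
    then obtain us f vs where "e # as = us @ [f, arev f] @ vs" by blast
    then have "c = us @ [f, arev f] @ (vs @ e # bs)" using arg_cong[of "e # as" _ "\<lambda>l. l @ e # bs"] by (simp add: c d)
    then show ?thesis by blast
  next
    case 2
    then obtain as bs where d: "d = as @ arev e # bs" by (meson split_list)
    show ?thesis
    proof (cases "as = []")
      case True
      then have "c = [] @ [e, arev e] @ bs" by (simp add: c d)
      then show ?thesis by blast
    next
      case False
      have "cas (head G e) as (head G e)" using e by (auto simp: d cas_append)
      then obtain us f vs where "as = us @ [f, arev f] @ vs"
        using less.hyps[of as "head G e"] less.prems(1) False by (auto simp: c d)
      then have "c = (e # us) @ [f, arev f] @ (vs @ arev e # bs)" by (simp add: c d)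
      then show ?thesis by blast
    qed
  next
    case 3
    then show ?thesis using no_single_crossing[of d u e] less.prems e by (auto simp: c)
  qed
qed

text \<open>Every closed walk in \<open>S\<close> reduces to the empty one by removing backtracks.
  It will be used for the product of the phases and for the lifts to a cover, both of which ignore
  backtracks.\<close>

lemma closed_walk_induct [consumes 2, case_names Nil backtrack]:
  assumes "set c \<subseteq> inner_arcs S" "cas u c u"
    and "P []"
    and "\<And>us e vs. e \<in> inner_arcs S \<Longrightarrow> set us \<subseteq> inner_arcs S \<Longrightarrow> set vs \<subseteq> inner_arcs S \<Longrightarrow>
      cas u us (tail G e) \<Longrightarrow> P (us @ vs) \<Longrightarrow> P (us @ [e, arev e] @ vs)"
  shows "P c"
  using assms(1,2)
proof (induction "length c" arbitrary: c rule: less_induct)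
  case less
  show ?case
  proof (cases "c = []")
    case True then show ?thesis using assms(3) by simp
  next
    case False
    then obtain us e vs where c: "c = us @ [e, arev e] @ vs" using backtrack_exists less.prems by blast
    have e: "e \<in> inner_arcs S" using less.prems by (simp add: c)
    have cs: "cas u us (tail G e)" "cas (tail G e) vs u" using less.prems e by (auto simp: c cas_append)
    then have "cas u (us @ vs) u" by (auto simp: cas_append)
    then have "P (us @ vs)" using less.hyps[of "us @ vs"] less.prems by (simp add: c)
    then show ?thesis unfolding c by (intro assms(4)) (use e cs less.prems in \<open>auto simp: c\<close>)
  qed
qed

lemma walk_exists:
  assumes "u \<in> S" "v \<in> S" shows "\<exists>c. set c \<subseteq> inner_arcs S \<and> cas u c v"
proof -
  define A where "A = {v \<in> S. \<exists>c. set c \<subseteq> inner_arcs S \<and> cas u c v}"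
  have uA: "u \<in> A" using assms by (auto simp: A_def intro!: exI[of _ "[]"])
  have "A = S"
  proof (rule ccontr)
    assume "A \<noteq> S"
    moreover have "A \<subseteq> S" by (auto simp: A_def)
    ultimately obtain e where e: "e \<in> arcs G" "tail G e \<in> A" "head G e \<in> S - A"
      using conn[of A] uA by blast
    then obtain c where c: "set c \<subseteq> inner_arcs S" "cas u c (tail G e)" by (auto simp: A_def)
    have "set (c @ [e]) \<subseteq> inner_arcs S" using c e by (auto simp: A_def)
    moreover have "cas u (c @ [e]) (head G e)" using c by (auto simp: cas_append)
    ultimately have "head G e \<in> A" using e by (auto simp: A_def)
    then show False using e by simp
  qed
  then show ?thesis using assms by (auto simp: A_def)
qed

abbreviation phase :: "'e list \<Rightarrow> complex" where
  "phase c \<equiv> prod_list (map (\<lambda>e. cis (x0 e - x0 (arev e))) c)"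

lemma phase_closed: "set c \<subseteq> inner_arcs S \<Longrightarrow> cas u c u \<Longrightarrow> phase c = 1"
proof (induction rule: closed_walk_induct)
  case (backtrack us e vs)
  then show ?case by (simp add: cis_mult mult.assoc[symmetric])
qed simp

lemma phase_revw: "phase (revw c) * phase c = 1"
proof (induction c)
  case (Cons e c)
  have "phase (revw (e # c)) * phase (e # c) =
      (cis (x0 (arev e) - x0 e) * cis (x0 e - x0 (arev e))) * (phase (revw c) * phase c)"
    by (simp add: mult_ac)
  also have "\<dots> = 1" unfolding Cons.IH by (simp add: cis_mult)
  finally show ?case .
qed simp

lemma inner_revw: "set c \<subseteq> inner_arcs S \<Longrightarrow> set (revw c) \<subseteq> inner_arcs S"
  by (auto simp: revw_def)

lemma phase_unique:
  assumes "set c \<subseteq> inner_arcs S" "cas u c v" "set d \<subseteq> inner_arcs S" "cas u d v"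
  shows "phase c = phase d"
proof -
  have "cas u (c @ revw d) u" using assms cas_revw[of d u v] by (auto simp: cas_append)
  then have "phase (c @ revw d) = 1" using phase_closed[of "c @ revw d" u] assms inner_revw[of d] by simp
  then have "phase c * phase (revw d) = phase d * phase (revw d)" using phase_revw[of d] by (simp add: mult.commute)
  then show ?thesis using phase_revw[of d] by auto
qed

text \<open>The tree structure of a critical set allows one to gauge the phases away.\<close>

lemma untwisted_kernel:
  obtains \<psi> :: "'v \<Rightarrow> complex" where "\<And>u. u \<in> S \<Longrightarrow> \<psi> u \<noteq> 0"
    "\<And>u. u \<in> S \<Longrightarrow> (\<Sum>e\<in>{e \<in> out_arcs G u. head G e \<in> S}. w e * \<psi> (head G e)) + V u * \<psi> u = 0"
proof -
  obtain v0 where v0: "v0 \<in> S" using S(2) by blast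
  have "\<forall>u\<in>S. \<exists>c. set c \<subseteq> inner_arcs S \<and> cas v0 c u" using walk_exists[OF v0] by blast
  then obtain c where c: "\<And>u. u \<in> S \<Longrightarrow> set (c u) \<subseteq> inner_arcs S" "\<And>u. u \<in> S \<Longrightarrow> cas v0 (c u) u" by metis
  define \<gamma> where "\<gamma> = (\<lambda>u. phase (c u))"
  have \<gamma>: "\<gamma> (head G e) = \<gamma> (tail G e) * cis (x0 e - x0 (arev e))" if e: "e \<in> inner_arcs S" for e
  proof -
    have "phase (c (head G e)) = phase (c (tail G e) @ [e])"
      by (rule phase_unique[of _ v0 "head G e"]) (use c[of "head G e"] c[of "tail G e"] e in \<open>auto simp: cas_append\<close>)
    then show ?thesis by (simp add: \<gamma>_def)
  qed
  have \<gamma>nz: "\<gamma> u \<noteq> 0" for u unfolding \<gamma>_def using phase_revw[of "c u"] by auto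
  obtain f where f: "f \<in> h.ker x0 S" "psi x0 = rep_l2 f" using psi_ker[OF x0] by blast
  define \<psi> where "\<psi> = (\<lambda>u. \<gamma> u * rep_l2 f u)"
  show thesis
  proof (rule that)
    show "\<psi> u \<noteq> 0" if "u \<in> S" for u using psi_nz[OF x0 that] \<gamma>nz by (simp add: \<psi>_def f(2))
    show "(\<Sum>e\<in>{e \<in> out_arcs G u. head G e \<in> S}. w e * \<psi> (head G e)) + V u * \<psi> u = 0" if u: "u \<in> S" for u
    proof -
      have "(\<Sum>e\<in>{e \<in> out_arcs G u. head G e \<in> S}. w e * \<psi> (head G e)) =
          (\<Sum>e\<in>{e \<in> out_arcs G u. head G e \<in> S}. \<gamma> u * (wx x0 e * rep_l2 f (head G e)))"
        by (rule sum.cong) (use u in \<open>auto simp: \<psi>_def \<gamma> wx_def\<close>)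
      then have "(\<Sum>e\<in>{e \<in> out_arcs G u. head G e \<in> S}. w e * \<psi> (head G e)) + V u * \<psi> u =
          \<gamma> u * ((\<Sum>e\<in>{e \<in> out_arcs G u. head G e \<in> S}. wx x0 e * rep_l2 f (head G e)) + V u * rep_l2 f u)"
        by (simp add: sum_distrib_left distrib_left \<psi>_def mult.left_commute)
      then show ?thesis using f(1) u by (simp add: h.ker_iff[OF S(1)])
    qed
  qed
qed

end

subsection \<open>Walks in a cover\<close>

context lift_sys begin

abbreviation lw :: "'x \<Rightarrow> 'e list \<Rightarrow> 'x" where "lw \<equiv> foldl L"

lemma lw_in: "x \<in> X \<Longrightarrow> set c \<subseteq> arcs G \<Longrightarrow> cas (p x) c v \<Longrightarrow> lw x c \<in> X \<and> p (lw x c) = v"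
  by (induction c arbitrary: x) (auto simp: L_in p_L)

lemma lw_revw: "x \<in> X \<Longrightarrow> set c \<subseteq> arcs G \<Longrightarrow> cas (p x) c v \<Longrightarrow> lw (lw x c) (revw c) = x"
proof (induction c arbitrary: x)
  case (Cons e c)
  then have "lw (lw (L x e) c) (revw c) = L x e" by (auto simp: L_in p_L)
  then show ?case using Cons.prems by (simp add: L_L)
qed simp

end

locale cover_critical = deck_weights G arev X p L \<Phi> s w V + critical G arev w V x0 S
  for G :: "('v, 'e) pre_digraph" and arev and X :: "'x set" and p L \<Phi> s w V x0 S
begin

lemma lw_closed:
  assumes "x \<in> X" "p x = u" "set c \<subseteq> inner_arcs S" "cas u c u" shows "lw x c = x"
  using assms(3,4)
proof (induction rule: closed_walk_induct)
  case (backtrack us e vs)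
  have "lw x us \<in> X \<and> p (lw x us) = tail G e"
    by (rule lw_in) (use backtrack assms in auto)
  then show ?case using backtrack by (simp add: L_L)
qed simp

text \<open>Since closed walks in \<open>S\<close> lift to closed walks, lifting along walks from
  \<open>v0\<close> gives a section \<open>t\<close> over \<open>S\<close>. Its image contains both
  ends or neither end of every lifted arc over \<open>S\<close>, so \<psi> transplanted to it is a
  finitely supported kernel vector \<open>f\<close>. By Cauchy-Schwarz the diagonal entry over
  \<open>u\<close> is at least |\<psi>(u)|^2 / |f|^2, and these bounds sum to 1.\<close>

theorem tr_critical: "1 \<le> tr (N S)"
proof -
  note S1 = S(1)
  have fS: "finite S" using fin_sub[OF S1] .
  obtain v0 where v0: "v0 \<in> S" using S(2) by blast
  define y0 where "y0 = s v0"
  have y0: "y0 \<in> X" "p y0 = v0" using s[of v0] v0 S1 by (auto simp: y0_def)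
  obtain \<psi> :: "'v \<Rightarrow> complex" where \<psi>: "\<And>u. u \<in> S \<Longrightarrow> \<psi> u \<noteq> 0"
    "\<And>u. u \<in> S \<Longrightarrow> (\<Sum>e\<in>{e \<in> out_arcs G u. head G e \<in> S}. w e * \<psi> (head G e)) + V u * \<psi> u = 0"
    using untwisted_kernel by blast
  have "\<forall>u\<in>S. \<exists>c. set c \<subseteq> inner_arcs S \<and> cas v0 c u" using walk_exists[OF v0] by blast
  then obtain c where c: "\<And>u. u \<in> S \<Longrightarrow> set (c u) \<subseteq> inner_arcs S" "\<And>u. u \<in> S \<Longrightarrow> cas v0 (c u) u" by metis
  define t where "t = (\<lambda>u. lw y0 (c u))"
  have tX: "t u \<in> X" "p (t u) = u" if "u \<in> S" for u
    using lw_in[OF y0(1), of "c u" u] c[OF that] y0(2) by (auto simp: t_def)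
  have tL: "L (t u) e = t (head G e)" if u: "u \<in> S" and e: "e \<in> out_arcs G u" "head G e \<in> S" for u e
  proof -
    have eI: "e \<in> inner_arcs S" using u e by auto
    define z where "z = t (head G e)"
    have z: "z \<in> X" "p z = head G e" using tX[OF e(2)] by (auto simp: z_def)
    define d where "d = revw (c (head G e)) @ c u @ [e]"
    have cr: "cas (head G e) (revw (c (head G e))) v0"
      by (rule cas_revw) (use c[OF e(2)] in auto)
    have "lw z d = z"
      by (rule lw_closed[OF z]) (use c[OF u] c[OF e(2)] inner_revw[OF c(1)[OF e(2)]] cr eI e in \<open>auto simp: d_def cas_append\<close>)
    moreover have "lw z (revw (c (head G e))) = y0"
      unfolding z_def t_def by (rule lw_revw[OF y0(1)]) (use c[OF e(2)] y0 in auto)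
    ultimately show ?thesis by (simp add: d_def t_def z_def)
  qed
  define C where "C = t ` S"
  have inj: "inj_on t S" using tX(2) by (metis inj_onI)
  define f where "f = (\<Sum>u\<in>S. scaleC (\<psi> u) (del (t u)))"
  have ft: "rep_l2 f (t u) = \<psi> u" if "u \<in> S" for u
  proof -
    have "rep_l2 f (t u) = (\<Sum>u'\<in>S. if u' = u then \<psi> u' else 0)"
      unfolding f_def rep_l2_sum
      by (rule sum.cong) (use inj that in \<open>auto simp: rep_del delta_def inj_on_eq_iff\<close>)
    then show ?thesis using that fS by simp
  qed
  have f0: "rep_l2 f y = 0" if "y \<notin> C" for y
    unfolding f_def rep_l2_sum
    by (rule sum.neutral) (use that in \<open>auto simp: rep_del delta_def C_def\<close>)
  have fN: "N S f = f"
    unfolding N_iff[OF S1]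
  proof
    show "restr (fib S) f = f"
      unfolding restr_fixed_iff
    proof (intro allI impI f0)
      fix y assume "y \<notin> fib S"
      then show "y \<notin> C" using tX by (auto simp: C_def fib_def)
    qed
    show "M S f = 0"
    proof (rule l2_eqI)
      fix y
      show "rep_l2 (M S f) y = rep_l2 0 y"
      proof (cases "y \<in> X \<and> p y \<in> S")
        case False then show ?thesis by (auto simp: rep_Mop[OF fS])
      next
        case True
        show ?thesis
        proof (cases "y \<in> C")
          case True
          then obtain u where u: "u \<in> S" "y = t u" by (auto simp: C_def)
          have "(\<Sum>e\<in>{e \<in> out_arcs G u. head G e \<in> S}. w e * rep_l2 f (L y e)) =
              (\<Sum>e\<in>{e \<in> out_arcs G u. head G e \<in> S}. w e * \<psi> (head G e))"
            by (rule sum.cong[OF refl]) (use u tL ft in auto)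
          then show ?thesis using \<psi>(2)[OF u(1)] u tX[OF u(1)] ft[OF u(1)] by (simp add: rep_Mop[OF fS])
        next
          case False
          \<comment> \<open>If the lifted arc ended in \<open>C\<close>, its reverse would start in
            \<open>C\<close> and hence, by \<open>tL\<close>, lead to a point of \<open>C\<close>;
            that point is \<open>y\<close>.\<close>
          have "rep_l2 f (L y e) = 0" if e: "e \<in> out_arcs G (p y)" "head G e \<in> S" for e
          proof (rule f0)
            show "L y e \<notin> C"
            proof
              assume "L y e \<in> C"
              then obtain u where u: "u \<in> S" "L y e = t u" by (auto simp: C_def)
              have eG: "e \<in> arcs G" "p y = tail G e" using e by auto
              have "u = head G e" using u p_L[of y e] True eG tX(2)[OF u(1)] by simp
              then have "L (t u) (arev e) = t (tail G e)"
                using tL[OF u(1), of "arev e"] eG True by (auto simp: out_arcs_def)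
              moreover have "L (t u) (arev e) = y" using L_L[of y e] True eG u(2) by simp
              ultimately show False using False True eG by (auto simp: C_def)
            qed
          qed
          then show ?thesis using True False f0 by (simp add: rep_Mop[OF fS])
        qed
      qed
    qed
  qed
  have fnz: "f \<noteq> 0" using ft[OF v0] \<psi>(1)[OF v0] by auto
  have nf: "(norm f)\<^sup>2 = (\<Sum>u\<in>S. (cmod (\<psi> u))\<^sup>2)"
  proof -
    have "(norm f)\<^sup>2 = (\<Sum>\<^sub>\<infinity>y\<in>C. (cmod (rep_l2 f y))\<^sup>2)"
      unfolding l2_norm_sq by (rule infsum_cong_neutral) (auto simp: f0)
    also have "\<dots> = (\<Sum>y\<in>C. (cmod (rep_l2 f y))\<^sup>2)" using fS by (simp add: C_def)
    also have "\<dots> = (\<Sum>u\<in>S. (cmod (rep_l2 f (t u)))\<^sup>2)"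
      unfolding C_def by (subst sum.reindex[OF inj]) simp
    finally show ?thesis by (simp add: ft)
  qed
  have low: "(cmod (\<psi> u))\<^sup>2 / (norm f)\<^sup>2 \<le> N S (del (s u)) \<bullet> del (s u)" if u: "u \<in> S" for u
  proof -
    have "N S (del (s u)) \<bullet> del (s u) = N S (del (t u)) \<bullet> del (t u)"
      by (rule eqv_diag[OF eqv_N[OF S1]]) (use u S1 s[of u] tX[OF u] in auto)
    also have "\<dots> = (norm (N S (del (t u))))\<^sup>2" by (rule is_proj_inner[OF N_proj[OF S1]])
    finally have e: "N S (del (s u)) \<bullet> del (s u) = (norm (N S (del (t u))))\<^sup>2" .
    have "cmod (\<psi> u) = cmod (cin f (del (t u)))" by (simp add: cin_del_right ft[OF u])
    also have "cin f (del (t u)) = cin f (N S (del (t u)))"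
      using csa_cin[OF N_csa[OF S1], of f "del (t u)"] fN by simp
    also have "cmod \<dots> \<le> norm f * norm (N S (del (t u)))" by (rule norm_cin_le)
    finally have "(cmod (\<psi> u))\<^sup>2 \<le> (norm f * norm (N S (del (t u))))\<^sup>2" by (intro power_mono) auto
    then show ?thesis using fnz by (simp add: e power_mult_distrib divide_le_eq mult.commute)
  qed
  have "1 = (\<Sum>u\<in>S. (cmod (\<psi> u))\<^sup>2) / (norm f)\<^sup>2" using fnz by (simp flip: nf)
  also have "\<dots> = (\<Sum>u\<in>S. (cmod (\<psi> u))\<^sup>2 / (norm f)\<^sup>2)" by (rule sum_divide_distrib)
  also have "\<dots> \<le> (\<Sum>u\<in>S. N S (del (s u)) \<bullet> del (s u))" by (rule sum_mono) (rule low)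
  also have "\<dots> \<le> tr (N S)"
    unfolding tr_def by (rule sum_mono2) (use S1 in \<open>auto simp: is_proj_inner[OF N_proj[OF S1]]\<close>)
  finally show ?thesis .
qed

end

locale cover_twist = deck_weights G arev X p L \<Phi> s w V + twist G arev w V
  for G :: "('v, 'e) pre_digraph" and arev and X :: "'x set" and p L \<Phi> s w V
begin

theorem generic_nullity_le:
  assumes x: "x \<in> gen" and S: "S \<subseteq> verts G"
  shows "h.\<tau> x S \<le> tr (N S)"
  using S
proof (induction "card S" arbitrary: S rule: less_induct)
  case less
  note S = \<open>S \<subseteq> verts G\<close>
  have fS: "finite S" by (rule fin_sub[OF S])
  have smaller: "h.\<tau> x A \<le> tr (N A)" if "A \<subset> S" for A
    by (rule less.hyps) (use that S psubset_card_mono[OF fS] in auto)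
  \<comment> \<open>If \<open>S\<close> falls into two parts without arcs between them, both sides
    are additive and the induction hypothesis applies to each part.\<close>
  have split: ?case if A: "A \<subseteq> S" "A \<noteq> {}" "A \<noteq> S" and sep: "\<And>e. e \<in> arcs G \<Longrightarrow> \<not> (tail G e \<in> A \<and> head G e \<in> S - A)" for A
  proof -
    have U: "A \<union> (S - A) = S" using A by auto
    have "h.\<tau> x S = h.\<tau> x A + h.\<tau> x (S - A)"
      using h.\<tau>_Un[of A "S - A", where x = x] sep S U by auto
    moreover have "tr (N S) = tr (N A) + tr (N (S - A))"
      using tr_N_disjoint[of A "S - A"] sep S U by auto
    moreover have "A \<subset> S" "S - A \<subset> S" using A by auto
    ultimately show ?thesis using smaller[of A] smaller[of "S - A"] by linarith
  qed
  show ?case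
  proof (cases "ess x S = {}")
    case True
    have "f = 0" if "f \<in> h.ker x S" for f
    proof (rule l2_eqI)
      fix a show "rep_l2 f a = rep_l2 0 a"
        using True that h.ker_iff[OF S, of f x] by (cases "a \<in> S") (auto simp: ess_def)
    qed
    moreover have "0 \<in> h.ker x S" by (simp add: h.ker_iff[OF S])
    ultimately have "h.ker x S = {0}" by blast
    then have "h.\<tau> x S = 0" using h.\<tau>_zero_iff[OF S] by blast
    then show ?thesis using N_nonneg[OF S] by simp
  next
    case ne: False
    have sub: "ess x S \<subseteq> S" by (auto simp: ess_def)
    show ?thesis
    proof (cases "\<exists>e\<in>arcs G. tail G e \<in> S - ess x S \<and> head G e \<in> ess x S")
      case True
      then obtain e where e: "e \<in> arcs G" "tail G e \<in> S" "tail G e \<notin> ess x S" "head G e \<in> ess x S" by auto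
      \<comment> \<open>Deleting this vertex raises the generic nullity by exactly one and the trace
        by at most one, so the inequality for the smaller set implies the one for
        \<open>S\<close>.\<close>
      have "h.\<tau> x (S - {tail G e}) = h.\<tau> x S + 1"
        by (rule delete_boundary[OF x S e(2,3,1) refl e(4)])
      moreover have "h.\<tau> x (S - {tail G e}) \<le> tr (N (S - {tail G e}))" by (rule smaller) (use e in auto)
      moreover have "tr (N (S - {tail G e})) \<le> tr (N S) + 1" by (rule interlace(1)[OF S e(2)])
      ultimately show ?thesis by linarith
    next
      case noedge: False
      have sep: "\<not> (tail G e \<in> ess x S \<and> head G e \<in> S - ess x S)" if "e \<in> arcs G" for e
        using noedge that by (metis DiffE arev_in_arcs head_arev tail_arev)
      show ?thesis
      proof (cases "ess x S = S")
        case False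
        then show ?thesis using split[OF sub ne] sep by blast
      next
        case all: True
        show ?thesis
        proof (cases "\<exists>A. A \<subseteq> S \<and> A \<noteq> {} \<and> A \<noteq> S \<and> (\<forall>e\<in>arcs G. \<not> (tail G e \<in> A \<and> head G e \<in> S - A))")
          case True
          then obtain A where A: "A \<subseteq> S" "A \<noteq> {}" "A \<noteq> S"
            and sep: "\<forall>e\<in>arcs G. \<not> (tail G e \<in> A \<and> head G e \<in> S - A)" by (elim exE conjE)
          show ?thesis by (rule split[OF A]) (use sep in blast)
        next
          case False
          have conn: "\<exists>e\<in>arcs G. tail G e \<in> A \<and> head G e \<in> S - A"
            if "A \<subseteq> S" "A \<noteq> {}" "A \<noteq> S" for A
          proof (rule ccontr)
            assume "\<not> (\<exists>e\<in>arcs G. tail G e \<in> A \<and> head G e \<in> S - A)"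
            then have "\<forall>e\<in>arcs G. \<not> (tail G e \<in> A \<and> head G e \<in> S - A)" by simp
            then show False using that False by metis
          qed
          have Sne: "S \<noteq> {}" using ne all by simp
          interpret cover_critical G arev X p L \<Phi> s w V x S
            by (intro cover_critical.intro critical.intro critical_axioms.intro deck_weights_axioms twist_axioms)
              (fact x S Sne all conn)+
          show ?thesis using \<tau>_critical tr_critical by linarith
        qed
      qed
    qed
  qed
qed

end

subsection \<open>Coverings as lifting systems\<close>

definition arc_lift :: "('x, 'f) pre_digraph \<Rightarrow> ('f \<Rightarrow> 'e) \<Rightarrow> 'x \<Rightarrow> 'e \<Rightarrow> 'f" where
  "arc_lift H q x e = inv_into (out_arcs H x) q e"

definition end_lift :: "('x, 'f) pre_digraph \<Rightarrow> ('f \<Rightarrow> 'e) \<Rightarrow> 'x \<Rightarrow> 'e \<Rightarrow> 'x" where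
  "end_lift H q x e = head H (arc_lift H q x e)"

locale covering = G: fin_digraph G + G: bidirected_digraph G arev
  for G :: "('v, 'e) pre_digraph" and arev +
  fixes H :: "('x, 'f) pre_digraph" and hrev p q
  assumes cov: "graph_covering G arev H hrev p q"
begin

sublocale H: bidirected_digraph H hrev
  using cov by (simp add: graph_covering_def)

abbreviation "L \<equiv> end_lift H q"

lemma p_verts: "x \<in> verts H \<Longrightarrow> p x \<in> verts G"
  and q_arcs: "f \<in> arcs H \<Longrightarrow> q f \<in> arcs G" "f \<in> arcs H \<Longrightarrow> tail G (q f) = p (tail H f)"
    "f \<in> arcs H \<Longrightarrow> head G (q f) = p (head H f)" "f \<in> arcs H \<Longrightarrow> q (hrev f) = arev (q f)"
  and q_bij: "x \<in> verts H \<Longrightarrow> bij_betw q (out_arcs H x) (out_arcs G (p x))"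
  using cov unfolding graph_covering_def by auto

lemma arc_lift:
  assumes "x \<in> verts H" "e \<in> arcs G" "p x = tail G e"
  shows "arc_lift H q x e \<in> arcs H" "tail H (arc_lift H q x e) = x" "q (arc_lift H q x e) = e"
proof -
  have "e \<in> q ` out_arcs H x" using q_bij[OF assms(1)] assms by (simp add: bij_betw_def)
  from inv_into_into[OF this] f_inv_into_f[OF this]
  show "arc_lift H q x e \<in> arcs H" "tail H (arc_lift H q x e) = x" "q (arc_lift H q x e) = e"
    by (auto simp: arc_lift_def)
qed

lemma arc_lift_q: "f \<in> arcs H \<Longrightarrow> arc_lift H q (tail H f) (q f) = f"
  unfolding arc_lift_def
  by (rule inv_into_f_f) (use q_bij[of "tail H f"] in \<open>auto simp: bij_betw_def\<close>)

lemma L_q: "f \<in> arcs H \<Longrightarrow> L (tail H f) (q f) = head H f"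
  by (simp add: end_lift_def arc_lift_q)

sublocale lift_sys G arev "verts H" p L
proof
  fix x e assume x: "x \<in> verts H" and e: "e \<in> arcs G" "p x = tail G e"
  note l = arc_lift[OF x e]
  show "L x e \<in> verts H" using l by (simp add: end_lift_def)
  show "p (L x e) = head G e" using q_arcs(3)[OF l(1)] l by (simp add: end_lift_def)
  have "L (tail H (hrev (arc_lift H q x e))) (q (hrev (arc_lift H q x e))) = head H (hrev (arc_lift H q x e))"
    by (rule L_q) (use l in simp)
  then show "L (L x e) (arev e) = x" using l q_arcs(4)[OF l(1)] by (simp add: end_lift_def)
qed (rule p_verts)

lemma fib_verts: "fib (verts G) = verts H"
  using p_verts by (auto simp: fib_def)

lemma rep_Mop_lifted: "rep_l2 (Mop w V (verts G) f) = lifted_operator H p q w V (rep_l2 f)"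
proof
  fix x
  have "(\<Sum>e\<in>{e \<in> out_arcs G (p x). head G e \<in> verts G}. w e * rep_l2 f (L x e)) =
      (\<Sum>e\<in>out_arcs H x. w (q e) * rep_l2 f (head H e))" if x: "x \<in> verts H"
  proof -
    have "{e \<in> out_arcs G (p x). head G e \<in> verts G} = out_arcs G (p x)" by auto
    then have "(\<Sum>e\<in>{e \<in> out_arcs G (p x). head G e \<in> verts G}. w e * rep_l2 f (L x e)) =
        (\<Sum>e\<in>out_arcs G (p x). w e * rep_l2 f (L x e))" by simp
    also have "\<dots> = (\<Sum>e\<in>out_arcs H x. w (q e) * rep_l2 f (L x (q e)))"
      by (rule sum.reindex_bij_betw[OF q_bij[OF x], symmetric])
    also have "\<dots> = (\<Sum>e\<in>out_arcs H x. w (q e) * rep_l2 f (head H e))"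
      by (rule sum.cong) (use L_q in auto)
    finally show ?thesis .
  qed
  then show "rep_l2 (Mop w V (verts G) f) x = lifted_operator H p q w V (rep_l2 f) x"
    using p_verts by (auto simp: rep_Mop lifted_operator_def schrodinger_operator_def)
qed

text \<open>Subtracting \<theta> from the potential turns the eigenspace into a kernel, whose
  projection is the limit of powers constructed above.\<close>

lemma spectral_projection_kerproj:
  assumes w: "\<And>e. e \<in> arcs G \<Longrightarrow> w (arev e) = cnj (w e)" and x: "x \<in> verts H"
  shows "ell2_inner (verts H) (spectral_projection (verts H) (lifted_operator H p q w V) {\<theta>} (delta x)) (delta x)
    = cin (kerproj w (\<lambda>v. V v - \<theta>) (verts G) (del x)) (del x)"
proof -
  interpret lift_weights G arev "verts H" p L w "\<lambda>v. V v - \<theta>" "verts G"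
    by unfold_locales (auto simp: w)
  define Q where "Q = kerproj w (\<lambda>v. V v - \<theta>) (verts G)"
  interpret E: ell2_operator "verts H" "lifted_operator H p q w V" "Mop w V (verts G)"
  proof
    show "csa (Mop w V (verts G))" by (rule csa_Mop) (rule w)
    show "rep_l2 (Mop w V (verts G) f) = lifted_operator H p q w V (rep_l2 f)" for f by (rule rep_Mop_lifted)
    show "restr (verts H) (Mop w V (verts G) f) = Mop w V (verts G) f" for f
      using restr_Mop[of "verts G" w V f] by (simp add: fib_verts)
    show "Mop w V (verts G) (restr (verts H) f) = Mop w V (verts G) f" for f
      using Mop_restr[of "verts G" w V f] by (simp add: fib_verts)
  qed
  have Qf: "Q f = f \<longleftrightarrow> restr (verts H) f = f \<and> Mop w V (verts G) f = \<theta> *\<^sub>R f" for f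
  proof -
    have "Mop w (\<lambda>v. V v - \<theta>) (verts G) f = Mop w V (verts G) f - \<theta> *\<^sub>R restr (verts H) f"
      by (rule l2_eqI) (use p_verts in \<open>auto simp: rep_Mop rep_restr algebra_simps\<close>)
    then show ?thesis unfolding Q_def kerproj_iff fib_verts by auto
  qed
  have "restr (verts H) (del x) = del x" using x by (simp add: restr_del)
  from E.spectral_projection_eigenspace[OF is_proj_kerproj Qf[unfolded Q_def] this]
  have e: "spectral_projection (verts H) (lifted_operator H p q w V) {\<theta>} (delta x) = rep_l2 (Q (del x))"
    by (simp add: rep_del Q_def)
  have m: "rep_l2 (Q (del x)) \<in> ell2 (verts H)"
    using kerproj_kernel(1)[of "del x"] by (intro rep_l2_mem_ell2) (simp add: Q_def fib_verts)
  show ?thesis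
    unfolding e using ell2_inner_cin[OF m delta_ell2[OF x]] by (simp add: rep_l2_inverse Q_def flip: del_def)
qed

end

definition deck_maps :: "('x, 'f) pre_digraph \<Rightarrow> ('f \<Rightarrow> 'f) \<Rightarrow> ('x \<Rightarrow> 'v) \<Rightarrow> ('f \<Rightarrow> 'e) \<Rightarrow> ('x \<Rightarrow> 'x) set" where
  "deck_maps H hrev p q = fst ` deck_transformations H hrev p q"

locale normal_covering = covering G arev H hrev p q
  for G :: "('v, 'e) pre_digraph" and arev and H :: "('x, 'f) pre_digraph" and hrev p q +
  fixes s :: "'v \<Rightarrow> 'x"
  assumes normal: "connected_normal_cover G arev H hrev p q"
    and lift: "vertex_lift G H p s"
begin

text \<open>Connectedness refers to the symmetrized digraph; a step against an arc is replaced by a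
  step along its reverse.\<close>

lemma walk_to:
  assumes "x \<in> verts H" "y \<in> verts H"
  shows "\<exists>c. set c \<subseteq> arcs G \<and> G.cas (p x) c (p y) \<and> lw x c = y"
proof -
  have "Digraph_Component.connected H" using normal by (simp add: connected_normal_cover_def)
  then have "x \<rightarrow>\<^sup>*\<^bsub>with_proj (mk_symmetric H)\<^esub> y"
    using assms by (auto simp: Digraph_Component.connected_def strongly_connected_def)
  then have "(x, y) \<in> rtrancl_on (verts H) (arcs_ends (with_proj (mk_symmetric H)))"
    by (simp add: reachable_def)
  then show ?thesis
  proof (induction rule: rtrancl_on_induct)
    case base
    show ?case by (intro exI[of _ "[]"]) simp
  next
    case (step y z)
    then obtain c where c: "set c \<subseteq> arcs G" "G.cas (p x) c (p y)" "lw x c = y" by blast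
    have "(y, z) \<in> arcs_ends H \<or> (z, y) \<in> arcs_ends H"
      using step by (auto simp: parcs_mk_symmetric arcs_ends_def arc_to_ends_def)
    then obtain f where f: "f \<in> arcs H" "tail H f = y" "head H f = z"
    proof
      assume "(y, z) \<in> arcs_ends H"
      then show thesis using that by (auto simp: arcs_ends_def arc_to_ends_def)
    next
      assume "(z, y) \<in> arcs_ends H"
      then obtain f where "f \<in> arcs H" "tail H f = z" "head H f = y" by (auto simp: arcs_ends_def arc_to_ends_def)
      then show thesis using that[of "hrev f"] by simp
    qed
    have "L y (q f) = z" using L_q[OF f(1)] f by simp
    then show ?case
      using c f q_arcs[OF f(1)] by (intro exI[of _ "c @ [q f]"]) (auto simp: G.cas_append)
  qed
qed

sublocale deck_sys G arev "verts H" p L "deck_maps H hrev p q" s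
proof -
  have D: "\<exists>\<psi>. (\<phi>, \<psi>) \<in> deck_transformations H hrev p q" if "\<phi> \<in> deck_maps H hrev p q" for \<phi>
    using that by (auto simp: deck_maps_def)
  have bij: "bij_betw \<phi> (verts H) (verts H)" and dp: "x \<in> verts H \<Longrightarrow> p (\<phi> x) = p x"
    if "\<phi> \<in> deck_maps H hrev p q" for \<phi> x
    using D[OF that] by (auto simp: deck_transformations_def)
  have inH: "\<phi> x \<in> verts H" if "\<phi> \<in> deck_maps H hrev p q" "x \<in> verts H" for \<phi> x
    using bij[OF that(1)] that(2) by (auto simp: bij_betw_def)
  have dL: "\<phi> (L x e) = L (\<phi> x) e"
    if \<phi>: "\<phi> \<in> deck_maps H hrev p q" and x: "x \<in> verts H" and e: "e \<in> arcs G" "p x = tail G e" for \<phi> x e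
  proof -
    obtain \<psi> where \<psi>: "(\<phi>, \<psi>) \<in> deck_transformations H hrev p q" using D[OF \<phi>] by blast
    note l = arc_lift[OF x e]
    define f where "f = arc_lift H q x e"
    have f: "f \<in> arcs H" "tail H f = x" "q f = e" using l by (auto simp: f_def)
    have "\<psi> f \<in> arcs H" "tail H (\<psi> f) = \<phi> x" "head H (\<psi> f) = \<phi> (head H f)" "q (\<psi> f) = e"
      using \<psi> f by (auto simp: deck_transformations_def bij_betw_def)
    then have "L (\<phi> x) e = \<phi> (head H f)" using L_q[of "\<psi> f"] by simp
    then show ?thesis by (simp add: end_lift_def f_def)
  qed
  have dlw: "\<phi> (lw x c) = lw (\<phi> x) c"
    if \<phi>: "\<phi> \<in> deck_maps H hrev p q" and "x \<in> verts H" "set c \<subseteq> arcs G" "G.cas (p x) c v" for \<phi> x c v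
    using that(2-) by (induction c arbitrary: x) (auto simp: dL[OF \<phi>] L_in p_L dp[OF \<phi>])
  show "deck_sys G arev (verts H) p L (deck_maps H hrev p q) s"
  proof
    show "bij_betw \<phi> (verts H) (verts H)" if "\<phi> \<in> deck_maps H hrev p q" for \<phi> by (rule bij[OF that])
    show "p (\<phi> x) = p x" if "\<phi> \<in> deck_maps H hrev p q" "x \<in> verts H" for \<phi> x by (rule dp[OF that])
    show "\<phi> (L x e) = L (\<phi> x) e"
      if "\<phi> \<in> deck_maps H hrev p q" "x \<in> verts H" "e \<in> arcs G" "p x = tail G e" for \<phi> x e by (rule dL[OF that])
    show "\<exists>\<phi>\<in>deck_maps H hrev p q. \<phi> x = y" if "x \<in> verts H" "y \<in> verts H" "p x = p y" for x y
    proof -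
      have "\<exists>(\<phi>, \<psi>)\<in>deck_transformations H hrev p q. \<phi> x = y"
        using normal that by (simp add: connected_normal_cover_def)
      then show ?thesis unfolding deck_maps_def by force
    qed
    \<comment> \<open>Lifts of walks are unique, so two deck maps that agree at \<open>x\<close>
      agree along the lift of every walk from \<open>x\<close>, and thus everywhere.\<close>
    show "\<phi> y = \<psi> y" if \<phi>: "\<phi> \<in> deck_maps H hrev p q" and \<psi>: "\<psi> \<in> deck_maps H hrev p q"
      and x: "x \<in> verts H" and e: "\<phi> x = \<psi> x" and y: "y \<in> verts H" for \<phi> \<psi> x y
    proof -
      obtain c where c: "set c \<subseteq> arcs G" "G.cas (p x) c (p y)" "lw x c = y" using walk_to[OF x y] by blast
      have "\<phi> y = lw (\<phi> x) c" using dlw[OF \<phi> x c(1,2)] c(3) by simp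
      moreover have "\<psi> y = lw (\<psi> x) c" using dlw[OF \<psi> x c(1,2)] c(3) by simp
      ultimately show ?thesis using e by simp
    qed
    show "s v \<in> verts H" "p (s v) = v" if "v \<in> verts G" for v
      using lift that by (auto simp: vertex_lift_def)
  qed
qed

theorem cover_spectral_measure_tr:
  assumes w: "\<And>e. e \<in> arcs G \<Longrightarrow> w (arev e) = cnj (w e)"
  shows "cover_spectral_measure G w V H p q s {\<theta>} =
    tr (kerproj w (\<lambda>v. V v - \<theta>) (verts G)) / real (card (verts G))"
  unfolding cover_spectral_measure_def tr_def
  by (intro arg_cong2[where f = "(/)"] sum.cong refl)
    (simp add: spectral_projection_kerproj[where w = w] w s inner_cin)

end

subsection \<open>Averaging over the phases\<close>

text \<open>The heights place each fibre injectively in an integer lattice, where they act as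
  coordinates for the position in the deck group. These two properties are what the averaging uses
  of the maximal abelian cover.\<close>

locale height = deck_weights G arev X p L \<Phi> s w V + twist G arev w V
  for G :: "('v, 'e) pre_digraph" and arev and X :: "'x set" and p L \<Phi> s w V +
  fixes hgt :: "'x \<Rightarrow> 'e \<Rightarrow> int"
  assumes hgt_L: "y \<in> X \<Longrightarrow> e \<in> arcs G \<Longrightarrow> p y = tail G e \<Longrightarrow> e' \<in> arcs G \<Longrightarrow>
      hgt (L y e) e' = hgt y e' + (if e' = e then 1 else 0) - (if e' = arev e then 1 else 0)"
    and hgt_inj: "y \<in> X \<Longrightarrow> z \<in> X \<Longrightarrow> p y = p z \<Longrightarrow> (\<And>e. e \<in> arcs G \<Longrightarrow> hgt y e = hgt z e) \<Longrightarrow> y = z"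
begin

section \<open>Fourier transform over the phases\<close>

abbreviation "torus \<equiv> Pi\<^sub>M (arcs G) (\<lambda>_. unif)"

text \<open>The character of the lattice given by the phases \<open>x\<close>, evaluated at the
  height of \<open>y\<close>.\<close>

definition Z :: "('e \<Rightarrow> real) \<Rightarrow> 'x \<Rightarrow> complex" where
  "Z x y = (\<Prod>e\<in>arcs G. cis (x e * hgt y e))"

lemma Z_cnj: "cnj (Z x y) * Z x y = 1"
  by (simp add: Z_def cis_cnj cis_mult flip: prod.distrib)

lemma Z_L:
  assumes "y \<in> X" "e \<in> arcs G" "p y = tail G e"
  shows "Z x (L y e) = Z x y * cis (x e - x (arev e))"
proof -
  have e': "arev e \<noteq> e" "arev e \<in> arcs G" using assms by (auto simp: arev_neq)
  have "Z x (L y e) = (\<Prod>e'\<in>arcs G. cis (x e' * hgt y e') *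
      ((if e' = e then cis (x e) else 1) * (if e' = arev e then cis (- x (arev e)) else 1)))"
    unfolding Z_def
    by (rule prod.cong) (use e' in \<open>auto simp: hgt_L[OF assms] cis_mult algebra_simps\<close>)
  also have "\<dots> = Z x y * (cis (x e) * cis (- x (arev e)))"
    using assms e' by (simp add: prod.distrib Z_def)
  finally show ?thesis by (simp add: cis_mult)
qed

text \<open>The graph of the Floquet transform on finitely supported vectors: \<open>F\<close> on
  the cover corresponds to the family \<open>f\<close> of vectors on the graph, one for each choice
  of phases. The moments start from a basis vector, so no extension to all of \<open>l2\<close> is
  called for.\<close>

inductive rel :: "'x l2 \<Rightarrow> (('e \<Rightarrow> real) \<Rightarrow> 'v l2) \<Rightarrow> bool" where
  rel_zero: "rel 0 (\<lambda>x. 0)"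
| rel_del: "y \<in> X \<Longrightarrow> rel (del y) (\<lambda>x. scaleC (cnj (Z x y)) (del (p y)))"
| rel_add: "rel F f \<Longrightarrow> rel F' f' \<Longrightarrow> rel (F + F') (\<lambda>x. f x + f' x)"
| rel_scale: "rel F f \<Longrightarrow> rel (scaleC c F) (\<lambda>x. scaleC c (f x))"

lemma rel_sum: "(\<And>i. i \<in> I \<Longrightarrow> rel (F i) (f i)) \<Longrightarrow> rel (\<Sum>i\<in>I. F i) (\<lambda>x. \<Sum>i\<in>I. f i x)"
  by (induction I rule: infinite_finite_induct) (auto intro: rel_zero rel_add)

lemma rel_linear:
  assumes B: "clin B" and b: "\<And>x. clin (b x)"
    and basis: "\<And>y. y \<in> X \<Longrightarrow> rel (B (del y)) (\<lambda>x. b x (scaleC (cnj (Z x y)) (del (p y))))"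
    and "rel F f"
  shows "rel (B F) (\<lambda>x. b x (f x))"
  using assms(4)
proof induction
  case rel_zero
  then show ?case using rel.rel_zero by (simp add: clin_simps[OF B] clin_simps[OF b])
next
  case (rel_del y) then show ?case by (rule basis)
next
  case (rel_add F f F' f')
  then show ?case using rel.rel_add by (simp add: clin_simps[OF B] clin_simps[OF b])
next
  case (rel_scale F f c)
  then show ?case using rel.rel_scale by (simp add: clin_simps[OF B] clin_simps[OF b])
qed

lemma Aop_del:
  assumes e: "e \<in> arcs G" and y: "y \<in> X"
  shows "Aop e (del y) = (if head G e = p y then del (L y (arev e)) else 0)"
proof (rule l2_eqI)
  fix z
  have "rep_l2 (Aop e (del y)) z = (if z \<in> X \<and> p z = tail G e \<and> L z e = y then 1 else 0)"
    by (auto simp: rep_Aop[OF e] rep_del delta_def)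
  also have "(z \<in> X \<and> p z = tail G e \<and> L z e = y) \<longleftrightarrow> head G e = p y \<and> z = L y (arev e)"
    using e y L_L[of z e] L_L[of y "arev e"] L_in[of y "arev e"] p_L[of z e] p_L[of y "arev e"] by auto
  finally show "rep_l2 (Aop e (del y)) z = rep_l2 (if head G e = p y then del (L y (arev e)) else 0) z"
    by (auto simp: rep_del delta_def)
qed

lemma triv_Aop_del:
  assumes e: "e \<in> arcs G" and u: "u \<in> verts G"
  shows "h.triv.Aop e (del u) = (if head G e = u then del (tail G e) else 0)"
  by (rule l2_eqI) (use e u in \<open>auto simp: h.triv.rep_Aop[OF e] rep_del delta_def\<close>)

text \<open>By \<open>Z_L\<close> the character changes along a lifted arc by exactly the phase of
  that arc; so the untwisted operator above corresponds to the twisted ones below.\<close>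

lemma rel_Aop:
  assumes e: "e \<in> arcs G" and F: "rel F f"
  shows "rel (Aop e F) (\<lambda>x. scaleC (cis (x e - x (arev e))) (h.triv.Aop e (f x)))"
proof (rule rel_linear[OF clin_Aop[OF e] _ _ F])
  show "clin (\<lambda>g. scaleC (cis (x e - x (arev e))) (h.triv.Aop e g))" for x
    by (rule clin_scaleC[OF h.triv.clin_Aop[OF e]])
  fix y assume y: "y \<in> X"
  note Ac = clin_simps[OF h.triv.clin_Aop[OF e]]
  show "rel (Aop e (del y)) (\<lambda>x. scaleC (cis (x e - x (arev e))) (h.triv.Aop e (scaleC (cnj (Z x y)) (del (p y)))))"
  proof (cases "head G e = p y")
    case True
    have ae: "arev e \<in> arcs G" "p y = tail G (arev e)" using e True by auto
    have "rel (del (L y (arev e))) (\<lambda>x. scaleC (cnj (Z x (L y (arev e)))) (del (p (L y (arev e)))))"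
      by (rule rel_del[OF L_in[OF y ae]])
    moreover have "cnj (Z x (L y (arev e))) = cis (x e - x (arev e)) * cnj (Z x y)" for x
      using Z_L[OF y ae] by (simp add: cis_cnj)
    ultimately show ?thesis
      using True e y p_in[OF y] by (simp add: Aop_del triv_Aop_del Ac p_L[OF y ae])
  next
    case False
    then show ?thesis using e y p_in[OF y] rel_zero by (simp add: Aop_del triv_Aop_del Ac)
  qed
qed

lemma rel_restr:
  assumes S: "S \<subseteq> verts G" and F: "rel F f"
  shows "rel (restr (fib S) F) (\<lambda>x. restr (h.triv.fib S) (f x))"
proof (rule rel_linear[OF clin_restr clin_restr _ F])
  fix y assume y: "y \<in> X"
  show "rel (restr (fib S) (del y)) (\<lambda>x. restr (h.triv.fib S) (scaleC (cnj (Z x y)) (del (p y))))"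
    using y p_in[OF y] rel_del[OF y] rel_zero
    by (simp add: restr_del clin_simps[OF clin_restr] fib_def h.triv.fib_def)
qed

lemma rel_Mop:
  assumes S: "S \<subseteq> verts G" and F: "rel F f"
  shows "rel (Mop w V S F) (\<lambda>x. h.triv.Mop (wx x) V S (f x))"
proof -
  have "rel (\<Sum>e\<in>arcs_in S. scaleC (w e) (Aop e F))
      (\<lambda>x. \<Sum>e\<in>arcs_in S. scaleC (w e) (scaleC (cis (x e - x (arev e))) (h.triv.Aop e (f x))))"
    by (intro rel_sum rel_scale rel_Aop F) (auto simp: arcs_in_def)
  moreover have "rel (\<Sum>v\<in>S. scaleC (complex_of_real (V v)) (restr (fib {v}) F))
      (\<lambda>x. \<Sum>v\<in>S. scaleC (complex_of_real (V v)) (restr (h.triv.fib {v}) (f x)))"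
    by (intro rel_sum rel_scale rel_restr F) (use S in auto)
  ultimately show ?thesis
    using rel_add by (simp add: Mop_def h.triv.Mop_def wx_def arcs_in_def h.triv.arcs_in_def)
qed

lemma Kc_twist: "h.triv.Kc (wx x) V = Kc w V"
  by (simp add: Kc_def h.triv.Kc_def wx_def norm_mult)

lemma rel_Dop:
  assumes S: "S \<subseteq> verts G" and F: "rel F f"
  shows "rel (Dop w V S F) (\<lambda>x. h.triv.Dop (wx x) V S (f x))"
proof -
  define k where "k = complex_of_real (- (1 / (Kc w V)\<^sup>2))"
  have "rel (restr (fib S) F + scaleC k (Mop w V S (Mop w V S F)))
      (\<lambda>x. restr (h.triv.fib S) (f x) + scaleC k (h.triv.Mop (wx x) V S (h.triv.Mop (wx x) V S (f x))))"
    by (intro rel_add rel_scale rel_restr rel_Mop S F)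
  moreover have "restr (fib S) F + scaleC k (Mop w V S (Mop w V S F)) = Dop w V S F"
    by (rule l2_eqI) (simp add: Dop_def k_def)
  moreover have "restr (h.triv.fib S) (f x) + scaleC k (h.triv.Mop (wx x) V S (h.triv.Mop (wx x) V S (f x)))
      = h.triv.Dop (wx x) V S (f x)" for x
    by (rule l2_eqI) (simp add: h.triv.Dop_def Kc_twist k_def)
  ultimately show ?thesis by simp
qed

lemma rel_funpow:
  assumes S: "S \<subseteq> verts G" and F: "rel F f"
  shows "rel ((Dop w V S ^^ m) F) (\<lambda>x. (h.triv.Dop (wx x) V S ^^ m) (f x))"
  by (induction m) (use F rel_Dop[OF S] in auto)

lemma meas_coord: "e \<in> arcs G \<Longrightarrow> (\<lambda>x. x e) \<in> borel_measurable torus"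
  using measurable_component_singleton[of e "arcs G" "\<lambda>_. unif"] by (simp cong: measurable_cong_sets)

lemma measurable_cis: "(\<lambda>t. cis t) \<in> borel_measurable borel"
  by (intro borel_measurable_continuous_onI continuous_on_cis continuous_on_id)

lemma Z_measurable: "(\<lambda>x. Z x y) \<in> borel_measurable torus"
  unfolding Z_def
  by (intro borel_measurable_prod measurable_compose[OF _ measurable_cis] borel_measurable_times meas_coord borel_measurable_const)

lemma norm_Z: "cmod (Z x y) = 1"
  by (simp add: Z_def prod_norm[symmetric])

lemma prob_space_torus: "prob_space torus"
  by (rule prob_space_PiM) (rule prob_space_unif)

lemma integral_cis_unif:
  fixes k :: int
  shows "(\<integral>t. cis (t * k) \<partial>unif) = (if k = 0 then 1 else 0)" "integrable unif (\<lambda>t. cis (t * k))"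
proof -
  have um: "measure unif UNIV = 1" using prob_space.prob_space[OF prob_space_unif] by simp
  show int: "integrable unif (\<lambda>t. cis (t * k))"
    by (rule finite_measure.integrable_const_bound[OF prob_space.finite_measure[OF prob_space_unif], of _ 1]) (auto intro!: measurable_compose[OF _ measurable_cis])
  show "(\<integral>t. cis (t * k) \<partial>unif) = (if k = 0 then 1 else 0)"
  proof (cases "k = 0")
    case True then show ?thesis using um by simp
  next
    case False
    define A where "A = (\<lambda>t::real. cis (t * k) / (\<i> * k))"
    have der: "(A has_vector_derivative cis (t * k)) (at t within {0..2*pi})" for t :: real
    proof -
      have "((\<lambda>z. exp (\<i> * complex_of_real k * z) / (\<i> * complex_of_real k)) has_field_derivative
          exp (\<i> * complex_of_real k * complex_of_real t)) (at (complex_of_real t))"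
        using False by (auto intro!: derivative_eq_intros)
      from has_vector_derivative_real_field[OF this, of "{0..2*pi}"]
      show ?thesis by (simp add: A_def cis_conv_exp mult_ac)
    qed
    have "((\<lambda>t. cis (t * k)) has_integral (A (2*pi) - A 0)) {0..2*pi}"
      by (rule fundamental_theorem_of_calculus) (auto intro: der)
    moreover have "cis (2 * pi * k) = 1" using cis_multiple_2pi[of "of_int k"] by (simp add: mult.commute)
    then have "A (2*pi) - A 0 = 0" by (simp add: A_def)
    ultimately have hi: "((\<lambda>t. cis (t * k)) has_integral 0) {0..2*pi}" by simp
    have si: "set_integrable lborel {0..2*pi} (\<lambda>t. cis (t * k))"
      unfolding set_integrable_def by (rule borel_integrable_compact) (auto intro!: continuous_intros continuous_on_cis)
    have dens: "unif = density lborel (\<lambda>t. ennreal (indicator {0..2*pi} t / (2*pi)))"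
      unfolding unif_def uniform_measure_def
      by (rule arg_cong2[where f = density]) (auto simp: indicator_def divide_ennreal simp flip: ennreal_1)
    have "(\<integral>t. cis (t * k) \<partial>unif) = (\<integral>t. (indicator {0..2*pi} t / (2*pi)) *\<^sub>R cis (t * k) \<partial>lborel)"
      unfolding dens by (rule integral_density) (auto intro!: measurable_compose[OF _ measurable_cis])
    also have "\<dots> = (\<integral>t. (1 / (2*pi)) *\<^sub>R (indicator {0..2*pi} t *\<^sub>R cis (t * k)) \<partial>lborel)"
      by (rule Bochner_Integration.integral_cong) auto
    also have "\<dots> = (1 / (2*pi)) *\<^sub>R (\<integral>t. indicator {0..2*pi} t *\<^sub>R cis (t * k) \<partial>lborel)"
      by (rule integral_scaleR_right)
    also have "(\<integral>t. indicator {0..2*pi} t *\<^sub>R cis (t * k) \<partial>lborel) = 0"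
      using set_borel_integral_eq_integral(2)[OF si] integral_unique[OF hi] by (simp add: set_lebesgue_integral_def)
    finally show ?thesis using False by simp
  qed
qed

text \<open>Orthogonality of characters: distinct vertices of one fibre have different heights at
  some arc, and the factor of that arc integrates to zero.\<close>

lemma integral_Z:
  assumes y: "y \<in> X" "z \<in> X" "p y = p z"
  shows "(\<integral>x. Z x z * cnj (Z x y) \<partial>torus) = (if y = z then 1 else 0)"
proof -
  have "Z x z * cnj (Z x y) = (\<Prod>e\<in>arcs G. cis (x e * real_of_int (hgt z e - hgt y e)))" for x
    by (simp add: Z_def cis_cnj cis_mult algebra_simps flip: prod.distrib)
  then have "(\<integral>x. Z x z * cnj (Z x y) \<partial>torus) = (\<integral>x. (\<Prod>e\<in>arcs G. cis (x e * real_of_int (hgt z e - hgt y e))) \<partial>torus)" by (simp del: of_int_diff)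
  also have "\<dots> = (\<Prod>e\<in>arcs G. \<integral>t. cis (t * real_of_int (hgt z e - hgt y e)) \<partial>unif)"
    using PU.product_integral_prod[of "arcs G" "\<lambda>e t. cis (t * real_of_int (hgt z e - hgt y e))"] integral_cis_unif(2) by (simp del: of_int_diff)
  also have "\<dots> = (\<Prod>e\<in>arcs G. if hgt z e - hgt y e = 0 then 1 else 0)"
    by (intro prod.cong refl) (rule integral_cis_unif(1))
  also have "\<dots> = (if y = z then 1 else 0)"
  proof (cases "y = z")
    case False
    then obtain e where "e \<in> arcs G" "hgt y e \<noteq> hgt z e" using hgt_inj[OF y] by blast
    then have "(\<Prod>e\<in>arcs G. if hgt z e - hgt y e = 0 then 1 else (0::complex)) = 0"
      by (intro prod_zero) (auto intro!: bexI[of _ e])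
    then show ?thesis using False by simp
  qed simp
  finally show ?thesis .
qed

text \<open>Fourier inversion, which needs checking only on basis vectors because \<open>rel\<close>
  is generated from them linearly.\<close>

lemma rel_integral:
  assumes "rel F f" and z: "z \<in> X"
  shows "integrable torus (\<lambda>x. Z x z * rep_l2 (f x) (p z)) \<and> (\<integral>x. Z x z * rep_l2 (f x) (p z) \<partial>torus) = rep_l2 F z"
  using assms(1)
proof induction
  case rel_zero then show ?case by simp
next
  case (rel_del y)
  have int: "integrable torus (\<lambda>x. Z x z * cnj (Z x y))"
    by (rule finite_measure.integrable_const_bound[OF prob_space.finite_measure[OF prob_space_torus], of _ 1])
      (auto simp: norm_mult norm_Z intro!: borel_measurable_times Z_measurable
        measurable_compose[OF Z_measurable borel_measurable_continuous_onI[OF continuous_on_cnj[OF continuous_on_id]]])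
  show ?case
  proof (cases "p y = p z")
    case True
    then show ?thesis using int integral_Z[OF rel_del z] by (simp add: rep_del delta_def)
  next
    case False
    then have "y \<noteq> z" by auto
    then show ?thesis using False by (simp add: rep_del delta_def)
  qed
next
  case (rel_add F f F' f') then show ?case by (simp add: distrib_left)
next
  case (rel_scale F f c)
  have e: "Z x z * rep_l2 (scaleC c (f x)) (p z) = c * (Z x z * rep_l2 (f x) (p z))" for x by simp
  show ?case unfolding e using rel_scale by (auto intro!: integrable_mult_right)
qed

lemma moment_identity:
  assumes v: "v \<in> verts G"
  shows "integrable torus (\<lambda>x. rep_l2 ((h.triv.Dop (wx x) V (verts G) ^^ m) (del v)) v)"
    "(\<integral>x. rep_l2 ((h.triv.Dop (wx x) V (verts G) ^^ m) (del v)) v \<partial>torus) =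
      rep_l2 ((Dop w V (verts G) ^^ m) (del (s v))) (s v)"
proof -
  have sv: "s v \<in> X" "p (s v) = v" using s[OF v] by auto
  have "rel ((Dop w V (verts G) ^^ m) (del (s v)))
      (\<lambda>x. (h.triv.Dop (wx x) V (verts G) ^^ m) (scaleC (cnj (Z x (s v))) (del (p (s v)))))"
    by (rule rel_funpow[OF _ rel_del[OF sv(1)]]) simp
  from rel_integral[OF this sv(1)]
  have 1: "integrable torus (\<lambda>x. Z x (s v) * rep_l2 ((h.triv.Dop (wx x) V (verts G) ^^ m) (scaleC (cnj (Z x (s v))) (del v))) v)"
    "(\<integral>x. Z x (s v) * rep_l2 ((h.triv.Dop (wx x) V (verts G) ^^ m) (scaleC (cnj (Z x (s v))) (del v))) v \<partial>torus) =
      rep_l2 ((Dop w V (verts G) ^^ m) (del (s v))) (s v)"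
    by (simp_all add: sv(2))
  have "(h.triv.Dop (wx x) V (verts G) ^^ m) (scaleC c f) = scaleC c ((h.triv.Dop (wx x) V (verts G) ^^ m) f)" for x c f
  proof (induction m)
    case (Suc m)
    have "csa (h.triv.Dop (wx x) V (verts G))" by (rule lift_weights.csaD[OF h.triv.lw]) simp
    then show ?case using Suc by (simp add: csa_scaleC)
  qed simp
  then have "Z x (s v) * rep_l2 ((h.triv.Dop (wx x) V (verts G) ^^ m) (scaleC (cnj (Z x (s v))) (del v))) v =
      rep_l2 ((h.triv.Dop (wx x) V (verts G) ^^ m) (del v)) v" for x
    using Z_cnj[of x "s v"] by (simp add: mult.assoc[symmetric] mult.commute[of "Z x (s v)"])
  then show "integrable torus (\<lambda>x. rep_l2 ((h.triv.Dop (wx x) V (verts G) ^^ m) (del v)) v)"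
    "(\<integral>x. rep_l2 ((h.triv.Dop (wx x) V (verts G) ^^ m) (del v)) v \<partial>torus) =
      rep_l2 ((Dop w V (verts G) ^^ m) (del (s v))) (s v)"
    using 1 by simp_all
qed

lemma gen_nonempty: "\<exists>x. x \<in> gen"
proof (rule ccontr)
  assume "\<nexists>x. x \<in> gen"
  then have "AE x in torus. False" using gen_AE by simp
  then show False by simp
qed

theorem tr_generic_nullity:
  assumes g: "g \<in> gen" shows "tr (N (verts G)) = h.\<tau> g (verts G)"
proof -
  let ?V = "verts G"
  define a where "a = (\<lambda>m x. \<Sum>v\<in>?V. Re (rep_l2 ((h.triv.Dop (wx x) V ?V ^^ m) (del v)) v))"
  define b where "b = (\<lambda>m. \<Sum>v\<in>?V. Re (rep_l2 ((Dop w V ?V ^^ m) (del (s v))) (s v)))"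
  have inta: "integrable torus (a m)" for m
    unfolding a_def by (intro Bochner_Integration.integrable_sum integrable_Re moment_identity(1))
  have ab: "(\<integral>x. a m x \<partial>torus) = b m" for m
  proof -
    have "(\<integral>x. a m x \<partial>torus) = (\<Sum>v\<in>?V. \<integral>x. Re (rep_l2 ((h.triv.Dop (wx x) V ?V ^^ m) (del v)) v) \<partial>torus)"
      unfolding a_def by (rule Bochner_Integration.integral_sum) (intro integrable_Re moment_identity(1))
    also have "\<dots> = b m"
      unfolding b_def by (rule sum.cong) (simp_all add: integral_Re moment_identity)
    finally show ?thesis .
  qed
  have Re_rep: "Re (rep_l2 f z) = f \<bullet> del z" for f :: "'x l2" and z
    by (simp add: inner_cin cin_del_right)
  have Re_rep': "Re (rep_l2 f z) = f \<bullet> del z" for f :: "'v l2" and z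
    by (simp add: inner_cin cin_del_right)
  have blim: "b \<longlonglongrightarrow> tr (N ?V)"
    unfolding b_def tr_def Re_rep by (intro tendsto_sum tendsto_inner N_tendsto tendsto_const) simp
  have alim: "(\<lambda>m. a m x) \<longlonglongrightarrow> h.\<tau> x ?V" for x
    unfolding a_def h.\<tau>_def h.triv.tr_def Re_rep'
    by (intro tendsto_sum tendsto_inner h.triv.N_tendsto tendsto_const) simp
  have bnd: "\<bar>a m x\<bar> \<le> real (card ?V)" for m x
  proof -
    interpret lwx: lift_weights G arev ?V "\<lambda>x. x" "\<lambda>x e. head G e" "wx x" V ?V by (rule h.triv.lw) simp
    have "\<bar>Re (rep_l2 ((h.triv.Dop (wx x) V ?V ^^ m) (del v)) v)\<bar> \<le> 1" for v
    proof -
      have "\<bar>Re (rep_l2 ((h.triv.Dop (wx x) V ?V ^^ m) (del v)) v)\<bar> \<le> cmod (rep_l2 ((h.triv.Dop (wx x) V ?V ^^ m) (del v)) v)"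
        by (rule abs_Re_le_cmod)
      also have "\<dots> \<le> norm ((h.triv.Dop (wx x) V ?V ^^ m) (del v))" by (rule l2_coord_le_norm)
      also have "\<dots> \<le> norm (del v :: 'v l2)" by (rule lwx.pc.norm_funpow_le)
      also have "\<dots> = 1" by (simp add: norm_eq_sqrt_inner inner_cin cin_del_right rep_del delta_def)
      finally show ?thesis .
    qed
    then have "(\<Sum>v\<in>?V. \<bar>Re (rep_l2 ((h.triv.Dop (wx x) V ?V ^^ m) (del v)) v)\<bar>) \<le> (\<Sum>v\<in>?V. 1)" by (intro sum_mono)
    then have "(\<Sum>v\<in>?V. \<bar>Re (rep_l2 ((h.triv.Dop (wx x) V ?V ^^ m) (del v)) v)\<bar>) \<le> real (card ?V)" by simp
    then show ?thesis unfolding a_def by (rule order_trans[OF sum_abs])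
  qed
  \<comment> \<open>Almost all phases are generic and have the same nullity as \<open>g\<close>, so
    the pointwise limit is almost everywhere constant; the entries of powers of a contraction supply
    the dominating bound.\<close>
  have "(\<lambda>m. \<integral>x. a m x \<partial>torus) \<longlonglongrightarrow> (\<integral>x. h.\<tau> g ?V \<partial>torus)"
  proof (rule integral_dominated_convergence[where w = "\<lambda>_. real (card ?V)"])
    show "AE x in torus. (\<lambda>m. a m x) \<longlonglongrightarrow> h.\<tau> g ?V"
      using gen_AE by eventually_elim (use alim \<tau>_gen_eq[OF g, of _ ?V] in auto)
    show "AE x in torus. norm (a m x) \<le> real (card ?V)" for m using bnd by simp
    show "a m \<in> borel_measurable torus" for m using inta by (rule borel_measurable_integrable)
  qed auto
  then have "b \<longlonglongrightarrow> h.\<tau> g ?V" unfolding ab by (simp add: prob_space.prob_space[OF prob_space_torus])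
  then show ?thesis using blim LIMSEQ_unique by blast
qed

end

subsection \<open>Homotopy classes of closed walks\<close>

text \<open>For \<open>r = arev\<close> this is the coefficient of \<open>e\<close> in the 1-chain
  of the walk, read on oriented edges; for a closed walk it represents the homology class.\<close>

definition net :: "('e \<Rightarrow> 'e) \<Rightarrow> 'e list \<Rightarrow> 'e \<Rightarrow> int" where
  "net r c e = int (count_list c e) - int (count_list c (r e))"

lemma net_Nil [simp]: "net r [] e = 0"
  and net_append [simp]: "net r (c @ d) e = net r c e + net r d e"
  by (simp_all add: net_def)

text \<open>Invariance under one inserted backtrack suffices. It will be applied to classes of
  products, to net numbers and to endpoints of lifts.\<close>

lemma loop_homotopic_invariant:
  assumes "loop_homotopic G arev u c d"
    and "\<And>us vs e. e \<in> arcs G \<Longrightarrow> pre_digraph.awalk G u (us @ vs) u \<Longrightarrow>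
      pre_digraph.awalk G u (us @ [e, arev e] @ vs) u \<Longrightarrow> F (us @ vs) = F (us @ [e, arev e] @ vs)"
  shows "F c = F d"
proof -
  have "F y = F z"
    if h: "pre_digraph.awalk G u y u \<and> pre_digraph.awalk G u z u \<and>
      (\<exists>us vs e. e \<in> arcs G \<and> y = us @ vs \<and> z = us @ [e, arev e] @ vs)" for y z
  proof -
    obtain us vs e where "e \<in> arcs G" "y = us @ vs" "z = us @ [e, arev e] @ vs"
      using h by blast
    then show ?thesis using h assms(2)[of e us vs] by simp
  qed
  note F = this
  show ?thesis using assms(1) unfolding loop_homotopic_def
  proof (induction rule: equivclp_induct)
    case (step y z)
    from step(2) have "F y = F z" by (elim disjE) (rule F, assumption, rule F[symmetric])
    then show ?case using step.IH by simp
  qed simp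
qed

lemma loop_class_eq_iff: "loop_class G arev u c = loop_class G arev u d \<longleftrightarrow> loop_homotopic G arev u c d"
  unfolding loop_class_def loop_homotopic_def
  by (auto intro: equivclp_sym equivclp_trans)

lemma loop_class_self: "c \<in> loop_class G arev u c"
  by (simp add: loop_class_def loop_homotopic_def)

lemma loop_class_mem: "d \<in> loop_class G arev u c \<Longrightarrow> loop_class G arev u d = loop_class G arev u c"
  unfolding loop_class_eq_iff by (auto simp: loop_class_def loop_homotopic_def intro: equivclp_sym)

context bidirected_digraph
begin

abbreviation cls :: "'a \<Rightarrow> 'b list \<Rightarrow> 'b list set" where "cls u \<equiv> loop_class G arev u"
abbreviation \<pi>\<^sub>1 :: "'a \<Rightarrow> 'b list set monoid" where "\<pi>\<^sub>1 u \<equiv> fundamental_group G arev u"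

lemma cls_backtrack:
  assumes "awalk u (us @ vs) u" "awalk u (us @ [e, arev e] @ vs) u" "e \<in> arcs G"
  shows "cls u (us @ [e, arev e] @ vs) = cls u (us @ vs)"
  unfolding loop_class_eq_iff loop_homotopic_def using assms
  by (intro converse_r_into_equivclp conjI exI) auto

lemma awalk_cong_cls: "cls u c = cls u d \<Longrightarrow> awalk u c u = awalk u d u"
  unfolding loop_class_eq_iff by (erule loop_homotopic_invariant) simp

lemma awalk_appendI: "awalk u c v \<Longrightarrow> awalk v d z \<Longrightarrow> awalk u (c @ d) z"
  by (auto simp: awalk_def cas_append)

lemma awalk_revw: "awalk u c v \<Longrightarrow> awalk v (revw c) u"
  using set_revw[of c] cas_revw[of c u v] awalk_last_in_verts[of u c v]
  by (auto simp: awalk_def)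

lemma cls_append_left:
  assumes "cls u c = cls u c'" "awalk u d u"
  shows "cls u (c @ d) = cls u (c' @ d)"
proof (rule loop_homotopic_invariant[where F = "\<lambda>c. cls u (c @ d)"])
  show "loop_homotopic G arev u c c'" using assms(1) by (simp add: loop_class_eq_iff)
  fix us vs e assume "e \<in> arcs G" "awalk u (us @ vs) u" "awalk u (us @ [e, arev e] @ vs) u"
  then show "cls u ((us @ vs) @ d) = cls u ((us @ [e, arev e] @ vs) @ d)"
    using cls_backtrack[of u us "vs @ d" e] awalk_appendI[OF _ assms(2), of u "us @ vs"]
      awalk_appendI[OF _ assms(2), of u "us @ [e, arev e] @ vs"] by simp
qed

lemma cls_append_right:
  assumes "cls u d = cls u d'" "awalk u c u"
  shows "cls u (c @ d) = cls u (c @ d')"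
proof (rule loop_homotopic_invariant[where F = "\<lambda>d. cls u (c @ d)"])
  show "loop_homotopic G arev u d d'" using assms(1) by (simp add: loop_class_eq_iff)
  fix us vs e assume "e \<in> arcs G" "awalk u (us @ vs) u" "awalk u (us @ [e, arev e] @ vs) u"
  then show "cls u (c @ us @ vs) = cls u (c @ us @ [e, arev e] @ vs)"
    using cls_backtrack[of u "c @ us" vs e] awalk_appendI[OF assms(2), of "us @ vs"]
      awalk_appendI[OF assms(2), of "us @ [e, arev e] @ vs"] by simp
qed

text \<open>The product in the fundamental group is a union over all pairs of representatives; all
  of them give the same class, so the union collapses.\<close>

lemma cls_mult:
  assumes "awalk u c u" "awalk u d u"
  shows "cls u c \<otimes>\<^bsub>\<pi>\<^sub>1 u\<^esub> cls u d = cls u (c @ d)"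
proof -
  have "cls u (c' @ d') = cls u (c @ d)" if "c' \<in> cls u c" "d' \<in> cls u d" for c' d'
  proof -
    have "cls u (c' @ d') = cls u (c @ d')"
      by (rule cls_append_left[OF loop_class_mem[OF that(1)]])
        (use awalk_cong_cls[OF loop_class_mem[OF that(2)]] assms in simp)
    also have "\<dots> = cls u (c @ d)" by (rule cls_append_right[OF loop_class_mem[OF that(2)] assms(1)])
    finally show ?thesis .
  qed
  note 1 = this
  have ne: "cls u c \<noteq> {}" for c using loop_class_self[of c G arev u] by blast
  have "(\<Union>c'\<in>cls u c. \<Union>d'\<in>cls u d. cls u (c' @ d')) = cls u (c @ d)"
    by (intro SUP_eq_const ne 1)
  then show ?thesis by (simp add: fundamental_group_def)
qed

lemma cls_one: "\<one>\<^bsub>\<pi>\<^sub>1 u\<^esub> = cls u []"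
  by (simp add: fundamental_group_def)

lemma cls_carrier: "awalk u c u \<Longrightarrow> cls u c \<in> carrier (\<pi>\<^sub>1 u)"
  by (auto simp: fundamental_group_def)

lemma carrier_cls:
  assumes "C \<in> carrier (\<pi>\<^sub>1 u)" obtains c where "awalk u c u" "C = cls u c"
  using assms by (auto simp: fundamental_group_def)

lemma cls_revw_right: "awalk u c v \<Longrightarrow> cls u (c @ revw c) = cls u []"
proof (induction c arbitrary: v rule: rev_induct)
  case (snoc e c)
  have w: "awalk u c (tail G e)" "e \<in> arcs G" using snoc.prems by (auto simp: awalk_def cas_append)
  have "cls u (c @ [e, arev e] @ revw c) = cls u (c @ revw c)"
  proof (rule cls_backtrack[OF _ _ w(2)])
    show "awalk u (c @ revw c) u" by (rule awalk_appendI[OF w(1) awalk_revw[OF w(1)]])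
    have "awalk u ((c @ [e]) @ revw (c @ [e])) u" by (rule awalk_appendI[OF snoc.prems awalk_revw[OF snoc.prems]])
    then show "awalk u (c @ [e, arev e] @ revw c) u" by (simp add: revw_def)
  qed
  then show ?case using snoc.IH[OF w(1)] by (simp add: revw_def)
qed simp

lemma revw_revw: "set c \<subseteq> arcs G \<Longrightarrow> revw (revw c) = c"
  by (induction c) (auto simp: revw_def)

lemma cls_revw_left: "awalk u c u \<Longrightarrow> cls u (revw c @ c) = cls u []"
  using cls_revw_right[OF awalk_revw[of u c u]] revw_revw[of c] by (simp add: awalk_def)

lemma group_fundamental_group:
  assumes u: "u \<in> verts G" shows "group (\<pi>\<^sub>1 u)"
proof (rule groupI)
  have Nil: "awalk u [] u" using u by (simp add: awalk_def)
  show "\<one>\<^bsub>\<pi>\<^sub>1 u\<^esub> \<in> carrier (\<pi>\<^sub>1 u)" using cls_carrier[OF Nil] by (simp add: cls_one)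
  fix A assume A: "A \<in> carrier (\<pi>\<^sub>1 u)"
  then obtain a where a: "awalk u a u" "A = cls u a" by (rule carrier_cls)
  show "\<one>\<^bsub>\<pi>\<^sub>1 u\<^esub> \<otimes>\<^bsub>\<pi>\<^sub>1 u\<^esub> A = A" using a Nil by (simp add: cls_one cls_mult)
  show "\<exists>B\<in>carrier (\<pi>\<^sub>1 u). B \<otimes>\<^bsub>\<pi>\<^sub>1 u\<^esub> A = \<one>\<^bsub>\<pi>\<^sub>1 u\<^esub>"
    using a awalk_revw[OF a(1)] by (intro bexI[of _ "cls u (revw a)"]) (auto simp: cls_mult cls_one cls_revw_left cls_carrier)
  fix B assume B: "B \<in> carrier (\<pi>\<^sub>1 u)"
  then obtain b where b: "awalk u b u" "B = cls u b" by (rule carrier_cls)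
  show "A \<otimes>\<^bsub>\<pi>\<^sub>1 u\<^esub> B \<in> carrier (\<pi>\<^sub>1 u)"
    using a b by (simp add: cls_mult cls_carrier awalk_appendI)
  fix C assume C: "C \<in> carrier (\<pi>\<^sub>1 u)"
  then obtain c where c: "awalk u c u" "C = cls u c" by (rule carrier_cls)
  show "A \<otimes>\<^bsub>\<pi>\<^sub>1 u\<^esub> B \<otimes>\<^bsub>\<pi>\<^sub>1 u\<^esub> C = A \<otimes>\<^bsub>\<pi>\<^sub>1 u\<^esub> (B \<otimes>\<^bsub>\<pi>\<^sub>1 u\<^esub> C)"
    using a b c by (simp add: cls_mult awalk_appendI)
qed

lemma cls_inv:
  assumes "awalk u c u" shows "inv\<^bsub>\<pi>\<^sub>1 u\<^esub> (cls u c) = cls u (revw c)"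
proof -
  have u: "u \<in> verts G" using assms by (simp add: awalk_def)
  show ?thesis
    by (rule group.inv_equality[OF group_fundamental_group[OF u]])
      (use assms awalk_revw[OF assms] in \<open>simp_all add: cls_mult cls_one cls_revw_left cls_carrier\<close>)
qed

lemma cls_commutator_derived:
  assumes "awalk u a u" "awalk u b u"
  shows "cls u (a @ b @ revw a @ revw b) \<in> derived (\<pi>\<^sub>1 u) (carrier (\<pi>\<^sub>1 u))"
proof -
  have "cls u (a @ b @ revw a @ revw b) =
      cls u a \<otimes>\<^bsub>\<pi>\<^sub>1 u\<^esub> cls u b \<otimes>\<^bsub>\<pi>\<^sub>1 u\<^esub> inv\<^bsub>\<pi>\<^sub>1 u\<^esub> (cls u a) \<otimes>\<^bsub>\<pi>\<^sub>1 u\<^esub> inv\<^bsub>\<pi>\<^sub>1 u\<^esub> (cls u b)"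
    using assms awalk_revw[OF assms(1)] awalk_revw[OF assms(2)]
    by (simp add: cls_inv cls_mult awalk_appendI)
  then show ?thesis
    unfolding derived_def using cls_carrier[OF assms(1)] cls_carrier[OF assms(2)]
    by (intro generate.incl) blast
qed

lemma net_single: "net arev [e] e' = (if e' = e then 1 else 0) - (if e' = arev e then 1 else 0)"
  and net_backtrack: "net arev [e, arev e] e' = 0"
proof -
  have "e = arev e' \<longleftrightarrow> e' = arev e" "arev e = arev e' \<longleftrightarrow> e' = e" by (metis arev_arev)+
  then show "net arev [e] e' = (if e' = e then 1 else 0) - (if e' = arev e then 1 else 0)"
    "net arev [e, arev e] e' = 0" by (auto simp: net_def)
qed

lemma net_revw: "set c \<subseteq> arcs G \<Longrightarrow> e \<in> arcs G \<Longrightarrow> net arev (revw c) e = - net arev c e"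
proof (induction c)
  case (Cons f c)
  have "net arev (revw (f # c)) e = - net arev c e + net arev [arev f] e" using Cons by simp
  also have "net arev [arev f] e = - net arev [f] e" using Cons.prems by (simp add: net_single)
  finally show ?case using net_append[of arev "[f]" c e] by simp
qed (simp add: revw_def)

lemma net_cong_cls:
  assumes "cls u c = cls u d" "e \<in> arcs G" shows "net arev c e = net arev d e"
proof -
  have "loop_homotopic G arev u c d" using assms(1) by (simp add: loop_class_eq_iff)
  then show ?thesis
    by (rule loop_homotopic_invariant) (simp only: net_append net_backtrack add_0)
qed

text \<open>Net numbers add under concatenation and change sign under reversal. The classes with net
  number zero at \<open>e\<close> therefore form a subgroup, and it contains all
  commutators.\<close>

lemma net_derived:
  assumes c: "cls u c \<in> derived (\<pi>\<^sub>1 u) (carrier (\<pi>\<^sub>1 u))" and u: "u \<in> verts G" and e: "e \<in> arcs G"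
  shows "net arev c e = 0"
proof -
  interpret \<pi>: group "\<pi>\<^sub>1 u" by (rule group_fundamental_group[OF u])
  define K where "K = {cls u d | d. awalk u d u \<and> net arev d e = 0}"
  have "subgroup K (\<pi>\<^sub>1 u)"
  proof (rule \<pi>.subgroupI)
    show "K \<subseteq> carrier (\<pi>\<^sub>1 u)" by (auto simp: K_def cls_carrier)
    have "awalk u [] u" using u by (simp add: awalk_def)
    then have "cls u [] \<in> K" unfolding K_def by (intro CollectI exI[of _ "[]"] conjI refl net_Nil)
    then show "K \<noteq> {}" by blast
    show "inv\<^bsub>\<pi>\<^sub>1 u\<^esub> A \<in> K" if A: "A \<in> K" for A
    proof -
      obtain a where a: "A = cls u a" "awalk u a u" "net arev a e = 0" using A by (auto simp: K_def)
      then have "net arev (revw a) e = 0" using net_revw[OF _ e, of a] by (simp add: awalk_def)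
      then show ?thesis unfolding K_def a(1) cls_inv[OF a(2)]
        using awalk_revw[OF a(2)] by (intro CollectI exI[of _ "revw a"] conjI refl)
    qed
    show "A \<otimes>\<^bsub>\<pi>\<^sub>1 u\<^esub> B \<in> K" if AB: "A \<in> K" "B \<in> K" for A B
    proof -
      obtain a b where a: "A = cls u a" "awalk u a u" "net arev a e = 0" and b: "B = cls u b" "awalk u b u" "net arev b e = 0"
        using AB by (auto simp: K_def)
      have "awalk u (a @ b) u" "net arev (a @ b) e = 0" using a b by (auto intro: awalk_appendI)
      then show ?thesis unfolding K_def a(1) b(1) cls_mult[OF a(2) b(2)] by (intro CollectI exI[of _ "a @ b"] conjI refl)
    qed
  qed
  moreover have "derived_set (\<pi>\<^sub>1 u) (carrier (\<pi>\<^sub>1 u)) \<subseteq> K"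
  proof clarify
    fix A B assume "A \<in> carrier (\<pi>\<^sub>1 u)" "B \<in> carrier (\<pi>\<^sub>1 u)"
    then obtain a b where a: "A = cls u a" "awalk u a u" and b: "B = cls u b" "awalk u b u"
      by (metis carrier_cls)
    have r: "awalk u (revw a) u" "awalk u (revw b) u" using a b by (auto intro: awalk_revw)
    have "net arev (a @ b @ revw a @ revw b) e = 0"
      using a(2) b(2) e by (simp add: net_revw awalk_def)
    moreover have "awalk u (a @ b @ revw a @ revw b) u"
      by (rule awalk_appendI[OF a(2) awalk_appendI[OF b(2) awalk_appendI[OF r]]])
    ultimately have "cls u (a @ b @ revw a @ revw b) \<in> K"
      unfolding K_def by (intro CollectI exI[of _ "a @ b @ revw a @ revw b"] conjI refl)
    moreover have "A \<otimes>\<^bsub>\<pi>\<^sub>1 u\<^esub> B \<otimes>\<^bsub>\<pi>\<^sub>1 u\<^esub> inv\<^bsub>\<pi>\<^sub>1 u\<^esub> A \<otimes>\<^bsub>\<pi>\<^sub>1 u\<^esub> inv\<^bsub>\<pi>\<^sub>1 u\<^esub> B = cls u (a @ b @ revw a @ revw b)"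
      using a b r by (simp add: cls_inv cls_mult awalk_appendI)
    ultimately show "A \<otimes>\<^bsub>\<pi>\<^sub>1 u\<^esub> B \<otimes>\<^bsub>\<pi>\<^sub>1 u\<^esub> inv\<^bsub>\<pi>\<^sub>1 u\<^esub> A \<otimes>\<^bsub>\<pi>\<^sub>1 u\<^esub> inv\<^bsub>\<pi>\<^sub>1 u\<^esub> B \<in> K" by simp
  qed
  ultimately have "derived (\<pi>\<^sub>1 u) (carrier (\<pi>\<^sub>1 u)) \<subseteq> K"
    unfolding derived_def by (rule \<pi>.generate_subgroup_incl[rotated])
  then have "cls u c \<in> K" using c by (rule subsetD)
  then obtain d where "cls u c = cls u d" "net arev d e = 0" unfolding K_def by blast
  then show ?thesis using net_cong_cls[of u c d e] e by simp
qed

end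

subsection \<open>Monodromy of the maximal abelian cover\<close>

context covering
begin

fun walk_lift :: "'x \<Rightarrow> 'e list \<Rightarrow> 'f list" where
  "walk_lift y [] = []"
| "walk_lift y (e # c) = arc_lift H q y e # walk_lift (L y e) c"

lemma walk_lift:
  "y \<in> verts H \<Longrightarrow> set c \<subseteq> arcs G \<Longrightarrow> G.cas (p y) c v \<Longrightarrow>
    H.awalk y (walk_lift y c) (lw y c) \<and> map q (walk_lift y c) = c"
proof (induction c arbitrary: y)
  case (Cons e c)
  have l: "arc_lift H q y e \<in> arcs H" "tail H (arc_lift H q y e) = y" "q (arc_lift H q y e) = e"
    using arc_lift[of y e] Cons.prems by auto
  have "L y e \<in> verts H" "p (L y e) = head G e" using Cons.prems L_in[of y e] p_L[of y e] by auto
  then have "H.awalk (L y e) (walk_lift (L y e) c) (lw (L y e) c) \<and> map q (walk_lift (L y e) c) = c"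
    using Cons.prems by (intro Cons.IH) auto
  moreover have "L y e = head H (arc_lift H q y e)" by (simp add: end_lift_def)
  ultimately show ?case using Cons.prems(1) l by (auto simp: H.awalk_def H.cas.simps)
qed (simp add: H.awalk_def H.cas.simps)

lemma map_q_walk:
  "H.awalk y d z \<Longrightarrow> G.awalk (p y) (map q d) (p z) \<and> lw y (map q d) = z"
proof (induction d arbitrary: y)
  case Nil then show ?case by (auto simp: H.awalk_def G.awalk_def H.cas.simps p_verts)
next
  case (Cons f d)
  have f: "f \<in> arcs H" "tail H f = y" "H.awalk (head H f) d z"
    using Cons.prems by (auto simp: H.awalk_def H.cas.simps)
  then show ?case using Cons.IH[OF f(3)] L_q[OF f(1)] q_arcs[OF f(1)] Cons.prems
    by (auto simp: G.awalk_def H.awalk_def p_verts)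
qed

lemma induced_map_class:
  assumes y: "H.awalk y d y"
  shows "induced_map G arev p q y (H.cls y d) = G.cls (p y) (map q d)"
proof -
  have "G.cls (p y) (map q d') = G.cls (p y) (map q d)" if "d' \<in> H.cls y d" for d'
  proof -
    have "loop_homotopic H hrev y d' d" using loop_class_mem[OF that] by (simp add: loop_class_eq_iff)
    then show ?thesis
    proof (rule loop_homotopic_invariant[where F = "\<lambda>d. G.cls (p y) (map q d)"])
      fix us vs f assume f: "f \<in> arcs H" "H.awalk y (us @ vs) y" "H.awalk y (us @ [f, hrev f] @ vs) y"
      show "G.cls (p y) (map q (us @ vs)) = G.cls (p y) (map q (us @ [f, hrev f] @ vs))"
        using G.cls_backtrack[of "p y" "map q us" "map q vs" "q f"] map_q_walk[OF f(2)] map_q_walk[OF f(3)]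
          q_arcs[OF f(1)] by simp
    qed
  qed
  moreover have "H.cls y d \<noteq> {}" using loop_class_self[of d H hrev y] by blast
  ultimately show ?thesis unfolding induced_map_def by (intro SUP_eq_const)
qed

lemma lw_cong_cls:
  assumes y: "y \<in> verts H" and c: "G.cls (p y) c = G.cls (p y) d" shows "lw y c = lw y d"
proof -
  have "loop_homotopic G arev (p y) c d" using c by (simp add: loop_class_eq_iff)
  then show ?thesis
  proof (rule loop_homotopic_invariant)
    fix us vs e assume e: "e \<in> arcs G" "G.awalk (p y) (us @ [e, arev e] @ vs) (p y)"
    have "lw y us \<in> verts H \<and> p (lw y us) = tail G e"
      by (rule lw_in[OF y]) (use e in \<open>auto simp: G.awalk_def G.cas_append\<close>)
    then show "lw y (us @ vs) = lw y (us @ [e, arev e] @ vs)" using e by (simp add: L_L)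
  qed
qed

end

locale abelian_covering = normal_covering G arev H hrev p q s
  for G :: "('v, 'e) pre_digraph" and arev and H :: "('x, 'f) pre_digraph" and hrev p q s +
  assumes maximal: "maximal_abelian_cover G arev H hrev p q"
begin

text \<open>Loops of the cover at \<open>y\<close> project exactly onto the derived subgroup. A
  closed walk below lifts to a closed one iff its class comes from such a loop, since endpoints of
  lifts depend on the homotopy class only.\<close>

lemma lw_closed_iff_derived:
  assumes y: "y \<in> verts H" and c: "G.awalk (p y) c (p y)"
  shows "lw y c = y \<longleftrightarrow> G.cls (p y) c \<in> derived (G.\<pi>\<^sub>1 (p y)) (carrier (G.\<pi>\<^sub>1 (p y)))"
proof -
  have D: "derived (G.\<pi>\<^sub>1 (p y)) (carrier (G.\<pi>\<^sub>1 (p y))) = induced_map G arev p q y ` carrier (H.\<pi>\<^sub>1 y)"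
    using maximal y by (simp add: maximal_abelian_cover_def)
  show ?thesis
  proof
    assume l: "lw y c = y"
    have w: "H.awalk y (walk_lift y c) y" "map q (walk_lift y c) = c"
      using walk_lift[OF y, of c "p y"] c l by (auto simp: G.awalk_def)
    show "G.cls (p y) c \<in> derived (G.\<pi>\<^sub>1 (p y)) (carrier (G.\<pi>\<^sub>1 (p y)))"
      unfolding D using induced_map_class[OF w(1)] H.cls_carrier[OF w(1)] w(2) by (metis imageI)
  next
    assume "G.cls (p y) c \<in> derived (G.\<pi>\<^sub>1 (p y)) (carrier (G.\<pi>\<^sub>1 (p y)))"
    then obtain C where C: "C \<in> carrier (H.\<pi>\<^sub>1 y)" "G.cls (p y) c = induced_map G arev p q y C"
      unfolding D by blast
    then obtain d where d: "H.awalk y d y" "C = H.cls y d" by (metis H.carrier_cls)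
    have "G.cls (p y) c = G.cls (p y) (map q d)" using C induced_map_class[OF d(1)] d(2) by simp
    then show "lw y c = y" using lw_cong_cls[OF y, of c "map q d"] map_q_walk[OF d(1)] by simp
  qed
qed

lemma net_closed:
  assumes "y \<in> verts H" "G.awalk (p y) c (p y)" "lw y c = y" "e \<in> arcs G"
  shows "net arev c e = 0"
  using G.net_derived[OF _ p_verts[OF assms(1)] assms(4)] lw_closed_iff_derived[OF assms(1,2)] assms(3) by simp

text \<open>The commutator of the two walks lies in the derived subgroup and lifts to a closed walk,
  so the monodromy on a fibre is abelian.\<close>

lemma lw_commute:
  assumes y: "y \<in> verts H" and a: "G.awalk (p y) a (p y)" and b: "G.awalk (p y) b (p y)"
  shows "lw (lw y a) b = lw (lw y b) a"
proof -
  define z where "z = lw y (a @ b)"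
  have ab: "G.awalk (p y) (a @ b) (p y)" and ba: "G.awalk (p y) (b @ a) (p y)"
    using a b by (auto intro: G.awalk_appendI)
  have z: "z \<in> verts H" "p z = p y"
    using lw_in[OF y, of "a @ b" "p y"] ab by (auto simp: z_def G.awalk_def)
  have r: "G.revw (b @ a) = G.revw a @ G.revw b" by (simp add: G.revw_def)
  have "lw y (a @ b @ G.revw a @ G.revw b) = y"
    by (subst lw_closed_iff_derived[OF y])
      (rule G.awalk_appendI[OF a G.awalk_appendI[OF b G.awalk_appendI[OF G.awalk_revw[OF a] G.awalk_revw[OF b]]]],
        rule G.cls_commutator_derived[OF a b])
  then have 1: "lw z (G.revw (b @ a)) = y" by (simp add: z_def r)
  have set: "set (b @ a) \<subseteq> arcs G" using ba by (simp add: G.awalk_def)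
  have "lw (lw z (G.revw (b @ a))) (G.revw (G.revw (b @ a))) = z"
    by (rule lw_revw[OF z(1) G.set_revw[OF set], of "p y"]) (use ba z G.awalk_revw[OF ba] in \<open>simp add: G.awalk_def\<close>)
  then have "lw y (b @ a) = z" unfolding 1 by (simp only: G.revw_revw[OF set])
  then show ?thesis by (simp add: z_def)
qed

text \<open>The converse of \<open>net_closed\<close>. With walks \<open>P u\<close> from
  \<open>v\<close> to each vertex, an arc \<open>e\<close> becomes a loop \<open>lp e\<close> at
  \<open>v\<close> and acts on the fibre over \<open>v\<close> by \<open>T\<close>. These actions
  commute and reversed arcs act inversely, so arcs with vanishing net numbers act trivially
  together. In the product along \<open>c\<close> the inserted walks cancel, and \<open>c\<close>
  conjugated by \<open>P v\<close> is left.\<close>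

lemma lw_closed_net:
  assumes y: "y \<in> verts H" and c: "G.awalk (p y) c (p y)" and net: "\<And>e. e \<in> arcs G \<Longrightarrow> net arev c e = 0"
  shows "lw y c = y"
proof -
  define v where "v = p y"
  have "\<exists>d. G.awalk v d u" if u: "u \<in> verts G" for u
  proof -
    obtain x where x: "x \<in> verts H" "p x = u" using s[OF u] by blast
    show ?thesis using walk_to[OF y x(1)] x p_verts[OF y] by (auto simp: G.awalk_def v_def)
  qed
  then obtain P where P: "\<And>u. u \<in> verts G \<Longrightarrow> G.awalk v (P u) u" by metis
  define lp where "lp e = P (tail G e) @ [e] @ G.revw (P (head G e))" for e
  define T where "T = (\<lambda>z e. lw z (lp e))"
  define F where "F = {z \<in> verts H. p z = v}"
  have lp: "G.awalk v (lp e) v" if e: "e \<in> arcs G" for e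
  proof -
    have "G.awalk (tail G e) [e] (head G e)" using e by (simp add: G.awalk_def)
    moreover have "G.awalk v (P (tail G e)) (tail G e)" "G.awalk v (P (head G e)) (head G e)" using e P by simp_all
    ultimately show ?thesis unfolding lp_def by (blast intro: G.awalk_appendI G.awalk_revw)
  qed
  have T_in: "T z e \<in> F" if "z \<in> F" "e \<in> arcs G" for z e
    using lw_in[of z "lp e" v] lp[OF that(2)] that by (auto simp: F_def T_def G.awalk_def)
  have T_commute: "T (T z e) f = T (T z f) e" if "z \<in> F" "e \<in> arcs G" "f \<in> arcs G" for z e f
    unfolding T_def using that lp by (intro lw_commute) (auto simp: F_def)
  have lwrev: "lw z (P u @ G.revw (P u)) = z" if "z \<in> F" "u \<in> verts G" for z u
    using lw_revw[of z "P u" u] P[OF that(2)] that by (auto simp: F_def G.awalk_def)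
  have lwrev': "lw z (G.revw (P u) @ P u) = z" if "z \<in> verts H" "p z = u" for z u
  proof -
    have u: "u \<in> verts G" using p_verts that by auto
    have "lw (lw z (G.revw (P u))) (G.revw (G.revw (P u))) = z"
      by (rule lw_revw[of _ _ v]) (use that G.awalk_revw[OF P[OF u]] in \<open>auto simp: G.awalk_def\<close>)
    then show ?thesis using G.revw_revw[of "P u"] P[OF u] by (simp add: G.awalk_def)
  qed
  have T_arev: "T (T z e) (arev e) = z" if z: "z \<in> F" and e: "e \<in> arcs G" for z e
  proof -
    have "T (T z e) (arev e) = lw (lw (lw z (P (tail G e) @ [e])) (G.revw (P (head G e)) @ P (head G e))) ([arev e] @ G.revw (P (tail G e)))"
      using e by (simp add: T_def lp_def)
    also have "lw (lw z (P (tail G e) @ [e])) (G.revw (P (head G e)) @ P (head G e)) = lw z (P (tail G e) @ [e])"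
    proof (rule lwrev')
      have "G.cas (p z) (P (tail G e) @ [e]) (head G e)" "set (P (tail G e) @ [e]) \<subseteq> arcs G"
        using P[of "tail G e"] e z by (auto simp: G.awalk_def G.cas_append F_def)
      then show "lw z (P (tail G e) @ [e]) \<in> verts H" "p (lw z (P (tail G e) @ [e])) = head G e"
        using lw_in[of z "P (tail G e) @ [e]" "head G e"] z by (simp_all add: F_def)
    qed
    also have "lw (lw z (P (tail G e) @ [e])) ([arev e] @ G.revw (P (tail G e))) = lw z (P (tail G e) @ G.revw (P (tail G e)))"
      using lw_in[of z "P (tail G e)" "tail G e"] P[of "tail G e"] e z by (auto simp: G.awalk_def F_def L_L)
    also have "\<dots> = z" using lwrev z e by simp
    finally show ?thesis .
  qed
  have swap: "foldl T (T z f) a = T (foldl T z a) f" if "z \<in> F" "f \<in> arcs G" "set a \<subseteq> arcs G" for z f a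
    using that by (induction a arbitrary: z) (auto simp: T_commute T_in)
  have foldl_T: "foldl T z d = z" if "z \<in> F" "set d \<subseteq> arcs G" "\<And>e. e \<in> arcs G \<Longrightarrow> net arev d e = 0" for z d
    using that
  proof (induction "length d" arbitrary: d rule: less_induct)
    case less
    show ?case
    proof (cases d)
      case (Cons e d')
      have e: "e \<in> arcs G" "arev e \<in> arcs G" "arev e \<noteq> e"
        using less.prems G.arev_neq[of e] by (auto simp: Cons)
      have "net arev d e = 0" using less.prems e by simp
      \<comment> \<open>Its own net number being zero, the first arc must be matched by a later
        occurrence of its reverse; commutativity brings the two together, and they cancel.\<close>
      then have "count_list d' (arev e) \<noteq> 0" using e by (auto simp: net_def Cons)
      then have "arev e \<in> set d'" by (metis count_notin)
      then obtain a b where d': "d' = a @ arev e # b" by (meson split_list)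
      have "foldl T z d = foldl T (T (foldl T (T z e) a) (arev e)) b" by (simp add: Cons d')
      also have "T (foldl T (T z e) a) (arev e) = foldl T (T (T z e) (arev e)) a"
        using less.prems e T_in by (intro swap[symmetric]) (auto simp: Cons d')
      also have "\<dots> = foldl T z a" using T_arev less.prems e by simp
      also have "foldl T (foldl T z a) b = foldl T z (a @ b)" by simp
      also have "\<dots> = z"
      proof (rule less.hyps)
        show "length (a @ b) < length d" by (simp add: Cons d')
        show "set (a @ b) \<subseteq> arcs G" using less.prems by (auto simp: Cons d')
        fix f assume f: "f \<in> arcs G"
        have "net arev d f = net arev [e] f + net arev a f + (net arev [arev e] f + net arev b f)"
          using net_append[of arev "[e]" d' f] net_append[of arev "[arev e]" b f] by (simp add: Cons d')
        moreover have "net arev [e] f + net arev [arev e] f = 0"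
          using G.net_backtrack[of e f] net_append[of arev "[e]" "[arev e]" f] by simp
        ultimately show "net arev (a @ b) f = 0" using less.prems(3)[OF f] by simp
      qed (rule less.prems)
      finally show ?thesis .
    qed simp
  qed
  have tele: "foldl T z d = lw z (P u @ d @ G.revw (P u'))"
    if "z \<in> F" "set d \<subseteq> arcs G" "G.cas u d u'" "u \<in> verts G" for z d u u'
    using that
  proof (induction d arbitrary: z u)
    case Nil then show ?case using lwrev by simp
  next
    case (Cons e d)
    have e: "e \<in> arcs G" "tail G e = u" "G.cas (head G e) d u'" using Cons.prems by auto
    have w: "G.cas (p z) (P u @ [e]) (head G e)" "set (P u @ [e]) \<subseteq> arcs G"
      using P[OF Cons.prems(4)] e Cons.prems(1) by (auto simp: G.awalk_def G.cas_append F_def)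
    have l: "lw z (P u @ [e]) \<in> verts H" "p (lw z (P u @ [e])) = head G e"
      using lw_in[OF _ w(2,1)] Cons.prems(1) by (auto simp: F_def)
    have "foldl T z (e # d) = foldl T (T z e) d" by simp
    also have "\<dots> = lw (T z e) (P (head G e) @ d @ G.revw (P u'))"
      by (rule Cons.IH) (use Cons.prems e T_in in auto)
    also have "\<dots> = lw (lw (lw z (P u @ [e])) (G.revw (P (head G e)) @ P (head G e))) (d @ G.revw (P u'))"
      using e by (simp add: T_def lp_def)
    also have "lw (lw z (P u @ [e])) (G.revw (P (head G e)) @ P (head G e)) = lw z (P u @ [e])"
      by (rule lwrev'[OF l])
    finally show ?case by simp
  qed
  have yF: "y \<in> F" using y by (simp add: F_def v_def)
  have vG: "v \<in> verts G" using p_verts[OF y] by (simp add: v_def)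
  \<comment> \<open>\<open>P v\<close> need not be empty, so the telescoped product begins with
    \<open>P v\<close> and ends with its reverse. Starting at \<open>y'\<close> compensates for
    this.\<close>
  define y' where "y' = lw y (G.revw (P v))"
  have "G.awalk v (G.revw (P v)) v" by (rule G.awalk_revw[OF P[OF vG]])
  then have y'F: "y' \<in> F" using lw_in[OF y, of "G.revw (P v)" v] by (auto simp: y'_def F_def G.awalk_def v_def)
  have y'P: "lw y' (P v) = y" using lwrev'[OF y, of v] by (simp add: y'_def v_def)
  have "foldl T y' c = y'" using foldl_T[OF y'F] c net by (auto simp: G.awalk_def)
  then have "lw (lw y c) (G.revw (P v)) = y'"
    using tele[OF y'F, of c v v] c vG y'P by (simp add: G.awalk_def v_def)
  then have "lw (lw (lw y c) (G.revw (P v))) (P v) = y" using y'P by simp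
  moreover have "lw y c \<in> verts H" "p (lw y c) = v" using lw_in[OF y, of c v] c by (auto simp: G.awalk_def v_def)
  ultimately show ?thesis using lwrev'[of "lw y c" v] by simp
qed

section \<open>Heights on the maximal abelian cover\<close>

definition base :: 'x where "base = (SOME y. y \<in> verts H)"

text \<open>The choice of the walk from \<open>base\<close> does not matter: two walks with the same
  lifted endpoint differ by a closed walk with closed lift, whose net numbers vanish by
  \<open>net_closed\<close>.\<close>

definition height_of :: "'x \<Rightarrow> 'e \<Rightarrow> int" where
  "height_of y = net arev (SOME c. set c \<subseteq> arcs G \<and> G.cas (p base) c (p y) \<and> lw base c = y)"

lemma base: "y \<in> verts H \<Longrightarrow> base \<in> verts H"
  unfolding base_def by (rule someI)

lemma awalk_diff:
  assumes y: "y \<in> verts H" "z \<in> verts H" "p y = p z"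
    and c: "set c \<subseteq> arcs G" "G.cas (p base) c (p y)" "lw base c = y"
    and d: "set d \<subseteq> arcs G" "G.cas (p base) d (p z)" "lw base d = z"
  shows "G.awalk (p base) (c @ G.revw d) (p base)" "lw z (G.revw d) = base" "lw (lw y (G.revw d)) d = y"
proof -
  have b: "base \<in> verts H" by (rule base[OF y(1)])
  have rd: "G.cas (p z) (G.revw d) (p base)" "set (G.revw d) \<subseteq> arcs G" using G.cas_revw G.set_revw d by auto
  show "G.awalk (p base) (c @ G.revw d) (p base)"
    using c rd y p_verts[OF b] by (auto simp: G.awalk_def G.cas_append)
  show "lw z (G.revw d) = base" using lw_revw[OF b d(1,2)] d(3) by simp
  have "lw (lw y (G.revw d)) (G.revw (G.revw d)) = y" by (rule lw_revw[OF y(1) rd(2)]) (use rd y in simp)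
  then show "lw (lw y (G.revw d)) d = y" using G.revw_revw[OF d(1)] by simp
qed

lemma height_of:
  assumes y: "y \<in> verts H" and d: "set d \<subseteq> arcs G" "G.cas (p base) d (p y)" "lw base d = y" and e: "e \<in> arcs G"
  shows "height_of y e = net arev d e"
proof -
  have b: "base \<in> verts H" by (rule base[OF y])
  define c where "c = (SOME c. set c \<subseteq> arcs G \<and> G.cas (p base) c (p y) \<and> lw base c = y)"
  have c: "set c \<subseteq> arcs G" "G.cas (p base) c (p y)" "lw base c = y"
    using someI_ex[OF walk_to[OF b y]] by (simp_all add: c_def)
  note a = awalk_diff[OF y y refl c d]
  have "lw base (c @ G.revw d) = base" using a c by simp
  from net_closed[OF b a(1) this e] show ?thesis
    by (simp add: height_of_def G.net_revw[OF d(1) e] flip: c_def)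
qed

lemma height_of_L:
  assumes y: "y \<in> verts H" and e: "e \<in> arcs G" "p y = tail G e" and f: "f \<in> arcs G"
  shows "height_of (L y e) f = height_of y f + (if f = e then 1 else 0) - (if f = arev e then 1 else 0)"
proof -
  obtain c where c: "set c \<subseteq> arcs G" "G.cas (p base) c (p y)" "lw base c = y"
    using walk_to[OF base[OF y] y] by blast
  have "height_of (L y e) f = net arev (c @ [e]) f"
    using c e L_in[OF y e] p_L[OF y e] by (intro height_of f) (auto simp: G.cas_append)
  also have "\<dots> = height_of y f + net arev [e] f" using height_of[OF y c f] by simp
  finally show ?thesis using G.net_single[of e f] by simp
qed

lemma height_of_inj:
  assumes y: "y \<in> verts H" "z \<in> verts H" "p y = p z" and eq: "\<And>e. e \<in> arcs G \<Longrightarrow> height_of y e = height_of z e"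
  shows "y = z"
proof -
  have b: "base \<in> verts H" by (rule base[OF y(1)])
  obtain c where c: "set c \<subseteq> arcs G" "G.cas (p base) c (p y)" "lw base c = y"
    using walk_to[OF b y(1)] by blast
  obtain d where d: "set d \<subseteq> arcs G" "G.cas (p base) d (p z)" "lw base d = z"
    using walk_to[OF b y(2)] by blast
  note a = awalk_diff[OF y c d]
  have "lw base (c @ G.revw d) = base"
  proof (rule lw_closed_net[OF b a(1)])
    fix e assume e: "e \<in> arcs G"
    show "net arev (c @ G.revw d) e = 0"
      using eq[OF e] height_of[OF y(1) c e] height_of[OF y(2) d e] G.net_revw[OF d(1) e] by simp
  qed
  then have "lw y (G.revw d) = base" using c by simp
  then show ?thesis using a(3) d(3) by simp
qed

end

theorem theorem5p1:
  fixes G :: "('v, 'e) pre_digraph" and arev :: "'e \<Rightarrow> 'e"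
    and w :: "'e \<Rightarrow> complex" and V :: "'v \<Rightarrow> real"
    and G\<^sub>a\<^sub>b :: "('x, 'f) pre_digraph" and arev\<^sub>a\<^sub>b :: "'f \<Rightarrow> 'f"
    and p\<^sub>a\<^sub>b :: "'x \<Rightarrow> 'v" and q\<^sub>a\<^sub>b :: "'f \<Rightarrow> 'e" and s\<^sub>a\<^sub>b :: "'v \<Rightarrow> 'x"
    and G\<^sub>\<Gamma> :: "('y, 'g) pre_digraph" and arev\<^sub>\<Gamma> :: "'g \<Rightarrow> 'g"
    and p\<^sub>\<Gamma> :: "'y \<Rightarrow> 'v" and q\<^sub>\<Gamma> :: "'g \<Rightarrow> 'e" and s\<^sub>\<Gamma> :: "'v \<Rightarrow> 'y"
    and \<theta> :: real
  assumes "fin_digraph G" and "bidirected_digraph G arev"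
    and "schrodinger_weights G arev w"
    and "maximal_abelian_cover G arev G\<^sub>a\<^sub>b arev\<^sub>a\<^sub>b p\<^sub>a\<^sub>b q\<^sub>a\<^sub>b"
    and "vertex_lift G G\<^sub>a\<^sub>b p\<^sub>a\<^sub>b s\<^sub>a\<^sub>b"
    and "connected_normal_cover G arev G\<^sub>\<Gamma> arev\<^sub>\<Gamma> p\<^sub>\<Gamma> q\<^sub>\<Gamma>"
    and "vertex_lift G G\<^sub>\<Gamma> p\<^sub>\<Gamma> s\<^sub>\<Gamma>"
  shows "cover_spectral_measure G w V G\<^sub>a\<^sub>b p\<^sub>a\<^sub>b q\<^sub>a\<^sub>b s\<^sub>a\<^sub>b {\<theta>}
       \<le> cover_spectral_measure G w V G\<^sub>\<Gamma> p\<^sub>\<Gamma> q\<^sub>\<Gamma> s\<^sub>\<Gamma> {\<theta>}"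
proof -
  have w: "w (arev e) = cnj (w e)" "w e \<noteq> 0" if "e \<in> arcs G" for e
    using assms(3) that by (auto simp: schrodinger_weights_def)
  let ?V = "\<lambda>v. V v - \<theta>"
  interpret G: fin_digraph G by (rule assms(1))
  interpret G: bidirected_digraph G arev by (rule assms(2))
  interpret A: abelian_covering G arev G\<^sub>a\<^sub>b arev\<^sub>a\<^sub>b p\<^sub>a\<^sub>b q\<^sub>a\<^sub>b s\<^sub>a\<^sub>b
    by unfold_locales
      (use assms(4,5) in \<open>auto simp: maximal_abelian_cover_def connected_normal_cover_def\<close>)
  interpret N: normal_covering G arev G\<^sub>\<Gamma> arev\<^sub>\<Gamma> p\<^sub>\<Gamma> q\<^sub>\<Gamma> s\<^sub>\<Gamma>
    by unfold_locales (use assms(6,7) in \<open>auto simp: connected_normal_cover_def\<close>)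
  interpret T: twist G arev w ?V
    by unfold_locales (auto simp: w)
  interpret A: height G arev "verts G\<^sub>a\<^sub>b" p\<^sub>a\<^sub>b "end_lift G\<^sub>a\<^sub>b q\<^sub>a\<^sub>b" "deck_maps G\<^sub>a\<^sub>b arev\<^sub>a\<^sub>b p\<^sub>a\<^sub>b q\<^sub>a\<^sub>b" s\<^sub>a\<^sub>b w ?V A.height_of
    by unfold_locales (auto simp: w A.height_of_L intro: A.height_of_inj)
  interpret N: cover_twist G arev "verts G\<^sub>\<Gamma>" p\<^sub>\<Gamma> "end_lift G\<^sub>\<Gamma> q\<^sub>\<Gamma>" "deck_maps G\<^sub>\<Gamma> arev\<^sub>\<Gamma> p\<^sub>\<Gamma> q\<^sub>\<Gamma>" s\<^sub>\<Gamma> w ?V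
    by unfold_locales (auto simp: w)
  obtain g where g: "g \<in> T.gen" using A.gen_nonempty by blast
  have "A.tr (A.N (verts G)) = T.h.\<tau> g (verts G)" by (rule A.tr_generic_nullity[OF g])
  also have "\<dots> \<le> N.tr (N.N (verts G))" by (rule N.generic_nullity_le[OF g]) simp
  finally have le: "A.tr (A.N (verts G)) \<le> N.tr (N.N (verts G))" .
  have "cover_spectral_measure G w V G\<^sub>a\<^sub>b p\<^sub>a\<^sub>b q\<^sub>a\<^sub>b s\<^sub>a\<^sub>b {\<theta>} = A.tr (A.N (verts G)) / real (card (verts G))"
    by (rule A.cover_spectral_measure_tr) (rule w)
  moreover have "cover_spectral_measure G w V G\<^sub>\<Gamma> p\<^sub>\<Gamma> q\<^sub>\<Gamma> s\<^sub>\<Gamma> {\<theta>} = N.tr (N.N (verts G)) / real (card (verts G))"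
    by (rule N.cover_spectral_measure_tr) (rule w)
  ultimately show ?thesis using le by (simp add: divide_right_mono)
qed

end
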